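(* Let $1<p\le 5$, let $1\le m\le 5$ satisfy $p\frac{m+1}{m}<6$, and suppose: (i) $\gamma\in W^{1,\infty}_{loc}(\mathbb{R}^+)$ is bounded and nonnegative on $\mathbb{R}^+=[0,+\infty)$; (ii) $g$ is continuous and monotone increasing with $g(0)=0$, and there are positive constants $b_1,b_2$ such that $b_1|s|^{m+1}\le g(s)s\le b_2|s|^{m+1}$ for $|s|>1$; (iii) $u_0\in H_0^1(\Omega)$ and $u_1\in L^2(\Omega)$; (iv) $$0<E(0)<\Big(\frac12-\frac1{p+1}\Big)\Big(\frac{\omega^{\frac{p+1}{2}}}{M^{p+1}}\Big)^{\frac{2}{p-1}},\qquad a(u_0,u_0)<\Big(\frac{\omega^{\frac{p+1}{2}}}{M^{p+1}}\Big)^{\frac{2}{p-1}};$$ (v) $\gamma:\mathbb{R}^+\to\mathbb{R}^+$ is a nonincreasing function of class $C^1$ and $\int_0^\infty\gamma(t)\,dt=\infty$; (vi) there exists a strictly increasing and odd function $h\in C^1([-1,1])$ such that $$|h(s)s|\le g(s)s\le|h^{-1}(s)s|\quad\text{where }|s|\le 1,$$ and $h^{-1}$ is the inverse function of $h$. Let $u$ be the global weak solution of $$u_{tt}-\mathcal{A}u+\gamma(t)g(u_t)=|u|^{p-1}u\ \text{ in }\Omega\times(0,\infty),\quad u=0\ \text{ on }\partial\Omega\times(0,\infty),\quad u(\cdot,0)=u_0,\ u_t(\cdot,0)=u_1\ \text{ in }\Omega,$$ and let $E(t)$ be its total energy. Then, with $C$ denoting a positive constant (possibly different in the two cases), for all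 $t\ge0$: (1) if $h(s)$ is linear, $$E(t)\le E(0)\,e^{1-C\int_0^t\gamma(s)ds};$$ (2) if $h(s)$ has polynomial growth, $$E(t)\le C\,E(0)\left(\frac{1}{1+\int_0^t\gamma(s)ds}\right)^{\frac{2}{m-1}}\quad\text{with } m>1.$$
   Context: $\Omega\subset\mathbb{R}^3$ is a bounded domain with $C^\infty$ boundary (so $n=3$ below). $\mathcal{A}u=\mathrm{div}(A(x)\nabla u)=\sum_{i,j=1}^{n}\frac{\partial}{\partial x_i}\big(a_{ij}(x)\frac{\partial u}{\partial x_j}\big)$, where $A(x)=(a_{ij}(x))$ is symmetric and positive definite, $a_{ij}\in C^\infty(\bar\Omega)$, and $\sum_{i,j=1}^n a_{ij}(x)\xi_i\xi_j\ge\omega\sum_{i=1}^n\xi_i^2$ for $x\in\bar\Omega$, with a constant $\omega>0$. The bilinear form $a$ on $H_0^1(\Omega)\times H_0^1(\Omega)$ is $a(u,v)=\int_\Omega A\nabla u\cdot\nabla v\,dx$; thus $a(u,u)\ge\omega\|\nabla u\|_2^2$. $\|\cdot\|_q$ is the norm of $L^q(\Omega)$ and $(\cdot,\cdot)$ is the $L^2(\Omega)$ inner product. $M$ is the optimal constant of the embedding $H_0^1(\Omega)\hookrightarrow L^{p+1}(\Omega)$, i.e. the smallest constant with $\|v\|_{p+1}\le M\|\nabla v\|_2$ for all $v\in H_0^1(\Omega)$. Weak solution on $[0,T]$: a function $u\in C([0,T];H_0^1(\Omega))$ with $u_t\in C([0,T];L^2(\Omega))\cap L^{m+1}(\Omega\times(0,T))$,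 having the prescribed initial data, such that for all $t\in[0,T]$ $$(u_t(t),\phi(t))-(u_t(0),\phi(0))+\int_0^t a(u(s),\phi(s))ds-\int_0^t\!\!\int_\Omega u_t(s)\phi_t(s)\,dxds+\int_0^t\!\!\int_\Omega\gamma(s)g(u_t(s))\phi(s)\,dxds=\int_0^t\!\!\int_\Omega |u(s)|^{p-1}u(s)\phi(s)\,dxds$$ for all $\phi\in C([0,T];H_0^1(\Omega))\cap L^{m+1}(\Omega\times(0,T))$ with $\phi_t\in C([0,T];L^2(\Omega))$. It is global if it exists for all times ($T=\infty$). Total energy: $E(t)=\frac12\|u_t(t)\|_2^2+\frac12a(u(t),u(t))-\frac1{p+1}\|u(t)\|_{p+1}^{p+1}$; in particular $E(0)=\frac12\|u_1\|_2^2+\frac12a(u_0,u_0)-\frac1{p+1}\|u_0\|_{p+1}^{p+1}$. Under (i)–(iv) the weak solution is global and satisfies the energy identity $E(t)+\int_0^t\int_\Omega\gamma(s)g(u_t)u_t\,dxds=E(0)$, so that $E$ is nonincreasing. The exponent $m$ in (2) is the same $m$ as in (ii). The theorem does not define "polynomial growth" further; its proof works, for simplicity, with $h(s)=b_5|s|^{m-1}s$ for $|s|\le1$, $b_5>0$, $m>1$. *)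

theory Defs
  imports "HOL-Analysis.Analysis"
begin

section \<open>Smooth functions and smooth domains\<close>

fun iter_pderiv :: "'a::euclidean_space list \<Rightarrow> ('a \<Rightarrow> real) \<Rightarrow> 'a \<Rightarrow> real" where
  "iter_pderiv [] f = f"
| "iter_pderiv (b # bs) f = iter_pderiv bs (\<lambda>x. frechet_derivative f (at x) b)"

text \<open>Meant for open \<open>S\<close>: all iterated partial derivatives exist and are (Frechet)
  differentiable, hence continuous, on \<open>S\<close>.\<close>

definition smooth_on :: "'a::euclidean_space set \<Rightarrow> ('a \<Rightarrow> real) \<Rightarrow> bool" where
  "smooth_on S f \<longleftrightarrow>
     (\<forall>bs. set bs \<subseteq> Basis \<longrightarrow> (\<forall>x\<in>S. iter_pderiv bs f differentiable (at x)))"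

text \<open>\<open>f \<in> C\<^sup>\<infinity>\<close> on the closure of an open set: \<open>f\<close> is smooth inside, and \<open>f\<close> and all its
  derivatives extend continuously to the closure (for \<open>f\<close> itself the extension is \<open>f\<close>).\<close>

definition smooth_on_closure :: "'a::euclidean_space set \<Rightarrow> ('a \<Rightarrow> real) \<Rightarrow> bool" where
  "smooth_on_closure \<Omega> f \<longleftrightarrow>
     smooth_on \<Omega> f \<and> continuous_on (closure \<Omega>) f \<and>
     (\<forall>bs. set bs \<subseteq> Basis \<longrightarrow>
        (\<exists>F. continuous_on (closure \<Omega>) F \<and> (\<forall>x\<in>\<Omega>. F x = iter_pderiv bs f x)))"

text \<open>Near each boundary point the set lies strictly above the graph of a smooth function, in
  coordinates \<open>x = (x - (x \<bullet> e) e) + (x \<bullet> e) e\<close> with vertical unit direction \<open>e\<close>; the function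
  \<open>\<theta>\<close> depends on the horizontal part of \<open>x\<close> only.\<close>

definition smooth_boundary :: "'a::euclidean_space set \<Rightarrow> bool" where
  "smooth_boundary \<Omega> \<longleftrightarrow>
     (\<forall>x0\<in>frontier \<Omega>. \<exists>r>0. \<exists>e \<theta>. norm e = 1 \<and> smooth_on UNIV \<theta> \<and>
        (\<forall>x. \<theta> x = \<theta> (x - (x \<bullet> e) *\<^sub>R e)) \<and>
        \<Omega> \<inter> ball x0 r = {x \<in> ball x0 r. x \<bullet> e > \<theta> x})"

definition bounded_smooth_domain :: "'a::euclidean_space set \<Rightarrow> bool" where
  "bounded_smooth_domain \<Omega> \<longleftrightarrow>
     \<Omega> \<noteq> {} \<and> open \<Omega> \<and> connected \<Omega> \<and> bounded \<Omega> \<and> smooth_boundary \<Omega>"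

definition C1_on :: "real set \<Rightarrow> (real \<Rightarrow> real) \<Rightarrow> bool" where
  "C1_on I f \<longleftrightarrow>
     (\<exists>f'. (\<forall>x\<in>I. (f has_real_derivative f' x) (at x within I)) \<and> continuous_on I f')"


section \<open>Lebesgue and Sobolev spaces\<close>

text \<open>Elements of function spaces over \<open>\<Omega>\<close> are represented by total functions, of which only the
  values almost everywhere on \<open>\<Omega>\<close> matter.\<close>

definition Lp_space :: "'a::euclidean_space set \<Rightarrow> real \<Rightarrow> ('a \<Rightarrow> real) set" where
  "Lp_space \<Omega> q = {f. f \<in> borel_measurable (lebesgue_on \<Omega>) \<and>
                      integrable (lebesgue_on \<Omega>) (\<lambda>x. \<bar>f x\<bar> powr q)}"

definition Lp_norm :: "'a::euclidean_space set \<Rightarrow> real \<Rightarrow> ('a \<Rightarrow> real) \<Rightarrow> real" where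
  "Lp_norm \<Omega> q f = (LINT x|lebesgue_on \<Omega>. \<bar>f x\<bar> powr q) powr (1 / q)"

definition test_function :: "'a::euclidean_space set \<Rightarrow> ('a \<Rightarrow> real) \<Rightarrow> bool" where
  "test_function \<Omega> \<psi> \<longleftrightarrow>
     smooth_on UNIV \<psi> \<and> compact (closure {x. \<psi> x \<noteq> 0}) \<and> closure {x. \<psi> x \<noteq> 0} \<subseteq> \<Omega>"

definition weak_gradient ::
    "'a::euclidean_space set \<Rightarrow> ('a \<Rightarrow> real) \<Rightarrow> ('a \<Rightarrow> 'a) \<Rightarrow> bool" where
  "weak_gradient \<Omega> v G \<longleftrightarrow>
     (\<forall>K. compact K \<and> K \<subseteq> \<Omega> \<longrightarrow>
        integrable (lebesgue_on K) v \<and> integrable (lebesgue_on K) G) \<and>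
     (\<forall>\<psi> b. test_function \<Omega> \<psi> \<and> b \<in> Basis \<longrightarrow>
        (LINT x|lebesgue_on \<Omega>. v x * frechet_derivative \<psi> (at x) b)
          = - (LINT x|lebesgue_on \<Omega>. (G x \<bullet> b) * \<psi> x))"

text \<open>The weak gradient, unique up to null sets when it exists.\<close>

definition wgrad :: "'a::euclidean_space set \<Rightarrow> ('a \<Rightarrow> real) \<Rightarrow> 'a \<Rightarrow> 'a" where
  "wgrad \<Omega> v = (SOME G. weak_gradient \<Omega> v G)"

definition grad_norm :: "'a::euclidean_space set \<Rightarrow> ('a \<Rightarrow> real) \<Rightarrow> real" where
  "grad_norm \<Omega> v = Lp_norm \<Omega> 2 (\<lambda>x. norm (wgrad \<Omega> v x))"

definition H1 :: "'a::euclidean_space set \<Rightarrow> ('a \<Rightarrow> real) set" where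
  "H1 \<Omega> = {v \<in> Lp_space \<Omega> 2.
             \<exists>G. weak_gradient \<Omega> v G \<and> (\<forall>b\<in>Basis. (\<lambda>x. G x \<bullet> b) \<in> Lp_space \<Omega> 2)}"

definition H1_norm :: "'a::euclidean_space set \<Rightarrow> ('a \<Rightarrow> real) \<Rightarrow> real" where
  "H1_norm \<Omega> v = sqrt ((Lp_norm \<Omega> 2 v)\<^sup>2 + (grad_norm \<Omega> v)\<^sup>2)"

text \<open>\<open>H\<^sub>0\<^sup>1\<close> is the closure of the test functions in \<open>H\<^sup>1\<close>.\<close>

definition H01 :: "'a::euclidean_space set \<Rightarrow> ('a \<Rightarrow> real) set" where
  "H01 \<Omega> = {v \<in> H1 \<Omega>.
              \<forall>\<epsilon>>0. \<exists>\<psi>. test_function \<Omega> \<psi> \<and> H1_norm \<Omega> (\<lambda>x. v x - \<psi> x) < \<epsilon>}"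

definition H01_embedding_bound :: "'a::euclidean_space set \<Rightarrow> real \<Rightarrow> real \<Rightarrow> bool" where
  "H01_embedding_bound \<Omega> q K \<longleftrightarrow>
     (\<forall>v\<in>H01 \<Omega>. v \<in> Lp_space \<Omega> q \<and> Lp_norm \<Omega> q v \<le> K * grad_norm \<Omega> v)"

definition optimal_H01_embedding_constant ::
    "'a::euclidean_space set \<Rightarrow> real \<Rightarrow> real \<Rightarrow> bool" where
  "optimal_H01_embedding_constant \<Omega> q M \<longleftrightarrow>
     H01_embedding_bound \<Omega> q M \<and> (\<forall>K. H01_embedding_bound \<Omega> q K \<longrightarrow> M \<le> K)"

text \<open>\<open>W\<^sup>1\<^sup>,\<^sup>\<infinity>\<close> locally on the closed half-line, i.e. \<open>W\<^sup>1\<^sup>,\<^sup>\<infinity>(0,T)\<close> for every \<open>T\<close>.\<close>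

definition W1inf_loc_halfline :: "(real \<Rightarrow> real) \<Rightarrow> bool" where
  "W1inf_loc_halfline f \<longleftrightarrow>
     (\<exists>f'. weak_gradient {0<..} f f' \<and>
        (\<forall>T>0. \<exists>K. AE t in lebesgue_on {0<..<T}. \<bar>f t\<bar> \<le> K \<and> \<bar>f' t\<bar> \<le> K))"


section \<open>Time-dependent functions\<close>

definition continuous_into_H01 ::
    "'a::euclidean_space set \<Rightarrow> real \<Rightarrow> (real \<Rightarrow> 'a \<Rightarrow> real) \<Rightarrow> bool" where
  "continuous_into_H01 \<Omega> T u \<longleftrightarrow>
     (\<forall>t\<in>{0..T}. u t \<in> H01 \<Omega> \<and>
        ((\<lambda>s. H1_norm \<Omega> (\<lambda>x. u s x - u t x)) \<longlongrightarrow> 0) (at t within {0..T}))"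

definition continuous_into_L2 ::
    "'a::euclidean_space set \<Rightarrow> real \<Rightarrow> (real \<Rightarrow> 'a \<Rightarrow> real) \<Rightarrow> bool" where
  "continuous_into_L2 \<Omega> T v \<longleftrightarrow>
     (\<forall>t\<in>{0..T}. v t \<in> Lp_space \<Omega> 2 \<and>
        ((\<lambda>s. Lp_norm \<Omega> 2 (\<lambda>x. v s x - v t x)) \<longlongrightarrow> 0) (at t within {0..T}))"

text \<open>\<open>v\<close> is the time derivative of the \<open>L\<^sup>2\<close>-valued function \<open>u\<close> on \<open>[0,T]\<close>, one-sided at the
  end points.  For continuous \<open>v\<close> this is the same as the distributional time derivative.\<close>

definition has_L2_time_derivative ::
    "'a::euclidean_space set \<Rightarrow> real \<Rightarrow> (real \<Rightarrow> 'a \<Rightarrow> real) \<Rightarrow> (real \<Rightarrow> 'a \<Rightarrow> real) \<Rightarrow> bool" where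
  "has_L2_time_derivative \<Omega> T u v \<longleftrightarrow>
     (\<forall>t\<in>{0..T}.
        ((\<lambda>s. Lp_norm \<Omega> 2 (\<lambda>x. (u s x - u t x) / (s - t) - v t x)) \<longlongrightarrow> 0)
          (at t within {0..T}))"

text \<open>Membership of a time-dependent function in \<open>L\<^sup>q(\<Omega> \<times> (0,T))\<close>.  The function \<open>w\<close> is a jointly
  measurable representative; pointwise in time only the class of \<open>v t\<close> is significant.\<close>

definition in_Lp_spacetime ::
    "'a::euclidean_space set \<Rightarrow> real \<Rightarrow> real \<Rightarrow> (real \<Rightarrow> 'a \<Rightarrow> real) \<Rightarrow> bool" where
  "in_Lp_spacetime \<Omega> T q v \<longleftrightarrow>
     (\<exists>w :: real \<times> 'a \<Rightarrow> real. w \<in> Lp_space ({0<..<T} \<times> \<Omega>) q \<and>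
        (AE s in lebesgue_on {0<..<T}. AE x in lebesgue_on \<Omega>. w (s, x) = v s x))"


section \<open>The wave equation\<close>

definition coefficient_matrix ::
    "(real^3) set \<Rightarrow> (real^3 \<Rightarrow> real^3^3) \<Rightarrow> real \<Rightarrow> bool" where
  "coefficient_matrix \<Omega> A \<omega> \<longleftrightarrow>
     (\<forall>i j. smooth_on_closure \<Omega> (\<lambda>x. A x $ i $ j)) \<and>
     (\<forall>x\<in>closure \<Omega>. transpose (A x) = A x \<and> (\<forall>\<xi>. \<xi> \<noteq> 0 \<longrightarrow> \<xi> \<bullet> (A x *v \<xi>) > 0)) \<and>
     \<omega> > 0 \<and>
     (\<forall>x\<in>closure \<Omega>. \<forall>\<xi>. (\<Sum>i\<in>UNIV. \<Sum>j\<in>UNIV. A x $ i $ j * \<xi> $ i * \<xi> $ j)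
                           \<ge> \<omega> * (\<Sum>i\<in>UNIV. (\<xi> $ i)\<^sup>2))"

definition a_form ::
    "(real^3) set \<Rightarrow> (real^3 \<Rightarrow> real^3^3) \<Rightarrow> (real^3 \<Rightarrow> real) \<Rightarrow> (real^3 \<Rightarrow> real) \<Rightarrow> real" where
  "a_form \<Omega> A v w = (LINT x|lebesgue_on \<Omega>. (A x *v wgrad \<Omega> v x) \<bullet> wgrad \<Omega> w x)"

text \<open>Energy of a state with displacement \<open>v\<close> and velocity \<open>z\<close>.\<close>

definition energy ::
    "(real^3) set \<Rightarrow> (real^3 \<Rightarrow> real^3^3) \<Rightarrow> real \<Rightarrow> (real^3 \<Rightarrow> real) \<Rightarrow> (real^3 \<Rightarrow> real) \<Rightarrow> real"
  where
  "energy \<Omega> A p v z =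
     1/2 * (Lp_norm \<Omega> 2 z)\<^sup>2 + 1/2 * a_form \<Omega> A v v
     - 1 / (p + 1) * Lp_norm \<Omega> (p + 1) v powr (p + 1)"

text \<open>Weak solution \<open>u\<close> on \<open>[0,T]\<close>, with \<open>v\<close> its time derivative; similarly \<open>\<psi>\<close> is the time
  derivative of \<open>\<phi>\<close>.\<close>

definition weak_solution_on ::
    "(real^3) set \<Rightarrow> (real^3 \<Rightarrow> real^3^3) \<Rightarrow> (real \<Rightarrow> real) \<Rightarrow> (real \<Rightarrow> real) \<Rightarrow> real \<Rightarrow> real \<Rightarrow>
     (real^3 \<Rightarrow> real) \<Rightarrow> (real^3 \<Rightarrow> real) \<Rightarrow> real \<Rightarrow>
     (real \<Rightarrow> real^3 \<Rightarrow> real) \<Rightarrow> (real \<Rightarrow> real^3 \<Rightarrow> real) \<Rightarrow> bool" where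
  "weak_solution_on \<Omega> A \<gamma> g p m u0 u1 T u v \<longleftrightarrow>
     continuous_into_H01 \<Omega> T u \<and>
     has_L2_time_derivative \<Omega> T u v \<and> continuous_into_L2 \<Omega> T v \<and>
     in_Lp_spacetime \<Omega> T (m + 1) v \<and>
     (AE x in lebesgue_on \<Omega>. u 0 x = u0 x) \<and> (AE x in lebesgue_on \<Omega>. v 0 x = u1 x) \<and>
     (\<forall>t\<in>{0..T}. \<forall>\<phi> \<psi>.
        continuous_into_H01 \<Omega> T \<phi> \<and> in_Lp_spacetime \<Omega> T (m + 1) \<phi> \<and>
        has_L2_time_derivative \<Omega> T \<phi> \<psi> \<and> continuous_into_L2 \<Omega> T \<psi> \<longrightarrow>
        (LINT x|lebesgue_on \<Omega>. v t x * \<phi> t x) - (LINT x|lebesgue_on \<Omega>. v 0 x * \<phi> 0 x)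
        + (LINT s|lebesgue_on {0..t}. a_form \<Omega> A (u s) (\<phi> s))
        - (LINT s|lebesgue_on {0..t}. LINT x|lebesgue_on \<Omega>. v s x * \<psi> s x)
        + (LINT s|lebesgue_on {0..t}. LINT x|lebesgue_on \<Omega>. \<gamma> s * g (v s x) * \<phi> s x)
        = (LINT s|lebesgue_on {0..t}. LINT x|lebesgue_on \<Omega>.
             \<bar>u s x\<bar> powr (p - 1) * u s x * \<phi> s x))"

definition global_weak_solution ::
    "(real^3) set \<Rightarrow> (real^3 \<Rightarrow> real^3^3) \<Rightarrow> (real \<Rightarrow> real) \<Rightarrow> (real \<Rightarrow> real) \<Rightarrow> real \<Rightarrow> real \<Rightarrow>
     (real^3 \<Rightarrow> real) \<Rightarrow> (real^3 \<Rightarrow> real) \<Rightarrow>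
     (real \<Rightarrow> real^3 \<Rightarrow> real) \<Rightarrow> (real \<Rightarrow> real^3 \<Rightarrow> real) \<Rightarrow> bool" where
  "global_weak_solution \<Omega> A \<gamma> g p m u0 u1 u v \<longleftrightarrow>
     (\<forall>T>0. weak_solution_on \<Omega> A \<gamma> g p m u0 u1 T u v)"


section \<open>Growth of the comparison function near zero\<close>

definition linear_on_unit :: "(real \<Rightarrow> real) \<Rightarrow> bool" where
  "linear_on_unit h \<longleftrightarrow> (\<exists>c. \<forall>s\<in>{-1..1}. h s = c * s)"

text \<open>Growth of order \<open>m\<close>, the model case being \<open>h s = b * \<bar>s\<bar> powr (m - 1) * s\<close>.\<close>

definition polynomial_growth_on_unit :: "real \<Rightarrow> (real \<Rightarrow> real) \<Rightarrow> bool" where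
  "polynomial_growth_on_unit m h \<longleftrightarrow>
     (\<exists>b>0. \<exists>c>0. \<forall>s\<in>{-1..1}. b * \<bar>s\<bar> powr m \<le> \<bar>h s\<bar> \<and> \<bar>h s\<bar> \<le> c * \<bar>s\<bar> powr m)"

text \<open>The inverse of \<open>h\<close> is defined on \<open>h ` [-1,1]\<close> only, so the upper bound is required there.
  (Comparing the two bounds shows that this range is contained in \<open>[-1,1]\<close>; it is a proper
  subset as soon as \<open>h 1 < 1\<close>.)\<close>

definition damping_bounds_near_zero :: "(real \<Rightarrow> real) \<Rightarrow> (real \<Rightarrow> real) \<Rightarrow> bool" where
  "damping_bounds_near_zero h g \<longleftrightarrow>
     (\<forall>s. \<bar>s\<bar> \<le> 1 \<longrightarrow> \<bar>h s * s\<bar> \<le> g s * s \<and>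
        (s \<in> h ` {-1..1} \<longrightarrow> g s * s \<le> \<bar>the_inv_into {-1..1} h s * s\<bar>))"

end

(*
  Testing the equation with the solution itself reflected oddly in time and differenced centrally,
  and letting the step tend to zero, gives the energy identity; the source term is handled by the
  convexity of |r|^(p+1), the damping term by weak convergence of the difference quotients in
  L^(m+1).  By hypothesis (iv) the orbit starts in the potential well and, the energy being
  nonincreasing, stays there, so that the energy is equivalent to |u_t|^2 + a(u,u).  Testing with u
  and weighting in time by gamma * E^kappa, where kappa = 0 if h is linear and kappa = (m-1)/2 if h
  has growth of order m, bounds the integral of gamma * E^(kappa+1) over [S,T] by a multiple of
  E(S): pointwise Young inequalities absorb u_t^2 and g(u_t) u into the dissipation g(u_t) u_t, and the
  second mean value theorem handles the momentum (u_t,u), since the weight is monotone.  As E is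
  nonincreasing, E(T)^(kappa+1) times the integral of gamma over [S,T] is at most C E(S), and
  iterating this gives the two decay rates.
*)
theory Submission
  imports Defs
begin

section \<open>Square integrable functions\<close>

text \<open>The velocity lies only in L^2, so it is not an admissible test function. Central
  differences replace it: for a symmetric form k the difference k(s, s+h) - k(s, s-h) telescopes in
  time without any differentiability. The odd reflection supplies times below zero and keeps the
  velocity, extended evenly, continuous there. The quotients must also lie in L^(m+1) of space-time;
  they are means of u_t over short intervals, so Jensen's inequality gives this with a bound uniform
  in h, once u_t has a jointly measurable representative. The condition p (m+1)/m < 6 and the
  embedding of H_0^1 into L^6, proved here by Gagliardo's line integrals, place the source in the
  dual space. The same embedding bounds the Young remainders in u by the energy. The exponent kappa
  is dictated by Young's inequality: when u_t^2 is traded for |u_t|^(k+1), with k = 1 or k = m, the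
  conjugate power turns E^kappa into E^(kappa+1). The weight gamma E^kappa is used only through its
  monotonicity.\<close>

definition sq_int :: "'a measure \<Rightarrow> ('a \<Rightarrow> 'b::euclidean_space) \<Rightarrow> bool" where
  "sq_int M f \<longleftrightarrow> f \<in> borel_measurable M \<and> integrable M (\<lambda>x. (norm (f x))\<^sup>2)"

definition ip :: "'a measure \<Rightarrow> ('a \<Rightarrow> 'b::euclidean_space) \<Rightarrow> ('a \<Rightarrow> 'b) \<Rightarrow> real" where
  "ip M f g = (LINT x|M. f x \<bullet> g x)"

text \<open>Functions, not classes, are the objects, so this is a seminorm. The codomain is any
  Euclidean space, so that functions and their gradients share one calculus.\<close>

definition nrm :: "'a measure \<Rightarrow> ('a \<Rightarrow> 'b::euclidean_space) \<Rightarrow> real" where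
  "nrm M f = sqrt (LINT x|M. (norm (f x))\<^sup>2)"

lemma sq_int_measurable: "sq_int M f \<Longrightarrow> f \<in> borel_measurable M"
  by (simp add: sq_int_def)

lemma sq_int_inner:
  assumes "sq_int M f" "sq_int M g"
  shows "integrable M (\<lambda>x. f x \<bullet> g x)"
proof (rule Bochner_Integration.integrable_bound)
  show "integrable M (\<lambda>x. (norm (f x))\<^sup>2 + (norm (g x))\<^sup>2)"
    using assms by (auto simp: sq_int_def)
  show "(\<lambda>x. f x \<bullet> g x) \<in> borel_measurable M"
    using assms by (auto simp: sq_int_def)
  have "\<bar>a \<bullet> b\<bar> \<le> (norm a)\<^sup>2 + (norm b)\<^sup>2" for a b :: 'b
  proof -
    have "\<bar>a \<bullet> b\<bar> \<le> norm a * norm b" by (rule Cauchy_Schwarz_ineq2)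
    also have "\<dots> \<le> (norm a)\<^sup>2 + (norm b)\<^sup>2"
      using sum_squares_bound[of "norm a" "norm b"] mult_nonneg_nonneg[OF norm_ge_zero[of a] norm_ge_zero[of b]]
      by linarith
    finally show ?thesis .
  qed
  then show "AE x in M. norm (f x \<bullet> g x) \<le> norm ((norm (f x))\<^sup>2 + (norm (g x))\<^sup>2)"
    by (auto simp del: norm_mult)
qed

lemma sq_int_scaleR: "sq_int M f \<Longrightarrow> sq_int M (\<lambda>x. c *\<^sub>R f x)"
  by (auto simp: sq_int_def power_mult_distrib)

lemma sq_int_minus: "sq_int M f \<Longrightarrow> sq_int M (\<lambda>x. - f x)"
  by (auto simp: sq_int_def)

lemma sq_int_add:
  assumes "sq_int M f" "sq_int M g"
  shows "sq_int M (\<lambda>x. f x + g x)"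
proof -
  have "(norm (f x + g x))\<^sup>2 = (norm (f x))\<^sup>2 + (norm (g x))\<^sup>2 + 2 * (f x \<bullet> g x)" for x
    by (simp add: power2_norm_eq_inner inner_add_left inner_add_right inner_commute)
  then show ?thesis
    using assms sq_int_inner[OF assms] by (auto simp: sq_int_def)
qed

lemma sq_int_diff: "sq_int M f \<Longrightarrow> sq_int M g \<Longrightarrow> sq_int M (\<lambda>x. f x - g x)"
  using sq_int_add[of M f "\<lambda>x. - g x"] sq_int_minus by auto

lemma ip_commute: "ip M f g = ip M g f"
  by (simp add: ip_def inner_commute)

lemma ip_add_left: "sq_int M f \<Longrightarrow> sq_int M g \<Longrightarrow> sq_int M k \<Longrightarrow>
    ip M (\<lambda>x. f x + g x) k = ip M f k + ip M g k"
  by (simp add: ip_def inner_add_left sq_int_inner)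

lemma ip_diff_left: "sq_int M f \<Longrightarrow> sq_int M g \<Longrightarrow> sq_int M k \<Longrightarrow>
    ip M (\<lambda>x. f x - g x) k = ip M f k - ip M g k"
  by (simp add: ip_def inner_diff_left sq_int_inner)

lemma ip_diff_right: "sq_int M f \<Longrightarrow> sq_int M g \<Longrightarrow> sq_int M k \<Longrightarrow>
    ip M k (\<lambda>x. f x - g x) = ip M k f - ip M k g"
  by (simp add: ip_def inner_diff_right sq_int_inner)

lemma ip_add_right: "sq_int M f \<Longrightarrow> sq_int M g \<Longrightarrow> sq_int M k \<Longrightarrow>
    ip M k (\<lambda>x. f x + g x) = ip M k f + ip M k g"
  by (simp add: ip_def inner_add_right sq_int_inner)

lemma ip_scaleR_left: "ip M (\<lambda>x. c *\<^sub>R f x) g = c * ip M f g"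
  by (simp add: ip_def)

lemma ip_scaleR_right: "ip M f (\<lambda>x. c *\<^sub>R g x) = c * ip M f g"
  by (simp add: ip_def)

lemma nrm_nonneg [simp]: "0 \<le> nrm M f"
  by (simp add: nrm_def)

lemma nrm_sq: "(nrm M f)\<^sup>2 = (LINT x|M. (norm (f x))\<^sup>2)"
  by (simp add: nrm_def)

lemma nrm_sq_ip: "(nrm M f)\<^sup>2 = ip M f f"
  by (simp add: nrm_sq ip_def power2_norm_eq_inner)

text \<open>The discriminant criterion, with the degenerate case included because the leading
  coefficient will be a squared seminorm.\<close>

lemma quadratic_nonneg_imp:
  fixes a b c :: real
  assumes "\<And>t. 0 \<le> a + 2 * t * b + t\<^sup>2 * c" "0 \<le> c"
  shows "b\<^sup>2 \<le> a * c"
proof (cases "c = 0")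
  case True
  have "b = 0"
  proof (rule ccontr)
    assume "b \<noteq> 0"
    \<comment> \<open>At this argument the affine function \<open>a + 2 * t * b\<close> has the
      value -1.\<close>
    then show False using assms(1)[of "- (a + 1) / (2 * b)"] True by (simp add: field_simps)
  qed
  then show ?thesis using True by simp
next
  case False
  then have "c > 0" using assms by simp
  have "0 \<le> a + 2 * (- b / c) * b + (- b / c)\<^sup>2 * c" by (rule assms(1))
  also have "\<dots> = a - b\<^sup>2 / c" using \<open>c > 0\<close> by (simp add: power2_eq_square field_simps)
  finally show ?thesis using \<open>c > 0\<close> by (simp add: field_simps)
qed

text \<open>The squared norm of f + t g is a nonnegative quadratic in t, so its discriminant is not
  positive.\<close>

lemma ip_CS:
  assumes "sq_int M f" "sq_int M g"
  shows "\<bar>ip M f g\<bar> \<le> nrm M f * nrm M g"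
proof -
  have "0 \<le> (nrm M f)\<^sup>2 + 2 * t * ip M f g + t\<^sup>2 * (nrm M g)\<^sup>2" for t
  proof -
    have "0 \<le> (nrm M (\<lambda>x. f x + t *\<^sub>R g x))\<^sup>2" by simp
    also have "\<dots> = (nrm M f)\<^sup>2 + 2 * t * ip M f g + t\<^sup>2 * (nrm M g)\<^sup>2"
      unfolding nrm_sq_ip using assms
      by (simp add: ip_add_left ip_add_right sq_int_scaleR sq_int_add ip_scaleR_left ip_scaleR_right
          ip_commute[of M g f] power2_eq_square algebra_simps)
    finally show ?thesis .
  qed
  then have "(ip M f g)\<^sup>2 \<le> (nrm M f)\<^sup>2 * (nrm M g)\<^sup>2"
    by (rule quadratic_nonneg_imp) auto
  then have "\<bar>ip M f g\<bar> \<le> \<bar>nrm M f * nrm M g\<bar>"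
    by (simp only: abs_le_square_iff power_mult_distrib)
  then show ?thesis by (simp add: abs_mult)
qed

lemma nrm_add:
  assumes "sq_int M f" "sq_int M g"
  shows "nrm M (\<lambda>x. f x + g x) \<le> nrm M f + nrm M g"
proof (rule power2_le_imp_le)
  have "(nrm M (\<lambda>x. f x + g x))\<^sup>2 = (nrm M f)\<^sup>2 + 2 * ip M f g + (nrm M g)\<^sup>2"
    unfolding nrm_sq_ip using assms
    by (simp add: ip_add_left ip_add_right sq_int_add ip_commute[of M g f])
  also have "\<dots> \<le> (nrm M f)\<^sup>2 + 2 * (nrm M f * nrm M g) + (nrm M g)\<^sup>2"
    using ip_CS[OF assms] by linarith
  finally show "(nrm M (\<lambda>x. f x + g x))\<^sup>2 \<le> (nrm M f + nrm M g)\<^sup>2"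
    by (simp add: power2_sum)
qed simp

lemma nrm_scaleR: "nrm M (\<lambda>x. c *\<^sub>R f x) = \<bar>c\<bar> * nrm M f"
  by (simp add: nrm_def power_mult_distrib real_sqrt_mult)

lemma nrm_minus: "nrm M (\<lambda>x. - f x) = nrm M f"
  by (simp add: nrm_def)

lemma nrm_diff:
  assumes "sq_int M f" "sq_int M g"
  shows "nrm M (\<lambda>x. f x - g x) \<le> nrm M f + nrm M g"
  using nrm_add[OF assms(1) sq_int_minus[OF assms(2)]] by (simp add: nrm_minus)

lemma nrm_cong_AE:
  assumes "f \<in> borel_measurable M" "g \<in> borel_measurable M" "AE x in M. f x = g x"
  shows "nrm M f = nrm M g"
  unfolding nrm_def using assms by (intro arg_cong[where f=sqrt] integral_cong_AE) auto

lemma ip_cong_AE: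
  assumes "f \<in> borel_measurable M" "g \<in> borel_measurable M" "AE x in M. f x = g x"
    "f' \<in> borel_measurable M" "g' \<in> borel_measurable M" "AE x in M. f' x = g' x"
  shows "ip M f f' = ip M g g'"
  unfolding ip_def using assms by (intro integral_cong_AE) auto

lemma sq_int_cong_AE:
  assumes "f \<in> borel_measurable M" "sq_int M g" "AE x in M. f x = g x"
  shows "sq_int M f"
  unfolding sq_int_def
proof
  show "integrable M (\<lambda>x. (norm (f x))\<^sup>2)"
  proof (rule integrable_cong_AE_imp)
    show "integrable M (\<lambda>x. (norm (g x))\<^sup>2)" using assms by (simp add: sq_int_def)
    show "AE x in M. (norm (g x))\<^sup>2 = (norm (f x))\<^sup>2" using assms(3) by eventually_elim simp
  qed (use assms in measurable)
qed (use assms in auto)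

section \<open>Continuity of L^2-valued functions of time\<close>

lemma ip_diff_bound:
  assumes "sq_int M f" "sq_int M f'" "sq_int M g" "sq_int M g'"
  shows "\<bar>ip M f' g' - ip M f g\<bar> \<le> nrm M (\<lambda>x. f' x - f x) * nrm M g
      + nrm M f * nrm M (\<lambda>x. g' x - g x)
      + nrm M (\<lambda>x. f' x - f x) * nrm M (\<lambda>x. g' x - g x)"
proof -
  have "ip M f' g' - ip M f g = ip M (\<lambda>x. f' x - f x) g + ip M f (\<lambda>x. g' x - g x)
     + ip M (\<lambda>x. f' x - f x) (\<lambda>x. g' x - g x)"
    using assms by (simp add: ip_diff_left ip_diff_right sq_int_diff)
  then show ?thesis
    using ip_CS[OF sq_int_diff[OF assms(2,1)] assms(3)] ip_CS[OF assms(1) sq_int_diff[OF assms(4,3)]]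
      ip_CS[OF sq_int_diff[OF assms(2,1)] sq_int_diff[OF assms(4,3)]] by linarith
qed

text \<open>Continuity is demanded at every real time, negative ones included, because the reflected
  trajectories live on the whole line.\<close>

definition sq_cont :: "'a measure \<Rightarrow> (real \<Rightarrow> 'a \<Rightarrow> 'b::euclidean_space) \<Rightarrow> bool" where
  "sq_cont M F \<longleftrightarrow> (\<forall>t. sq_int M (F t) \<and> ((\<lambda>s. nrm M (\<lambda>x. F s x - F t x)) \<longlongrightarrow> 0) (at t))"

lemma sq_contD: "sq_cont M F \<Longrightarrow> sq_int M (F t)"
  by (simp add: sq_cont_def)

text \<open>Joint continuity in two separate times: it is applied on the diagonal as well as to
  shifted pairs such as \<open>s\<close> and \<open>s + h\<close>.\<close>

lemma sq_cont_ip_continuous: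
  assumes "sq_cont M F" "sq_cont M G"
  shows "continuous_on UNIV (\<lambda>(s, r). ip M (F s) (G r))"
  unfolding continuous_on_def
proof clarify
  fix t t' :: real
  have nrm0: "nrm M (\<lambda>x. F' x - F' x) = 0" for F' :: "'a \<Rightarrow> 'b"
    by (simp add: nrm_def)
  have F: "((\<lambda>z. nrm M (\<lambda>x. F (fst z) x - F t x)) \<longlongrightarrow> 0) (at (t, t'))"
  proof -
    have "isCont (\<lambda>s. nrm M (\<lambda>x. F s x - F t x)) t"
      using assms(1) unfolding sq_cont_def isCont_def nrm0 by blast
    then have "isCont (\<lambda>z. nrm M (\<lambda>x. F (fst z) x - F t x)) (t, t')"
      by (intro isCont_o2[where g="\<lambda>s. nrm M (\<lambda>x. F s x - F t x)" and f=fst]) simp_all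
    then show ?thesis unfolding isCont_def fst_conv snd_conv nrm0 .
  qed
  have G: "((\<lambda>z. nrm M (\<lambda>x. G (snd z) x - G t' x)) \<longlongrightarrow> 0) (at (t, t'))"
  proof -
    have "isCont (\<lambda>s. nrm M (\<lambda>x. G s x - G t' x)) t'"
      using assms(2) unfolding sq_cont_def isCont_def nrm0 by blast
    then have "isCont (\<lambda>z. nrm M (\<lambda>x. G (snd z) x - G t' x)) (t, t')"
      by (intro isCont_o2[where g="\<lambda>s. nrm M (\<lambda>x. G s x - G t' x)" and f=snd]) simp_all
    then show ?thesis unfolding isCont_def fst_conv snd_conv nrm0 .
  qed
  have "((\<lambda>z. ip M (F (fst z)) (G (snd z)) - ip M (F t) (G t')) \<longlongrightarrow> 0) (at (t, t'))"
  proof (rule Lim_null_comparison)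
    show "\<forall>\<^sub>F z in at (t, t'). norm (ip M (F (fst z)) (G (snd z)) - ip M (F t) (G t'))
        \<le> nrm M (\<lambda>x. F (fst z) x - F t x) * nrm M (G t')
      + nrm M (F t) * nrm M (\<lambda>x. G (snd z) x - G t' x)
      + nrm M (\<lambda>x. F (fst z) x - F t x) * nrm M (\<lambda>x. G (snd z) x - G t' x)"
      unfolding real_norm_def
      by (intro always_eventually allI ip_diff_bound sq_contD[OF assms(1)] sq_contD[OF assms(2)])
    have "((\<lambda>z. nrm M (\<lambda>x. F (fst z) x - F t x) * nrm M (G t')
      + nrm M (F t) * nrm M (\<lambda>x. G (snd z) x - G t' x)
      + nrm M (\<lambda>x. F (fst z) x - F t x) * nrm M (\<lambda>x. G (snd z) x - G t' x)) \<longlongrightarrow> 0 * nrm M (G t')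
       + nrm M (F t) * 0 + 0 * 0) (at (t, t'))"
      by (intro tendsto_intros F G)
    then show "((\<lambda>z. nrm M (\<lambda>x. F (fst z) x - F t x) * nrm M (G t')
      + nrm M (F t) * nrm M (\<lambda>x. G (snd z) x - G t' x)
      + nrm M (\<lambda>x. F (fst z) x - F t x) * nrm M (\<lambda>x. G (snd z) x - G t' x)) \<longlongrightarrow> 0) (at (t, t'))"
      by simp
  qed
  then show "((\<lambda>(s, r). ip M (F s) (G r)) \<longlongrightarrow> ip M (F t) (G t')) (at (t, t') within UNIV)"
    by (subst Lim_null) (simp add: case_prod_unfold)
qed

lemma Lp_norm_2: "Lp_norm \<Omega> 2 f = nrm (lebesgue_on \<Omega>) f"
proof -
  have "\<bar>a\<bar> powr 2 = (norm a)\<^sup>2" for a :: real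
    using powr_numeral[of "\<bar>a\<bar>" num.One] by (cases "a = 0") (auto simp: powr_numeral)
  then show ?thesis
    by (simp add: Lp_norm_def nrm_def powr_half_sqrt)
qed

lemma Lp_space_2: "f \<in> Lp_space \<Omega> 2 \<longleftrightarrow> sq_int (lebesgue_on \<Omega>) f"
proof -
  have "\<bar>a\<bar> powr 2 = (norm a)\<^sup>2" for a :: real
    by (cases "a = 0") (auto simp: powr_numeral)
  then show ?thesis
    by (simp add: Lp_space_def sq_int_def)
qed

lemma grad_norm_nrm: "grad_norm \<Omega> v = nrm (lebesgue_on \<Omega>) (wgrad \<Omega> v)"
  by (simp add: grad_norm_def Lp_norm_2) (simp add: nrm_def)

text \<open>Reconciles the componentwise condition in \<open>H1\<close> with square integrability of
  the gradient as a vector field.\<close>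

lemma sq_int_components:
  "sq_int M (f :: 'a \<Rightarrow> 'b::euclidean_space) \<longleftrightarrow> (\<forall>b\<in>Basis. sq_int M (\<lambda>x. f x \<bullet> b))"
proof
  assume f: "sq_int M f"
  have [measurable]: "f \<in> borel_measurable M" using f by (rule sq_int_measurable)
  show "\<forall>b\<in>Basis. sq_int M (\<lambda>x. f x \<bullet> b)"
  proof
    fix b :: 'b assume b: "b \<in> Basis"
    have "integrable M (\<lambda>x. (norm (f x \<bullet> b))\<^sup>2)"
    proof (rule Bochner_Integration.integrable_bound)
      show "integrable M (\<lambda>x. (norm (f x))\<^sup>2)" using f by (simp add: sq_int_def)
      have "(norm (y \<bullet> b))\<^sup>2 \<le> (norm y)\<^sup>2" for y
        using b by (intro power_mono) (auto simp: Basis_le_norm)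
      then show "AE x in M. norm ((norm (f x \<bullet> b))\<^sup>2) \<le> norm ((norm (f x))\<^sup>2)"
        by simp
    qed measurable
    moreover have "(\<lambda>x. f x \<bullet> b) \<in> borel_measurable M" by measurable
    ultimately show "sq_int M (\<lambda>x. f x \<bullet> b)"
      unfolding sq_int_def by blast
  qed
next
  assume *: "\<forall>b\<in>Basis. sq_int M (\<lambda>x. f x \<bullet> b)"
  have m: "f \<in> borel_measurable M"
    using * by (intro borel_measurable_euclidean_space[THEN iffD2]) (simp add: sq_int_def)
  have eq: "(norm (f x))\<^sup>2 = (\<Sum>b\<in>Basis. (norm (f x \<bullet> b))\<^sup>2)" for x
    unfolding norm_eq_sqrt_inner[of "f x"] by (subst euclidean_inner) (simp add: sum_nonneg power2_eq_square)
  have "integrable M (\<lambda>x. \<Sum>b\<in>Basis. (norm (f x \<bullet> b))\<^sup>2)"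
    using * by (intro Bochner_Integration.integrable_sum) (simp add: sq_int_def)
  then show "sq_int M f" using m unfolding sq_int_def eq by blast
qed


section \<open>Bump functions\<close>

text \<open>The index \<open>k\<close> counts the powers of 1/x that differentiation creates; the
  family as a whole, unlike exp(-1/x) alone, is closed under derivatives up to linear
  combinations.\<close>

definition flat_exp :: "nat \<Rightarrow> real \<Rightarrow> real" where
  "flat_exp k x = (if x > 0 then exp (- 1 / x) / x ^ k else 0)"

lemma flat_exp_tendsto_0: "((\<lambda>x. exp (- 1 / x) / x ^ k) \<longlongrightarrow> (0::real)) (at_right 0)"
proof -
  have "((\<lambda>x. (inverse x) ^ k / exp (inverse x)) \<longlongrightarrow> (0::real)) (at_right 0)"
    using tendsto_power_div_exp_0 filterlim_inverse_at_top_right by (rule filterlim_compose)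
  moreover have "(inverse x) ^ k / exp (inverse x) = exp (- 1 / x) / x ^ k" for x :: real
    by (simp add: exp_minus field_simps power_inverse)
  ultimately show ?thesis by simp
qed

text \<open>Away from zero this is calculus. At zero the quotient from the right is exp(-1/x) /
  x^(k+1), which tends to 0, and from the left it vanishes.\<close>

lemma flat_exp_deriv:
  "(flat_exp k has_real_derivative flat_exp (k + 2) x - real k * flat_exp (k + 1) x) (at x)"
proof -
  consider "x > 0" | "x < 0" | "x = 0" by linarith
  then show ?thesis
  proof cases
    case 1
    have "((\<lambda>x. exp (- 1 / x) / x ^ k) has_real_derivative
        (exp (- 1 / x) * (1 / x\<^sup>2) * x ^ k - exp (- 1 / x) * (real k * x ^ (k - 1))) / (x ^ k * x ^ k)) (at x)"
      using 1 by (auto intro!: derivative_eq_intros simp: power2_eq_square)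
    moreover have "(exp (- 1 / x) * (1 / x\<^sup>2) * x ^ k - exp (- 1 / x) * (real k * x ^ (k - 1))) / (x ^ k * x ^ k)
        = exp (- 1 / x) / x ^ (k + 2) - real k * (exp (- 1 / x) / x ^ (k + 1))"
      using 1 by (cases k) (auto simp: power2_eq_square field_simps)
    ultimately have "((\<lambda>x. exp (- 1 / x) / x ^ k) has_real_derivative
        exp (- 1 / x) / x ^ (k + 2) - real k * (exp (- 1 / x) / x ^ (k + 1))) (at x)"
      by simp
    then show ?thesis
      using 1 by (intro has_field_derivative_transform_within_open[of _ _ _ "{0<..}" "flat_exp k"])
        (auto simp: flat_exp_def)
  next
    case 2
    then show ?thesis
      by (intro has_field_derivative_transform_within_open[of "\<lambda>x. 0" _ _ "{..<0}" "flat_exp k"])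
        (auto simp: flat_exp_def)
  next
    case 3
    have "((\<lambda>h. flat_exp k h / h) \<longlongrightarrow> 0) (at 0)"
    proof (rule filterlim_split_at)
      have "eventually (\<lambda>h. 0 = flat_exp k h / h) (at_left (0::real))"
        by (auto simp: eventually_at_filter flat_exp_def)
      then show "((\<lambda>h. flat_exp k h / h) \<longlongrightarrow> 0) (at_left 0)"
        by (rule Lim_transform_eventually[OF tendsto_const])
      have "eventually (\<lambda>h. exp (- 1 / h) / h ^ (k + 1) = flat_exp k h / h) (at_right (0::real))"
        by (auto simp: eventually_at_filter flat_exp_def)
      then show "((\<lambda>h. flat_exp k h / h) \<longlongrightarrow> 0) (at_right 0)"
        by (rule Lim_transform_eventually[OF flat_exp_tendsto_0])
    qed
    then show ?thesis using 3 by (simp add: DERIV_def flat_exp_def)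
  qed
qed

text \<open>An algebra of functions closed under partial derivatives, hence consisting of smooth functions.\<close>

inductive flat_algebra :: "('a::euclidean_space \<Rightarrow> real) \<Rightarrow> bool" where
  base: "flat_algebra (\<lambda>x. flat_exp k (c + x \<bullet> b))"
| const: "flat_algebra (\<lambda>x. c)"
| add: "flat_algebra f \<Longrightarrow> flat_algebra g \<Longrightarrow> flat_algebra (\<lambda>x. f x + g x)"
| mult: "flat_algebra f \<Longrightarrow> flat_algebra g \<Longrightarrow> flat_algebra (\<lambda>x. f x * g x)"

lemma flat_algebra_deriv:
  assumes "flat_algebra (f :: 'a::euclidean_space \<Rightarrow> real)"
  shows "\<exists>f'. (\<forall>x. (f has_derivative f' x) (at x)) \<and> (\<forall>b. flat_algebra (\<lambda>x. f' x b))"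
  using assms
proof induction
  case (base k c b)
  let ?d = "\<lambda>x. flat_exp (k + 2) (c + x \<bullet> b) + (- real k) * flat_exp (k + 1) (c + x \<bullet> b)"
  have "((\<lambda>x. flat_exp k (c + x \<bullet> b)) has_derivative (\<lambda>h. ?d x * (h \<bullet> b))) (at x)" for x
  proof -
    have 1: "(flat_exp k has_derivative (*) (?d x)) (at (c + x \<bullet> b))"
      using flat_exp_deriv[of k "c + x \<bullet> b"] by (simp add: has_field_derivative_def)
    have 2: "((\<lambda>x. c + x \<bullet> b) has_derivative (\<lambda>h. h \<bullet> b)) (at x)"
      by (auto intro!: derivative_eq_intros)
    show ?thesis using has_derivative_compose[OF 2 1] by simp
  qed
  moreover have "flat_algebra (\<lambda>x. ?d x * (h \<bullet> b))" for h
    by (intro flat_algebra.intros)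
  ultimately show ?case by (intro exI[of _ "\<lambda>x h. ?d x * (h \<bullet> b)"]) blast
next
  case (const c)
  show ?case by (intro exI[of _ "\<lambda>x h. 0"]) (auto intro: flat_algebra.const)
next
  case (add f g)
  then obtain f' g' where
    "\<And>x. (f has_derivative f' x) (at x)" "\<And>b. flat_algebra (\<lambda>x. f' x b)"
    "\<And>x. (g has_derivative g' x) (at x)" "\<And>b. flat_algebra (\<lambda>x. g' x b)" by metis
  then show ?case
    by (intro exI[of _ "\<lambda>x h. f' x h + g' x h"]) (auto intro: flat_algebra.add has_derivative_add)
next
  case (mult f g)
  then obtain f' g' where
    "\<And>x. (f has_derivative f' x) (at x)" "\<And>b. flat_algebra (\<lambda>x. f' x b)"
    "\<And>x. (g has_derivative g' x) (at x)" "\<And>b. flat_algebra (\<lambda>x. g' x b)" by metis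
  then show ?case using mult.hyps
    by (intro exI[of _ "\<lambda>x h. f x * g' x h + f' x h * g x"] conjI allI has_derivative_mult
        flat_algebra.add[OF flat_algebra.mult flat_algebra.mult]) auto
qed

text \<open>Induction on the list of directions, for all members of the algebra at once: a partial
  derivative is again a member.\<close>

lemma flat_algebra_smooth:
  assumes "flat_algebra (f :: 'a::euclidean_space \<Rightarrow> real)"
  shows "smooth_on UNIV f"
proof -
  have "flat_algebra f \<Longrightarrow> iter_pderiv bs f differentiable (at x)" for bs x f
  proof (induction bs arbitrary: f)
    case Nil
    then show ?case using flat_algebra_deriv[of f] by (auto simp: differentiable_def)
  next
    case (Cons b bs)
    obtain f' where f': "\<And>x. (f has_derivative f' x) (at x)" "\<And>b. flat_algebra (\<lambda>x. f' x b)"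
      using flat_algebra_deriv[OF Cons.prems] by blast
    have "frechet_derivative f (at x) = f' x" for x
      using frechet_derivative_at[OF f'(1)] by simp
    then show ?case using Cons.IH[OF f'(2)] by simp
  qed
  then show ?thesis using assms by (auto simp: smooth_on_def)
qed

lemma flat_algebra_prod: "finite I \<Longrightarrow> (\<And>i. i \<in> I \<Longrightarrow> flat_algebra (f i)) \<Longrightarrow> flat_algebra (\<lambda>x. \<Prod>i\<in>I. f i x)"
  by (induction I rule: finite_induct) (auto intro: flat_algebra.intros)

text \<open>Smooth functions increasing to the indicator function of a box, since
  \<open>exp (- 1 / (n * y))\<close> tends to \<open>1\<close> for \<open>y > 0\<close>.\<close>

definition box_bump :: "'a::euclidean_space \<Rightarrow> 'a \<Rightarrow> nat \<Rightarrow> 'a \<Rightarrow> real" where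
  "box_bump a c n x = (\<Prod>b\<in>Basis. flat_exp 0 (real (Suc n) * (x \<bullet> b - a \<bullet> b))
       * flat_exp 0 (real (Suc n) * (c \<bullet> b - x \<bullet> b)))"

lemma flat_exp_0_bounds: "0 \<le> flat_exp 0 x" "flat_exp 0 x \<le> 1"
  by (auto simp: flat_exp_def)

lemma box_bump_bounds: "0 \<le> box_bump a c n x" "box_bump a c n x \<le> 1"
  unfolding box_bump_def by (auto intro!: prod_nonneg prod_le_1 mult_le_one simp: flat_exp_0_bounds)

lemma box_bump_nonzero_iff: "box_bump a c n x \<noteq> 0 \<longleftrightarrow> x \<in> box a c"
  unfolding box_bump_def by (auto simp: flat_exp_def mem_box zero_less_mult_iff)

lemma box_bump_test_function:
  fixes a :: "'a::euclidean_space"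
  assumes "cbox a c \<subseteq> S"
  shows "test_function S (box_bump a c n)"
  unfolding test_function_def
proof (intro conjI)
  have "flat_algebra (box_bump a c n)"
    unfolding box_bump_def[abs_def]
  proof (intro flat_algebra_prod flat_algebra.mult)
    fix b :: 'a
    show "flat_algebra (\<lambda>x. flat_exp 0 (real (Suc n) * (x \<bullet> b - a \<bullet> b)))"
      using flat_algebra.base[of 0 "- real (Suc n) * (a \<bullet> b)" "real (Suc n) *\<^sub>R b"]
      by (simp add: algebra_simps)
    show "flat_algebra (\<lambda>x. flat_exp 0 (real (Suc n) * (c \<bullet> b - x \<bullet> b)))"
      using flat_algebra.base[of 0 "real (Suc n) * (c \<bullet> b)" "- real (Suc n) *\<^sub>R b"]
      by (simp add: algebra_simps)
  qed simp
  then show "smooth_on UNIV (box_bump a c n)" by (rule flat_algebra_smooth)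
  have "closure {x. box_bump a c n x \<noteq> 0} \<subseteq> cbox a c"
    using closure_minimal[OF box_subset_cbox closed_cbox] by (simp add: box_bump_nonzero_iff)
  then show "closure {x. box_bump a c n x \<noteq> 0} \<subseteq> S" "compact (closure {x. box_bump a c n x \<noteq> 0})"
    using assms by (auto simp: compact_closure box_bump_nonzero_iff)
qed

lemma box_bump_tendsto: "(\<lambda>n. box_bump a c n x) \<longlonglongrightarrow> indicator (box a c) x"
proof (cases "x \<in> box a c")
  case True
  have "(\<lambda>n. flat_exp 0 (real (Suc n) * y)) \<longlonglongrightarrow> 1" if "y > 0" for y
  proof -
    have "(\<lambda>n. exp (- 1 / y * inverse (real (Suc n)))) \<longlonglongrightarrow> exp (- 1 / y * 0)"
      by (intro tendsto_intros LIMSEQ_inverse_real_of_nat)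
    moreover have "exp (- 1 / y * inverse (real (Suc n))) = flat_exp 0 (real (Suc n) * y)" for n
    proof -
      have "real (Suc n) * y > 0" using that by simp
      then show ?thesis using that by (simp add: flat_exp_def inverse_eq_divide mult.commute)
    qed
    ultimately show ?thesis by simp
  qed
  then have "(\<lambda>n. box_bump a c n x) \<longlonglongrightarrow> (\<Prod>b\<in>(Basis::'a set). 1 * 1)"
    unfolding box_bump_def using True by (intro tendsto_prod tendsto_mult) (auto simp: mem_box)
  then show ?thesis using True by simp
next
  case False
  then have "box_bump a c n x = 0" for n using box_bump_nonzero_iff by blast
  then show ?thesis using False by simp
qed

section \<open>Weak gradients\<close>

text \<open>The positive and negative parts are densities of two measures that agree on boxes. Boxes
  form an intersection-stable generator, so the measures coincide, the densities agree almost
  everywhere, and equal positive and negative parts force \<open>f\<close> to vanish.\<close>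

lemma AE_zero_if_box_integrals_zero:
  fixes f :: "'a::euclidean_space \<Rightarrow> real"
  assumes f: "integrable lborel f"
    and 0: "\<And>a c. (LINT x|lborel. indicator (box a c) x * f x) = 0"
  shows "AE x in lborel. f x = 0"
proof -
  have [measurable]: "f \<in> borel_measurable lborel" using f by auto
  have int: "integrable lborel (\<lambda>x. indicator (box a c) x * max 0 (s * f x))" for a c s
  proof (rule Bochner_Integration.integrable_bound)
    show "integrable lborel (\<lambda>x. s * f x)" using f by simp
  qed (auto simp: indicator_def)
  have ind: "ennreal y * indicator A x = ennreal (indicator A x * y)" for y and A :: "'a set" and x
    by (simp split: split_indicator)
  have eq: "(\<integral>\<^sup>+x. ennreal (max 0 (1 * f x)) * indicator (box a c) x \<partial>lborel)
      = (\<integral>\<^sup>+x. ennreal (max 0 ((-1) * f x)) * indicator (box a c) x \<partial>lborel)" for a c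
  proof -
    have *: "(\<integral>\<^sup>+x. ennreal (max 0 (s * f x)) * indicator (box a c) x \<partial>lborel)
        = ennreal (LINT x|lborel. indicator (box a c) x * max 0 (s * f x))" for s
      using nn_integral_eq_integral[OF int[of a c s]] by (simp add: ind)
    have "(LINT x|lborel. indicator (box a c) x * max 0 (1 * f x))
        - (LINT x|lborel. indicator (box a c) x * max 0 ((-1) * f x))
       = (LINT x|lborel. indicator (box a c) x * f x)"
      unfolding Bochner_Integration.integral_diff[OF int int, symmetric]
      by (intro Bochner_Integration.integral_cong) (auto simp: indicator_def)
    then show ?thesis unfolding * using 0 by simp
  qed
  have "density lborel (\<lambda>x. ennreal (max 0 (1 * f x))) = density lborel (\<lambda>x. ennreal (max 0 ((-1) * f x)))"
  proof (rule measure_eqI_generator_eq[where E="range (\<lambda>(a,b). box a b :: 'a set)" and \<Omega>=UNIV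
        and A="\<lambda>n. box (- (real n *\<^sub>R One)) (real n *\<^sub>R One)"])
    show "Int_stable (range (\<lambda>(a,b). box a b :: 'a set))"
      by (auto simp: Int_stable_def box_Int_box)
    show "emeasure (density lborel (\<lambda>x. ennreal (max 0 (1 * f x)))) X
      = emeasure (density lborel (\<lambda>x. ennreal (max 0 ((-1) * f x)))) X"
      if "X \<in> range (\<lambda>(a,b). box a b :: 'a set)" for X
      using that eq by (auto simp: emeasure_density)
    show "sets (density lborel (\<lambda>x. ennreal (max 0 (1 * f x)))) = sigma_sets UNIV (range (\<lambda>(a,b). box a b :: 'a set))"
      "sets (density lborel (\<lambda>x. ennreal (max 0 ((-1) * f x)))) = sigma_sets UNIV (range (\<lambda>(a,b). box a b :: 'a set))"
      by (simp_all add: borel_eq_box)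
    show "(\<Union>i. box (- (real i *\<^sub>R One)) (real i *\<^sub>R One)) = (UNIV :: 'a set)"
      by (rule UN_box_eq_UNIV)
    show "emeasure (density lborel (\<lambda>x. ennreal (max 0 (1 * f x)))) (box (- (real i *\<^sub>R One)) (real i *\<^sub>R One)) \<noteq> \<infinity>" for i
      using nn_integral_eq_integral[OF int[of "- (real i *\<^sub>R One)" "real i *\<^sub>R One" 1]]
      by (simp add: emeasure_density ind)
  qed auto
  then have "AE x in lborel. ennreal (max 0 (1 * f x)) = ennreal (max 0 ((-1) * f x))"
    by (subst (asm) sigma_finite_measure.density_unique_iff[OF sigma_finite_lborel]) auto
  then show ?thesis
    by eventually_elim (auto simp: max_def split: if_splits)
qed

lemma smooth_on_UNIV_has_derivative:
  "smooth_on UNIV \<psi> \<Longrightarrow> (\<psi> has_derivative frechet_derivative \<psi> (at x)) (at x)"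
  unfolding smooth_on_def by (metis UNIV_I empty_subsetI frechet_derivative_works iter_pderiv.simps(1) list.set(1))

lemma smooth_on_UNIV_partial_continuous:
  assumes "smooth_on UNIV \<psi>" "b \<in> Basis"
  shows "continuous_on UNIV (\<lambda>x. frechet_derivative \<psi> (at x) b)"
proof -
  have "iter_pderiv [b] \<psi> differentiable (at x)" for x
    using assms unfolding smooth_on_def by (metis UNIV_I empty_set insert_subset list.simps(15) empty_subsetI)
  then show ?thesis
    by (auto intro!: continuous_at_imp_continuous_on differentiable_imp_continuous_within)
qed

lemma smooth_on_UNIV_continuous: "smooth_on UNIV \<psi> \<Longrightarrow> continuous_on UNIV \<psi>"
  by (intro continuous_at_imp_continuous_on ballI has_derivative_continuous[OF smooth_on_UNIV_has_derivative])

definition cgrad :: "('a::euclidean_space \<Rightarrow> real) \<Rightarrow> 'a \<Rightarrow> 'a" where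
  "cgrad \<psi> x = (\<Sum>b\<in>Basis. frechet_derivative \<psi> (at x) b *\<^sub>R b)"

lemma cgrad_inner: "b \<in> Basis \<Longrightarrow> cgrad \<psi> x \<bullet> b = frechet_derivative \<psi> (at x) b"
  by (simp add: cgrad_def inner_sum_left inner_Basis if_distrib cong: if_cong)

lemma cgrad_continuous: "smooth_on UNIV \<psi> \<Longrightarrow> continuous_on UNIV (cgrad \<psi>)"
  unfolding cgrad_def[abs_def]
  by (intro continuous_intros smooth_on_UNIV_partial_continuous) auto


section \<open>Integration by parts for compactly supported functions\<close>

lemma lborel_integral_translate:
  fixes f :: "'a::euclidean_space \<Rightarrow> real"
  assumes "f \<in> borel_measurable borel"
  shows "(LINT x|lborel. f (c + x)) = (LINT x|lborel. f x)"
  using integral_distr[of "(+) c" lborel borel f] assms by (simp add: lborel_distr_plus)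

lemma lborel_integrable_translate:
  fixes f :: "'a::euclidean_space \<Rightarrow> real"
  assumes "integrable lborel f"
  shows "integrable lborel (\<lambda>x. f (c + x))"
  using integrable_distr_eq[of "(+) c" lborel borel f] assms by (simp add: lborel_distr_plus)

lemma integrable_continuous_compact_support:
  fixes f :: "'a::euclidean_space \<Rightarrow> real"
  assumes "continuous_on UNIV f" "compact K" "\<And>x. x \<notin> K \<Longrightarrow> f x = 0"
  shows "integrable lborel f"
proof -
  have "integrable lborel (\<lambda>x. indicator K x *\<^sub>R f x)"
    using assms by (intro borel_integrable_compact) (auto intro: continuous_on_subset)
  moreover have "(\<lambda>x. indicator K x *\<^sub>R f x) = f"
    using assms(3) by (intro ext) (auto simp: indicator_def)
  ultimately show ?thesis by simp
qed

text \<open>By translation invariance every difference quotient in direction \<open>b\<close> has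
  integral zero; dominated convergence carries this over to the derivative.\<close>

lemma integral_partial_derivative_eq_0:
  fixes F :: "'a::euclidean_space \<Rightarrow> real"
  assumes F: "\<And>x. (F has_derivative F' x) (at x)"
    and D: "continuous_on UNIV (\<lambda>x. F' x b)"
    and K: "compact K" "\<And>x. x \<notin> K \<Longrightarrow> F x = 0"
  shows "(LINT x|lborel. F' x b) = 0"
proof -
  have contF: "continuous_on UNIV F"
    using F by (intro continuous_at_imp_continuous_on ballI has_derivative_continuous)
  have D0: "F' x b = 0" if "x \<notin> K" for x
  proof -
    have "((\<lambda>_. 0) has_derivative F' x) (at x)"
      by (rule has_derivative_transform_within_open[OF F, of "- K"])
        (use K that in \<open>auto simp: compact_imp_closed open_Compl\<close>)
    then have "F' x = (\<lambda>_. 0)" using has_derivative_unique has_derivative_const by blast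
    then show ?thesis by simp
  qed
  have line: "((\<lambda>t. F (x + t *\<^sub>R b)) has_real_derivative F' (x + t *\<^sub>R b) b) (at t)" for x t
  proof -
    have 1: "((\<lambda>t. x + t *\<^sub>R b) has_derivative (\<lambda>h. h *\<^sub>R b)) (at t)"
      by (auto intro!: derivative_eq_intros)
    have "((\<lambda>t. F (x + t *\<^sub>R b)) has_derivative (\<lambda>h. F' (x + t *\<^sub>R b) (h *\<^sub>R b))) (at t)"
      using has_derivative_compose[OF 1 F] .
    moreover have "(\<lambda>h. F' (x + t *\<^sub>R b) (h *\<^sub>R b)) = (*) (F' (x + t *\<^sub>R b) b)"
      using has_derivative_linear[OF F] by (auto simp: linear_scale mult.commute)
    ultimately show ?thesis by (simp add: has_field_derivative_def)
  qed
  have "bounded ((\<lambda>x. F' x b) ` K)"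
    using D K(1) by (intro compact_imp_bounded compact_continuous_image) (auto intro: continuous_on_subset)
  then obtain C0 where C0: "\<And>x. x \<in> K \<Longrightarrow> \<bar>F' x b\<bar> \<le> C0" by (auto simp: bounded_iff)
  define C where "C = max C0 0"
  have C: "\<bar>F' x b\<bar> \<le> C" for x using C0[of x] D0[of x] unfolding C_def by (cases "x \<in> K") auto
  obtain R where R: "\<And>x. x \<in> K \<Longrightarrow> norm x \<le> R" using compact_imp_bounded[OF K(1)] by (auto simp: bounded_iff)
  define h :: "nat \<Rightarrow> real" where "h n = inverse (real (Suc n))" for n
  have h: "h n > 0" "h n \<le> 1" for n by (auto simp: h_def inverse_le_1_iff)
  define G where "G n x = (F (x + h n *\<^sub>R b) - F x) / h n" for n x
  have [measurable]: "F \<in> borel_measurable borel" "(\<lambda>x. F' x b) \<in> borel_measurable borel"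
    using contF D by (auto intro: borel_measurable_continuous_onI)
  have Gm [measurable]: "G n \<in> borel_measurable lborel" for n
    unfolding G_def by measurable
  have "integrable lborel F" using integrable_continuous_compact_support[OF contF K(1)] K(2) by blast
  then have "(LINT x|lborel. G n x) = 0" for n
    unfolding G_def
    using lborel_integral_translate[of F "h n *\<^sub>R b"] lborel_integrable_translate[of F "h n *\<^sub>R b"]
    by (simp add: add.commute)
  moreover have "(\<lambda>n. LINT x|lborel. G n x) \<longlonglongrightarrow> (LINT x|lborel. F' x b)"
  proof (rule integral_dominated_convergence)
    \<comment> \<open>The steps satisfy \<open>h n \<le> 1\<close>, so all quotients vanish outside
      this ball; inside, the mean value theorem bounds them by \<open>C\<close>.\<close>
    show "integrable lborel (\<lambda>x. indicator (cball 0 (R + norm b)) x *\<^sub>R C)"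
      by (intro borel_integrable_compact) auto
    have hlim: "filterlim h (at 0) sequentially"
      unfolding filterlim_at
    proof
      show "h \<longlonglongrightarrow> 0" unfolding h_def[abs_def] by (rule LIMSEQ_inverse_real_of_nat)
      show "\<forall>\<^sub>F x in sequentially. h x \<in> UNIV \<and> h x \<noteq> 0"
        using h by (intro always_eventually allI) (simp add: less_imp_neq[symmetric])
    qed
    show "AE x in lborel. (\<lambda>n. G n x) \<longlonglongrightarrow> F' x b"
    proof (intro always_eventually allI)
      fix x
      have "((\<lambda>t. (F (x + t *\<^sub>R b) - F x) / t) \<longlongrightarrow> F' x b) (at 0)"
        using line[of x 0] by (simp add: DERIV_def)
      from filterlim_compose[OF this hlim] show "(\<lambda>n. G n x) \<longlonglongrightarrow> F' x b" by (simp add: G_def)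
    qed
    show "AE x in lborel. norm (G n x) \<le> indicator (cball 0 (R + norm b)) x *\<^sub>R C" for n
    proof (intro always_eventually allI)
      fix x
      show "norm (G n x) \<le> indicator (cball 0 (R + norm b)) x *\<^sub>R C"
      proof (cases "norm x \<le> R + norm b")
        case True
        obtain z where "F (x + h n *\<^sub>R b) - F (x + 0 *\<^sub>R b) = (h n - 0) * F' (x + z *\<^sub>R b) b"
          using MVT2[of 0 "h n" "\<lambda>t. F (x + t *\<^sub>R b)" "\<lambda>t. F' (x + t *\<^sub>R b) b"] h[of n] line by blast
        then have "G n x = F' (x + z *\<^sub>R b) b" using h[of n] by (simp add: G_def)
        then show ?thesis using C True by simp
      next
        case False
        have "norm (x + h n *\<^sub>R b) \<ge> norm x - norm (h n *\<^sub>R b)"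
          using norm_triangle_ineq2[of x "- (h n *\<^sub>R b)"] by simp
        moreover have "norm (h n *\<^sub>R b) \<le> norm b" using h[of n] by (simp add: mult_left_le_one_le)
        ultimately have "x \<notin> K" "x + h n *\<^sub>R b \<notin> K"
          using False R[of x] R[of "x + h n *\<^sub>R b"] norm_ge_zero[of b] by linarith+
        then show ?thesis using K(2) False by (simp add: G_def)
      qed
    qed
  qed measurable
  ultimately show ?thesis using LIMSEQ_unique[OF tendsto_const[of 0]] by simp
qed

text \<open>Completeness of Lebesgue measure. The functions of the development are arbitrary
  representatives, so measurability has to pass along equality almost everywhere.\<close>

lemma lebesgue_on_measurable_AE:
  fixes f g :: "'a::euclidean_space \<Rightarrow> 'b::euclidean_space"
  assumes "S \<in> sets lebesgue" "f \<in> borel_measurable (lebesgue_on S)"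
    and "AE x in lebesgue_on S. f x = g x"
  shows "g \<in> borel_measurable (lebesgue_on S)"
proof (subst borel_measurable_euclidean_space, rule ballI)
  fix b :: 'b assume "b \<in> Basis"
  have "(\<lambda>x. f x \<bullet> b) \<in> borel_measurable (lebesgue_on S)" using assms(2) by measurable
  then have "(\<lambda>x. indicator S x *\<^sub>R (f x \<bullet> b)) \<in> borel_measurable lebesgue"
    using assms(1) by (subst (asm) borel_measurable_restrict_space_iff) auto
  moreover have "AE x in lebesgue. indicator S x *\<^sub>R (f x \<bullet> b) = indicator S x *\<^sub>R (g x \<bullet> b)"
    using assms(1,3) by (subst (asm) AE_restrict_space_iff) (auto elim!: eventually_mono simp: indicator_def)
  ultimately have "(\<lambda>x. indicator S x *\<^sub>R (g x \<bullet> b)) \<in> borel_measurable lebesgue"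
    by (rule borel_measurable_AE)
  then show "(\<lambda>x. g x \<bullet> b) \<in> borel_measurable (lebesgue_on S)"
    using assms(1) by (subst borel_measurable_restrict_space_iff) auto
qed

lemma AE_lebesgue_on_subset:
  assumes "AE x in lebesgue_on S. P x" "T \<subseteq> S" "S \<in> sets lebesgue" "T \<in> sets lebesgue"
  shows "AE x in lebesgue_on T. P x"
  using assms by (simp add: AE_restrict_space_iff) (auto elim!: eventually_mono)

lemma integral_lebesgue_on_supp:
  fixes f :: "'a::euclidean_space \<Rightarrow> real"
  assumes "S \<in> sets lebesgue" "f \<in> borel_measurable borel" "\<And>x. x \<notin> S \<Longrightarrow> f x = 0"
  shows "(LINT x|lebesgue_on S. f x) = (LINT x|lborel. f x)"
proof -
  have "(LINT x|lebesgue_on S. f x) = (LINT x|lebesgue. indicator S x *\<^sub>R f x)"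
    using assms(1) by (subst integral_restrict_space) auto
  also have "(\<lambda>x. indicator S x *\<^sub>R f x) = f"
    using assms(3) by (intro ext) (auto simp: indicator_def)
  also have "integral\<^sup>L lebesgue f = (LINT x|lborel. f x)"
    using assms(2) by (simp add: integral_completion)
  finally show ?thesis .
qed

text \<open>Only integrability of \<open>f\<close> on \<open>K\<close> is at hand; a continuous
  factor is bounded on the compact \<open>K\<close>, and it vanishes on the rest of
  \<open>S\<close>.\<close>

lemma integrable_mult_compact_support:
  fixes f :: "'a::euclidean_space \<Rightarrow> real"
  assumes "integrable (lebesgue_on K) f" "compact K" "K \<subseteq> S" "S \<in> sets lebesgue"
    and "continuous_on UNIV \<eta>" "\<And>x. x \<notin> K \<Longrightarrow> \<eta> x = 0"
  shows "integrable (lebesgue_on S) (\<lambda>x. f x * \<eta> x)"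
proof -
  have Kl: "K \<in> sets lebesgue" using assms(2) by (simp add: lmeasurable_compact fmeasurableD)
  have "bounded (\<eta> ` K)"
    using assms(2,5) by (intro compact_imp_bounded compact_continuous_image) (auto intro: continuous_on_subset)
  then obtain C where C: "\<And>x. x \<in> K \<Longrightarrow> \<bar>\<eta> x\<bar> \<le> C" by (auto simp: bounded_iff)
  have int: "integrable lebesgue (\<lambda>x. indicator K x *\<^sub>R f x)"
    using assms(1) Kl by (subst (asm) integrable_restrict_space) auto
  have [measurable]: "\<eta> \<in> borel_measurable lebesgue"
    using borel_measurable_continuous_onI[OF assms(5)] by (intro measurable_completion) simp
  have "integrable lebesgue (\<lambda>x. (indicator K x *\<^sub>R f x) * \<eta> x)"
  proof (rule Bochner_Integration.integrable_bound)
    show "integrable lebesgue (\<lambda>x. C * (indicator K x *\<^sub>R f x))" using int by simp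
    show "(\<lambda>x. (indicator K x *\<^sub>R f x) * \<eta> x) \<in> borel_measurable lebesgue"
      using borel_measurable_integrable[OF int] by measurable
    show "AE x in lebesgue. norm ((indicator K x *\<^sub>R f x) * \<eta> x) \<le> norm (C * (indicator K x *\<^sub>R f x))"
    proof (intro always_eventually allI)
      fix x
      show "norm ((indicator K x *\<^sub>R f x) * \<eta> x) \<le> norm (C * (indicator K x *\<^sub>R f x))"
        using C[of x] by (cases "x \<in> K") (auto simp: abs_mult mult.commute[of "\<bar>f x\<bar>"] intro!: mult_right_mono)
    qed
  qed
  moreover have "(\<lambda>x. (indicator K x *\<^sub>R f x) * \<eta> x) = (\<lambda>x. indicator S x *\<^sub>R (f x * \<eta> x))"
    using assms(3,6) by (intro ext) (auto simp: indicator_def)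
  ultimately show ?thesis
    using assms(4) by (subst integrable_restrict_space) auto
qed

lemma test_functionD:
  assumes "test_function S \<psi>"
  shows "smooth_on UNIV \<psi>" "compact (closure {x. \<psi> x \<noteq> 0})" "closure {x. \<psi> x \<noteq> 0} \<subseteq> S"
    "x \<notin> closure {x. \<psi> x \<noteq> 0} \<Longrightarrow> \<psi> x = 0"
    "x \<notin> closure {x. \<psi> x \<noteq> 0} \<Longrightarrow> frechet_derivative \<psi> (at x) b = 0"
proof -
  show s: "smooth_on UNIV \<psi>" and "compact (closure {x. \<psi> x \<noteq> 0})" "closure {x. \<psi> x \<noteq> 0} \<subseteq> S"
    using assms by (auto simp: test_function_def)
  show 0: "x \<notin> closure {x. \<psi> x \<noteq> 0} \<Longrightarrow> \<psi> x = 0" for x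
    using closure_subset[of "{x. \<psi> x \<noteq> 0}"] by blast
  assume x: "x \<notin> closure {x. \<psi> x \<noteq> 0}"
  have "((\<lambda>_. 0) has_derivative frechet_derivative \<psi> (at x)) (at x)"
  proof (rule has_derivative_transform_within_open[OF smooth_on_UNIV_has_derivative[OF s]])
    show "open (- closure {x. \<psi> x \<noteq> 0})" by (simp only: open_Compl closed_closure)
    show "x \<in> - closure {x. \<psi> x \<noteq> 0}" using x by blast
    show "\<psi> y = 0" if "y \<in> - closure {x. \<psi> x \<noteq> 0}" for y using 0 that by blast
  qed
  then have "frechet_derivative \<psi> (at x) = (\<lambda>_. 0)" using has_derivative_unique has_derivative_const by blast
  then show "frechet_derivative \<psi> (at x) b = 0" by simp
qed

lemma test_function_support:
  assumes "test_function S \<psi>"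
  obtains K where "compact K" "K \<subseteq> S" "\<And>x. x \<notin> K \<Longrightarrow> \<psi> x = 0"
    "\<And>x b. x \<notin> K \<Longrightarrow> frechet_derivative \<psi> (at x) b = 0"
  using test_functionD[OF assms] by metis

text \<open>The product \<open>\<psi> x * \<eta> x\<close> has compact support, so its partial
  derivative has integral zero, which is integration by parts.\<close>

lemma weak_gradient_cgrad:
  fixes S :: "'a::euclidean_space set"
  assumes S: "open S" and \<psi>: "test_function S \<psi>"
  shows "weak_gradient S \<psi> (cgrad \<psi>)"
  unfolding weak_gradient_def
proof (intro conjI allI impI)
  note s = test_functionD(1)[OF \<psi>]
  fix K assume K: "compact K \<and> K \<subseteq> S"
  have *: "integrable (lebesgue_on K) f" if "continuous_on UNIV f" for f :: "'a \<Rightarrow> 'b::euclidean_space"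
  proof (subst integrable_restrict_space)
    show "K \<inter> space lebesgue \<in> sets lebesgue" using K by (simp add: lmeasurable_compact fmeasurableD)
    have "integrable lborel (\<lambda>x. indicator K x *\<^sub>R f x)"
      using K that by (intro borel_integrable_compact) (auto intro: continuous_on_subset)
    moreover have "(\<lambda>x. indicator K x *\<^sub>R f x) \<in> borel_measurable lborel"
      using calculation by auto
    ultimately show "integrable lebesgue (\<lambda>x. indicator K x *\<^sub>R f x)"
      by (subst integrable_completion)
  qed
  show "integrable (lebesgue_on K) \<psi>" "integrable (lebesgue_on K) (cgrad \<psi>)"
    using * smooth_on_UNIV_continuous[OF s] cgrad_continuous[OF s] by blast+
next
  fix \<eta> and b :: 'a assume "test_function S \<eta> \<and> b \<in> Basis"
  then have \<eta>: "test_function S \<eta>" and b: "b \<in> Basis" by auto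
  note s = test_functionD(1)[OF \<psi>] and s' = test_functionD(1)[OF \<eta>]
  note c = smooth_on_UNIV_continuous[OF s] smooth_on_UNIV_continuous[OF s']
    smooth_on_UNIV_partial_continuous[OF s b] smooth_on_UNIV_partial_continuous[OF s' b]
  obtain K where K: "compact K" "K \<subseteq> S" and out: "\<And>x. x \<notin> K \<Longrightarrow> \<psi> x = 0"
    "\<And>x b. x \<notin> K \<Longrightarrow> frechet_derivative \<psi> (at x) b = 0"
    using test_function_support[OF \<psi>] by blast
  let ?f1 = "\<lambda>x. \<psi> x * frechet_derivative \<eta> (at x) b"
  let ?f2 = "\<lambda>x. frechet_derivative \<psi> (at x) b * \<eta> x"
  have Sl: "S \<in> sets lebesgue" using S by auto
  have outS: "x \<notin> S \<Longrightarrow> x \<notin> K" for x using K by blast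
  have "(LINT x|lborel. ?f1 x + ?f2 x) = 0"
  proof (rule integral_partial_derivative_eq_0[where F="\<lambda>x. \<psi> x * \<eta> x" and b=b and K=K and
        F'="\<lambda>x h. \<psi> x * frechet_derivative \<eta> (at x) h + frechet_derivative \<psi> (at x) h * \<eta> x"])
    show "continuous_on UNIV (\<lambda>x. ?f1 x + ?f2 x)" using c by (intro continuous_intros) auto
    show "((\<lambda>x. \<psi> x * \<eta> x) has_derivative (\<lambda>h. \<psi> x * frechet_derivative \<eta> (at x) h
        + frechet_derivative \<psi> (at x) h * \<eta> x)) (at x)" for x
      by (intro has_derivative_mult smooth_on_UNIV_has_derivative s s')
    show "x \<notin> K \<Longrightarrow> \<psi> x * \<eta> x = 0" for x using out(1) by simp
  qed (rule K(1))
  moreover have "integrable lborel ?f1" "integrable lborel ?f2"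
    using c out by (auto intro!: integrable_continuous_compact_support[OF _ K(1)] continuous_intros)
  ultimately have "(LINT x|lborel. ?f1 x) = - (LINT x|lborel. ?f2 x)" by simp
  moreover have "(LINT x|lebesgue_on S. ?f1 x) = (LINT x|lborel. ?f1 x)"
    using c out outS by (intro integral_lebesgue_on_supp[OF Sl]) (auto intro!: borel_measurable_continuous_onI continuous_intros)
  moreover have "(LINT x|lebesgue_on S. ?f2 x) = (LINT x|lborel. ?f2 x)"
    using c out outS by (intro integral_lebesgue_on_supp[OF Sl]) (auto intro!: borel_measurable_continuous_onI continuous_intros)
  ultimately show "(LINT x|lebesgue_on S. \<psi> x * frechet_derivative \<eta> (at x) b)
      = - (LINT x|lebesgue_on S. (cgrad \<psi> x \<bullet> b) * \<eta> x)"
    using b by (simp add: cgrad_inner)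
qed

lemma weak_gradient_loc_integrable:
  assumes "weak_gradient S v G" "compact K" "K \<subseteq> S"
  shows "integrable (lebesgue_on K) v" "integrable (lebesgue_on K) G"
proof -
  have "\<forall>K. compact K \<and> K \<subseteq> S \<longrightarrow> integrable (lebesgue_on K) v \<and> integrable (lebesgue_on K) G"
    using assms(1) unfolding weak_gradient_def by (rule conjunct1)
  then show "integrable (lebesgue_on K) v" "integrable (lebesgue_on K) G"
    using assms(2,3) by simp_all
qed

lemma weak_gradient_eq:
  assumes "weak_gradient S v G" "test_function S \<psi>" "b \<in> Basis"
  shows "(LINT x|lebesgue_on S. v x * frechet_derivative \<psi> (at x) b)
          = - (LINT x|lebesgue_on S. (G x \<bullet> b) * \<psi> x)"
proof -
  have "\<forall>\<psi> b. test_function S \<psi> \<and> b \<in> Basis \<longrightarrow>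
        (LINT x|lebesgue_on S. v x * frechet_derivative \<psi> (at x) b)
          = - (LINT x|lebesgue_on S. (G x \<bullet> b) * \<psi> x)"
    using assms(1) unfolding weak_gradient_def by (rule conjunct2)
  then show ?thesis using assms(2,3) by blast
qed

lemma weak_gradient_integrable:
  assumes "weak_gradient S v G" "S \<in> sets lebesgue" "test_function S \<psi>" "b \<in> Basis"
  shows "integrable (lebesgue_on S) (\<lambda>x. v x * frechet_derivative \<psi> (at x) b)"
    "integrable (lebesgue_on S) (\<lambda>x. (G x \<bullet> b) * \<psi> x)"
proof -
  obtain K where K: "compact K" "K \<subseteq> S" and out: "\<And>x. x \<notin> K \<Longrightarrow> \<psi> x = 0"
    "\<And>x b. x \<notin> K \<Longrightarrow> frechet_derivative \<psi> (at x) b = 0"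
    using test_function_support[OF assms(3)] by blast
  note s = test_functionD(1)[OF assms(3)]
  have v: "integrable (lebesgue_on K) v" and G: "integrable (lebesgue_on K) G"
    using weak_gradient_loc_integrable[OF assms(1) K] by auto
  show "integrable (lebesgue_on S) (\<lambda>x. v x * frechet_derivative \<psi> (at x) b)"
    by (rule integrable_mult_compact_support[OF v K assms(2) smooth_on_UNIV_partial_continuous[OF s assms(4)]])
      (rule out)
  have Gb: "integrable (lebesgue_on K) (\<lambda>x. G x \<bullet> b)" using G by simp
  show "integrable (lebesgue_on S) (\<lambda>x. (G x \<bullet> b) * \<psi> x)"
    by (rule integrable_mult_compact_support[OF Gb K assms(2) smooth_on_UNIV_continuous[OF s]]) (rule out)
qed

text \<open>Du Bois-Reymond: on a box with closure in \<open>S\<close> the components of the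
  difference integrate to zero against bump functions, hence over every subbox, hence vanish almost
  everywhere. Countably many closed boxes exhaust \<open>S\<close>, and their faces are null
  sets.\<close>

lemma weak_gradient_unique:
  fixes S :: "'a::euclidean_space set"
  assumes S: "open S" and G: "weak_gradient S v G" "weak_gradient S v G'"
  shows "AE x in lebesgue_on S. G x = G' x"
proof -
  have Sl: "S \<in> sets lebesgue" using S by auto
  have main: "AE x in lebesgue. x \<in> box k l \<longrightarrow> G x \<bullet> b = G' x \<bullet> b"
    if kl: "cbox k l \<subseteq> S" and b: "b \<in> Basis" for k l b
  proof -
    define f where "f x = indicator (box k l) x * (G x \<bullet> b - G' x \<bullet> b)" for x
    have "integrable (lebesgue_on (cbox k l)) G" "integrable (lebesgue_on (cbox k l)) G'"
      using weak_gradient_loc_integrable[OF G(1) compact_cbox kl] weak_gradient_loc_integrable[OF G(2) compact_cbox kl]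
      by auto
    then have "integrable (lebesgue_on (cbox k l)) (\<lambda>x. G x \<bullet> b - G' x \<bullet> b)" by simp
    then have "integrable lebesgue (\<lambda>x. indicator (cbox k l) x *\<^sub>R (G x \<bullet> b - G' x \<bullet> b))"
      by (subst (asm) integrable_restrict_space) auto
    then have "integrable lebesgue (\<lambda>x. indicator (box k l) x *\<^sub>R (indicator (cbox k l) x *\<^sub>R (G x \<bullet> b - G' x \<bullet> b)))"
      by (rule integrable_mult_indicator[rotated]) auto
    moreover have "(\<lambda>x. indicator (box k l) x *\<^sub>R (indicator (cbox k l) x *\<^sub>R (G x \<bullet> b - G' x \<bullet> b))) = f"
      using box_subset_cbox[of k l] by (intro ext) (auto simp: f_def indicator_def)
    ultimately have f: "integrable lebesgue f" by simp
    \<comment> \<open>A Borel representative, because the argument with box integrals is about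
      \<open>lborel\<close>.\<close>
    obtain f0 where f0 [measurable]: "f0 \<in> borel_measurable lborel" and f0eq: "AE x in lborel. f x = f0 x"
      using completion_ex_borel_measurable_real[OF borel_measurable_integrable[OF f]] by blast
    have AEc: "AE x in lebesgue. f x = f0 x" using f0eq by (rule AE_completion)
    have "integrable lebesgue f0"
      using integrable_cong_AE_imp[OF f _ AEc] f0 measurable_completion by blast
    then have f0i: "integrable lborel f0" by (subst (asm) integrable_completion) auto
    have 0: "(LINT x|lborel. indicator (box a c) x * f0 x) = 0" for a c
    proof -
      obtain a' c' where ac: "box a c \<inter> box k l = box a' c'" using box_Int_box[of a c k l] by blast
      show ?thesis
      \<comment> \<open>An empty box is set apart because its endpoints are then arbitrary and
        \<open>cbox a' c'\<close> need not lie in \<open>S\<close>.\<close>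
      proof (cases "box a' c' = {}")
        case True
        have "AE x in lborel. indicator (box a c) x * f0 x = 0"
          using f0eq
        proof eventually_elim
          case (elim x)
          then show ?case using ac True by (cases "x \<in> box k l"; cases "x \<in> box a c") (auto simp: f_def)
        qed
        then show ?thesis by (rule integral_eq_zero_AE)
      next
        case False
        have "closure (box a' c') \<subseteq> cbox k l"
          using ac box_subset_cbox[of k l] by (intro closure_minimal) auto
        then have sub: "cbox a' c' \<subseteq> S" using False kl by (simp add: closure_box)
        have z: "(LINT x|lborel. f0 x * box_bump a' c' n x) = 0" for n
        proof -
          note t = box_bump_test_function[OF sub, of n]
          have "(LINT x|lebesgue_on S. (G x \<bullet> b) * box_bump a' c' n x - (G' x \<bullet> b) * box_bump a' c' n x) = 0"
            using weak_gradient_integrable(2)[OF G(1) Sl t b] weak_gradient_integrable(2)[OF G(2) Sl t b]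
              weak_gradient_eq[OF G(1) t b] weak_gradient_eq[OF G(2) t b] by simp
          then have "(LINT x|lebesgue. indicator S x *\<^sub>R ((G x \<bullet> b) * box_bump a' c' n x - (G' x \<bullet> b) * box_bump a' c' n x)) = 0"
            using Sl by (subst (asm) integral_restrict_space) auto
          moreover have "indicator S x *\<^sub>R ((G x \<bullet> b) * box_bump a' c' n x - (G' x \<bullet> b) * box_bump a' c' n x)
              = f x * box_bump a' c' n x" for x
          proof (cases "x \<in> box a' c'")
            case True
            then have "x \<in> S" "x \<in> box k l" using sub box_subset_cbox[of a' c'] ac by auto
            then show ?thesis by (simp add: f_def algebra_simps)
          next
            case False
            then have "box_bump a' c' n x = 0" using box_bump_nonzero_iff by blast
            then show ?thesis by simp
          qed
          ultimately have "(LINT x|lebesgue. f x * box_bump a' c' n x) = 0" by simp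
          moreover have bm: "box_bump a' c' n \<in> borel_measurable borel"
            using smooth_on_UNIV_continuous[OF test_functionD(1)[OF t]] by (rule borel_measurable_continuous_onI)
          then have "(LINT x|lebesgue. f x * box_bump a' c' n x) = (LINT x|lebesgue. f0 x * box_bump a' c' n x)"
            using AEc f0 borel_measurable_integrable[OF f]
            by (intro integral_cong_AE) (auto intro!: borel_measurable_times intro: measurable_completion)
          moreover have "\<dots> = (LINT x|lborel. f0 x * box_bump a' c' n x)"
            using bm by (intro integral_completion) auto
          ultimately show ?thesis by simp
        qed
        have bm: "box_bump a' c' n \<in> borel_measurable borel" for n
          using smooth_on_UNIV_continuous[OF test_functionD(1)[OF box_bump_test_function[OF sub]]]
          by (rule borel_measurable_continuous_onI)
        have "(\<lambda>n. LINT x|lborel. f0 x * box_bump a' c' n x) \<longlonglongrightarrow> (LINT x|lborel. f0 x * indicator (box a' c') x)"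
        proof (rule integral_dominated_convergence)
          show "integrable lborel (\<lambda>x. norm (f0 x))" using f0i by simp
          show "AE x in lborel. (\<lambda>n. f0 x * box_bump a' c' n x) \<longlonglongrightarrow> f0 x * indicator (box a' c') x"
            by (intro always_eventually allI tendsto_mult tendsto_const box_bump_tendsto)
          show "AE x in lborel. norm (f0 x * box_bump a' c' n x) \<le> norm (f0 x)" for n
            using box_bump_bounds[of a' c' n] by (auto simp: abs_mult intro!: mult_left_le)
        qed (use bm in auto)
        then have "(LINT x|lborel. f0 x * indicator (box a' c') x) = 0"
          unfolding z using LIMSEQ_unique[OF tendsto_const[of 0]] by auto
        moreover have "AE x in lborel. f0 x * indicator (box a' c') x = indicator (box a c) x * f0 x"
          using f0eq
        proof eventually_elim
          case (elim x)
          then show ?case using ac[symmetric] by (cases "x \<in> box k l"; cases "x \<in> box a c") (auto simp: f_def)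
        qed
        ultimately show ?thesis
          using integral_cong_AE[of "\<lambda>x. f0 x * indicator (box a' c') x" lborel "\<lambda>x. indicator (box a c) x * f0 x"]
          by auto
      qed
    qed
    have "AE x in lborel. f0 x = 0" using AE_zero_if_box_integrals_zero[OF f0i 0] .
    then have "AE x in lebesgue. f0 x = 0" by (rule AE_completion)
    then show ?thesis using AEc by eventually_elim (auto simp: f_def)
  qed
  obtain \<D> where \<D>: "countable \<D>" "\<D> \<subseteq> Pow S" "\<And>X. X \<in> \<D> \<Longrightarrow> \<exists>a b. X = cbox a b" "\<Union>\<D> = S"
    using open_countable_Union_open_cbox[OF S] by metis
  have "AE x in lebesgue. x \<in> X \<longrightarrow> G x = G' x" if X: "X \<in> \<D>" for X
  proof -
    obtain k l where kl: "X = cbox k l" using \<D>(3) X by blast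
    have "cbox k l \<subseteq> S" using X \<D>(2) kl by auto
    then have "AE x in lebesgue. \<forall>b\<in>Basis. x \<in> box k l \<longrightarrow> G x \<bullet> b = G' x \<bullet> b"
      using main by (intro AE_finite_allI) auto
    moreover have "AE x in lebesgue. x \<notin> cbox k l - box k l"
      by (intro AE_not_in) (simp add: negligible_iff_null_sets[symmetric] negligible_frontier_interval)
    ultimately show ?thesis unfolding kl
    proof eventually_elim
      case (elim x)
      show ?case
      proof
        assume "x \<in> cbox k l"
        then have "x \<in> box k l" using elim(2) by blast
        then show "G x = G' x" using elim(1) by (simp add: euclidean_eq_iff[of "G x"])
      qed
    qed
  qed
  then have "AE x in lebesgue. \<forall>X\<in>\<D>. x \<in> X \<longrightarrow> G x = G' x"
    using \<D>(1) by (intro AE_ball_countable') auto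
  then have "AE x in lebesgue. x \<in> S \<longrightarrow> G x = G' x"
    by eventually_elim (use \<D>(4) in blast)
  then show ?thesis using Sl by (simp add: AE_restrict_space_iff)
qed


section \<open>The spaces H^1 and H_0^1 as vector spaces\<close>

lemma weak_gradient_lin:
  fixes S :: "'a::euclidean_space set"
  assumes G: "weak_gradient S v G" "weak_gradient S w H" and S: "S \<in> sets lebesgue"
  shows "weak_gradient S (\<lambda>x. a * v x + b * w x) (\<lambda>x. a *\<^sub>R G x + b *\<^sub>R H x)"
  unfolding weak_gradient_def
proof (intro conjI allI impI)
  fix K assume "compact K \<and> K \<subseteq> S"
  then have K: "compact K" "K \<subseteq> S" by auto
  note i = weak_gradient_loc_integrable[OF G(1) K] weak_gradient_loc_integrable[OF G(2) K]
  show "integrable (lebesgue_on K) (\<lambda>x. a * v x + b * w x)"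
    using i by (intro Bochner_Integration.integrable_add integrable_mult_right) auto
  show "integrable (lebesgue_on K) (\<lambda>x. a *\<^sub>R G x + b *\<^sub>R H x)"
    using i by (intro Bochner_Integration.integrable_add integrable_scaleR_right) auto
next
  fix \<psi> and e :: 'a assume "test_function S \<psi> \<and> e \<in> Basis"
  then have t: "test_function S \<psi>" and e: "e \<in> Basis" by auto
  note i = weak_gradient_integrable[OF G(1) S t e] weak_gradient_integrable[OF G(2) S t e]
  have "(LINT x|lebesgue_on S. (a * v x + b * w x) * frechet_derivative \<psi> (at x) e)
      = a * (LINT x|lebesgue_on S. v x * frechet_derivative \<psi> (at x) e)
        + b * (LINT x|lebesgue_on S. w x * frechet_derivative \<psi> (at x) e)"
    using i by (simp add: distrib_right mult.assoc)
  also have "\<dots> = - (a * (LINT x|lebesgue_on S. (G x \<bullet> e) * \<psi> x) + b * (LINT x|lebesgue_on S. (H x \<bullet> e) * \<psi> x))"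
    using weak_gradient_eq[OF G(1) t e] weak_gradient_eq[OF G(2) t e] by simp
  also have "a * (LINT x|lebesgue_on S. (G x \<bullet> e) * \<psi> x) + b * (LINT x|lebesgue_on S. (H x \<bullet> e) * \<psi> x)
      = (LINT x|lebesgue_on S. ((a *\<^sub>R G x + b *\<^sub>R H x) \<bullet> e) * \<psi> x)"
    using i by (simp add: inner_add_left distrib_right mult.assoc)
  finally show "(LINT x|lebesgue_on S. (a * v x + b * w x) * frechet_derivative \<psi> (at x) e)
      = - (LINT x|lebesgue_on S. ((a *\<^sub>R G x + b *\<^sub>R H x) \<bullet> e) * \<psi> x)" .
qed

lemma weak_gradient_cong_AE_imp:
  fixes v w :: "'a::euclidean_space \<Rightarrow> real"
  assumes S: "S \<in> sets lebesgue" and eq: "AE x in lebesgue_on S. v x = w x" and v: "weak_gradient S v G"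
  shows "weak_gradient S w G"
  unfolding weak_gradient_def
proof (intro conjI allI impI)
  fix K assume "compact K \<and> K \<subseteq> S"
  then have K: "compact K" "K \<subseteq> S" by auto
  have Kl: "K \<in> sets lebesgue" using K(1) by (simp add: lmeasurable_compact fmeasurableD)
  note i = weak_gradient_loc_integrable[OF v K]
  show "integrable (lebesgue_on K) G" by (rule i(2))
  have e: "AE x in lebesgue_on K. v x = w x" by (rule AE_lebesgue_on_subset[OF eq K(2) S Kl])
  show "integrable (lebesgue_on K) w"
    by (rule integrable_cong_AE_imp[OF i(1) lebesgue_on_measurable_AE[OF Kl borel_measurable_integrable[OF i(1)] e] e])
next
  fix \<psi> and b :: 'a assume "test_function S \<psi> \<and> b \<in> Basis"
  then have t: "test_function S \<psi>" and b: "b \<in> Basis" by auto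
  have m: "(\<lambda>x. v x * frechet_derivative \<psi> (at x) b) \<in> borel_measurable (lebesgue_on S)"
    using weak_gradient_integrable(1)[OF v S t b] by (rule borel_measurable_integrable)
  have e: "AE x in lebesgue_on S. v x * frechet_derivative \<psi> (at x) b = w x * frechet_derivative \<psi> (at x) b"
    using eq by eventually_elim simp
  have "(LINT x|lebesgue_on S. v x * frechet_derivative \<psi> (at x) b)
      = (LINT x|lebesgue_on S. w x * frechet_derivative \<psi> (at x) b)"
    by (rule integral_cong_AE[OF m lebesgue_on_measurable_AE[OF S m e] e])
  then show "(LINT x|lebesgue_on S. w x * frechet_derivative \<psi> (at x) b) = - (LINT x|lebesgue_on S. (G x \<bullet> b) * \<psi> x)"
    using weak_gradient_eq[OF v t b] by simp
qed

text \<open>\<open>wgrad\<close> chooses from a predicate that depends only on the class of the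
  function, so the two choices are literally the same.\<close>

lemma wgrad_cong_AE:
  fixes v w :: "'a::euclidean_space \<Rightarrow> real"
  assumes "S \<in> sets lebesgue" "AE x in lebesgue_on S. v x = w x"
  shows "wgrad S v = wgrad S w"
proof -
  have "AE x in lebesgue_on S. w x = v x" using assms(2) by eventually_elim simp
  then have "weak_gradient S v = weak_gradient S w"
    using weak_gradient_cong_AE_imp[OF assms(1)] assms(2) by blast
  then show ?thesis by (simp add: wgrad_def)
qed

lemma wgrad_AE_eq:
  assumes "open S" "weak_gradient S v G"
  shows "AE x in lebesgue_on S. wgrad S v x = G x" "weak_gradient S v (wgrad S v)"
proof -
  show w: "weak_gradient S v (wgrad S v)" unfolding wgrad_def by (rule someI[where P="weak_gradient S v", OF assms(2)])
  show "AE x in lebesgue_on S. wgrad S v x = G x" by (rule weak_gradient_unique[OF assms(1) w assms(2)])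
qed

lemma H1_I:
  assumes "sq_int (lebesgue_on S) v" "weak_gradient S v G" "sq_int (lebesgue_on S) G"
  shows "v \<in> H1 S"
proof -
  have "\<forall>b\<in>Basis. (\<lambda>x. G x \<bullet> b) \<in> Lp_space S 2"
    using assms(3) unfolding Lp_space_2 by (rule sq_int_components[THEN iffD1])
  then show ?thesis using assms(1,2) unfolding H1_def by (auto simp: Lp_space_2)
qed

lemma H1_D:
  fixes S :: "'a::euclidean_space set"
  assumes S: "open S" and v: "v \<in> H1 S"
  shows "sq_int (lebesgue_on S) v" "weak_gradient S v (wgrad S v)" "sq_int (lebesgue_on S) (wgrad S v)"
proof -
  show "sq_int (lebesgue_on S) v" using v by (auto simp: H1_def Lp_space_2)
  obtain G where G: "weak_gradient S v G" and c: "\<forall>b\<in>Basis. (\<lambda>x. G x \<bullet> b) \<in> Lp_space S 2"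
    using v by (auto simp: H1_def)
  have sG: "sq_int (lebesgue_on S) G"
    using c unfolding Lp_space_2 by (rule sq_int_components[THEN iffD2])
  show "weak_gradient S v (wgrad S v)" by (rule wgrad_AE_eq(2)[OF S G])
  have e: "AE x in lebesgue_on S. wgrad S v x = G x" by (rule wgrad_AE_eq(1)[OF S G])
  then have e': "AE x in lebesgue_on S. G x = wgrad S v x" by eventually_elim simp
  have Sl: "S \<in> sets lebesgue" using S by auto
  show "sq_int (lebesgue_on S) (wgrad S v)"
    by (rule sq_int_cong_AE[OF lebesgue_on_measurable_AE[OF Sl sq_int_measurable[OF sG] e'] sG e])
qed

text \<open>The gradient is linear only up to null sets, since each \<open>wgrad\<close> is a
  separate choice.\<close>

lemma H1_lin:
  fixes S :: "'a::euclidean_space set"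
  assumes S: "open S" and v: "v \<in> H1 S" "w \<in> H1 S"
  shows "(\<lambda>x. a * v x + b * w x) \<in> H1 S"
    "AE x in lebesgue_on S. wgrad S (\<lambda>x. a * v x + b * w x) x = a *\<^sub>R wgrad S v x + b *\<^sub>R wgrad S w x"
proof -
  have Sl: "S \<in> sets lebesgue" using S by auto
  note dv = H1_D[OF S v(1)] and dw = H1_D[OF S v(2)]
  have wg: "weak_gradient S (\<lambda>x. a * v x + b * w x) (\<lambda>x. a *\<^sub>R wgrad S v x + b *\<^sub>R wgrad S w x)"
    by (rule weak_gradient_lin[OF dv(2) dw(2) Sl])
  show "AE x in lebesgue_on S. wgrad S (\<lambda>x. a * v x + b * w x) x = a *\<^sub>R wgrad S v x + b *\<^sub>R wgrad S w x"
    by (rule wgrad_AE_eq(1)[OF S wg])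
  show "(\<lambda>x. a * v x + b * w x) \<in> H1 S"
  proof (rule H1_I[OF _ wg])
    show "sq_int (lebesgue_on S) (\<lambda>x. a * v x + b * w x)"
      using sq_int_add[OF sq_int_scaleR[OF dv(1), of a] sq_int_scaleR[OF dw(1), of b]] by simp
    show "sq_int (lebesgue_on S) (\<lambda>x. a *\<^sub>R wgrad S v x + b *\<^sub>R wgrad S w x)"
      by (rule sq_int_add[OF sq_int_scaleR[OF dv(3), of a] sq_int_scaleR[OF dw(3), of b]])
  qed
qed

lemma H1_norm_ge:
  "nrm (lebesgue_on S) v \<le> H1_norm S v" "grad_norm S v \<le> H1_norm S v" "0 \<le> H1_norm S v"
  unfolding H1_norm_def Lp_norm_2 grad_norm_nrm
  by (auto intro!: real_le_rsqrt)

lemma H1_norm_le: "H1_norm S v \<le> nrm (lebesgue_on S) v + grad_norm S v"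
  unfolding H1_norm_def Lp_norm_2 grad_norm_nrm
  by (intro real_le_lsqrt) (auto simp: power2_sum)

lemma nrm_lin:
  assumes "sq_int M v" "sq_int M w"
  shows "nrm M (\<lambda>x. a *\<^sub>R v x + b *\<^sub>R w x) \<le> \<bar>a\<bar> * nrm M v + \<bar>b\<bar> * nrm M w"
  using nrm_add[OF sq_int_scaleR[OF assms(1), of a] sq_int_scaleR[OF assms(2), of b]]
  by (simp add: nrm_scaleR)

lemma grad_norm_lin:
  fixes S :: "'a::euclidean_space set"
  assumes S: "open S" and v: "v \<in> H1 S" "w \<in> H1 S"
  shows "grad_norm S (\<lambda>x. a * v x + b * w x) \<le> \<bar>a\<bar> * grad_norm S v + \<bar>b\<bar> * grad_norm S w"
proof -
  note dv = H1_D[OF S v(1)] and dw = H1_D[OF S v(2)]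
  have "grad_norm S (\<lambda>x. a * v x + b * w x) = nrm (lebesgue_on S) (\<lambda>x. a *\<^sub>R wgrad S v x + b *\<^sub>R wgrad S w x)"
    unfolding grad_norm_nrm
    by (rule nrm_cong_AE[OF sq_int_measurable[OF H1_D(3)[OF S H1_lin(1)[OF assms]]] _ H1_lin(2)[OF assms]])
      (rule sq_int_measurable[OF sq_int_add[OF sq_int_scaleR[OF dv(3), of a] sq_int_scaleR[OF dw(3), of b]]])
  then show ?thesis unfolding grad_norm_nrm using nrm_lin[OF dv(3) dw(3)] by simp
qed

text \<open>The factor 2 comes from passing between the Euclidean norm of the pair and the sum of
  its two parts; limits to zero do not feel it.\<close>

lemma H1_norm_lin:
  fixes S :: "'a::euclidean_space set"
  assumes S: "open S" and v: "v \<in> H1 S" "w \<in> H1 S"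
  shows "H1_norm S (\<lambda>x. a * v x + b * w x) \<le> 2 * \<bar>a\<bar> * H1_norm S v + 2 * \<bar>b\<bar> * H1_norm S w"
proof -
  have "nrm (lebesgue_on S) (\<lambda>x. a * v x + b * w x) \<le> \<bar>a\<bar> * nrm (lebesgue_on S) v + \<bar>b\<bar> * nrm (lebesgue_on S) w"
    using nrm_lin[OF H1_D(1)[OF S v(1)] H1_D(1)[OF S v(2)], of a b] by simp
  moreover have "\<bar>a\<bar> * nrm (lebesgue_on S) v \<le> \<bar>a\<bar> * H1_norm S v" "\<bar>b\<bar> * nrm (lebesgue_on S) w \<le> \<bar>b\<bar> * H1_norm S w"
    "\<bar>a\<bar> * grad_norm S v \<le> \<bar>a\<bar> * H1_norm S v" "\<bar>b\<bar> * grad_norm S w \<le> \<bar>b\<bar> * H1_norm S w"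
    by (intro mult_left_mono H1_norm_ge abs_ge_zero)+
  ultimately show ?thesis
    using H1_norm_le[of S "\<lambda>x. a * v x + b * w x"] grad_norm_lin[OF assms, of a b] by linarith
qed

lemma smooth_on_UNIV_partial:
  assumes "smooth_on UNIV f" "b \<in> Basis"
  shows "smooth_on UNIV (\<lambda>x. frechet_derivative f (at x) b)"
  unfolding smooth_on_def
proof (intro allI impI ballI)
  fix bs x assume bs: "set bs \<subseteq> (Basis :: 'a set)"
  have "set (b # bs) \<subseteq> Basis" using bs assms(2) by simp
  then have "iter_pderiv (b # bs) f differentiable (at x)"
    using assms(1) unfolding smooth_on_def by blast
  then show "iter_pderiv bs (\<lambda>x. frechet_derivative f (at x) b) differentiable (at x)" by simp
qed

lemma smooth_on_UNIV_lin:
  assumes "smooth_on UNIV f" "smooth_on UNIV g"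
  shows "smooth_on UNIV (\<lambda>x. a * f x + c * g x)"
proof -
  have "set bs \<subseteq> Basis \<Longrightarrow> smooth_on UNIV f \<Longrightarrow> smooth_on UNIV g \<Longrightarrow>
      iter_pderiv bs (\<lambda>x. a * f x + c * g x) differentiable (at x)" for bs x f g
  proof (induction bs arbitrary: f g)
    case Nil
    then show ?case
      using smooth_on_UNIV_has_derivative[of f x] smooth_on_UNIV_has_derivative[of g x]
      by (auto simp: differentiable_def intro!: exI derivative_eq_intros)
  next
    case (Cons b bs)
    have "frechet_derivative (\<lambda>x. a * f x + c * g x) (at x)
        = (\<lambda>h. a * frechet_derivative f (at x) h + c * frechet_derivative g (at x) h)" for x
    proof -
      have "((\<lambda>x. a * f x + c * g x) has_derivative
          (\<lambda>h. a * frechet_derivative f (at x) h + c * frechet_derivative g (at x) h)) (at x)"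
        by (intro has_derivative_add has_derivative_mult_right smooth_on_UNIV_has_derivative Cons.prems)
      from frechet_derivative_at[OF this] show ?thesis by simp
    qed
    then show ?case using Cons.prems
      by (simp add: Cons.IH smooth_on_UNIV_partial)
  qed
  then show ?thesis using assms by (auto simp: smooth_on_def)
qed

text \<open>The support of the combination lies in the union of the two supports, a compact subset
  of \<open>S\<close>.\<close>

lemma test_function_lin:
  fixes S :: "'a::euclidean_space set"
  assumes "test_function S f" "test_function S g"
  shows "test_function S (\<lambda>x. a * f x + c * g x)"
proof -
  obtain K where K: "compact K" "K \<subseteq> S" and f: "\<And>x. x \<notin> K \<Longrightarrow> f x = 0"
    "\<And>x b. x \<notin> K \<Longrightarrow> frechet_derivative f (at x) b = 0"
    using test_function_support[OF assms(1)] by blast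
  obtain L where L: "compact L" "L \<subseteq> S" and g: "\<And>x. x \<notin> L \<Longrightarrow> g x = 0"
    "\<And>x b. x \<notin> L \<Longrightarrow> frechet_derivative g (at x) b = 0"
    using test_function_support[OF assms(2)] by blast
  let ?c = "closure {x. a * f x + c * g x \<noteq> 0}"
  have KL: "compact (K \<union> L)" using K(1) L(1) by (rule compact_Un)
  have "{x. a * f x + c * g x \<noteq> 0} \<subseteq> K \<union> L"
  proof
    fix x assume "x \<in> {x. a * f x + c * g x \<noteq> 0}"
    then have "f x \<noteq> 0 \<or> g x \<noteq> 0" by auto
    then show "x \<in> K \<union> L" using f(1)[of x] g(1)[of x] by blast
  qed
  then have sub: "?c \<subseteq> K \<union> L" using compact_imp_closed[OF KL] by (rule closure_minimal)
  have "compact (?c \<inter> (K \<union> L))" using KL by (intro closed_Int_compact closed_closure)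
  moreover have "?c \<inter> (K \<union> L) = ?c" using sub by (rule Int_absorb2)
  ultimately have "compact ?c" by simp
  then show ?thesis
    using sub K(2) L(2) smooth_on_UNIV_lin[OF test_functionD(1)[OF assms(1)] test_functionD(1)[OF assms(2)]]
    unfolding test_function_def by blast
qed

lemma test_function_sq_int:
  fixes S :: "'a::euclidean_space set" and f :: "'a \<Rightarrow> 'b::euclidean_space"
  assumes S: "S \<in> sets lebesgue" and "compact K" "\<And>x. x \<notin> K \<Longrightarrow> f x = 0" "continuous_on UNIV f"
  shows "sq_int (lebesgue_on S) f"
  unfolding sq_int_def
proof
  have fm: "f \<in> borel_measurable borel" using assms(4) by (rule borel_measurable_continuous_onI)
  then show "f \<in> borel_measurable (lebesgue_on S)"
    by (intro measurable_restrict_space1 measurable_completion) simp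
  have c: "continuous_on UNIV (\<lambda>x. (norm (f x))\<^sup>2)" using assms(4) by (intro continuous_intros)
  have "integrable lborel (\<lambda>x. (norm (f x))\<^sup>2)"
    using assms(3) by (intro integrable_continuous_compact_support[OF c assms(2)]) simp
  then have "integrable lebesgue (\<lambda>x. (norm (f x))\<^sup>2)"
    using borel_measurable_continuous_onI[OF c] by (subst integrable_completion) simp_all
  then have "integrable lebesgue (\<lambda>x. indicator S x *\<^sub>R (norm (f x))\<^sup>2)"
    using S by (intro integrable_mult_indicator)
  then show "integrable (lebesgue_on S) (\<lambda>x. (norm (f x))\<^sup>2)"
    using S by (subst integrable_restrict_space) simp_all
qed

lemma test_function_H1:
  fixes S :: "'a::euclidean_space set"
  assumes S: "open S" and t: "test_function S \<psi>"
  shows "\<psi> \<in> H1 S" "sq_int (lebesgue_on S) (cgrad \<psi>)"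
proof -
  obtain K where K: "compact K" "K \<subseteq> S" and f: "\<And>x. x \<notin> K \<Longrightarrow> \<psi> x = 0"
     "\<And>x b. x \<notin> K \<Longrightarrow> frechet_derivative \<psi> (at x) b = 0"
    using test_function_support[OF t] by blast
  note s = test_functionD(1)[OF t]
  have Sl: "S \<in> sets lebesgue" using S by auto
  have "cgrad \<psi> x = 0" if "x \<notin> K" for x using f(2)[OF that] by (simp add: cgrad_def)
  then show sq: "sq_int (lebesgue_on S) (cgrad \<psi>)"
    by (rule test_function_sq_int[OF Sl K(1) _ cgrad_continuous[OF s]])
  have "sq_int (lebesgue_on S) \<psi>"
    by (rule test_function_sq_int[OF Sl K(1) _ smooth_on_UNIV_continuous[OF s]]) (rule f(1))
  then show "\<psi> \<in> H1 S" by (rule H1_I[OF _ weak_gradient_cgrad[OF S t] sq])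
qed

lemma H01_D: "v \<in> H01 S \<Longrightarrow> v \<in> H1 S"
  "v \<in> H01 S \<Longrightarrow> \<epsilon> > 0 \<Longrightarrow> \<exists>\<psi>. test_function S \<psi> \<and> H1_norm S (\<lambda>x. v x - \<psi> x) < \<epsilon>"
  by (auto simp: H01_def)

lemma H01_lin:
  fixes S :: "'a::euclidean_space set"
  assumes S: "open S" and v: "v \<in> H01 S" "w \<in> H01 S"
  shows "(\<lambda>x. a * v x + b * w x) \<in> H01 S"
proof -
  note v1 = H01_D(1)[OF v(1)] H01_D(1)[OF v(2)]
  have "\<exists>\<psi>. test_function S \<psi> \<and> H1_norm S (\<lambda>x. (a * v x + b * w x) - \<psi> x) < \<epsilon>" if "\<epsilon> > 0" for \<epsilon>
  proof -
    \<comment> \<open>The summand 1 keeps the denominator positive when both coefficients vanish and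
      makes the final inequality strict.\<close>
    define d where "d = \<epsilon> / (2 * \<bar>a\<bar> + 2 * \<bar>b\<bar> + 1)"
    have d: "d > 0" using that by (simp add: d_def add_nonneg_pos)
    obtain f where f: "test_function S f" "H1_norm S (\<lambda>x. v x - f x) < d" using H01_D(2)[OF v(1) d] by blast
    obtain g where g: "test_function S g" "H1_norm S (\<lambda>x. w x - g x) < d" using H01_D(2)[OF v(2) d] by blast
    have vf: "(\<lambda>x. v x - f x) \<in> H1 S" using H1_lin(1)[OF S v1(1) test_function_H1(1)[OF S f(1)], of 1 "-1"] by simp
    have wg: "(\<lambda>x. w x - g x) \<in> H1 S" using H1_lin(1)[OF S v1(2) test_function_H1(1)[OF S g(1)], of 1 "-1"] by simp
    have "(\<lambda>x. (a * v x + b * w x) - (a * f x + b * g x)) = (\<lambda>x. a * (v x - f x) + b * (w x - g x))"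
      by (auto simp: algebra_simps)
    then have "H1_norm S (\<lambda>x. (a * v x + b * w x) - (a * f x + b * g x))
        \<le> 2 * \<bar>a\<bar> * H1_norm S (\<lambda>x. v x - f x) + 2 * \<bar>b\<bar> * H1_norm S (\<lambda>x. w x - g x)"
      using H1_norm_lin[OF S vf wg, of a b] by simp
    also have "\<dots> \<le> 2 * \<bar>a\<bar> * d + 2 * \<bar>b\<bar> * d"
      using f(2) g(2) by (intro add_mono mult_left_mono) auto
    also have "\<dots> < (2 * \<bar>a\<bar> + 2 * \<bar>b\<bar> + 1) * d" using d by (simp add: algebra_simps)
    also have "\<dots> = \<epsilon>" by (simp add: d_def add_nonneg_pos less_imp_neq[symmetric])
    finally show ?thesis using test_function_lin[OF f(1) g(1), of a b] by blast
  qed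
  then show ?thesis using H1_lin(1)[OF S v1] unfolding H01_def by blast
qed

lemma H01_diff: "open S \<Longrightarrow> v \<in> H01 S \<Longrightarrow> w \<in> H01 S \<Longrightarrow> (\<lambda>x. v x - w x) \<in> H01 S"
  using H01_lin[of S v w 1 "-1"] by simp

lemma H01_add: "open S \<Longrightarrow> v \<in> H01 S \<Longrightarrow> w \<in> H01 S \<Longrightarrow> (\<lambda>x. v x + w x) \<in> H01 S"
  using H01_lin[of S v w 1 1] by simp

section \<open>The Sobolev inequality in dimension three\<close>

text \<open>Nested pairs carry product measures, for which iterated integration is available; this
  map transports it to \<open>real^3\<close>.\<close>

definition vec3 :: "real \<times> real \<times> real \<Rightarrow> real^3" where
  "vec3 = (\<lambda>(a, b, c). a *\<^sub>R axis 1 1 + b *\<^sub>R axis 2 1 + c *\<^sub>R axis 3 1)"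

lemma vec3_nth: "vec3 (a, b, c) $ 1 = a" "vec3 (a, b, c) $ 2 = b" "vec3 (a, b, c) $ 3 = c"
  by (simp_all add: vec3_def axis_def)

lemma vec3_continuous: "continuous_on UNIV vec3"
  unfolding vec3_def case_prod_unfold by (intro continuous_intros)

lemma vec3_measurable [measurable]: "vec3 \<in> borel_measurable borel"
  using vec3_continuous by (rule borel_measurable_continuous_onI)

lemma vec3_measurable' [measurable]:
  assumes [measurable]: "f1 \<in> borel_measurable M" "f2 \<in> borel_measurable M" "f3 \<in> borel_measurable M"
  shows "(\<lambda>x. vec3 (f1 x, f2 x, f3 x)) \<in> borel_measurable M"
  unfolding vec3_def prod.case by measurable

lemma Basis_real3: "(Basis :: (real^3) set) = (\<lambda>i. axis i 1) ` UNIV"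
  by (auto simp: Basis_vec_def)

lemma prod_Basis_real3: "(\<Prod>b\<in>(Basis :: (real^3) set). f (x \<bullet> b)) = f (x $ 1) * f (x $ 2) * f (x $ 3)"
proof -
  have inj: "inj (\<lambda>i::3. axis i (1::real))" by (auto simp: inj_def axis_eq_axis)
  have "(\<Prod>b\<in>(Basis :: (real^3) set). f (x \<bullet> b)) = (\<Prod>i\<in>UNIV. f (x $ i))"
    unfolding Basis_real3 by (subst prod.reindex[OF inj]) (simp add: inner_axis)
  also have "\<dots> = (\<Prod>i\<in>{1, 2, 3}. f (x $ i))" by (simp only: UNIV_3)
  also have "\<dots> = f (x $ 1) * f (x $ 2) * f (x $ 3)" by (simp add: mult.assoc)
  finally show ?thesis .
qed

lemma mem_box_real3: "(x :: real^3) \<in> box l u \<longleftrightarrow>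
    l $ 1 < x $ 1 \<and> x $ 1 < u $ 1 \<and> l $ 2 < x $ 2 \<and> x $ 2 < u $ 2 \<and> l $ 3 < x $ 3 \<and> x $ 3 < u $ 3"
  unfolding mem_box Basis_real3 by (simp add: inner_axis forall_3)

text \<open>Lebesgue measure is determined by its values on boxes, and the preimage of a box under
  \<open>vec3\<close> is a product of three intervals.\<close>

lemma lborel_real3: "(lborel :: (real^3) measure) = distr lborel borel vec3"
proof (rule lborel_eqI)
  fix l u :: "real^3" assume le: "\<And>b. b \<in> Basis \<Longrightarrow> l \<bullet> b \<le> u \<bullet> b"
  have le': "l $ i \<le> u $ i" for i
    using le[of "axis i 1"] by (simp add: Basis_real3 inner_axis)
  have "vec3 -` box l u = {l$1<..<u$1} \<times> {l$2<..<u$2} \<times> {l$3<..<u$3}"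
    by (auto simp: mem_box_real3 vec3_nth)
  then have "emeasure (distr lborel borel vec3) (box l u)
      = emeasure (lborel \<Otimes>\<^sub>M (lborel :: (real \<times> real) measure)) ({l$1<..<u$1} \<times> ({l$2<..<u$2} \<times> {l$3<..<u$3}))"
    by (simp add: emeasure_distr lborel_prod)
  also have "\<dots> = emeasure lborel {l$1<..<u$1} * emeasure (lborel :: (real \<times> real) measure) ({l$2<..<u$2} \<times> {l$3<..<u$3})"
    by (rule lborel.emeasure_pair_measure_Times) (auto intro!: open_Times borel_open)
  also have "emeasure (lborel :: (real \<times> real) measure) ({l$2<..<u$2} \<times> {l$3<..<u$3})
      = emeasure (lborel \<Otimes>\<^sub>M lborel) ({l$2<..<u$2} \<times> {l$3<..<u$3})"
    by (simp only: lborel_prod)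
  also have "\<dots> = emeasure lborel {l$2<..<u$2} * emeasure lborel {l$3<..<u$3}"
    by (rule lborel.emeasure_pair_measure_Times) auto
  also have "emeasure lborel {l$1<..<u$1} * (emeasure lborel {l$2<..<u$2} * emeasure lborel {l$3<..<u$3})
     = ennreal (u$1 - l$1) * (ennreal (u$2 - l$2) * ennreal (u$3 - l$3))"
    using le' by simp
  also have "\<dots> = (\<Prod>b\<in>Basis. (u - l) \<bullet> b)"
    unfolding prod_Basis_real3[of "\<lambda>x. x"] using le' by (simp add: ennreal_mult' mult.assoc)
  finally show "emeasure (distr lborel borel vec3) (box l u) = (\<Prod>b\<in>Basis. (u - l) \<bullet> b)" .
qed simp

text \<open>Three orders of integration, each with a different coordinate innermost: these are the
  directions of the three line integrals in the Sobolev inequality.\<close>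

lemma nn_integral_real3:
  fixes F :: "real^3 \<Rightarrow> ennreal"
  assumes [measurable]: "F \<in> borel_measurable borel"
  shows "(\<integral>\<^sup>+x. F x \<partial>lborel) = (\<integral>\<^sup>+a. \<integral>\<^sup>+b. \<integral>\<^sup>+c. F (vec3 (a, b, c)) \<partial>lborel \<partial>lborel \<partial>lborel)"
    and "(\<integral>\<^sup>+x. F x \<partial>lborel) = (\<integral>\<^sup>+b. \<integral>\<^sup>+c. \<integral>\<^sup>+a. F (vec3 (a, b, c)) \<partial>lborel \<partial>lborel \<partial>lborel)"
    and "(\<integral>\<^sup>+x. F x \<partial>lborel) = (\<integral>\<^sup>+a. \<integral>\<^sup>+c. \<integral>\<^sup>+b. F (vec3 (a, b, c)) \<partial>lborel \<partial>lborel \<partial>lborel)"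
proof -
  have [measurable]: "F \<in> borel_measurable lborel" by simp
  have "(\<integral>\<^sup>+x. F x \<partial>lborel) = (\<integral>\<^sup>+p. F (vec3 p) \<partial>lborel)"
    by (subst lborel_real3) (simp add: nn_integral_distr)
  also have "\<dots> = (\<integral>\<^sup>+p. F (vec3 p) \<partial>(lborel \<Otimes>\<^sub>M (lborel :: (real \<times> real) measure)))"
    by (simp add: lborel_prod)
  also have "\<dots> = (\<integral>\<^sup>+a. \<integral>\<^sup>+q. F (vec3 (a, q)) \<partial>lborel \<partial>lborel)"
    by (subst lborel.nn_integral_fst[symmetric]) (auto simp: lborel_prod)
  finally have 0: "(\<integral>\<^sup>+x. F x \<partial>lborel) = (\<integral>\<^sup>+a. \<integral>\<^sup>+q. F (vec3 (a, q)) \<partial>lborel \<partial>lborel)" .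
  have q: "(\<integral>\<^sup>+q. F (vec3 (a, q)) \<partial>lborel) = (\<integral>\<^sup>+b. \<integral>\<^sup>+c. F (vec3 (a, b, c)) \<partial>lborel \<partial>lborel)" for a
  proof -
    have "(\<integral>\<^sup>+q. F (vec3 (a, q)) \<partial>lborel) = (\<integral>\<^sup>+q. F (vec3 (a, q)) \<partial>(lborel \<Otimes>\<^sub>M lborel))"
      by (simp add: lborel_prod)
    also have "\<dots> = (\<integral>\<^sup>+b. \<integral>\<^sup>+c. F (vec3 (a, b, c)) \<partial>lborel \<partial>lborel)"
      by (subst lborel.nn_integral_fst[symmetric]) (auto simp: lborel_prod)
    finally show ?thesis .
  qed
  show 1: "(\<integral>\<^sup>+x. F x \<partial>lborel) = (\<integral>\<^sup>+a. \<integral>\<^sup>+b. \<integral>\<^sup>+c. F (vec3 (a, b, c)) \<partial>lborel \<partial>lborel \<partial>lborel)"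
    unfolding 0 q ..
  have sw: "(\<integral>\<^sup>+x. \<integral>\<^sup>+y. f x y \<partial>lborel \<partial>lborel) = (\<integral>\<^sup>+y. \<integral>\<^sup>+x. f x y \<partial>lborel \<partial>lborel)"
    if [measurable]: "case_prod f \<in> borel_measurable (lborel \<Otimes>\<^sub>M lborel)" for f :: "real \<Rightarrow> real \<Rightarrow> ennreal"
    by (rule lborel_pair.Fubini'[symmetric]) measurable
  have m: "(\<lambda>(b, c). F (vec3 (a, b, c))) \<in> borel_measurable (lborel \<Otimes>\<^sub>M lborel)" for a
    by measurable
  show "(\<integral>\<^sup>+x. F x \<partial>lborel) = (\<integral>\<^sup>+a. \<integral>\<^sup>+c. \<integral>\<^sup>+b. F (vec3 (a, b, c)) \<partial>lborel \<partial>lborel \<partial>lborel)"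
    unfolding 1 by (subst sw[OF m]) (rule refl)
  have "(\<integral>\<^sup>+a. \<integral>\<^sup>+b. \<integral>\<^sup>+c. F (vec3 (a, b, c)) \<partial>lborel \<partial>lborel \<partial>lborel)
      = (\<integral>\<^sup>+b. \<integral>\<^sup>+a. \<integral>\<^sup>+c. F (vec3 (a, b, c)) \<partial>lborel \<partial>lborel \<partial>lborel)"
    by (rule sw) measurable
  also have "\<dots> = (\<integral>\<^sup>+b. \<integral>\<^sup>+c. \<integral>\<^sup>+a. F (vec3 (a, b, c)) \<partial>lborel \<partial>lborel \<partial>lborel)"
  proof (rule nn_integral_cong)
    fix b show "(\<integral>\<^sup>+a. \<integral>\<^sup>+c. F (vec3 (a, b, c)) \<partial>lborel \<partial>lborel)
      = (\<integral>\<^sup>+c. \<integral>\<^sup>+a. F (vec3 (a, b, c)) \<partial>lborel \<partial>lborel)"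
      by (rule sw) measurable
  qed
  finally show "(\<integral>\<^sup>+x. F x \<partial>lborel) = (\<integral>\<^sup>+b. \<integral>\<^sup>+c. \<integral>\<^sup>+a. F (vec3 (a, b, c)) \<partial>lborel \<partial>lborel \<partial>lborel)"
    unfolding 1 .
qed

text \<open>Cauchy-Schwarz twice: in \<open>(b, c)\<close> to split off \<open>g1\<close>, then in
  \<open>a\<close> for the product of \<open>g2\<close> and \<open>g3\<close>, after which the
  variables separate. The statement is squared so that no roots of extended reals appear.\<close>

lemma loomis_whitney:
  fixes g1 g2 g3 :: "real \<Rightarrow> real \<Rightarrow> ennreal"
  assumes [measurable]: "case_prod g1 \<in> borel_measurable borel" "case_prod g2 \<in> borel_measurable borel"
    "case_prod g3 \<in> borel_measurable borel"
  shows "(\<integral>\<^sup>+b. \<integral>\<^sup>+c. \<integral>\<^sup>+a. g1 b c * (g2 a c * g3 a b) \<partial>lborel \<partial>lborel \<partial>lborel)\<^sup>2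
    \<le> (\<integral>\<^sup>+b. \<integral>\<^sup>+c. (g1 b c)\<^sup>2 \<partial>lborel \<partial>lborel) * ((\<integral>\<^sup>+a. \<integral>\<^sup>+c. (g2 a c)\<^sup>2 \<partial>lborel \<partial>lborel)
      * (\<integral>\<^sup>+a. \<integral>\<^sup>+b. (g3 a b)\<^sup>2 \<partial>lborel \<partial>lborel))"
proof -
  have m: "(\<lambda>x. g (f1 x) (f2 x)) \<in> borel_measurable M" if "case_prod g \<in> borel_measurable borel"
    "f1 \<in> borel_measurable M" "f2 \<in> borel_measurable M" for g :: "real \<Rightarrow> real \<Rightarrow> ennreal" and f1 f2 and M :: "'z measure"
    using measurable_compose[OF _ that(1), of "\<lambda>x. (f1 x, f2 x)" M] that(2,3) by simp
  note [measurable] = m[OF assms(1)] m[OF assms(2)] m[OF assms(3)]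
  define K where "K b c = (\<integral>\<^sup>+a. g2 a c * g3 a b \<partial>lborel)" for b c
  have Km: "case_prod K \<in> borel_measurable (lborel \<Otimes>\<^sub>M lborel)"
    unfolding K_def by measurable
  note [measurable] = m[OF Km[unfolded lborel_prod measurable_lborel2]]
  have "(\<integral>\<^sup>+b. \<integral>\<^sup>+c. \<integral>\<^sup>+a. g1 b c * (g2 a c * g3 a b) \<partial>lborel \<partial>lborel \<partial>lborel)
      = (\<integral>\<^sup>+b. \<integral>\<^sup>+c. g1 b c * K b c \<partial>lborel \<partial>lborel)"
    unfolding K_def by (intro nn_integral_cong nn_integral_cmult) measurable
  also have "\<dots> = (\<integral>\<^sup>+p. case_prod g1 p * case_prod K p \<partial>(lborel \<Otimes>\<^sub>M lborel))"
    by (subst lborel.nn_integral_fst[symmetric]) (auto simp: case_prod_unfold)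
  finally have "(\<integral>\<^sup>+b. \<integral>\<^sup>+c. \<integral>\<^sup>+a. g1 b c * (g2 a c * g3 a b) \<partial>lborel \<partial>lborel \<partial>lborel)\<^sup>2
      \<le> (\<integral>\<^sup>+p. (case_prod g1 p)\<^sup>2 \<partial>(lborel \<Otimes>\<^sub>M lborel)) * (\<integral>\<^sup>+p. (case_prod K p)\<^sup>2 \<partial>(lborel \<Otimes>\<^sub>M lborel))"
    using Cauchy_Schwarz_nn_integral[of "case_prod g1" "lborel \<Otimes>\<^sub>M lborel" "case_prod K"] Km assms(1)
    by (simp add: lborel_prod)
  also have "(\<integral>\<^sup>+p. (case_prod g1 p)\<^sup>2 \<partial>(lborel \<Otimes>\<^sub>M lborel)) = (\<integral>\<^sup>+b. \<integral>\<^sup>+c. (g1 b c)\<^sup>2 \<partial>lborel \<partial>lborel)"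
    by (subst lborel.nn_integral_fst[symmetric]) (auto simp: case_prod_unfold)
  also have "(\<integral>\<^sup>+p. (case_prod K p)\<^sup>2 \<partial>(lborel \<Otimes>\<^sub>M lborel)) = (\<integral>\<^sup>+b. \<integral>\<^sup>+c. (K b c)\<^sup>2 \<partial>lborel \<partial>lborel)"
    by (subst lborel.nn_integral_fst[symmetric]) (auto simp: case_prod_unfold)
  also have "\<dots> \<le> (\<integral>\<^sup>+b. \<integral>\<^sup>+c. (\<integral>\<^sup>+a. (g2 a c)\<^sup>2 \<partial>lborel) * (\<integral>\<^sup>+a. (g3 a b)\<^sup>2 \<partial>lborel) \<partial>lborel \<partial>lborel)"
    unfolding K_def by (intro nn_integral_mono Cauchy_Schwarz_nn_integral) measurable
  also have "\<dots> = (\<integral>\<^sup>+c. \<integral>\<^sup>+a. (g2 a c)\<^sup>2 \<partial>lborel \<partial>lborel) * (\<integral>\<^sup>+b. \<integral>\<^sup>+a. (g3 a b)\<^sup>2 \<partial>lborel \<partial>lborel)"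
    by (simp add: nn_integral_multc nn_integral_cmult)
  also have "(\<integral>\<^sup>+c. \<integral>\<^sup>+a. (g2 a c)\<^sup>2 \<partial>lborel \<partial>lborel) = (\<integral>\<^sup>+a. \<integral>\<^sup>+c. (g2 a c)\<^sup>2 \<partial>lborel \<partial>lborel)"
    by (rule lborel_pair.Fubini') measurable
  also have "(\<integral>\<^sup>+b. \<integral>\<^sup>+a. (g3 a b)\<^sup>2 \<partial>lborel \<partial>lborel) = (\<integral>\<^sup>+a. \<integral>\<^sup>+b. (g3 a b)\<^sup>2 \<partial>lborel \<partial>lborel)"
    by (rule lborel_pair.Fubini') measurable
  finally show ?thesis by (simp add: mult_left_mono)
qed

text \<open>Takes the value infinity at infinity, so that line integrals can be used before they are
  known to be finite.\<close>

definition esqrt :: "ennreal \<Rightarrow> ennreal" where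
  "esqrt F = (if F = \<infinity> then \<infinity> else ennreal (sqrt (enn2real F)))"

lemma esqrt_measurable [measurable]: "esqrt \<in> borel_measurable borel"
  unfolding esqrt_def[abs_def] by measurable

lemma esqrt_sq: "(esqrt F)\<^sup>2 = F"
  by (cases F) (auto simp: esqrt_def ennreal_power power2_eq_square[of top])

lemma le_esqrt: "0 \<le> y \<Longrightarrow> ennreal (y\<^sup>2) \<le> F \<Longrightarrow> ennreal y \<le> esqrt F"
  by (cases F) (auto simp: esqrt_def real_le_rsqrt)


text \<open>The fourth power is the integral of its derivative along the line, starting from a point
  outside the support. Enlarging the range to the whole line makes the bound independent of
  \<open>a\<close>.\<close>

lemma test_function_line_bound:
  fixes f :: "'a::euclidean_space \<Rightarrow> real"
  assumes t: "test_function UNIV f" and e: "e \<in> Basis"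
  shows "ennreal ((f (y + a *\<^sub>R e)) ^ 4)
    \<le> (\<integral>\<^sup>+t. ennreal (4 * \<bar>f (y + t *\<^sub>R e)\<bar> ^ 3 * norm (cgrad f (y + t *\<^sub>R e))) \<partial>lborel)"
proof -
  note s = test_functionD(1)[OF t]
  obtain K where K: "compact K" "K \<subseteq> UNIV" and f: "\<And>x. x \<notin> K \<Longrightarrow> f x = 0"
     "\<And>x b. x \<notin> K \<Longrightarrow> frechet_derivative f (at x) b = 0"
    using test_function_support[OF t] by blast
  obtain R where R: "\<And>x. x \<in> K \<Longrightarrow> norm x \<le> R" using compact_imp_bounded[OF K(1)] by (auto simp: bounded_iff)
  \<comment> \<open>Far enough to the left to lie below \<open>a\<close> and, after allowing for the
    offset \<open>y\<close>, outside the ball of radius \<open>R\<close> that holds the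
    support.\<close>
  define a' where "a' = - (\<bar>a\<bar> + norm y + \<bar>R\<bar> + 1)"
  have "y + a' *\<^sub>R e \<notin> K"
  proof
    assume "y + a' *\<^sub>R e \<in> K"
    then have "norm (y + a' *\<^sub>R e) \<le> R" by (rule R)
    moreover have "norm (a' *\<^sub>R e) \<le> norm (y + a' *\<^sub>R e) + norm y"
      using norm_triangle_ineq4[of "y + a' *\<^sub>R e" y] by simp
    moreover have "norm (a' *\<^sub>R e) = \<bar>a\<bar> + norm y + \<bar>R\<bar> + 1" proof -
      have "\<bar>a'\<bar> = \<bar>a\<bar> + norm y + \<bar>R\<bar> + 1" using norm_ge_zero[of y] unfolding a'_def by linarith
      then show ?thesis using e by simp
    qed
    ultimately show False by linarith
  qed
  then have f0: "f (y + a' *\<^sub>R e) = 0" by (rule f(1))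
  have le: "a' \<le> a" using norm_ge_zero[of y] unfolding a'_def by linarith
  define D where "D x = frechet_derivative f (at x) e" for x
  have contD: "continuous_on UNIV D" unfolding D_def by (rule smooth_on_UNIV_partial_continuous[OF s e])
  have contf: "continuous_on UNIV f" by (rule smooth_on_UNIV_continuous[OF s])
  define g where "g t = 4 * (f (y + t *\<^sub>R e)) ^ 3 * D (y + t *\<^sub>R e)" for t
  have contg: "continuous_on UNIV g"
    unfolding g_def
    by (intro continuous_intros continuous_on_compose2[OF contf] continuous_on_compose2[OF contD]) auto
  have line: "((\<lambda>t. f (y + t *\<^sub>R e)) has_real_derivative D (y + t *\<^sub>R e)) (at t)" for t
  proof -
    have 1: "((\<lambda>t. y + t *\<^sub>R e) has_derivative (\<lambda>h. h *\<^sub>R e)) (at t)"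
      by (auto intro!: derivative_eq_intros)
    have "((\<lambda>t. f (y + t *\<^sub>R e)) has_derivative (\<lambda>h. frechet_derivative f (at (y + t *\<^sub>R e)) (h *\<^sub>R e))) (at t)"
      by (rule has_derivative_compose[OF 1 smooth_on_UNIV_has_derivative[OF s]])
    moreover have "(\<lambda>h. frechet_derivative f (at (y + t *\<^sub>R e)) (h *\<^sub>R e)) = (*) (D (y + t *\<^sub>R e))"
      using has_derivative_linear[OF smooth_on_UNIV_has_derivative[OF s]]
      by (intro ext) (simp add: linear_scale mult.commute D_def)
    ultimately show ?thesis by (simp add: has_field_derivative_def)
  qed
  have "((\<lambda>t. (f (y + t *\<^sub>R e)) ^ 4) has_real_derivative g t) (at t)" for t
    using DERIV_power[OF line, of 4 t] by (simp add: g_def mult_ac)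
  then have F: "has_bochner_integral lborel (\<lambda>t. indicator {a'..a} t *\<^sub>R g t) ((f (y + a *\<^sub>R e)) ^ 4 - (f (y + a' *\<^sub>R e)) ^ 4)"
    by (intro has_bochner_integral_FTC_Icc[OF le]) (auto simp: has_real_derivative_iff_has_vector_derivative
        intro: has_vector_derivative_at_within continuous_on_subset[OF contg])
  then have i: "integrable lborel (\<lambda>t. indicator {a'..a} t *\<^sub>R g t)"
    and eq: "(LINT t|lborel. indicator {a'..a} t *\<^sub>R g t) = (f (y + a *\<^sub>R e)) ^ 4"
    using f0 by (auto simp: has_bochner_integral_iff)
  have "ennreal ((f (y + a *\<^sub>R e)) ^ 4) = ennreal (norm (LINT t|lborel. indicator {a'..a} t *\<^sub>R g t))"
    unfolding eq by simp
  also have "\<dots> \<le> (\<integral>\<^sup>+t. ennreal (norm (indicator {a'..a} t *\<^sub>R g t)) \<partial>lborel)"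
    by (rule integral_norm_bound_ennreal[OF i])
  also have "\<dots> \<le> (\<integral>\<^sup>+t. ennreal (4 * \<bar>f (y + t *\<^sub>R e)\<bar> ^ 3 * norm (cgrad f (y + t *\<^sub>R e))) \<partial>lborel)"
  proof (intro nn_integral_mono ennreal_leI)
    fix t
    have "\<bar>D (y + t *\<^sub>R e)\<bar> \<le> norm (cgrad f (y + t *\<^sub>R e))"
      using Basis_le_norm[OF e, of "cgrad f (y + t *\<^sub>R e)"] by (simp add: cgrad_inner[OF e] D_def)
    then have "norm (g t) \<le> 4 * \<bar>f (y + t *\<^sub>R e)\<bar> ^ 3 * norm (cgrad f (y + t *\<^sub>R e))"
      unfolding g_def by (simp add: abs_mult power_abs mult_left_mono)
    then show "norm (indicator {a'..a} t *\<^sub>R g t) \<le> 4 * \<bar>f (y + t *\<^sub>R e)\<bar> ^ 3 * norm (cgrad f (y + t *\<^sub>R e))"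
      by (simp add: indicator_def)
  qed
  finally show ?thesis .
qed

text \<open>Let X, Y, I be the integrals of f^6, |grad f|^2 and 4 |f|^3 |grad f|. Each of the three
  factors f^2 of f^6 is at most the root of a line integral, so Loomis-Whitney gives X^2 \<le> I^3,
  and Cauchy-Schwarz gives I^2 \<le> 16 X Y. Hence X^4 \<le> 16^3 X^3 Y^3, and 16^3 is 4096.\<close>

lemma gagliardo_nirenberg_test_function:
  fixes f :: "real^3 \<Rightarrow> real"
  assumes t: "test_function UNIV f"
  shows "(LINT x|lborel. (f x) ^ 6) \<le> 4096 * (LINT x|lborel. (norm (cgrad f x))\<^sup>2) ^ 3"
    and "integrable lborel (\<lambda>x. (f x) ^ 6)"
proof -
  note s = test_functionD(1)[OF t]
  obtain K where K: "compact K" "K \<subseteq> UNIV" and f: "\<And>x. x \<notin> K \<Longrightarrow> f x = 0"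
     "\<And>x b. x \<notin> K \<Longrightarrow> frechet_derivative f (at x) b = 0"
    using test_function_support[OF t] by blast
  note cont = smooth_on_UNIV_continuous[OF s] cgrad_continuous[OF s]
  have fm [measurable]: "f \<in> borel_measurable borel" "cgrad f \<in> borel_measurable borel"
    using cont by (auto intro: borel_measurable_continuous_onI)
  define \<Phi> where "\<Phi> x = ennreal (4 * \<bar>f x\<bar> ^ 3 * norm (cgrad f x))" for x
  have [measurable]: "\<Phi> \<in> borel_measurable borel" unfolding \<Phi>_def by measurable
  define I where "I = (\<integral>\<^sup>+x. \<Phi> x \<partial>lborel)"
  define X where "X = (\<integral>\<^sup>+x. ennreal ((f x) ^ 6) \<partial>lborel)"
  define F1 where "F1 b c = (\<integral>\<^sup>+t. \<Phi> (vec3 (t, b, c)) \<partial>lborel)" for b c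
  define F2 where "F2 a c = (\<integral>\<^sup>+t. \<Phi> (vec3 (a, t, c)) \<partial>lborel)" for a c
  define F3 where "F3 a b = (\<integral>\<^sup>+t. \<Phi> (vec3 (a, b, t)) \<partial>lborel)" for a b
  have line: "ennreal ((f (vec3 (a, b, c)))\<^sup>2) \<le> esqrt (F1 b c)"
     "ennreal ((f (vec3 (a, b, c)))\<^sup>2) \<le> esqrt (F2 a c)"
     "ennreal ((f (vec3 (a, b, c)))\<^sup>2) \<le> esqrt (F3 a b)" for a b c
  proof -
    have B: "axis i 1 \<in> (Basis :: (real^3) set)" for i by (auto simp: Basis_real3)
    have e: "((f x)\<^sup>2)\<^sup>2 = (f x) ^ 4" for x by simp
    show "ennreal ((f (vec3 (a, b, c)))\<^sup>2) \<le> esqrt (F1 b c)"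
      using test_function_line_bound[OF t B[of 1], of "vec3 (0, b, c)" a]
      by (intro le_esqrt) (auto simp: F1_def \<Phi>_def vec3_def e algebra_simps)
    show "ennreal ((f (vec3 (a, b, c)))\<^sup>2) \<le> esqrt (F2 a c)"
      using test_function_line_bound[OF t B[of 2], of "vec3 (a, 0, c)" b]
      by (intro le_esqrt) (auto simp: F2_def \<Phi>_def vec3_def e algebra_simps)
    show "ennreal ((f (vec3 (a, b, c)))\<^sup>2) \<le> esqrt (F3 a b)"
      using test_function_line_bound[OF t B[of 3], of "vec3 (a, b, 0)" c]
      by (intro le_esqrt) (auto simp: F3_def \<Phi>_def vec3_def e algebra_simps)
  qed
  have Fm: "case_prod (\<lambda>b c. esqrt (F1 b c)) \<in> borel_measurable borel"
    "case_prod (\<lambda>a c. esqrt (F2 a c)) \<in> borel_measurable borel"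
    "case_prod (\<lambda>a b. esqrt (F3 a b)) \<in> borel_measurable borel"
    unfolding F1_def F2_def F3_def borel_prod[symmetric] by measurable
  have "X = (\<integral>\<^sup>+b. \<integral>\<^sup>+c. \<integral>\<^sup>+a. ennreal ((f (vec3 (a, b, c))) ^ 6) \<partial>lborel \<partial>lborel \<partial>lborel)"
    unfolding X_def by (rule nn_integral_real3(2)) measurable
  also have "\<dots> \<le> (\<integral>\<^sup>+b. \<integral>\<^sup>+c. \<integral>\<^sup>+a. esqrt (F1 b c) * (esqrt (F2 a c) * esqrt (F3 a b)) \<partial>lborel \<partial>lborel \<partial>lborel)"
  proof (intro nn_integral_mono)
    fix a b c
    have "ennreal ((f (vec3 (a, b, c))) ^ 6) = ennreal ((f (vec3 (a, b, c)))\<^sup>2) *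
        (ennreal ((f (vec3 (a, b, c)))\<^sup>2) * ennreal ((f (vec3 (a, b, c)))\<^sup>2))"
      by (simp add: ennreal_mult'[symmetric] power2_eq_square eval_nat_numeral mult.assoc)
    also have "\<dots> \<le> esqrt (F1 b c) * (esqrt (F2 a c) * esqrt (F3 a b))"
      by (intro mult_mono line) auto
    finally show "ennreal ((f (vec3 (a, b, c))) ^ 6) \<le> esqrt (F1 b c) * (esqrt (F2 a c) * esqrt (F3 a b))" .
  qed
  finally have "X\<^sup>2 \<le> (\<integral>\<^sup>+b. \<integral>\<^sup>+c. \<integral>\<^sup>+a. esqrt (F1 b c) * (esqrt (F2 a c) * esqrt (F3 a b)) \<partial>lborel \<partial>lborel \<partial>lborel)\<^sup>2"
    by (rule power_mono) simp
  also have "\<dots> \<le> (\<integral>\<^sup>+b. \<integral>\<^sup>+c. (esqrt (F1 b c))\<^sup>2 \<partial>lborel \<partial>lborel) * ((\<integral>\<^sup>+a. \<integral>\<^sup>+c. (esqrt (F2 a c))\<^sup>2 \<partial>lborel \<partial>lborel)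
      * (\<integral>\<^sup>+a. \<integral>\<^sup>+b. (esqrt (F3 a b))\<^sup>2 \<partial>lborel \<partial>lborel))"
    by (rule loomis_whitney[OF Fm])
  also have "\<dots> = I * (I * I)"
    unfolding esqrt_sq F1_def F2_def F3_def I_def
    using nn_integral_real3[of \<Phi>] by simp
  finally have XI: "X\<^sup>2 \<le> I * (I * I)" .
  define Y where "Y = (\<integral>\<^sup>+x. ennreal ((norm (cgrad f x))\<^sup>2) \<partial>lborel)"
  have "I = (\<integral>\<^sup>+x. ennreal (4 * \<bar>f x\<bar> ^ 3) * ennreal (norm (cgrad f x)) \<partial>lborel)"
    unfolding I_def \<Phi>_def by (simp add: ennreal_mult)
  then have "I\<^sup>2 \<le> (\<integral>\<^sup>+x. (ennreal (4 * \<bar>f x\<bar> ^ 3))\<^sup>2 \<partial>lborel) * (\<integral>\<^sup>+x. (ennreal (norm (cgrad f x)))\<^sup>2 \<partial>lborel)"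
    using Cauchy_Schwarz_nn_integral[of "\<lambda>x. ennreal (4 * \<bar>f x\<bar> ^ 3)" lborel "\<lambda>x. ennreal (norm (cgrad f x))"] by simp
  also have "(\<integral>\<^sup>+x. (ennreal (norm (cgrad f x)))\<^sup>2 \<partial>lborel) = Y"
    unfolding Y_def by (simp add: ennreal_power)
  also have "(\<integral>\<^sup>+x. (ennreal (4 * \<bar>f x\<bar> ^ 3))\<^sup>2 \<partial>lborel) = (\<integral>\<^sup>+x. ennreal 16 * ennreal ((f x) ^ 6) \<partial>lborel)"
    by (intro nn_integral_cong) (simp add: ennreal_power ennreal_mult power_mult_distrib
        power_even_abs flip: power_mult)
  also have "\<dots> = ennreal 16 * X" unfolding X_def by (rule nn_integral_cmult) measurable
  finally have IXY: "I\<^sup>2 \<le> ennreal 16 * X * Y" .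
  \<comment> \<open>Compact support makes X and Y finite, and the later cancellation of X^3 depends
    on that.\<close>
  have "continuous_on UNIV (\<lambda>x. (f x) ^ 6)" "continuous_on UNIV (\<lambda>x. (norm (cgrad f x))\<^sup>2)"
    using cont by (auto intro!: continuous_intros)
  moreover have "(f x) ^ 6 = 0" "(norm (cgrad f x))\<^sup>2 = 0" if "x \<notin> K" for x
    using f(1)[OF that] f(2)[OF that] by (simp_all add: cgrad_def)
  ultimately have int: "integrable lborel (\<lambda>x. (f x) ^ 6)" "integrable lborel (\<lambda>x. (norm (cgrad f x))\<^sup>2)"
    using integrable_continuous_compact_support[OF _ K(1)] by auto
  show "integrable lborel (\<lambda>x. (f x) ^ 6)" by (rule int)
  define x where "x = (LINT x|lborel. (f x) ^ 6)"
  define y where "y = (LINT x|lborel. (norm (cgrad f x))\<^sup>2)"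
  have xy: "0 \<le> x" "0 \<le> y" unfolding x_def y_def by (auto intro!: integral_nonneg_AE)
  have X: "X = ennreal x" and Y: "Y = ennreal y"
    unfolding X_def Y_def x_def y_def using int by (auto intro!: nn_integral_eq_integral)
  have IXY': "I\<^sup>2 \<le> ennreal (16 * x * y)" using IXY xy unfolding X Y by (simp add: ennreal_mult)
  then have "I\<^sup>2 < \<infinity>" by (rule le_less_trans) simp
  then obtain i where i: "I = ennreal i" "0 \<le> i" by (cases I) (auto simp: power2_eq_square[of top])
  have "ennreal (x\<^sup>2) \<le> ennreal (i ^ 3)"
  proof -
    have "ennreal (x\<^sup>2) = X\<^sup>2" using xy by (simp add: X ennreal_power)
    also have "\<dots> \<le> I * (I * I)" by (rule XI)
    also have "\<dots> = ennreal (i * (i * i))" using i(2) by (simp only: i(1) ennreal_mult mult_nonneg_nonneg)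
    also have "i * (i * i) = i ^ 3" by (simp add: power3_eq_cube mult.assoc)
    finally show ?thesis .
  qed
  then have 1: "x\<^sup>2 \<le> i ^ 3" using i(2) by (subst (asm) ennreal_le_iff) auto
  have "ennreal (i\<^sup>2) \<le> ennreal (16 * x * y)"
    using IXY' i(2) by (simp only: i(1) ennreal_power)
  then have 2: "i\<^sup>2 \<le> 16 * x * y" using xy by (subst (asm) ennreal_le_iff) auto
  have "x ^ 3 * x = (x\<^sup>2)\<^sup>2" by (simp add: power2_eq_square power3_eq_cube)
  also have "\<dots> \<le> (i ^ 3)\<^sup>2" using 1 by (rule power_mono) simp
  also have "\<dots> = (i\<^sup>2) ^ 3" by (simp flip: power_mult)
  also have "\<dots> \<le> (16 * x * y) ^ 3" using 2 by (rule power_mono) simp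
  also have "\<dots> = x ^ 3 * (4096 * y ^ 3)" by (simp add: power_mult_distrib)
  finally have "x ^ 3 * x \<le> x ^ 3 * (4096 * y ^ 3)" .
  then have "x \<le> 4096 * y ^ 3"
  proof (cases "x = 0")
    case False
    then have "x ^ 3 > 0" using xy by simp
    then show ?thesis using \<open>x ^ 3 * x \<le> x ^ 3 * (4096 * y ^ 3)\<close> by (simp only: mult_le_cancel_left_pos)
  qed (use xy in simp)
  then show "(LINT x|lborel. (f x) ^ 6) \<le> 4096 * (LINT x|lborel. (norm (cgrad f x))\<^sup>2) ^ 3"
    by (simp only: x_def y_def)
qed

text \<open>Passage to the closure: along a subsequence the approximating test functions converge almost
  everywhere, so that Fatou's lemma applies.\<close>

theorem sobolev_H01:
  fixes S :: "(real^3) set"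
  assumes S: "open S" and v: "v \<in> H01 S"
  shows "integrable (lebesgue_on S) (\<lambda>x. (v x) ^ 6)"
    "(LINT x|lebesgue_on S. (v x) ^ 6) \<le> 4096 * (grad_norm S v) ^ 6"
proof -
  have Sl: "S \<in> sets lebesgue" using S by auto
  define \<mu> where "\<mu> = lebesgue_on S"
  have "\<forall>n. \<exists>\<psi>. test_function S \<psi> \<and> H1_norm S (\<lambda>x. v x - \<psi> x) < inverse (real (Suc n))"
    using H01_D(2)[OF v] by simp
  then obtain \<psi> where \<psi>: "\<And>n. test_function S (\<psi> n)" "\<And>n. H1_norm S (\<lambda>x. v x - \<psi> n x) < inverse (real (Suc n))"
    by metis
  note v1 = H01_D(1)[OF v]
  note \<psi>1 = test_function_H1(1)[OF S \<psi>(1)]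
  have d1: "(\<lambda>x. v x - \<psi> n x) \<in> H1 S" for n using H1_lin(1)[OF S v1 \<psi>1, of 1 "-1"] by simp
  have vm [measurable]: "v \<in> borel_measurable \<mu>"
    using H1_D(1)[OF S v1] by (simp add: sq_int_measurable \<mu>_def)
  have \<psi>m [measurable]: "\<psi> n \<in> borel_measurable \<mu>" for n
    using H1_D(1)[OF S \<psi>1] by (simp add: sq_int_measurable \<mu>_def)
  have L1: "(\<lambda>n. LINT x|\<mu>. norm ((v x - \<psi> n x)\<^sup>2)) \<longlonglongrightarrow> 0"
  proof (rule tendsto_sandwich[OF _ _ tendsto_const])
    have "(\<lambda>n. (inverse (real (Suc n)))\<^sup>2) \<longlonglongrightarrow> 0\<^sup>2" by (intro tendsto_power LIMSEQ_inverse_real_of_nat)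
    then show "(\<lambda>n. (inverse (real (Suc n)))\<^sup>2) \<longlonglongrightarrow> 0" by simp
    show "\<forall>\<^sub>F n in sequentially. (LINT x|\<mu>. norm ((v x - \<psi> n x)\<^sup>2)) \<le> (inverse (real (Suc n)))\<^sup>2"
    proof (intro always_eventually allI)
      fix n
      have "nrm \<mu> (\<lambda>x. v x - \<psi> n x) \<le> inverse (real (Suc n))"
        using H1_norm_ge(1)[of S "\<lambda>x. v x - \<psi> n x"] \<psi>(2)[of n] by (simp add: \<mu>_def)
      then have "(nrm \<mu> (\<lambda>x. v x - \<psi> n x))\<^sup>2 \<le> (inverse (real (Suc n)))\<^sup>2" by (rule power_mono) simp
      then show "(LINT x|\<mu>. norm ((v x - \<psi> n x)\<^sup>2)) \<le> (inverse (real (Suc n)))\<^sup>2" by (simp add: nrm_sq)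
    qed
  qed simp
  have i1: "integrable \<mu> (\<lambda>x. (v x - \<psi> n x)\<^sup>2)" for n
    using H1_D(1)[OF S d1[of n]] by (simp add: sq_int_def \<mu>_def)
  from tendsto_L1_AE_subseq[OF i1 L1] obtain r where r: "strict_mono r"
    "AE x in \<mu>. (\<lambda>n. (v x - \<psi> (r n) x)\<^sup>2) \<longlonglongrightarrow> 0" by auto
  \<comment> \<open>By the triangle inequality the gradient norm of \<open>\<psi> n\<close> exceeds
    that of \<open>v\<close> by at most 1/(n+1).\<close>
  define c where "c n = 4096 * (grad_norm S v + inverse (real (Suc n))) ^ 6" for n
  have bound: "(\<integral>\<^sup>+x. ennreal ((\<psi> n x) ^ 6) \<partial>\<mu>) \<le> ennreal (c n)" for n
  proof -
    have t: "test_function UNIV (\<psi> n)" using \<psi>(1)[of n] by (auto simp: test_function_def)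
    note s = test_functionD(1)[OF t]
    obtain K where K: "compact K" "K \<subseteq> S" and f: "\<And>x. x \<notin> K \<Longrightarrow> \<psi> n x = 0"
     "\<And>x b. x \<notin> K \<Longrightarrow> frechet_derivative (\<psi> n) (at x) b = 0"
      using test_function_support[OF \<psi>(1)[of n]] by blast
    have out: "\<psi> n x = 0" "cgrad (\<psi> n) x = 0" if "x \<notin> S" for x
    proof -
      have "x \<notin> K" using that K(2) by blast
      then show "\<psi> n x = 0" "cgrad (\<psi> n) x = 0" using f by (simp_all add: cgrad_def)
    qed
    have m: "\<psi> n \<in> borel_measurable borel" "cgrad (\<psi> n) \<in> borel_measurable borel"
      using smooth_on_UNIV_continuous[OF s] cgrad_continuous[OF s] by (auto intro: borel_measurable_continuous_onI)
    have 1: "(LINT x|\<mu>. (\<psi> n x) ^ 6) = (LINT x|lborel. (\<psi> n x) ^ 6)"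
      unfolding \<mu>_def using m out by (intro integral_lebesgue_on_supp[OF Sl]) auto
    have 2: "(LINT x|\<mu>. (norm (cgrad (\<psi> n) x))\<^sup>2) = (LINT x|lborel. (norm (cgrad (\<psi> n) x))\<^sup>2)"
      unfolding \<mu>_def using m out by (intro integral_lebesgue_on_supp[OF Sl]) auto
    have "nrm \<mu> (cgrad (\<psi> n)) = grad_norm S (\<psi> n)"
      unfolding grad_norm_nrm \<mu>_def using wgrad_AE_eq(1)[OF S weak_gradient_cgrad[OF S \<psi>(1)]]
        sq_int_measurable[OF test_function_H1(2)[OF S \<psi>(1)]] sq_int_measurable[OF H1_D(3)[OF S \<psi>1]]
      by (intro nrm_cong_AE[symmetric])
    also have "\<dots> \<le> grad_norm S v + grad_norm S (\<lambda>x. v x - \<psi> n x)"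
      using grad_norm_lin[OF S v1 d1[of n], of 1 "-1"] by simp
    also have "\<dots> \<le> grad_norm S v + inverse (real (Suc n))"
      using H1_norm_ge(2)[of S "\<lambda>x. v x - \<psi> n x"] \<psi>(2)[of n] by simp
    finally have "(nrm \<mu> (cgrad (\<psi> n))) ^ 6 \<le> (grad_norm S v + inverse (real (Suc n))) ^ 6"
      by (intro power_mono) auto
    moreover have "(nrm \<mu> (cgrad (\<psi> n))) ^ 6 = (LINT x|lborel. (norm (cgrad (\<psi> n) x))\<^sup>2) ^ 3"
    proof -
      have "(nrm \<mu> (cgrad (\<psi> n))) ^ 6 = ((nrm \<mu> (cgrad (\<psi> n)))\<^sup>2) ^ 3" by (simp flip: power_mult)
      then show ?thesis unfolding nrm_sq 2 .
    qed
    ultimately have le: "(LINT x|\<mu>. (\<psi> n x) ^ 6) \<le> c n"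
      unfolding 1 c_def using gagliardo_nirenberg_test_function(1)[OF t] by simp
    have "integrable lebesgue (\<lambda>x. (\<psi> n x) ^ 6)"
      using gagliardo_nirenberg_test_function(2)[OF t] m by (subst integrable_completion) auto
    then have "integrable lebesgue (\<lambda>x. indicator S x *\<^sub>R (\<psi> n x) ^ 6)"
      using Sl by (intro integrable_mult_indicator)
    then have "integrable \<mu> (\<lambda>x. (\<psi> n x) ^ 6)"
      unfolding \<mu>_def using Sl by (subst integrable_restrict_space) simp_all
    then show ?thesis using le by (subst nn_integral_eq_integral) (auto intro: ennreal_leI)
  qed
  have "(\<integral>\<^sup>+x. ennreal ((v x) ^ 6) \<partial>\<mu>) = (\<integral>\<^sup>+x. liminf (\<lambda>n. ennreal ((\<psi> (r n) x) ^ 6)) \<partial>\<mu>)"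
  proof (rule nn_integral_cong_AE)
    show "AE x in \<mu>. ennreal ((v x) ^ 6) = liminf (\<lambda>n. ennreal ((\<psi> (r n) x) ^ 6))"
      using r(2)
    proof eventually_elim
      case (elim x)
      have "(\<lambda>n. sqrt ((v x - \<psi> (r n) x)\<^sup>2)) \<longlonglongrightarrow> sqrt 0" using elim by (intro tendsto_real_sqrt)
      then have "(\<lambda>n. \<bar>v x - \<psi> (r n) x\<bar>) \<longlonglongrightarrow> 0" by simp
      then have "(\<lambda>n. v x - \<psi> (r n) x) \<longlonglongrightarrow> 0" by (rule tendsto_rabs_zero_cancel)
      then have "(\<lambda>n. v x - (v x - \<psi> (r n) x)) \<longlonglongrightarrow> v x - 0" by (intro tendsto_intros)
      then have "(\<lambda>n. ennreal ((\<psi> (r n) x) ^ 6)) \<longlonglongrightarrow> ennreal ((v x) ^ 6)"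
        by (intro tendsto_ennrealI tendsto_power) simp
      then show ?case using lim_imp_Liminf[OF sequentially_bot] by metis
    qed
  qed
  also have "\<dots> \<le> liminf (\<lambda>n. \<integral>\<^sup>+x. ennreal ((\<psi> (r n) x) ^ 6) \<partial>\<mu>)"
    by (rule nn_integral_liminf) measurable
  also have "\<dots> \<le> liminf (\<lambda>n. ennreal (c (r n)))"
    using bound by (intro Liminf_mono always_eventually) auto
  also have "liminf (\<lambda>n. ennreal (c (r n))) = ennreal (4096 * (grad_norm S v) ^ 6)"
  proof (rule lim_imp_Liminf[OF sequentially_bot])
    have "c \<longlonglongrightarrow> 4096 * (grad_norm S v + 0) ^ 6"
      unfolding c_def by (intro tendsto_intros LIMSEQ_inverse_real_of_nat)
    then have "(c \<circ> r) \<longlonglongrightarrow> 4096 * (grad_norm S v) ^ 6" using LIMSEQ_subseq_LIMSEQ[OF _ r(1)] by simp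
    then show "(\<lambda>n. ennreal (c (r n))) \<longlonglongrightarrow> ennreal (4096 * (grad_norm S v) ^ 6)"
      by (intro tendsto_ennrealI) (simp add: o_def)
  qed
  finally have fin: "(\<integral>\<^sup>+x. ennreal ((v x) ^ 6) \<partial>\<mu>) \<le> ennreal (4096 * (grad_norm S v) ^ 6)" .
  then have "(\<integral>\<^sup>+x. ennreal (norm ((v x) ^ 6)) \<partial>\<mu>) < \<infinity>" by (simp add: le_less_trans)
  then show int: "integrable (lebesgue_on S) (\<lambda>x. (v x) ^ 6)"
    using vm unfolding \<mu>_def[symmetric] by (intro integrableI_bounded) auto
  have "ennreal (LINT x|\<mu>. (v x) ^ 6) \<le> ennreal (4096 * (grad_norm S v) ^ 6)"
    using fin int unfolding \<mu>_def by (subst (asm) nn_integral_eq_integral) auto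
  then show "(LINT x|lebesgue_on S. (v x) ^ 6) \<le> 4096 * (grad_norm S v) ^ 6"
    unfolding \<mu>_def by (subst (asm) ennreal_le_iff) (auto simp: grad_norm_nrm)
qed


section \<open>Elementary inequalities and limits\<close>

text \<open>Young's inequality for \<open>k * a\<close> and \<open>b / k\<close> with
  \<open>k = \<epsilon> powr (1 / P)\<close>; the divisors \<open>P\<close> and \<open>Q\<close>
  exceed 1 and are discarded.\<close>

lemma young_eps:
  fixes P Q \<epsilon> :: real
  assumes "P > 1" "Q > 1" "1 / P + 1 / Q = 1" "\<epsilon> > 0"
  obtains C where "C > 0" "\<And>a b. a \<ge> 0 \<Longrightarrow> b \<ge> 0 \<Longrightarrow> a * b \<le> \<epsilon> * a powr P + C * b powr Q"
proof
  define k where "k = \<epsilon> powr (1 / P)"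
  have k: "k > 0" using assms(4) by (simp add: k_def)
  show "(1 / k) powr Q > 0" using k by simp
  fix a b :: real assume ab: "a \<ge> 0" "b \<ge> 0"
  have "a * b = (k * a) * (1 / k * b)" using k by simp
  also have "\<dots> \<le> (k * a) powr P / P + (1 / k * b) powr Q / Q"
    using Youngs_inequality[OF assms(1,2,3), of "k * a" "1 / k * b"] k ab by simp
  also have "\<dots> \<le> (k * a) powr P + (1 / k * b) powr Q"
  proof (intro add_mono)
    have d: "x / y \<le> x" if "x \<ge> 0" "y > 1" for x y :: real
      using mult_left_mono[of 1 y x] that by (simp add: divide_le_eq)
    show "(k * a) powr P / P \<le> (k * a) powr P" "(1 / k * b) powr Q / Q \<le> (1 / k * b) powr Q"
      by (rule d; use assms(1,2) in simp)+
  qed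
  also have "(k * a) powr P = \<epsilon> * a powr P"
    using k ab assms(1,4) by (simp add: powr_mult k_def powr_powr)
  also have "(1 / k * b) powr Q = (1 / k) powr Q * b powr Q"
    by (rule powr_mult)
  finally show "a * b \<le> \<epsilon> * a powr P + (1 / k) powr Q * b powr Q" .
qed

text \<open>Convexity of the power function in tangent form, deduced from Young's inequality with
  the conjugate exponent r/(r-1).\<close>

lemma powr_tangent:
  fixes x y r :: real
  assumes r: "r > 1" and "x \<ge> 0" "y \<ge> 0"
  shows "y powr r + r * y powr (r - 1) * (x - y) \<le> x powr r"
proof (cases "y = 0")
  case False
  then have y: "y > 0" using assms by simp
  define q where "q = r / (r - 1)"
  have q: "q > 1" "1 / r + 1 / q = 1" using r by (auto simp: q_def field_simps)
  have "x * y powr (r - 1) \<le> x powr r / r + (y powr (r - 1)) powr q / q"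
    using assms by (intro Youngs_inequality[OF r q]) auto
  also have "(y powr (r - 1)) powr q = y powr r"
    using r by (simp add: powr_powr q_def)
  finally have 1: "x * y powr (r - 1) \<le> x powr r / r + y powr r / q" .
  have "1 / q = 1 - 1 / r" using q(2) by simp
  then have "y powr r / q = y powr r * (1 - 1 / r)" by (metis mult.right_neutral times_divide_eq_right)
  then have "r * (x * y powr (r - 1)) \<le> r * (x powr r / r + y powr r * (1 - 1 / r))"
    using 1 r by (intro mult_left_mono) auto
  also have "\<dots> = x powr r + (r - 1) * y powr r" using r by (simp add: field_simps)
  finally have "r * (x * y powr (r - 1)) \<le> x powr r + (r - 1) * y powr r" .
  moreover have "y powr (r - 1) * y = y powr r" using y by (simp add: powr_diff)
  ultimately show ?thesis by (simp add: algebra_simps)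
qed (use r in simp)

text \<open>The tangent inequality and Young's inequality bound the difference of two such integrals
  by \<open>\<delta>\<close> times one of them plus a multiple of the integral of
  \<open>\<bar>w s x - w t x\<bar> powr r\<close>. This takes the place of Minkowski's
  inequality.\<close>

lemma abs_powr_integral_continuous:
  fixes w :: "real \<Rightarrow> 'a \<Rightarrow> real"
  assumes r: "r > 1"
    and m: "\<And>s. w s \<in> borel_measurable M"
    and i: "\<And>s. integrable M (\<lambda>x. \<bar>w s x\<bar> powr r)"
    and d: "\<And>s. integrable M (\<lambda>x. \<bar>w s x - w t x\<bar> powr r)"
    and lim: "((\<lambda>s. LINT x|M. \<bar>w s x - w t x\<bar> powr r) \<longlongrightarrow> 0) (at t)"
  shows "isCont (\<lambda>s. LINT x|M. \<bar>w s x\<bar> powr r) t"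
proof -
  define F where "F s = (LINT x|M. \<bar>w s x\<bar> powr r)" for s
  define D where "D s = (LINT x|M. \<bar>w s x - w t x\<bar> powr r)" for s
  have F0: "F s \<ge> 0" "D s \<ge> 0" for s unfolding F_def D_def by (auto intro!: integral_nonneg_AE)
  define q where "q = r / (r - 1)"
  have q: "q > 1" "1 / q + 1 / r = 1" using r by (auto simp: q_def field_simps)
  have key: "\<exists>C>0. \<forall>s. F s - F t \<le> \<delta> * F s + C * D s \<and> F t - F s \<le> \<delta> * F t + C * D s" if \<delta>: "\<delta> > 0" for \<delta>
  proof -
    obtain C where C: "C > 0" "\<And>a b. a \<ge> 0 \<Longrightarrow> b \<ge> 0 \<Longrightarrow> a * b \<le> (\<delta> / r) * a powr q + C * b powr r"
      using young_eps[OF q(1) r q(2), of "\<delta> / r"] \<delta> r by (metis divide_pos_pos less_trans zero_less_one)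
    have pt: "\<bar>a\<bar> powr r - \<bar>b\<bar> powr r \<le> \<delta> * \<bar>a\<bar> powr r + r * C * \<bar>c\<bar> powr r" if "\<bar>\<bar>a\<bar> - \<bar>b\<bar>\<bar> \<le> \<bar>c\<bar>" for a b c :: real
    proof -
      have "\<bar>a\<bar> powr r - \<bar>b\<bar> powr r \<le> r * \<bar>a\<bar> powr (r - 1) * (\<bar>a\<bar> - \<bar>b\<bar>)"
        using powr_tangent[OF r, of "\<bar>b\<bar>" "\<bar>a\<bar>"] by (simp add: algebra_simps)
      also have "\<dots> \<le> r * \<bar>a\<bar> powr (r - 1) * \<bar>c\<bar>"
        using that r by (intro mult_left_mono) auto
      also have "\<dots> = r * (\<bar>a\<bar> powr (r - 1) * \<bar>c\<bar>)" by simp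
      also have "\<dots> \<le> r * ((\<delta> / r) * (\<bar>a\<bar> powr (r - 1)) powr q + C * \<bar>c\<bar> powr r)"
        using r by (intro mult_left_mono C(2)) auto
      also have "(\<bar>a\<bar> powr (r - 1)) powr q = \<bar>a\<bar> powr r" using r by (simp add: powr_powr q_def)
      also have "r * ((\<delta> / r) * \<bar>a\<bar> powr r + C * \<bar>c\<bar> powr r) = \<delta> * \<bar>a\<bar> powr r + r * C * \<bar>c\<bar> powr r"
        using r by (simp add: field_simps)
      finally show ?thesis .
    qed
    have "F s - F t \<le> \<delta> * F s + r * C * D s" for s
    proof -
      have "F s - F t = (LINT x|M. \<bar>w s x\<bar> powr r - \<bar>w t x\<bar> powr r)" unfolding F_def using i by simp
      also have "\<dots> \<le> (LINT x|M. \<delta> * \<bar>w s x\<bar> powr r + r * C * \<bar>w s x - w t x\<bar> powr r)"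
        using i d by (intro integral_mono pt) (auto intro!: abs_triangle_ineq3)
      also have "\<dots> = \<delta> * F s + r * C * D s" unfolding F_def D_def using i d by simp
      finally show ?thesis .
    qed
    moreover have "F t - F s \<le> \<delta> * F t + r * C * D s" for s
    proof -
      have "F t - F s = (LINT x|M. \<bar>w t x\<bar> powr r - \<bar>w s x\<bar> powr r)" unfolding F_def using i by simp
      also have "\<dots> \<le> (LINT x|M. \<delta> * \<bar>w t x\<bar> powr r + r * C * \<bar>w s x - w t x\<bar> powr r)"
        using i d by (intro integral_mono pt) (auto simp: abs_minus_commute[of "\<bar>w t _\<bar>"] intro!: abs_triangle_ineq3)
      also have "\<dots> = \<delta> * F t + r * C * D s" unfolding F_def D_def using i d by simp
      finally show ?thesis .
    qed
    ultimately show ?thesis using C(1) r by (intro exI[of _ "r * C"]) simp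
  qed
  have "(F \<longlongrightarrow> F t) (at t)"
  proof (rule tendstoI)
    fix e :: real assume e: "e > 0"
    \<comment> \<open>The bound 1/2 allows \<open>\<delta> * F s\<close> to be absorbed, as
      \<open>F s\<close> is not bounded beforehand; the summand 1 keeps the quotient defined when
      \<open>F t = 0\<close>.\<close>
    define \<delta> where "\<delta> = min (1/2) (e / (4 * (F t + 1)))"
    have "\<delta> \<le> 1/2" unfolding \<delta>_def by (rule min.cobounded1)
    moreover have "\<delta> > 0" using e F0[of t] by (simp add: \<delta>_def add_nonneg_pos)
    ultimately have \<delta>: "\<delta> > 0" "\<delta> \<le> 1/2" by auto
    have "\<delta> * (F t + 1) \<le> e / (4 * (F t + 1)) * (F t + 1)"
      using F0(1)[of t] by (intro mult_right_mono) (auto simp: \<delta>_def)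
    also have "\<dots> = e / 4" using F0(1)[of t] by (simp add: field_simps)
    finally have \<delta>F: "\<delta> * F t < e / 4" using \<delta>(1) by (simp add: algebra_simps)
    obtain C where C: "C > 0" "\<And>s. F s - F t \<le> \<delta> * F s + C * D s" "\<And>s. F t - F s \<le> \<delta> * F t + C * D s"
      using key[OF \<delta>(1)] by blast
    have "\<forall>\<^sub>F s in at t. D s < e / (4 * C)"
      using order_tendstoD(2)[OF lim, of "e / (4 * C)"] e C(1) by (simp add: D_def)
    then show "\<forall>\<^sub>F s in at t. dist (F s) (F t) < e"
    proof eventually_elim
      case (elim s)
      then have CD: "C * D s < e / 4" using C(1) by (simp add: field_simps)
      have "F t - F s < e" using C(3)[of s] CD \<delta>F e by linarith
      moreover have "F s - F t < e"
      proof -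
        define z where "z = F s - F t"
        have "\<delta> * z \<le> z / 2 \<or> z < 0"
          using mult_right_mono[OF \<delta>(2), of z] by (cases "z < 0") auto
        moreover have "z \<le> \<delta> * z + \<delta> * F t + C * D s"
          using C(2)[of s] by (simp add: z_def algebra_simps)
        ultimately show ?thesis using CD \<delta>F e unfolding z_def[symmetric] by argo
      qed
      ultimately show ?case by (simp add: dist_real_def abs_less_iff)
    qed
  qed
  then show ?thesis unfolding isCont_def F_def .
qed

text \<open>Integrate the tangent inequality at the mean: for a probability measure the linear term
  has integral zero.\<close>

lemma jensen_powr:
  fixes f :: "'a \<Rightarrow> real"
  assumes q: "q > 1" and M: "finite_measure M" "measure M (space M) = 1"
    and f: "integrable M f" "\<And>x. 0 \<le> f x" and fq: "integrable M (\<lambda>x. f x powr q)"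
  shows "(LINT x|M. f x) powr q \<le> (LINT x|M. f x powr q)"
proof -
  interpret finite_measure M by (rule M(1))
  define a where "a = (LINT x|M. f x)"
  have a: "a \<ge> 0" unfolding a_def using f(2) by (intro integral_nonneg_AE) auto
  have "a powr q = (LINT x|M. a powr q + q * a powr (q - 1) * (f x - a))"
    using f(1) M(2) by (simp add: a_def)
  also have "\<dots> \<le> (LINT x|M. f x powr q)"
    using f fq a by (intro integral_mono powr_tangent q) auto
  finally show ?thesis by (simp add: a_def)
qed

text \<open>Convergence in \<open>L\<^sup>1\<close> together with a bound in \<open>L\<^sup>q\<close> gives weak convergence in \<open>L\<^sup>q\<close>: large
  values of the test function \<open>K\<close> are absorbed by Young's inequality.\<close>

lemma weak_convergence:
  fixes f :: "'i \<Rightarrow> 'a \<Rightarrow> real" and g K :: "'a \<Rightarrow> real"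
  assumes q: "q > 1" "q' > 1" "1 / q + 1 / q' = 1"
    and f: "\<forall>\<^sub>F h in F. f h \<in> borel_measurable M \<and> integrable M (f h) \<and>
        integrable M (\<lambda>x. \<bar>f h x\<bar> powr q) \<and> (LINT x|M. \<bar>f h x\<bar> powr q) \<le> B"
    and g: "g \<in> borel_measurable M" "integrable M g" "integrable M (\<lambda>x. \<bar>g x\<bar> powr q)" "(LINT x|M. \<bar>g x\<bar> powr q) \<le> B"
    and K: "K \<in> borel_measurable M" "integrable M (\<lambda>x. \<bar>K x\<bar> powr q')"
    and lim: "((\<lambda>h. LINT x|M. \<bar>f h x - g x\<bar>) \<longlongrightarrow> 0) F"
  shows "((\<lambda>h. LINT x|M. K x * f h x) \<longlongrightarrow> (LINT x|M. K x * g x)) F"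
    and "integrable M (\<lambda>x. K x * g x)"
    and "\<forall>\<^sub>F h in F. integrable M (\<lambda>x. K x * f h x)"
proof -
  note [measurable] = g(1) K(1)
  have pre: "integrable M (\<lambda>x. K x * y x)" if y: "y \<in> borel_measurable M" "integrable M (\<lambda>x. \<bar>y x\<bar> powr q)" for y
  proof (rule Bochner_Integration.integrable_bound)
    show "integrable M (\<lambda>x. \<bar>y x\<bar> powr q / q + \<bar>K x\<bar> powr q' / q')" using y K by simp
    show "(\<lambda>x. K x * y x) \<in> borel_measurable M" using y by measurable
    have "\<bar>K x * y x\<bar> \<le> \<bar>y x\<bar> powr q / q + \<bar>K x\<bar> powr q' / q'" for x
      using Youngs_inequality[OF q, of "\<bar>y x\<bar>" "\<bar>K x\<bar>"] by (simp add: abs_mult mult.commute)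
    then show "AE x in M. norm (K x * y x) \<le> norm (\<bar>y x\<bar> powr q / q + \<bar>K x\<bar> powr q' / q')"
      by (auto intro!: order_trans[OF _ abs_ge_self])
  qed
  show ig: "integrable M (\<lambda>x. K x * g x)" by (rule pre[OF g(1,3)])
  show ifh: "\<forall>\<^sub>F h in F. integrable M (\<lambda>x. K x * f h x)"
    using f by eventually_elim (auto intro: pre)
  show "((\<lambda>h. LINT x|M. K x * f h x) \<longlongrightarrow> (LINT x|M. K x * g x)) F"
  proof (rule tendstoI)
    fix e :: real assume e: "e > 0"
    define \<epsilon> where "\<epsilon> = e / (8 * (\<bar>B\<bar> + 1))"
    have \<epsilon>: "\<epsilon> > 0" using e by (simp add: \<epsilon>_def)
    have "\<epsilon> * \<bar>B\<bar> \<le> \<epsilon> * (\<bar>B\<bar> + 1)" using \<epsilon> by simp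
    also have "\<dots> = e / 8" by (simp add: \<epsilon>_def field_simps)
    finally have \<epsilon>B: "\<epsilon> * B \<le> e / 8" using \<epsilon> abs_ge_self[of B] by (smt (verit) mult_left_mono)
    obtain C where C: "C > 0" "\<And>a b. a \<ge> 0 \<Longrightarrow> b \<ge> 0 \<Longrightarrow> a * b \<le> \<epsilon> * a powr q + C * b powr q'"
      using young_eps[OF q \<epsilon>] by blast
    \<comment> \<open>The tail of \<open>K\<close> beyond height \<open>N\<close>: its integral
      tends to zero by dominated convergence, and below that height L^1 convergence
      suffices.\<close>
    define J where "J N x = (if \<bar>K x\<bar> > real N then \<bar>K x\<bar> powr q' else 0)" for N :: nat and x
    have Jm [measurable]: "J N \<in> borel_measurable M" for N unfolding J_def by measurable
    have Ji: "integrable M (J N)" for N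
      by (rule Bochner_Integration.integrable_bound[OF K(2)]) (auto simp: J_def)
    have "(\<lambda>N. LINT x|M. J N x) \<longlonglongrightarrow> (LINT x|M. 0)"
    proof (rule integral_dominated_convergence[where w="\<lambda>x. \<bar>K x\<bar> powr q'"])
      show "AE x in M. (\<lambda>N. J N x) \<longlonglongrightarrow> 0"
      proof (intro always_eventually allI)
        fix x
        obtain n0 :: nat where "\<bar>K x\<bar> \<le> real n0" using real_arch_simple by blast
        then have "\<forall>\<^sub>F N in sequentially. 0 = J N x"
          by (intro eventually_sequentiallyI[of n0]) (auto simp: J_def)
        then show "(\<lambda>N. J N x) \<longlonglongrightarrow> 0" by (rule Lim_transform_eventually[OF tendsto_const])
      qed
    qed (auto simp: J_def K)
    then have "(\<lambda>N. LINT x|M. J N x) \<longlonglongrightarrow> 0" by simp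
    then have "\<forall>\<^sub>F N in sequentially. (LINT x|M. J N x) < e / (8 * C)"
      using e C(1) by (intro order_tendstoD(2)) auto
    then obtain N where N: "(LINT x|M. J N x) < e / (8 * C)" by (metis eventually_sequentially order_refl)
    then have CJ: "C * (LINT x|M. J N x) < e / 8" using C(1) by (simp add: field_simps)
    have "\<forall>\<^sub>F h in F. (LINT x|M. \<bar>f h x - g x\<bar>) < e / (4 * (real N + 1))"
      using e by (intro order_tendstoD(2)[OF lim]) auto
    then show "\<forall>\<^sub>F h in F. dist (LINT x|M. K x * f h x) (LINT x|M. K x * g x) < e"
      using f ifh
    proof eventually_elim
      case (elim h)
      then have fh: "f h \<in> borel_measurable M" "integrable M (f h)" "integrable M (\<lambda>x. \<bar>f h x\<bar> powr q)"
        "(LINT x|M. \<bar>f h x\<bar> powr q) \<le> B" by auto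
      note [measurable] = fh(1)
      have pt: "\<bar>K x * f h x - K x * g x\<bar> \<le> real N * \<bar>f h x - g x\<bar> + \<epsilon> * \<bar>f h x\<bar> powr q + \<epsilon> * \<bar>g x\<bar> powr q + 2 * C * J N x" for x
      proof (cases "\<bar>K x\<bar> > real N")
        case True
        have 1: "\<bar>K x * f h x - K x * g x\<bar> \<le> \<bar>f h x\<bar> * \<bar>K x\<bar> + \<bar>g x\<bar> * \<bar>K x\<bar>"
          using abs_triangle_ineq4[of "K x * f h x" "K x * g x"] by (simp add: abs_mult mult.commute)
        have 2: "\<bar>f h x\<bar> * \<bar>K x\<bar> \<le> \<epsilon> * \<bar>f h x\<bar> powr q + C * \<bar>K x\<bar> powr q'"
           "\<bar>g x\<bar> * \<bar>K x\<bar> \<le> \<epsilon> * \<bar>g x\<bar> powr q + C * \<bar>K x\<bar> powr q'"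
          by (intro C(2); simp)+
        have J: "J N x = \<bar>K x\<bar> powr q'" using True by (simp add: J_def)
        have "0 \<le> real N * \<bar>f h x - g x\<bar>" by simp
        then show ?thesis using 1 2 unfolding J by linarith
      next
        case False
        have "\<bar>K x * f h x - K x * g x\<bar> = \<bar>K x\<bar> * \<bar>f h x - g x\<bar>" by (simp add: abs_mult flip: right_diff_distrib)
        also have "\<dots> \<le> real N * \<bar>f h x - g x\<bar>" using False by (intro mult_right_mono) auto
        moreover have "0 \<le> \<epsilon> * \<bar>f h x\<bar> powr q + \<epsilon> * \<bar>g x\<bar> powr q" using \<epsilon> by simp
        ultimately show ?thesis using False by (simp add: J_def)
      qed
      have "\<bar>(LINT x|M. K x * f h x) - (LINT x|M. K x * g x)\<bar> = \<bar>LINT x|M. K x * f h x - K x * g x\<bar>"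
        using elim(3) ig by simp
      also have "\<dots> \<le> (LINT x|M. \<bar>K x * f h x - K x * g x\<bar>)" by (rule integral_abs_bound)
      also have "\<dots> \<le> (LINT x|M. real N * \<bar>f h x - g x\<bar> + \<epsilon> * \<bar>f h x\<bar> powr q + \<epsilon> * \<bar>g x\<bar> powr q + 2 * C * J N x)"
        using fh g elim(3) ig Ji by (intro integral_mono pt) auto
      also have "\<dots> = real N * (LINT x|M. \<bar>f h x - g x\<bar>) + \<epsilon> * (LINT x|M. \<bar>f h x\<bar> powr q)
          + \<epsilon> * (LINT x|M. \<bar>g x\<bar> powr q) + 2 * C * (LINT x|M. J N x)"
        using fh g Ji by simp
      also have "\<dots> < e"
      proof -
        have "real N * (LINT x|M. \<bar>f h x - g x\<bar>) \<le> (real N + 1) * (LINT x|M. \<bar>f h x - g x\<bar>)"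
          by (intro mult_right_mono integral_nonneg_AE) auto
        also have "\<dots> < e / 4" using elim(1) by (simp add: field_simps)
        finally have "real N * (LINT x|M. \<bar>f h x - g x\<bar>) < e / 4" .
        moreover have "\<epsilon> * (LINT x|M. \<bar>f h x\<bar> powr q) \<le> \<epsilon> * B" "\<epsilon> * (LINT x|M. \<bar>g x\<bar> powr q) \<le> \<epsilon> * B"
          using \<epsilon> fh(4) g(4) by (auto intro!: mult_left_mono)
        ultimately show ?thesis using \<epsilon>B CJ e by linarith
      qed
      finally show ?case by (simp add: dist_real_def)
    qed
  qed
qed

section \<open>Limits of telescoping differences in time\<close>

lemma continuous_integral_diff_eq_mvt:
  fixes G :: "real \<Rightarrow> real"
  assumes G: "continuous_on UNIV G" and h: "h > 0" and t: "t \<ge> 0"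
  obtains \<xi> \<eta> where "t - h < \<xi>" "\<xi> < t" "- h < \<eta>" "\<eta> < 0"
    "(LINT s|lebesgue_on {0..t}. G s - G (s - h)) = h * (G \<xi> - G \<eta>)"
proof -
  \<comment> \<open>A margin of 1 on both sides keeps every point used in the interior, where the
    primitive \<open>P\<close> has a two-sided derivative.\<close>
  define a b where "a = - h - 1" and "b = t + 1"
  define P where "P x = integral {a..x} G" for x
  have P: "(P has_real_derivative G x) (at x)" if "a < x" "x < b" for x
  proof -
    have "(P has_vector_derivative G x) (at x within {a..b})"
      unfolding P_def using that by (intro integral_has_vector_derivative continuous_on_subset[OF G]) auto
    then have "(P has_vector_derivative G x) (at x)"
      using that at_within_Icc_at by metis
    then show ?thesis by (simp add: has_real_derivative_iff_has_vector_derivative)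
  qed
  obtain \<xi> where \<xi>: "t - h < \<xi>" "\<xi> < t" "P t - P (t - h) = (t - (t - h)) * G \<xi>"
    using MVT2[of "t - h" t P G] P h t by (auto simp: a_def b_def)
  obtain \<eta> where \<eta>: "- h < \<eta>" "\<eta> < 0" "P 0 - P (- h) = (0 - (- h)) * G \<eta>"
    using MVT2[of "- h" 0 P G] P h t by (auto simp: a_def b_def)
  have c: "continuous_on {0..t} (\<lambda>s. G s - G (s - h))"
    by (intro continuous_intros continuous_on_compose2[OF G]) auto
  \<comment> \<open>What remains are two increments of the primitive, over \<open>[t - h, t]\<close>
    and over \<open>[- h, 0]\<close>; the mean value theorem has been applied to each.\<close>
  have "((\<lambda>s. G s - G (s - h)) has_integral ((P t - P (t - h)) - (P 0 - P (0 - h)))) {0..t}"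
  proof (rule fundamental_theorem_of_calculus[OF t])
    fix x assume x: "x \<in> {0..t}"
    have "((\<lambda>s. P (s - h)) has_real_derivative G (x - h) * 1) (at x)"
      by (rule DERIV_chain2[OF P]) (use x h in \<open>auto simp: a_def b_def intro!: derivative_eq_intros\<close>)
    then have "((\<lambda>s. P s - P (s - h)) has_real_derivative (G x - G (x - h))) (at x)"
      using P[of x] x h by (auto simp: a_def b_def intro!: derivative_eq_intros)
    then show "((\<lambda>s. P s - P (s - h)) has_vector_derivative (G x - G (x - h))) (at x within {0..t})"
      by (simp add: has_real_derivative_iff_has_vector_derivative has_vector_derivative_at_within)
  qed
  then have "integral {0..t} (\<lambda>s. G s - G (s - h)) = h * (G \<xi> - G \<eta>)"
    using \<xi>(3) \<eta>(3) by (simp add: integral_unique right_diff_distrib)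
  moreover have "(LINT s|lebesgue_on {0..t}. G s - G (s - h)) = integral {0..t} (\<lambda>s. G s - G (s - h))"
    by (rule lebesgue_integral_eq_integral[OF continuous_imp_integrable_real[OF c]]) simp
  ultimately show ?thesis using that \<xi>(1,2) \<eta>(1,2) by simp
qed

text \<open>By symmetry \<open>k s (s - h)\<close> is \<open>G (s - h)\<close> for
  \<open>G s = k s (s + h)\<close>, so the integrand is a multiple of an increment of one continuous
  function, and only values near the two end points survive.\<close>

lemma symmetric_telescoping_limit:
  fixes k :: "real \<Rightarrow> real \<Rightarrow> real"
  assumes k: "continuous_on UNIV (\<lambda>(s, r). k s r)" and sym: "\<And>s r. k s r = k r s" and t: "t \<ge> 0"
  shows "((\<lambda>h. LINT s|lebesgue_on {0..t}. (k s (s + h) - k s (s - h)) / (2 * h)) \<longlongrightarrow> (k t t - k 0 0) / 2) (at_right 0)"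
proof (rule tendstoI)
  fix e :: real assume e: "e > 0"
  have c: "\<exists>d>0. \<forall>s r. \<bar>s - t\<bar> < d \<and> \<bar>r - t\<bar> < d \<longrightarrow> \<bar>k s r - k t t\<bar> < e / 2" for t
  proof -
    have "isCont (\<lambda>(s, r). k s r) (t, t)"
      using k by (simp add: continuous_on_eq_continuous_at)
    then obtain d where d: "d > 0" "\<And>p. dist p (t, t) < d \<Longrightarrow> dist (case_prod k p) (k t t) < e / 2"
      unfolding continuous_at_eps_delta using e by (metis (mono_tags, lifting) half_gt_zero old.prod.case)
    have "\<bar>k s r - k t t\<bar> < e / 2" if "\<bar>s - t\<bar> < d / 2" "\<bar>r - t\<bar> < d / 2" for s r
    proof -
      have "dist (s, r) (t, t) \<le> \<bar>s - t\<bar> + \<bar>r - t\<bar>"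
        using sqrt_sum_squares_le_sum_abs[of "dist s t" "dist r t"] by (simp add: dist_Pair_Pair dist_real_def)
      then have "dist (s, r) (t, t) < d" using that by linarith
      from d(2)[OF this] show ?thesis by (simp add: dist_real_def)
    qed
    then show ?thesis using d(1) by (intro exI[of _ "d / 2"]) auto
  qed
  obtain d1 where d1: "d1 > 0" "\<And>s r. \<bar>s - t\<bar> < d1 \<Longrightarrow> \<bar>r - t\<bar> < d1 \<Longrightarrow> \<bar>k s r - k t t\<bar> < e / 2" using c[of t] by blast
  obtain d0 where d0: "d0 > 0" "\<And>s r. \<bar>s - 0\<bar> < d0 \<Longrightarrow> \<bar>r - 0\<bar> < d0 \<Longrightarrow> \<bar>k s r - k 0 0\<bar> < e / 2" using c[of 0] by blast
  show "\<forall>\<^sub>F h in at_right 0. dist (LINT s|lebesgue_on {0..t}. (k s (s + h) - k s (s - h)) / (2 * h)) ((k t t - k 0 0) / 2) < e"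
    unfolding eventually_at_right_field
  proof (intro exI[of _ "min d0 d1"] conjI allI impI)
    show "0 < min d0 d1" using d0 d1 by simp
    fix h :: real assume h: "0 < h" "h < min d0 d1"
    define G where "G s = k s (s + h)" for s
    have cG: "continuous_on UNIV G"
    proof -
      have "continuous_on UNIV (\<lambda>s. (s, s + h))" by (intro continuous_intros)
      from continuous_on_compose2[OF k this] show ?thesis by (simp add: G_def[abs_def])
    qed
    obtain \<xi> \<eta> where \<xi>: "t - h < \<xi>" "\<xi> < t" "- h < \<eta>" "\<eta> < 0"
      and eq: "(LINT s|lebesgue_on {0..t}. G s - G (s - h)) = h * (G \<xi> - G \<eta>)"
      by (rule continuous_integral_diff_eq_mvt[OF cG h(1) t])
    have "k s (s - h) = G (s - h)" for s using sym[of s "s - h"] by (simp add: G_def)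
    then have "(LINT s|lebesgue_on {0..t}. (k s (s + h) - k s (s - h)) / (2 * h)) = (h * (G \<xi> - G \<eta>)) / (2 * h)"
      using eq by (simp add: G_def)
    also have "\<dots> = (G \<xi> - G \<eta>) / 2" using h by simp
    finally have I: "(LINT s|lebesgue_on {0..t}. (k s (s + h) - k s (s - h)) / (2 * h)) = (G \<xi> - G \<eta>) / 2" .
    have "\<bar>\<xi> - t\<bar> < d1" "\<bar>\<xi> + h - t\<bar> < d1" "\<bar>\<eta> - 0\<bar> < d0" "\<bar>\<eta> + h - 0\<bar> < d0"
      using \<xi> h by linarith+
    then have "\<bar>G \<xi> - k t t\<bar> < e / 2" "\<bar>G \<eta> - k 0 0\<bar> < e / 2"
      unfolding G_def using d1(2) d0(2) by blast+
    then show "dist (LINT s|lebesgue_on {0..t}. (k s (s + h) - k s (s - h)) / (2 * h)) ((k t t - k 0 0) / 2) < e"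
      unfolding I dist_real_def using e by argo
  qed
qed


section \<open>The elliptic form\<close>

locale elliptic_domain =
  fixes \<Omega> :: "(real^3) set" and A :: "real^3 \<Rightarrow> real^3^3" and \<omega> :: real
  assumes open_dom: "open \<Omega>" and bounded_dom: "bounded \<Omega>" and coeff: "coefficient_matrix \<Omega> A \<omega>"
begin

abbreviation \<mu> :: "(real^3) measure" where "\<mu> \<equiv> lebesgue_on \<Omega>"

lemma dom_sets: "\<Omega> \<in> sets lebesgue"
  using open_dom by auto

lemma dom_finite: "finite_measure \<mu>"
  using bounded_set_imp_lmeasurable[OF bounded_dom dom_sets] by (rule finite_measure_lebesgue_on)

lemma omega_pos: "\<omega> > 0"
  using coeff by (simp add: coefficient_matrix_def)

lemma A_cont: "continuous_on (closure \<Omega>) (\<lambda>x. A x $ i $ j)"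
  using coeff by (simp add: coefficient_matrix_def smooth_on_closure_def)

lemma A_bound: obtains \<Lambda> where "\<Lambda> \<ge> 0" "\<And>x \<xi>. x \<in> \<Omega> \<Longrightarrow> norm (A x *v \<xi>) \<le> \<Lambda> * norm \<xi>"
proof -
  have cc: "compact (closure \<Omega>)" using bounded_dom by simp
  have "\<exists>B. \<forall>x\<in>closure \<Omega>. \<bar>A x $ i $ j\<bar> \<le> B" for i j
    using compact_imp_bounded[OF compact_continuous_image[OF A_cont[of i j] cc]] by (auto simp: bounded_iff)
  then obtain B where B: "\<And>i j x. x \<in> closure \<Omega> \<Longrightarrow> \<bar>A x $ i $ j\<bar> \<le> B i j" by metis
  show ?thesis
  proof
    show "0 \<le> (\<Sum>i\<in>UNIV. \<Sum>j\<in>UNIV. \<bar>B i j\<bar>)" by (intro sum_nonneg) simp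
    fix x \<xi> assume "x \<in> \<Omega>"
    then have x: "x \<in> closure \<Omega>" using closure_subset by blast
    have "norm (A x *v \<xi>) \<le> (\<Sum>i\<in>UNIV. \<bar>(A x *v \<xi>) $ i\<bar>)" by (rule norm_le_l1_cart)
    also have "\<dots> \<le> (\<Sum>i\<in>UNIV. \<Sum>j\<in>UNIV. \<bar>B i j\<bar> * norm \<xi>)"
    proof (rule sum_mono)
      fix i
      have "\<bar>(A x *v \<xi>) $ i\<bar> \<le> (\<Sum>j\<in>UNIV. \<bar>A x $ i $ j * \<xi> $ j\<bar>)"
        unfolding matrix_vector_mult_def by (simp add: sum_abs)
      also have "\<dots> \<le> (\<Sum>j\<in>UNIV. \<bar>B i j\<bar> * norm \<xi>)"
      proof (rule sum_mono)
        fix j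
        have "\<bar>A x $ i $ j\<bar> \<le> \<bar>B i j\<bar>" using B[OF x, of i j] by linarith
        then show "\<bar>A x $ i $ j * \<xi> $ j\<bar> \<le> \<bar>B i j\<bar> * norm \<xi>"
          unfolding abs_mult by (intro mult_mono component_le_norm_cart) auto
      qed
      finally show "\<bar>(A x *v \<xi>) $ i\<bar> \<le> (\<Sum>j\<in>UNIV. \<bar>B i j\<bar> * norm \<xi>)" .
    qed
    also have "\<dots> = (\<Sum>i\<in>UNIV. \<Sum>j\<in>UNIV. \<bar>B i j\<bar>) * norm \<xi>" by (simp add: sum_distrib_right)
    finally show "norm (A x *v \<xi>) \<le> (\<Sum>i\<in>UNIV. \<Sum>j\<in>UNIV. \<bar>B i j\<bar>) * norm \<xi>" .
  qed
qed

lemma A_measurable: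
  assumes G: "G \<in> borel_measurable \<mu>"
  shows "(\<lambda>x. A x *v G x) \<in> borel_measurable \<mu>"
proof (subst borel_measurable_euclidean_space, rule ballI)
  fix b :: "real^3" assume "b \<in> Basis"
  then obtain i where b: "b = axis i 1" by (auto simp: Basis_real3)
  have "(\<lambda>x. A x $ i $ j) \<in> borel_measurable \<mu>" for j
    by (rule continuous_imp_measurable_on_sets_lebesgue[OF continuous_on_subset[OF A_cont closure_subset] dom_sets])
  moreover have "(\<lambda>x. G x $ j) \<in> borel_measurable \<mu>" for j
  proof -
    have "(\<lambda>x. G x \<bullet> axis j 1) \<in> borel_measurable \<mu>" using G by measurable
    then show ?thesis by (simp add: inner_axis)
  qed
  ultimately have "(\<lambda>x. \<Sum>j\<in>UNIV. A x $ i $ j * G x $ j) \<in> borel_measurable \<mu>"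
    by (intro borel_measurable_sum borel_measurable_times)
  then show "(\<lambda>x. (A x *v G x) \<bullet> b) \<in> borel_measurable \<mu>"
    unfolding b by (simp add: inner_axis matrix_vector_mult_def)
qed

lemma space_mu: "space \<mu> = \<Omega>"
  by simp

text \<open>Multiplication by the coefficients is a bounded operator on square integrable fields;
  this lets the continuity of the bilinear form follow from that of the inner product.\<close>

lemma A_nrm:
  obtains \<Lambda> where "\<Lambda> \<ge> 0" "\<And>G. sq_int \<mu> G \<Longrightarrow> sq_int \<mu> (\<lambda>x. A x *v G x)"
    "\<And>G. sq_int \<mu> G \<Longrightarrow> nrm \<mu> (\<lambda>x. A x *v G x) \<le> \<Lambda> * nrm \<mu> G"
proof -
  obtain \<Lambda> where \<Lambda>: "\<Lambda> \<ge> 0" "\<And>x \<xi>. x \<in> \<Omega> \<Longrightarrow> norm (A x *v \<xi>) \<le> \<Lambda> * norm \<xi>" using A_bound by blast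
  have pt: "(norm (A x *v \<xi>))\<^sup>2 \<le> \<Lambda>\<^sup>2 * (norm \<xi>)\<^sup>2" if "x \<in> \<Omega>" for x \<xi>
    using power_mono[OF \<Lambda>(2)[OF that, of \<xi>], of 2] by (simp add: power_mult_distrib)
  have s: "sq_int \<mu> (\<lambda>x. A x *v G x)" if G: "sq_int \<mu> G" for G
    unfolding sq_int_def
  proof
    show m: "(\<lambda>x. A x *v G x) \<in> borel_measurable \<mu>" using G by (intro A_measurable sq_int_measurable)
    show "integrable \<mu> (\<lambda>x. (norm (A x *v G x))\<^sup>2)"
    proof (rule Bochner_Integration.integrable_bound)
      show "integrable \<mu> (\<lambda>x. \<Lambda>\<^sup>2 * (norm (G x))\<^sup>2)" using G by (simp add: sq_int_def)
      show "AE x in \<mu>. norm ((norm (A x *v G x))\<^sup>2) \<le> norm (\<Lambda>\<^sup>2 * (norm (G x))\<^sup>2)"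
        using pt by (intro AE_I2) simp
    qed (use m in measurable)
  qed
  have "nrm \<mu> (\<lambda>x. A x *v G x) \<le> \<Lambda> * nrm \<mu> G" if G: "sq_int \<mu> G" for G
  proof (rule power2_le_imp_le)
    have "(nrm \<mu> (\<lambda>x. A x *v G x))\<^sup>2 \<le> (LINT x|\<mu>. \<Lambda>\<^sup>2 * (norm (G x))\<^sup>2)"
      unfolding nrm_sq using s[OF G] G pt by (intro integral_mono) (auto simp: sq_int_def)
    then show "(nrm \<mu> (\<lambda>x. A x *v G x))\<^sup>2 \<le> (\<Lambda> * nrm \<mu> G)\<^sup>2"
      by (simp add: power_mult_distrib nrm_sq)
  qed (use \<Lambda>(1) in simp)
  then show ?thesis using that \<Lambda>(1) s by blast
qed

lemma a_form_ip: "a_form \<Omega> A v w = ip \<mu> (\<lambda>x. A x *v wgrad \<Omega> v x) (wgrad \<Omega> w)"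
  by (simp add: a_form_def ip_def)

lemma a_form_sym: "a_form \<Omega> A v w = a_form \<Omega> A w v"
  unfolding a_form_def
proof (rule Bochner_Integration.integral_cong[OF refl])
  fix x assume "x \<in> space \<mu>"
  then have "x \<in> closure \<Omega>" using closure_subset by auto
  then have "transpose (A x) = A x" using coeff by (simp add: coefficient_matrix_def)
  then have "(A x *v \<xi>) \<bullet> \<eta> = \<xi> \<bullet> (A x *v \<eta>)" for \<xi> \<eta>
    using dot_lmul_matrix[of \<xi> "A x" \<eta>] by (metis transpose_matrix_vector)
  then show "(A x *v wgrad \<Omega> v x) \<bullet> wgrad \<Omega> w x = (A x *v wgrad \<Omega> w x) \<bullet> wgrad \<Omega> v x"
    by (simp add: inner_commute)
qed

lemma a_form_coercive:
  assumes v: "v \<in> H1 \<Omega>"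
  shows "\<omega> * (grad_norm \<Omega> v)\<^sup>2 \<le> a_form \<Omega> A v v"
proof -
  note d = H1_D(3)[OF open_dom v]
  have s: "sq_int \<mu> (\<lambda>x. A x *v wgrad \<Omega> v x)" using A_nrm d by blast
  have "\<omega> * (grad_norm \<Omega> v)\<^sup>2 = (LINT x|\<mu>. \<omega> * (norm (wgrad \<Omega> v x))\<^sup>2)"
    by (simp add: grad_norm_nrm nrm_sq)
  also have "\<dots> \<le> (LINT x|\<mu>. (A x *v wgrad \<Omega> v x) \<bullet> wgrad \<Omega> v x)"
  proof (rule integral_mono)
    show "integrable \<mu> (\<lambda>x. \<omega> * (norm (wgrad \<Omega> v x))\<^sup>2)" using d by (simp add: sq_int_def)
    show "integrable \<mu> (\<lambda>x. (A x *v wgrad \<Omega> v x) \<bullet> wgrad \<Omega> v x)" by (rule sq_int_inner[OF s d])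
    fix x assume "x \<in> space \<mu>"
    then have x: "x \<in> closure \<Omega>" using closure_subset by auto
    have "\<omega> * (norm \<xi>)\<^sup>2 \<le> (A x *v \<xi>) \<bullet> \<xi>" for \<xi>
    proof -
      have "(\<Sum>i\<in>UNIV. \<Sum>j\<in>UNIV. A x $ i $ j * \<xi> $ i * \<xi> $ j) \<ge> \<omega> * (\<Sum>i\<in>UNIV. (\<xi> $ i)\<^sup>2)"
        using coeff x unfolding coefficient_matrix_def by blast
      moreover have "(\<Sum>i\<in>UNIV. (\<xi> $ i)\<^sup>2) = (norm \<xi>)\<^sup>2"
        unfolding power2_norm_eq_inner inner_vec_def by (simp add: power2_eq_square)
      moreover have "(\<Sum>i\<in>UNIV. \<Sum>j\<in>UNIV. A x $ i $ j * \<xi> $ i * \<xi> $ j) = (A x *v \<xi>) \<bullet> \<xi>"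
        by (simp add: inner_vec_def matrix_vector_mult_def sum_distrib_left sum_distrib_right mult_ac)
      ultimately show ?thesis by simp
    qed
    then show "\<omega> * (norm (wgrad \<Omega> v x))\<^sup>2 \<le> (A x *v wgrad \<Omega> v x) \<bullet> wgrad \<Omega> v x" .
  qed
  finally show ?thesis by (simp add: a_form_def)
qed

lemma a_form_lin_right:
  assumes "v \<in> H1 \<Omega>" "w \<in> H1 \<Omega>" "w' \<in> H1 \<Omega>"
  shows "a_form \<Omega> A v (\<lambda>x. a * w x + b * w' x) = a * a_form \<Omega> A v w + b * a_form \<Omega> A v w'"
proof -
  note d = H1_D(3)[OF open_dom assms(1)] H1_D(3)[OF open_dom assms(2)] H1_D(3)[OF open_dom assms(3)]
  have s: "sq_int \<mu> (\<lambda>x. A x *v wgrad \<Omega> v x)" using A_nrm d(1) by blast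
  have "a_form \<Omega> A v (\<lambda>x. a * w x + b * w' x)
      = ip \<mu> (\<lambda>x. A x *v wgrad \<Omega> v x) (\<lambda>x. a *\<^sub>R wgrad \<Omega> w x + b *\<^sub>R wgrad \<Omega> w' x)"
    unfolding a_form_ip
  proof (rule ip_cong_AE)
    show "AE x in \<mu>. wgrad \<Omega> (\<lambda>x. a * w x + b * w' x) x = a *\<^sub>R wgrad \<Omega> w x + b *\<^sub>R wgrad \<Omega> w' x"
      by (rule H1_lin(2)[OF open_dom assms(2,3)])
    show "wgrad \<Omega> (\<lambda>x. a * w x + b * w' x) \<in> borel_measurable \<mu>"
      by (rule sq_int_measurable[OF H1_D(3)[OF open_dom H1_lin(1)[OF open_dom assms(2,3)]]])
    show "(\<lambda>x. a *\<^sub>R wgrad \<Omega> w x + b *\<^sub>R wgrad \<Omega> w' x) \<in> borel_measurable \<mu>"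
      by (rule sq_int_measurable[OF sq_int_add[OF sq_int_scaleR[OF d(2), of a] sq_int_scaleR[OF d(3), of b]]])
  qed (use sq_int_measurable[OF s] in auto)
  also have "\<dots> = a * a_form \<Omega> A v w + b * a_form \<Omega> A v w'"
    unfolding a_form_ip
    by (simp add: ip_add_right sq_int_scaleR d s ip_scaleR_right)
  finally show ?thesis .
qed

lemma grad_norm_nonneg [simp]: "0 \<le> grad_norm \<Omega> v"
  by (simp add: grad_norm_nrm)

definition H01_cont :: "(real \<Rightarrow> real^3 \<Rightarrow> real) \<Rightarrow> bool" where
  "H01_cont w \<longleftrightarrow> (\<forall>t. w t \<in> H01 \<Omega> \<and> ((\<lambda>s. H1_norm \<Omega> (\<lambda>x. w s x - w t x)) \<longlongrightarrow> 0) (at t))"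

lemma H01_contD: "H01_cont w \<Longrightarrow> w t \<in> H01 \<Omega>" "H01_cont w \<Longrightarrow> w t \<in> H1 \<Omega>"
  "H01_cont w \<Longrightarrow> ((\<lambda>s. H1_norm \<Omega> (\<lambda>x. w s x - w t x)) \<longlongrightarrow> 0) (at t)"
  by (auto simp: H01_cont_def intro: H01_D)

lemma nrm_wgrad_diff:
  assumes "v \<in> H1 \<Omega>" "w \<in> H1 \<Omega>"
  shows "nrm \<mu> (\<lambda>x. wgrad \<Omega> v x - wgrad \<Omega> w x) = grad_norm \<Omega> (\<lambda>x. v x - w x)"
  unfolding grad_norm_nrm
proof (rule nrm_cong_AE)
  have "AE x in \<mu>. wgrad \<Omega> (\<lambda>x. 1 * v x + (- 1) * w x) x = 1 *\<^sub>R wgrad \<Omega> v x + (- 1) *\<^sub>R wgrad \<Omega> w x"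
    by (rule H1_lin(2)[OF open_dom assms])
  then show "AE x in \<mu>. wgrad \<Omega> v x - wgrad \<Omega> w x = wgrad \<Omega> (\<lambda>x. v x - w x) x"
    by (auto elim!: eventually_mono)
  show "(\<lambda>x. wgrad \<Omega> v x - wgrad \<Omega> w x) \<in> borel_measurable \<mu>"
    by (intro sq_int_measurable sq_int_diff H1_D(3)[OF open_dom] assms)
  show "wgrad \<Omega> (\<lambda>x. v x - w x) \<in> borel_measurable \<mu>"
    using sq_int_measurable[OF H1_D(3)[OF open_dom H1_lin(1)[OF open_dom assms, of 1 "-1"]]] by simp
qed

lemma H01_cont_sq_cont:
  assumes w: "H01_cont w"
  shows "sq_cont \<mu> w" "sq_cont \<mu> (\<lambda>t. wgrad \<Omega> (w t))" "sq_cont \<mu> (\<lambda>t x. A x *v wgrad \<Omega> (w t) x)"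
proof -
  note d = H1_D[OF open_dom H01_contD(2)[OF w]]
  show "sq_cont \<mu> w"
    unfolding sq_cont_def
  proof (intro allI conjI)
    fix t
    show "((\<lambda>s. nrm \<mu> (\<lambda>x. w s x - w t x)) \<longlongrightarrow> 0) (at t)"
      by (rule Lim_null_comparison[OF _ H01_contD(3)[OF w]]) (auto intro!: always_eventually H1_norm_ge)
  qed (rule d(1))
  have g: "((\<lambda>s. nrm \<mu> (\<lambda>x. wgrad \<Omega> (w s) x - wgrad \<Omega> (w t) x)) \<longlongrightarrow> 0) (at t)" for t
    by (rule Lim_null_comparison[OF _ H01_contD(3)[OF w]])
      (auto intro!: always_eventually H1_norm_ge simp: nrm_wgrad_diff[OF H01_contD(2)[OF w] H01_contD(2)[OF w]])
  then show "sq_cont \<mu> (\<lambda>t. wgrad \<Omega> (w t))" using d(3) by (simp add: sq_cont_def)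
  obtain \<Lambda> where \<Lambda>: "\<Lambda> \<ge> 0" "\<And>G. sq_int \<mu> G \<Longrightarrow> sq_int \<mu> (\<lambda>x. A x *v G x)"
    "\<And>G. sq_int \<mu> G \<Longrightarrow> nrm \<mu> (\<lambda>x. A x *v G x) \<le> \<Lambda> * nrm \<mu> G" using A_nrm by blast
  show "sq_cont \<mu> (\<lambda>t x. A x *v wgrad \<Omega> (w t) x)"
    unfolding sq_cont_def
  proof (intro allI conjI)
    fix t
    show "sq_int \<mu> (\<lambda>x. A x *v wgrad \<Omega> (w t) x)" by (rule \<Lambda>(2)[OF d(3)])
    show "((\<lambda>s. nrm \<mu> (\<lambda>x. A x *v wgrad \<Omega> (w s) x - A x *v wgrad \<Omega> (w t) x)) \<longlongrightarrow> 0) (at t)"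
    proof (rule Lim_null_comparison)
      show "\<forall>\<^sub>F s in at t. norm (nrm \<mu> (\<lambda>x. A x *v wgrad \<Omega> (w s) x - A x *v wgrad \<Omega> (w t) x))
          \<le> \<Lambda> * nrm \<mu> (\<lambda>x. wgrad \<Omega> (w s) x - wgrad \<Omega> (w t) x)"
        using \<Lambda>(3)[OF sq_int_diff[OF d(3) d(3)]]
        by (intro always_eventually allI) (simp add: matrix_vector_mult_diff_distrib)
      show "((\<lambda>s. \<Lambda> * nrm \<mu> (\<lambda>x. wgrad \<Omega> (w s) x - wgrad \<Omega> (w t) x)) \<longlongrightarrow> 0) (at t)"
        using tendsto_mult[OF tendsto_const[of \<Lambda>] g] by simp
    qed
  qed
qed

lemma a_form_continuous:
  assumes "H01_cont w" "H01_cont z"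
  shows "continuous_on UNIV (\<lambda>(s, r). a_form \<Omega> A (w s) (z r))"
  unfolding a_form_ip
  by (rule sq_cont_ip_continuous[OF H01_cont_sq_cont(3)[OF assms(1)] H01_cont_sq_cont(2)[OF assms(2)]])

text \<open>Drawn from the Sobolev inequality on a domain of finite measure: with \<open>s\<close>
  the squared gradient norm, \<open>y\<^sup>2 \<le> s + y ^ 6 / s\<^sup>2\<close> is integrated, and
  the second term contributes at most \<open>4096 * s\<close>.\<close>

lemma poincare:
  assumes v: "v \<in> H01 \<Omega>"
  shows "(nrm \<mu> v)\<^sup>2 \<le> (measure \<mu> \<Omega> + 4096) * (grad_norm \<Omega> v)\<^sup>2"
proof -
  interpret finite_measure \<mu> by (rule dom_finite)
  note sob = sobolev_H01[OF open_dom v]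
  note d = H1_D(1)[OF open_dom H01_D(1)[OF v]]
  have m: "v \<in> borel_measurable \<mu>" using d by (rule sq_int_measurable)
  show ?thesis
  \<comment> \<open>For zero gradient norm the division by \<open>s\<close> breaks down; there the
    sixth power has integral zero, so \<open>v\<close> vanishes almost everywhere.\<close>
  proof (cases "grad_norm \<Omega> v = 0")
    case True
    then have "(LINT x|\<mu>. (v x) ^ 6) = 0" using sob(2) by (auto intro!: antisym integral_nonneg_AE)
    then have "AE x in \<mu>. (v x) ^ 6 = 0" using sob(1) by (subst (asm) integral_nonneg_eq_0_iff_AE) auto
    then have "AE x in \<mu>. (norm (v x))\<^sup>2 = 0" by eventually_elim simp
    then have "(nrm \<mu> v)\<^sup>2 = 0" unfolding nrm_sq by (rule integral_eq_zero_AE)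
    then show ?thesis using True by simp
  next
    case False
    define s where "s = (grad_norm \<Omega> v)\<^sup>2"
    have s: "s > 0" using False by (simp add: s_def)
    have pt: "(norm y)\<^sup>2 \<le> s + y ^ 6 / s\<^sup>2" for y :: real
    proof -
      define z where "z = y\<^sup>2 / s"
      have z: "z \<ge> 0" using s by (simp add: z_def)
      have "z \<le> 1 + z ^ 3"
      proof (cases "z \<le> 1")
        case False
        then have "z ^ 1 \<le> z ^ 3" by (intro power_increasing) auto
        then show ?thesis by simp
      qed (use z in \<open>simp add: add_increasing2\<close>)
      then have "s * z \<le> s * (1 + z ^ 3)" using s by (intro mult_left_mono) auto
      moreover have "s * z = y\<^sup>2" using s by (simp add: z_def)
      moreover have "s * (1 + z ^ 3) = s + y ^ 6 / s\<^sup>2"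
        using s by (simp add: z_def power_divide field_simps power2_eq_square power3_eq_cube eval_nat_numeral)
      ultimately show ?thesis by simp
    qed
    have "(nrm \<mu> v)\<^sup>2 \<le> (LINT x|\<mu>. s + (v x) ^ 6 / s\<^sup>2)"
      unfolding nrm_sq using d sob pt by (intro integral_mono) (auto simp: sq_int_def)
    also have "\<dots> = measure \<mu> \<Omega> * s + (LINT x|\<mu>. (v x) ^ 6) / s\<^sup>2"
      using sob(1) by simp
    also have "\<dots> \<le> measure \<mu> \<Omega> * s + (4096 * (grad_norm \<Omega> v) ^ 6) / s\<^sup>2"
      using sob(2) by (intro add_left_mono divide_right_mono) auto
    also have "(4096 * (grad_norm \<Omega> v) ^ 6) / s\<^sup>2 = 4096 * s"
      using False by (simp add: s_def field_simps flip: power_mult power_add)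
    finally show ?thesis by (simp add: s_def algebra_simps)
  qed
qed

text \<open>One bound for all exponents between 2 and 6, so that squares and sixth powers serve
  \<open>p + 1\<close> and \<open>m + 1\<close> alike.\<close>

lemma powr_le_sq_plus_sixth:
  fixes y :: real
  assumes "2 \<le> q" "q \<le> 6"
  shows "\<bar>y\<bar> powr q \<le> y\<^sup>2 + y ^ 6"
proof (cases "\<bar>y\<bar> \<le> 1")
  case True
  show ?thesis
  proof (cases "y = 0")
    case False
    then have "\<bar>y\<bar> powr q \<le> \<bar>y\<bar> powr 2" using True assms by (intro powr_mono') auto
    then show ?thesis using False by (simp add: powr_numeral add_increasing2)
  qed simp
next
  case False
  then have "\<bar>y\<bar> powr q \<le> \<bar>y\<bar> powr 6" using assms by (intro powr_mono) auto
  then show ?thesis using False by (simp add: powr_numeral power_even_abs add_increasing)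
qed

lemma Lq_bound:
  assumes v: "v \<in> H01 \<Omega>" and q: "2 \<le> q" "q \<le> 6"
  shows "integrable \<mu> (\<lambda>x. \<bar>v x\<bar> powr q)"
    "(LINT x|\<mu>. \<bar>v x\<bar> powr q) \<le> (nrm \<mu> v)\<^sup>2 + 4096 * (grad_norm \<Omega> v) ^ 6"
proof -
  note sob = sobolev_H01[OF open_dom v]
  note d = H1_D(1)[OF open_dom H01_D(1)[OF v]]
  have d2: "integrable \<mu> (\<lambda>x. (v x)\<^sup>2)" using d by (simp add: sq_int_def)
  have m: "v \<in> borel_measurable \<mu>" using d by (rule sq_int_measurable)
  show i: "integrable \<mu> (\<lambda>x. \<bar>v x\<bar> powr q)"
  proof (rule Bochner_Integration.integrable_bound)
    show "integrable \<mu> (\<lambda>x. (v x)\<^sup>2 + (v x) ^ 6)" using d2 sob(1) by simp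
    show "AE x in \<mu>. norm (\<bar>v x\<bar> powr q) \<le> norm ((v x)\<^sup>2 + (v x) ^ 6)"
      using powr_le_sq_plus_sixth[OF q] by (intro AE_I2) (auto intro: order_trans[OF _ abs_ge_self])
  qed (use m in measurable)
  have "(LINT x|\<mu>. \<bar>v x\<bar> powr q) \<le> (LINT x|\<mu>. (v x)\<^sup>2 + (v x) ^ 6)"
    using i d2 sob(1) powr_le_sq_plus_sixth[OF q] by (intro integral_mono) auto
  also have "\<dots> \<le> (nrm \<mu> v)\<^sup>2 + 4096 * (grad_norm \<Omega> v) ^ 6"
    using d2 sob by (simp add: nrm_sq)
  finally show "(LINT x|\<mu>. \<bar>v x\<bar> powr q) \<le> (nrm \<mu> v)\<^sup>2 + 4096 * (grad_norm \<Omega> v) ^ 6" .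
qed

text \<open>The difference of two states is again in H_0^1, so its q-th power integral is at most
  H^2 + 4096 H^6 with H its norm.\<close>

lemma Lq_continuous:
  assumes w: "H01_cont w" and q: "2 \<le> q" "q \<le> 6"
  shows "isCont (\<lambda>s. LINT x|\<mu>. \<bar>w s x\<bar> powr q) t"
proof (rule abs_powr_integral_continuous)
  show "w s \<in> borel_measurable \<mu>" for s
    by (rule sq_int_measurable[OF H1_D(1)[OF open_dom H01_contD(2)[OF w]]])
  show "integrable \<mu> (\<lambda>x. \<bar>w s x\<bar> powr q)" for s by (rule Lq_bound(1)[OF H01_contD(1)[OF w] q])
  note diff = H01_diff[OF open_dom H01_contD(1)[OF w] H01_contD(1)[OF w]]
  show "integrable \<mu> (\<lambda>x. \<bar>w s x - w t x\<bar> powr q)" for s by (rule Lq_bound(1)[OF diff q])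
  show "((\<lambda>s. LINT x|\<mu>. \<bar>w s x - w t x\<bar> powr q) \<longlongrightarrow> 0) (at t)"
  proof (rule Lim_null_comparison)
    let ?H = "\<lambda>s. H1_norm \<Omega> (\<lambda>x. w s x - w t x)"
    show "\<forall>\<^sub>F s in at t. norm (LINT x|\<mu>. \<bar>w s x - w t x\<bar> powr q) \<le> (?H s)\<^sup>2 + 4096 * (?H s) ^ 6"
    proof (intro always_eventually allI)
      fix s
      have "(LINT x|\<mu>. \<bar>w s x - w t x\<bar> powr q)
          \<le> (nrm \<mu> (\<lambda>x. w s x - w t x))\<^sup>2 + 4096 * (grad_norm \<Omega> (\<lambda>x. w s x - w t x)) ^ 6"
        by (rule Lq_bound(2)[OF diff q])
      also have "\<dots> \<le> (?H s)\<^sup>2 + 4096 * (?H s) ^ 6"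
        by (intro add_mono mult_left_mono power_mono H1_norm_ge) auto
      finally show "norm (LINT x|\<mu>. \<bar>w s x - w t x\<bar> powr q) \<le> (?H s)\<^sup>2 + 4096 * (?H s) ^ 6"
        by (simp add: integral_nonneg_AE)
    qed
    have "((\<lambda>s. (?H s)\<^sup>2 + 4096 * (?H s) ^ 6) \<longlongrightarrow> 0\<^sup>2 + 4096 * 0 ^ 6) (at t)"
      by (intro tendsto_intros H01_contD(3)[OF w])
    then show "((\<lambda>s. (?H s)\<^sup>2 + 4096 * (?H s) ^ 6) \<longlongrightarrow> 0) (at t)" by simp
  qed
qed (use q in simp)

end


section \<open>Trajectories of the weak solution\<close>

text \<open>Turns limits within the half-line into two-sided limits of compositions with
  \<open>max\<close> and \<open>abs\<close>.\<close>

lemma within_limit_compose: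
  fixes k :: "real \<Rightarrow> real" and f :: "real \<Rightarrow> real"
  assumes "(k \<longlongrightarrow> 0) (at (f t) within {0..})" "k (f t) = 0" "isCont f t" "\<And>s. f s \<ge> 0"
  shows "((\<lambda>s. k (f s)) \<longlongrightarrow> 0) (at t)"
proof -
  have "continuous (at (f t) within {0..}) k" using assms(1,2) by (simp add: continuous_within)
  then have "continuous (at (f t) within range f) k"
    by (rule continuous_within_subset) (use assms(4) in auto)
  then have "continuous (at t within UNIV) (\<lambda>s. k (f s))"
    by (rule continuous_within_compose2[OF assms(3), of k])
  then show ?thesis using assms(2) by (simp add: continuous_within)
qed

lemma nrm_zero: "nrm M (\<lambda>x. 0) = 0"
  by (simp add: nrm_def)

lemma (in elliptic_domain) H1_norm_zero: "v \<in> H1 \<Omega> \<Longrightarrow> H1_norm \<Omega> (\<lambda>x. v x - v x) = 0"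
  using H1_norm_lin[OF open_dom, of v v 0 0] H1_norm_ge(3)[of \<Omega> "\<lambda>x. v x - v x"] by simp

text \<open>The setting of the energy and momentum identities; the smallness of the data and the
  behaviour of \<open>g\<close> near zero are added in later extensions.\<close>

locale damped_wave = elliptic_domain +
  fixes p m b1 b2 :: real and \<gamma> g :: "real \<Rightarrow> real" and u0 u1 :: "real^3 \<Rightarrow> real"
    and u v :: "real \<Rightarrow> real^3 \<Rightarrow> real"
  assumes p: "1 < p" "p \<le> 5" and m: "1 \<le> m" "m \<le> 5" and pm: "p * ((m + 1) / m) < 6"
    and gamma_nonneg: "\<And>t. 0 \<le> t \<Longrightarrow> 0 \<le> \<gamma> t"
    and gamma_antimono: "\<And>s t. 0 \<le> s \<Longrightarrow> s \<le> t \<Longrightarrow> \<gamma> t \<le> \<gamma> s"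
    and g_cont: "continuous_on UNIV g" and g_mono: "mono g" and g_0: "g 0 = 0" and b: "0 < b1" "0 < b2"
    and g_growth: "\<And>s. \<bar>s\<bar> > 1 \<Longrightarrow> b1 * \<bar>s\<bar> powr (m + 1) \<le> g s * s \<and> g s * s \<le> b2 * \<bar>s\<bar> powr (m + 1)"
    and sol: "global_weak_solution \<Omega> A \<gamma> g p m u0 u1 u v"
begin

lemma weak_sol: "T > 0 \<Longrightarrow> weak_solution_on \<Omega> A \<gamma> g p m u0 u1 T u v"
  using sol by (simp add: global_weak_solution_def)

lemma within_halfline:
  fixes t :: real
  assumes "0 \<le> t" shows "at t within {0..t + 1} = at t within {0..}"
  by (rule at_within_nhd[of t "{..<t + 1}"]) (use assms in auto)

text \<open>The solution on \<open>[0, t + 1]\<close> already determines limits at \<open>t\<close>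
  within the half-line, so finite horizons disappear from these facts.\<close>

lemma u_facts:
  assumes t: "0 \<le> t"
  shows "u t \<in> H01 \<Omega>" "((\<lambda>s. H1_norm \<Omega> (\<lambda>x. u s x - u t x)) \<longlongrightarrow> 0) (at t within {0..})"
    "sq_int \<mu> (v t)" "((\<lambda>s. nrm \<mu> (\<lambda>x. v s x - v t x)) \<longlongrightarrow> 0) (at t within {0..})"
    "((\<lambda>s. nrm \<mu> (\<lambda>x. (u s x - u t x) / (s - t) - v t x)) \<longlongrightarrow> 0) (at t within {0..})"
proof -
  have w: "weak_solution_on \<Omega> A \<gamma> g p m u0 u1 (t + 1) u v" using t by (intro weak_sol) simp
  have t': "t \<in> {0..t + 1}" using t by simp
  have 1: "continuous_into_H01 \<Omega> (t + 1) u" "continuous_into_L2 \<Omega> (t + 1) v" "has_L2_time_derivative \<Omega> (t + 1) u v"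
    using w by (simp_all add: weak_solution_on_def)
  show "u t \<in> H01 \<Omega>" "((\<lambda>s. H1_norm \<Omega> (\<lambda>x. u s x - u t x)) \<longlongrightarrow> 0) (at t within {0..})"
    using bspec[OF 1(1)[unfolded continuous_into_H01_def] t'] unfolding within_halfline[OF t] by simp_all
  show "sq_int \<mu> (v t)" "((\<lambda>s. nrm \<mu> (\<lambda>x. v s x - v t x)) \<longlongrightarrow> 0) (at t within {0..})"
    using bspec[OF 1(2)[unfolded continuous_into_L2_def] t'] unfolding within_halfline[OF t] Lp_space_2 Lp_norm_2 by simp_all
  show "((\<lambda>s. nrm \<mu> (\<lambda>x. (u s x - u t x) / (s - t) - v t x)) \<longlongrightarrow> 0) (at t within {0..})"
    using bspec[OF 1(3)[unfolded has_L2_time_derivative_def] t'] unfolding within_halfline[OF t] Lp_norm_2 by simp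
qed

text \<open>Odd reflection in time about the initial state: difference quotients of \<open>ubar\<close> are admissible
  test functions on \<open>[0,T]\<close>.\<close>

definition ubar :: "real \<Rightarrow> real^3 \<Rightarrow> real" where
  "ubar t x = u (max t 0) x - u (max (- t) 0) x + u 0 x"

text \<open>The derivative of an odd reflection is an even extension, hence continuous at zero; an
  even reflection of \<open>u\<close> would reverse the sign of the velocity there.\<close>

definition vbar :: "real \<Rightarrow> real^3 \<Rightarrow> real" where
  "vbar t = v \<bar>t\<bar>"

lemma ubar_nonneg: "0 \<le> t \<Longrightarrow> ubar t = u t"
  by (auto simp: ubar_def max_def)

lemma vbar_nonneg: "0 \<le> t \<Longrightarrow> vbar t = v t"
  by (simp add: vbar_def)

lemma H1_norm_0: "H1_norm \<Omega> (\<lambda>x. 0) = 0"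
  using H1_norm_zero[OF H01_D(1)[OF u_facts(1)[of 0]]] by simp

lemma ubar_H01_cont: "H01_cont ubar"
  unfolding H01_cont_def
proof (intro allI conjI)
  fix t
  note uH = u_facts(1)
  have uH': "0 \<le> s \<Longrightarrow> u s \<in> H1 \<Omega>" for s using uH H01_D by blast
  have ueq: "ubar t = (\<lambda>x. (u (max t 0) x - u (max (- t) 0) x) + u 0 x)" by (simp add: ubar_def fun_eq_iff)
  show "ubar t \<in> H01 \<Omega>"
    unfolding ueq by (intro H01_add H01_diff open_dom uH) auto
  let ?H = "\<lambda>s r. H1_norm \<Omega> (\<lambda>x. u s x - u r x)"
  have 1: "((\<lambda>s. ?H (max s 0) (max t 0)) \<longlongrightarrow> 0) (at t)"
    by (rule within_limit_compose[of "\<lambda>r. ?H r (max t 0)" "\<lambda>s. max s 0"])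
      (auto intro!: u_facts(2) continuous_intros simp: H1_norm_0)
  have 2: "((\<lambda>s. ?H (max (- s) 0) (max (- t) 0)) \<longlongrightarrow> 0) (at t)"
    by (rule within_limit_compose[of "\<lambda>r. ?H r (max (- t) 0)" "\<lambda>s. max (- s) 0"])
      (auto intro!: u_facts(2) continuous_intros simp: H1_norm_0)
  show "((\<lambda>s. H1_norm \<Omega> (\<lambda>x. ubar s x - ubar t x)) \<longlongrightarrow> 0) (at t)"
  proof (rule Lim_null_comparison)
    show "\<forall>\<^sub>F s in at t. norm (H1_norm \<Omega> (\<lambda>x. ubar s x - ubar t x))
        \<le> 2 * ?H (max s 0) (max t 0) + 2 * ?H (max (- s) 0) (max (- t) 0)"
    proof (intro always_eventually allI)
      fix s
      have "(\<lambda>x. ubar s x - ubar t x) = (\<lambda>x. 1 * (u (max s 0) x - u (max t 0) x) + (- 1) * (u (max (- s) 0) x - u (max (- t) 0) x))"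
        by (simp add: ubar_def fun_eq_iff)
      moreover have "(\<lambda>x. u (max s 0) x - u (max t 0) x) \<in> H1 \<Omega>" "(\<lambda>x. u (max (- s) 0) x - u (max (- t) 0) x) \<in> H1 \<Omega>"
        by (intro H01_D(1) H01_diff open_dom uH; simp)+
      ultimately show "norm (H1_norm \<Omega> (\<lambda>x. ubar s x - ubar t x))
          \<le> 2 * ?H (max s 0) (max t 0) + 2 * ?H (max (- s) 0) (max (- t) 0)"
        using H1_norm_lin[OF open_dom, of "\<lambda>x. u (max s 0) x - u (max t 0) x" "\<lambda>x. u (max (- s) 0) x - u (max (- t) 0) x" 1 "-1"]
          H1_norm_ge(3)[of \<Omega> "\<lambda>x. ubar s x - ubar t x"] by simp
    qed
    have "((\<lambda>s. 2 * ?H (max s 0) (max t 0) + 2 * ?H (max (- s) 0) (max (- t) 0)) \<longlongrightarrow> 2 * 0 + 2 * 0) (at t)"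
      by (intro tendsto_intros 1 2)
    then show "((\<lambda>s. 2 * ?H (max s 0) (max t 0) + 2 * ?H (max (- s) 0) (max (- t) 0)) \<longlongrightarrow> 0) (at t)" by simp
  qed
qed

lemma vbar_sq_cont: "sq_cont \<mu> vbar"
  unfolding sq_cont_def
proof (intro allI conjI)
  fix t
  show "sq_int \<mu> (vbar t)" unfolding vbar_def by (rule u_facts(3)) simp
  have "((\<lambda>s. nrm \<mu> (\<lambda>x. v \<bar>s\<bar> x - v \<bar>t\<bar> x)) \<longlongrightarrow> 0) (at t)"
    by (rule within_limit_compose[of "\<lambda>r. nrm \<mu> (\<lambda>x. v r x - v \<bar>t\<bar> x)" abs])
      (auto intro!: u_facts(4) continuous_intros simp: nrm_zero)
  then show "((\<lambda>s. nrm \<mu> (\<lambda>x. vbar s x - vbar t x)) \<longlongrightarrow> 0) (at t)" by (simp add: vbar_def)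
qed

lemma ubar_sq_int: "sq_int \<mu> (ubar t)"
  using H01_cont_sq_cont(1)[OF ubar_H01_cont] by (rule sq_contD)

lemma vbar_sq_int: "sq_int \<mu> (vbar t)"
  using vbar_sq_cont by (rule sq_contD)

text \<open>Negative times reduce to positive ones by changing the sign of time, and at zero both
  one-sided limits come from the right derivative of \<open>u\<close>.\<close>

lemma ubar_deriv: "((\<lambda>s. nrm \<mu> (\<lambda>x. (ubar s x - ubar t x) / (s - t) - vbar t x)) \<longlongrightarrow> 0) (at t)"
proof -
  let ?k = "\<lambda>t s. nrm \<mu> (\<lambda>x. (u s x - u t x) / (s - t) - v t x)"
  let ?K = "\<lambda>s. nrm \<mu> (\<lambda>x. (ubar s x - ubar t x) / (s - t) - vbar t x)"
  have pos: "?k t s = ?K s" if "0 \<le> s" "0 \<le> t" for s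
    using that by (simp add: ubar_nonneg vbar_nonneg)
  have neg: "?k (- t) (- s) = ?K s" if "s \<le> 0" "t \<le> 0" for s
  proof -
    have 1: "max s 0 = 0" "max (- s) 0 = - s" "max t 0 = 0" "max (- t) 0 = - t" using that by auto
    have e: "(u (- s) x - u (- t) x) / (- s - - t) = (ubar s x - ubar t x) / (s - t)" for x
    proof -
      have 2: "ubar s x - ubar t x = - (u (- s) x - u (- t) x)" unfolding ubar_def 1 by simp
      have 3: "s - t = - (- s - - t)" by simp
      show ?thesis unfolding 2 by (subst 3) (rule minus_divide_divide[symmetric])
    qed
    have "\<bar>t\<bar> = - t" using that by simp
    then have v: "vbar t = v (- t)" unfolding vbar_def by (rule arg_cong)
    show ?thesis unfolding e v ..
  qed
  consider "t > 0" | "t < 0" | "t = 0" by linarith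
  then show ?thesis
  proof cases
    case 1
    have "at t within {0..} = at t" by (rule at_within_interior) (use 1 in simp)
    then have "(?k t \<longlongrightarrow> 0) (at t)"
      using u_facts(5)[OF less_imp_le[OF 1]] by simp
    moreover have "\<forall>\<^sub>F s in at t. ?k t s = ?K s"
      using order_tendstoD(1)[OF tendsto_ident_at[of t UNIV] 1]
    proof eventually_elim
      case (elim s)
      show ?case by (rule pos) (use elim 1 in simp_all)
    qed
    ultimately show ?thesis by (rule Lim_transform_eventually)
  next
    case 2
    have "at (- t) within {0..} = at (- t)" by (rule at_within_interior) (use 2 in simp)
    then have "(?k (- t) \<longlongrightarrow> 0) (at (- t))"
      using u_facts(5)[of "- t"] 2 by simp
    moreover have "filterlim uminus (at (- t)) (at t)"
      unfolding filterlim_at by (auto intro!: tendsto_intros simp: eventually_at_filter)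
    ultimately have "((\<lambda>s. ?k (- t) (- s)) \<longlongrightarrow> 0) (at t)" by (rule filterlim_compose)
    moreover have "\<forall>\<^sub>F s in at t. ?k (- t) (- s) = ?K s"
      using order_tendstoD(2)[OF tendsto_ident_at[of t UNIV] 2]
    proof eventually_elim
      case (elim s)
      show ?case by (rule neg) (use elim 2 in simp_all)
    qed
    ultimately show ?thesis by (rule Lim_transform_eventually)
  next
    case 3
    have r: "at t within {0..} = at_right 0" unfolding 3 by (rule at_within_Ici_at_right)
    have k: "(?k t \<longlongrightarrow> 0) (at_right 0)"
      using u_facts(5)[of t] 3 unfolding r by simp
    have "(?K \<longlongrightarrow> 0) (at 0)"
    proof (rule filterlim_split_at)
      have "\<forall>\<^sub>F s in at_right 0. ?k t s = ?K s"
        using eventually_at_right_less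
      proof eventually_elim
        case (elim s)
        show ?case by (rule pos) (use elim 3 in simp_all)
      qed
      with k show "(?K \<longlongrightarrow> 0) (at_right 0)" by (rule Lim_transform_eventually)
      have "\<forall>\<^sub>F s in at_right 0. ?k t s = ?K (- s)"
        using eventually_at_right_less
      proof eventually_elim
        case (elim s)
        have "?k (- t) (- (- s)) = ?K (- s)" by (rule neg) (use elim 3 in simp_all)
        moreover have "- t = t" using 3 by simp
        ultimately show ?case unfolding minus_minus by simp
      qed
      with k have "((\<lambda>s. ?K (- s)) \<longlongrightarrow> 0) (at_right 0)" by (rule Lim_transform_eventually)
      then show "(?K \<longlongrightarrow> 0) (at_left 0)"
        by (simp only: filterlim_at_left_to_right[of _ _ 0] minus_zero)
    qed
    then show ?thesis by (simp only: 3)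
  qed
qed

lemma quotient_sq_int: "sq_int \<mu> (\<lambda>x. (ubar s x - ubar t x) / c)"
  using sq_int_scaleR[OF sq_int_diff[OF ubar_sq_int[of s] ubar_sq_int[of t]], of "1 / c"]
  by simp

text \<open>Testing with a fixed \<open>y\<close> turns the L^2-valued derivative into an ordinary
  one, so that calculus is done for real functions.\<close>

lemma ip_ubar_deriv:
  assumes y: "sq_int \<mu> y"
  shows "((\<lambda>s. ip \<mu> (ubar s) y) has_real_derivative ip \<mu> (vbar t) y) (at t)"
  unfolding has_field_derivative_iff
proof (rule Lim_null[THEN iffD2], rule Lim_null_comparison)
  show "\<forall>\<^sub>F s in at t. norm ((ip \<mu> (ubar s) y - ip \<mu> (ubar t) y) / (s - t) - ip \<mu> (vbar t) y)
      \<le> nrm \<mu> (\<lambda>x. (ubar s x - ubar t x) / (s - t) - vbar t x) * nrm \<mu> y"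
  proof (intro always_eventually allI)
    fix s
    have d: "sq_int \<mu> (\<lambda>x. ubar s x - ubar t x)" by (intro sq_int_diff ubar_sq_int)
    have "ip \<mu> (\<lambda>x. (ubar s x - ubar t x) / (s - t) - vbar t x) y
        = ip \<mu> (\<lambda>x. (1 / (s - t)) *\<^sub>R (ubar s x - ubar t x)) y - ip \<mu> (vbar t) y"
      using ip_diff_left[OF quotient_sq_int vbar_sq_int y, of s t "s - t" t] by simp
    also have "\<dots> = (ip \<mu> (ubar s) y - ip \<mu> (ubar t) y) / (s - t) - ip \<mu> (vbar t) y"
      unfolding ip_scaleR_left by (simp add: ip_diff_left ubar_sq_int y)
    finally have "(ip \<mu> (ubar s) y - ip \<mu> (ubar t) y) / (s - t) - ip \<mu> (vbar t) y
       = ip \<mu> (\<lambda>x. (ubar s x - ubar t x) / (s - t) - vbar t x) y" by simp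
    then show "norm ((ip \<mu> (ubar s) y - ip \<mu> (ubar t) y) / (s - t) - ip \<mu> (vbar t) y)
      \<le> nrm \<mu> (\<lambda>x. (ubar s x - ubar t x) / (s - t) - vbar t x) * nrm \<mu> y"
      using ip_CS[OF sq_int_diff[OF quotient_sq_int vbar_sq_int] y] by simp
  qed
  show "((\<lambda>s. nrm \<mu> (\<lambda>x. (ubar s x - ubar t x) / (s - t) - vbar t x) * nrm \<mu> y) \<longlongrightarrow> 0) (at t)"
    using tendsto_mult[OF ubar_deriv tendsto_const] by simp
qed

lemma ip_vbar_continuous: "sq_int \<mu> y \<Longrightarrow> continuous_on UNIV (\<lambda>r. ip \<mu> (vbar r) y)"
proof -
  assume y: "sq_int \<mu> y"
  have "sq_cont \<mu> (\<lambda>t :: real. y)" using y by (simp add: sq_cont_def nrm_def)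
  then have c: "continuous_on UNIV (\<lambda>(s, r :: real). ip \<mu> (vbar s) y)" by (rule sq_cont_ip_continuous[OF vbar_sq_cont])
  have "continuous_on UNIV (\<lambda>r :: real. (r, 0 :: real))" by (intro continuous_intros)
  from continuous_on_compose2[OF c this]
  show ?thesis by simp
qed

text \<open>The fundamental theorem in tested form, in place of a vector-valued integral of the
  velocity. The interval is rescaled to \<open>[0, 1]\<close> so that \<open>h\<close> may have
  either sign.\<close>

lemma ip_ubar_FTC:
  assumes y: "sq_int \<mu> y"
  shows "ip \<mu> (\<lambda>x. ubar (s + h) x - ubar s x) y = h * (LINT \<theta>|lebesgue_on {0..1}. ip \<mu> (vbar (s + h * \<theta>)) y)"
proof -
  let ?G = "\<lambda>\<theta>. ip \<mu> (ubar (s + h * \<theta>)) y"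
  let ?g = "\<lambda>\<theta>. ip \<mu> (vbar (s + h * \<theta>)) y"
  have "(?G has_real_derivative ?g \<theta> * h) (at \<theta>)" for \<theta>
    by (rule DERIV_chain2[OF ip_ubar_deriv[OF y]]) (auto intro!: derivative_eq_intros)
  then have "((\<lambda>\<theta>. ?g \<theta> * h) has_integral (?G 1 - ?G 0)) {0..1}"
    by (intro fundamental_theorem_of_calculus)
      (auto simp: has_real_derivative_iff_has_vector_derivative has_vector_derivative_at_within)
  then have "integral {0..1} (\<lambda>\<theta>. ?g \<theta> * h) = ?G 1 - ?G 0" by (rule integral_unique)
  moreover have c: "continuous_on {0..1} (\<lambda>\<theta>. ?g \<theta> * h)"
    by (intro continuous_intros continuous_on_compose2[OF ip_vbar_continuous[OF y]]) auto
  then have "(LINT \<theta>|lebesgue_on {0..1}. ?g \<theta> * h) = integral {0..1} (\<lambda>\<theta>. ?g \<theta> * h)"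
    by (intro lebesgue_integral_eq_integral continuous_imp_integrable_real) auto
  ultimately have "(LINT \<theta>|lebesgue_on {0..1}. ?g \<theta> * h) = ?G 1 - ?G 0" by simp
  then show ?thesis by (simp add: ip_diff_left ubar_sq_int y mult.commute)
qed

lemma vbar_bound: obtains V where "V \<ge> 0" "\<And>r. \<bar>r\<bar> \<le> R \<Longrightarrow> nrm \<mu> (vbar r) \<le> V"
proof -
  have "continuous_on UNIV (\<lambda>r :: real. (r, r))" by (intro continuous_intros)
  from continuous_on_compose2[OF sq_cont_ip_continuous[OF vbar_sq_cont vbar_sq_cont] this]
  have c: "continuous_on UNIV (\<lambda>r. ip \<mu> (vbar r) (vbar r))" by simp
  have "bounded ((\<lambda>r. ip \<mu> (vbar r) (vbar r)) ` {- R..R})"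
    by (intro compact_imp_bounded compact_continuous_image continuous_on_subset[OF c]) auto
  then obtain B where B': "\<forall>r\<in>{- R..R}. \<bar>ip \<mu> (vbar r) (vbar r)\<bar> \<le> B" by (auto simp: bounded_iff)
  have B: "\<bar>ip \<mu> (vbar r) (vbar r)\<bar> \<le> B" if "r \<in> {- R..R}" for r using B' that by blast
  show ?thesis
  proof
    show "0 \<le> sqrt \<bar>B\<bar>" by simp
    fix r assume "\<bar>r\<bar> \<le> R"
    then have "(nrm \<mu> (vbar r))\<^sup>2 \<le> \<bar>B\<bar>" using B[of r] by (simp add: nrm_sq_ip abs_le_iff)
    then show "nrm \<mu> (vbar r) \<le> sqrt \<bar>B\<bar>" by (intro real_le_rsqrt)
  qed
qed

text \<open>A mean value inequality: the quotient itself is taken as the tested function, and one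
  factor of its norm is cancelled.\<close>

lemma quotient_bound:
  assumes V: "\<And>r. \<bar>r\<bar> \<le> R \<Longrightarrow> nrm \<mu> (vbar r) \<le> V" and R: "\<bar>s\<bar> + \<bar>h\<bar> \<le> R" and h: "h \<noteq> 0"
  shows "nrm \<mu> (\<lambda>x. (ubar (s + h) x - ubar s x) / h) \<le> V"
proof -
  let ?D = "\<lambda>x. (ubar (s + h) x - ubar s x) / h"
  have D: "sq_int \<mu> ?D" by (rule quotient_sq_int)
  have "(nrm \<mu> ?D)\<^sup>2 = (1 / h) * ip \<mu> (\<lambda>x. ubar (s + h) x - ubar s x) ?D"
    unfolding nrm_sq_ip using ip_scaleR_left[of \<mu> "1 / h" "\<lambda>x. ubar (s + h) x - ubar s x" ?D] by simp
  also have "\<dots> = (LINT \<theta>|lebesgue_on {0..1}. ip \<mu> (vbar (s + h * \<theta>)) ?D)"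
    unfolding ip_ubar_FTC[OF D] using h by simp
  also have "\<dots> \<le> (LINT \<theta>|lebesgue_on {0..1::real}. V * nrm \<mu> ?D)"
  proof (rule integral_mono)
    show "integrable (lebesgue_on {0..1}) (\<lambda>\<theta>. ip \<mu> (vbar (s + h * \<theta>)) ?D)"
      by (intro continuous_imp_integrable_real continuous_on_compose2[OF ip_vbar_continuous[OF D]] continuous_intros) auto
    show "integrable (lebesgue_on {0..1::real}) (\<lambda>\<theta>. V * nrm \<mu> ?D)"
      by (intro continuous_imp_integrable_real continuous_intros)
    fix \<theta> :: real assume "\<theta> \<in> space (lebesgue_on {0..1})"
    then have "\<theta> \<in> {0..1}" by simp
    then have "\<bar>h * \<theta>\<bar> \<le> \<bar>h\<bar>" by (simp add: abs_mult mult_left_le)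
    then have "\<bar>s + h * \<theta>\<bar> \<le> R" using R by linarith
    then have "nrm \<mu> (vbar (s + h * \<theta>)) * nrm \<mu> ?D \<le> V * nrm \<mu> ?D"
      by (intro mult_right_mono V) auto
    then show "ip \<mu> (vbar (s + h * \<theta>)) ?D \<le> V * nrm \<mu> ?D"
      using ip_CS[OF vbar_sq_int D, of "s + h * \<theta>"] by linarith
  qed
  also have "\<dots> = V * nrm \<mu> ?D" by (simp add: measure_restrict_space)
  finally have "nrm \<mu> ?D * nrm \<mu> ?D \<le> V * nrm \<mu> ?D" by (simp add: power2_eq_square)
  moreover have "V \<ge> 0" using V[of 0] R nrm_nonneg[of \<mu> "vbar 0"] by linarith
  ultimately show ?thesis
    by (cases "nrm \<mu> ?D = 0") (auto simp: mult_le_cancel_right less_le)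
qed

end


section \<open>Jointly measurable representatives\<close>

context elliptic_domain
begin

lemma AE_mu_iff: "(AE x in \<mu>. P x) \<longleftrightarrow> (AE x in lborel. x \<in> \<Omega> \<longrightarrow> P x)"
  using dom_sets by (simp add: AE_restrict_space_iff AE_completion_iff)

lemma id_measurable_lebesgue_on: "(\<lambda>x. x) \<in> borel_measurable (lebesgue_on S)"
  by (intro measurable_restrict_space1 measurable_completion) simp

lemma nn_integral_mu: "f \<in> borel_measurable borel \<Longrightarrow> (\<integral>\<^sup>+x. f x \<partial>\<mu>) = (\<integral>\<^sup>+x. f x * indicator \<Omega> x \<partial>lborel)"
  using dom_sets by (subst nn_integral_restrict_space) (auto simp: nn_integral_completion)

text \<open>The representative is Borel on the whole space and zero outside the cylinder, so that
  translation in time and iterated integration over \<open>lborel\<close> apply directly.\<close>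

lemma in_Lp_spacetimeD:
  assumes "in_Lp_spacetime \<Omega> T q v"
  shows "\<exists>W :: real \<times> (real^3) \<Rightarrow> real. W \<in> borel_measurable borel \<and> integrable lborel (\<lambda>z. \<bar>W z\<bar> powr q)
    \<and> (\<forall>s x. s \<notin> {0<..<T} \<or> x \<notin> \<Omega> \<longrightarrow> W (s, x) = 0)
    \<and> (AE s in lborel. s \<in> {0<..<T} \<longrightarrow> (AE x in \<mu>. W (s, x) = v s x))"
proof -
  define S where "S = {0<..<T} \<times> \<Omega>"
  have So: "open S" unfolding S_def by (intro open_Times open_dom) simp
  then have Sb [measurable]: "S \<in> sets borel" and Sl: "S \<in> sets lebesgue" by auto
  obtain w :: "real \<times> (real^3) \<Rightarrow> real" where w: "w \<in> borel_measurable (lebesgue_on S)"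
    "integrable (lebesgue_on S) (\<lambda>z. \<bar>w z\<bar> powr q)"
    and wv: "AE s in lebesgue_on {0<..<T}. AE x in \<mu>. w (s, x) = v s x"
    using assms unfolding in_Lp_spacetime_def Lp_space_def S_def by auto
  have w1: "(\<lambda>z. indicator S z *\<^sub>R w z) \<in> borel_measurable lebesgue"
    using w(1) Sl by (subst (asm) borel_measurable_restrict_space_iff) auto
  obtain W0 where W0 [measurable]: "W0 \<in> borel_measurable lborel" and eq0: "AE z in lborel. indicator S z *\<^sub>R w z = W0 z"
    using completion_ex_borel_measurable_real[OF w1] by blast
  define W where "W z = indicator S z * W0 z" for z
  have Wm: "W \<in> borel_measurable borel" unfolding W_def using W0 by measurable
  have eq: "AE z in lborel. z \<in> S \<longrightarrow> W z = w z"
    using eq0 by eventually_elim (auto simp: W_def)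
  have i0: "integrable lebesgue (\<lambda>z. indicator S z *\<^sub>R (\<bar>w z\<bar> powr q))"
    using w(2) Sl by (subst (asm) integrable_restrict_space) auto
  have ae0: "AE z in lebesgue. indicator S z *\<^sub>R (\<bar>w z\<bar> powr q) = \<bar>W z\<bar> powr q"
    using AE_completion[OF eq] by eventually_elim (auto simp: W_def indicator_def)
  have WB: "(\<lambda>z. \<bar>W z\<bar> powr q) \<in> borel_measurable borel" using Wm by measurable
  have "(\<lambda>z. \<bar>W z\<bar> powr q) \<in> borel_measurable lebesgue"
    by (rule measurable_completion) (use WB in simp)
  from integrable_cong_AE_imp[OF i0 this ae0] have "integrable lebesgue (\<lambda>z. \<bar>W z\<bar> powr q)" .
  then have i: "integrable lborel (\<lambda>z. \<bar>W z\<bar> powr q)"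
    using WB by (subst (asm) integrable_completion) auto
  have "AE z in lborel \<Otimes>\<^sub>M lborel. z \<in> S \<longrightarrow> W z = w z" unfolding lborel_prod by (rule eq)
  then have "AE s in lborel. AE x in lborel. (s, x) \<in> S \<longrightarrow> W (s, x) = w (s, x)"
    by (rule lborel_pair.AE_pair)
  moreover have "AE s in lborel. s \<in> {0<..<T} \<longrightarrow> (AE x in \<mu>. w (s, x) = v s x)"
    using wv by (simp add: AE_restrict_space_iff AE_completion_iff)
  ultimately have "AE s in lborel. s \<in> {0<..<T} \<longrightarrow> (AE x in \<mu>. W (s, x) = v s x)"
  proof eventually_elim
    case (elim s)
    show ?case
    proof
      assume s: "s \<in> {0<..<T}"
      with elim(2) have 1: "AE x in \<mu>. w (s, x) = v s x" by blast
      have "AE x in \<mu>. W (s, x) = w (s, x)"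
        unfolding AE_mu_iff using elim(1) by eventually_elim (use s in \<open>auto simp: S_def\<close>)
      with 1 show "AE x in \<mu>. W (s, x) = v s x" by eventually_elim simp
    qed
  qed
  moreover have "\<forall>s x. s \<notin> {0<..<T} \<or> x \<notin> \<Omega> \<longrightarrow> W (s, x) = 0" by (auto simp: W_def S_def)
  ultimately show ?thesis using Wm i by blast
qed

text \<open>The space-time class refers to Lebesgue measure on the product space, while estimates
  are made for the product of two restricted measures. For a Borel function both are compared
  through iterated integrals over \<open>lborel\<close>.\<close>

lemma in_Lp_spacetimeI:
  fixes \<Phi> :: "real \<times> (real^3) \<Rightarrow> real"
  assumes \<Phi>: "\<Phi> \<in> borel_measurable borel"
    and fin: "(\<integral>\<^sup>+z. ennreal (\<bar>\<Phi> z\<bar> powr q) \<partial>(lebesgue_on {0..T} \<Otimes>\<^sub>M \<mu>)) < \<infinity>"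
    and eq: "\<And>s. s \<in> {0<..<T} \<Longrightarrow> AE x in \<mu>. \<Phi> (s, x) = \<phi> s x"
  shows "in_Lp_spacetime \<Omega> T q \<phi>"
proof -
  define S where "S = {0<..<T} \<times> \<Omega>"
  have So: "open S" unfolding S_def by (intro open_Times open_dom) simp
  then have Sb [measurable]: "S \<in> sets borel" and Sl: "S \<in> sets lebesgue" by auto
  interpret finite_measure \<mu> by (rule dom_finite)
  note [measurable] = \<Phi>
  have dm [measurable]: "\<Omega> \<in> sets borel" using open_dom by auto
  have id1: "fst \<in> borel_measurable (lebesgue_on {0..T} \<Otimes>\<^sub>M \<mu>)"
    by (rule measurable_compose[OF measurable_fst id_measurable_lebesgue_on])
  have id2: "snd \<in> borel_measurable (lebesgue_on {0..T} \<Otimes>\<^sub>M \<mu>)"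
    by (rule measurable_compose[OF measurable_snd id_measurable_lebesgue_on])
  have id: "(\<lambda>z. z) \<in> borel_measurable (lebesgue_on {0..T} \<Otimes>\<^sub>M \<mu>)"
    using borel_measurable_Pair[OF id1 id2] by simp
  have m: "(\<lambda>z. ennreal (\<bar>\<Phi> z\<bar> powr q)) \<in> borel_measurable borel" by measurable
  have Pm: "(\<lambda>x. ennreal (\<bar>\<Phi> (s, x)\<bar> powr q)) \<in> borel_measurable borel" for s
    using measurable_compose[OF _ m, of "\<lambda>x. (s, x)" borel] by simp
  have Jm: "(\<lambda>s. \<integral>\<^sup>+x. ennreal (\<bar>\<Phi> (s, x)\<bar> powr q) * indicator \<Omega> x \<partial>lborel) \<in> borel_measurable borel"
  proof -
    have "(\<lambda>(s, x). ennreal (\<bar>\<Phi> (s, x)\<bar> powr q) * indicator \<Omega> x) \<in> borel_measurable (borel \<Otimes>\<^sub>M lborel)"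
      using m unfolding borel_prod[symmetric] by measurable
    then show ?thesis by (rule lborel.borel_measurable_nn_integral)
  qed
  have "(\<integral>\<^sup>+z. ennreal (\<bar>\<Phi> z\<bar> powr q) * indicator S z \<partial>lborel)
      = (\<integral>\<^sup>+z. ennreal (\<bar>\<Phi> z\<bar> powr q) * indicator S z \<partial>(lborel \<Otimes>\<^sub>M lborel))" by (simp add: lborel_prod)
  also have "\<dots> = (\<integral>\<^sup>+s. \<integral>\<^sup>+x. ennreal (\<bar>\<Phi> (s, x)\<bar> powr q) * indicator S (s, x) \<partial>lborel \<partial>lborel)"
    by (subst lborel.nn_integral_fst[symmetric]) (use \<Phi> in \<open>auto simp: lborel_prod\<close>)
  also have "\<dots> \<le> (\<integral>\<^sup>+s. (\<integral>\<^sup>+x. ennreal (\<bar>\<Phi> (s, x)\<bar> powr q) * indicator \<Omega> x \<partial>lborel) * indicator {0..T} s \<partial>lborel)"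
  proof (rule nn_integral_mono)
    fix s
    show "(\<integral>\<^sup>+x. ennreal (\<bar>\<Phi> (s, x)\<bar> powr q) * indicator S (s, x) \<partial>lborel)
      \<le> (\<integral>\<^sup>+x. ennreal (\<bar>\<Phi> (s, x)\<bar> powr q) * indicator \<Omega> x \<partial>lborel) * indicator {0..T} s"
    proof (cases "s \<in> {0..T}")
      case True
      then have "indicator {0..T} s = (1 :: ennreal)" by simp
      then show ?thesis by (simp only: mult_1_right) (auto simp: S_def indicator_def intro!: nn_integral_mono)
    next
      case False
      then have "indicator S (s, x) = (0 :: ennreal)" for x by (auto simp: S_def indicator_def)
      then show ?thesis by simp
    qed
  qed
  also have "\<dots> = (\<integral>\<^sup>+s. \<integral>\<^sup>+x. ennreal (\<bar>\<Phi> (s, x)\<bar> powr q) \<partial>\<mu> \<partial>lebesgue_on {0..T})"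
    by (subst nn_integral_restrict_space) (auto simp: nn_integral_completion nn_integral_mu[OF Pm])
  also have "\<dots> = (\<integral>\<^sup>+z. ennreal (\<bar>\<Phi> z\<bar> powr q) \<partial>(lebesgue_on {0..T} \<Otimes>\<^sub>M \<mu>))"
    by (subst nn_integral_fst[symmetric]) (use measurable_compose[OF id m] in auto)
  finally have f: "(\<integral>\<^sup>+z. ennreal (\<bar>\<Phi> z\<bar> powr q) * indicator S z \<partial>lborel) < \<infinity>"
    using fin by (rule le_less_trans)
  have "integrable lborel (\<lambda>z. indicator S z *\<^sub>R (\<bar>\<Phi> z\<bar> powr q))"
  proof (rule integrableI_bounded)
    have "ennreal (norm (indicator S z *\<^sub>R (\<bar>\<Phi> z\<bar> powr q))) = ennreal (\<bar>\<Phi> z\<bar> powr q) * indicator S z" for z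
      by (simp add: indicator_def)
    then show "(\<integral>\<^sup>+z. ennreal (norm (indicator S z *\<^sub>R (\<bar>\<Phi> z\<bar> powr q))) \<partial>lborel) < \<infinity>" using f by simp
  qed measurable
  then have "integrable lebesgue (\<lambda>z. indicator S z *\<^sub>R (\<bar>\<Phi> z\<bar> powr q))"
    by (subst integrable_completion) auto
  then have "integrable (lebesgue_on S) (\<lambda>z. \<bar>\<Phi> z\<bar> powr q)"
    using Sl by (subst integrable_restrict_space) auto
  moreover have "\<Phi> \<in> borel_measurable (lebesgue_on S)"
    using \<Phi> by (intro measurable_restrict_space1 measurable_completion) simp
  ultimately have "\<Phi> \<in> Lp_space S q" by (simp add: Lp_space_def)
  moreover have "AE s in lebesgue_on {0<..<T}. AE x in \<mu>. \<Phi> (s, x) = \<phi> s x"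
    by (rule AE_I2) (use eq in auto)
  ultimately show ?thesis unfolding in_Lp_spacetime_def S_def by blast
qed

end

text \<open>The velocity is given slice by slice, each slice up to null sets, so joint measurability
  rests with \<open>W\<close>, which agrees with it at almost every time.\<close>

locale joint_rep = damped_wave +
  fixes T :: real and W :: "real \<times> (real^3) \<Rightarrow> real"
  assumes T: "T > 0" and W_borel: "W \<in> borel_measurable borel"
    and W_int: "integrable lborel (\<lambda>z. \<bar>W z\<bar> powr (m + 1))"
    and W_out: "\<And>s x. s \<notin> {0<..<T} \<or> x \<notin> \<Omega> \<Longrightarrow> W (s, x) = 0"
    and W_eq: "AE s in lborel. s \<in> {0<..<T} \<longrightarrow> (AE x in \<mu>. W (s, x) = v s x)"

lemma (in damped_wave) joint_rep_exists:
  assumes "T > 0"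
  obtains W where "joint_rep \<Omega> A \<omega> p m b1 b2 \<gamma> g u0 u1 u v T W"
proof -
  have "in_Lp_spacetime \<Omega> T (m + 1) v" using weak_sol[OF assms] by (simp add: weak_solution_on_def)
  from in_Lp_spacetimeD[OF this] obtain W where
    "W \<in> borel_measurable borel" "integrable lborel (\<lambda>z. \<bar>W z\<bar> powr (m + 1))"
    "\<forall>s x. s \<notin> {0<..<T} \<or> x \<notin> \<Omega> \<longrightarrow> W (s, x) = 0"
    "AE s in lborel. s \<in> {0<..<T} \<longrightarrow> (AE x in \<mu>. W (s, x) = v s x)" by blast
  then have "joint_rep \<Omega> A \<omega> p m b1 b2 \<gamma> g u0 u1 u v T W"
    using assms by unfold_locales auto
  then show ?thesis by (rule that)
qed

context joint_rep
begin

text \<open>Even in time, to match \<open>vbar\<close>.\<close>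

definition Wb :: "real \<Rightarrow> real^3 \<Rightarrow> real" where "Wb r x = W (\<bar>r\<bar>, x)"

lemma Wb_measurable [measurable (raw)]:
  assumes "f \<in> borel_measurable N" "h \<in> borel_measurable N"
  shows "(\<lambda>z. Wb (f z) (h z)) \<in> borel_measurable N"
  unfolding Wb_def
  by (rule measurable_compose[OF _ W_borel]) (use assms in measurable)

text \<open>\<open>P\<close> may fail to be measurable, so its exceptional set is first enclosed in
  a Borel null set.\<close>

lemma AE_borel_affine':
  assumes "AE r in lborel. P (r :: real)" "c \<noteq> 0"
  shows "AE \<theta> in lborel. P (s + c * \<theta>)"
proof -
  obtain N where N: "N \<in> null_sets lborel" "{r. \<not> P r} \<subseteq> N"
    using assms(1) by (auto simp: eventually_ae_filter)
  have [measurable]: "N \<in> sets borel" using N(1) by (auto simp: null_sets_def)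
  have "AE r in lborel. r \<notin> N" using N(1) by (rule AE_not_in)
  then have "AE \<theta> in lborel. s + c * \<theta> \<notin> N" using assms(2) by (intro AE_borel_affine) auto
  then show ?thesis by eventually_elim (use N(2) in auto)
qed

lemma Wb_eq: "AE r in lborel. \<bar>r\<bar> < T \<longrightarrow> (AE x in \<mu>. Wb r x = vbar r x)"
proof -
  have "AE r in lborel. - r \<in> {0<..<T} \<longrightarrow> (AE x in \<mu>. W (- r, x) = v (- r) x)"
    using AE_borel_affine'[OF W_eq, of "-1" 0] by simp
  moreover have "AE r in lborel. r \<noteq> (0 :: real)" by (rule AE_lborel_singleton)
  ultimately show ?thesis using W_eq
  proof eventually_elim
    case (elim r)
    show ?case
    proof
      assume r: "\<bar>r\<bar> < T"
      consider "r > 0" | "r < 0" using elim(2) by linarith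
      then show "AE x in \<mu>. Wb r x = vbar r x"
        by cases (use elim r in \<open>auto simp: Wb_def vbar_def\<close>)
    qed
  qed
qed

text \<open>An extended real, since the L^(m+1) integral of a time slice may be infinite at
  exceptional times.\<close>

definition J :: "real \<Rightarrow> ennreal" where "J r = (\<integral>\<^sup>+x. ennreal (\<bar>Wb r x\<bar> powr (m + 1)) \<partial>\<mu>)"

lemma mu_sigma_finite: "sigma_finite_measure \<mu>"
  using dom_finite by (simp add: finite_measure.axioms)

lemma id_mu [measurable]: "(\<lambda>x. x) \<in> borel_measurable \<mu>"
  by (rule id_measurable_lebesgue_on)

lemma J_measurable [measurable]: "J \<in> borel_measurable borel"
proof -
  interpret sigma_finite_measure \<mu> by (rule mu_sigma_finite)
  have "(\<lambda>(r, x). ennreal (\<bar>Wb r x\<bar> powr (m + 1))) \<in> borel_measurable (borel \<Otimes>\<^sub>M \<mu>)"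
  proof -
    have 1: "(\<lambda>z. fst z) \<in> borel_measurable (borel \<Otimes>\<^sub>M \<mu>)" by measurable
    have 2: "(\<lambda>z. snd z) \<in> borel_measurable (borel \<Otimes>\<^sub>M \<mu>)"
      by (rule measurable_compose[OF measurable_snd id_mu])
    show ?thesis using Wb_measurable[OF 1 2] unfolding case_prod_unfold by measurable
  qed
  then show ?thesis unfolding J_def[abs_def] by (rule borel_measurable_nn_integral)
qed

text \<open>The even extension in time at most doubles the space-time integral of
  \<open>W\<close>.\<close>

lemma J_finite: "(\<integral>\<^sup>+r. J r \<partial>lborel) < \<infinity>"
proof -
  define j where "j s = (\<integral>\<^sup>+x. ennreal (\<bar>W (s, x)\<bar> powr (m + 1)) \<partial>lborel)" for s
  note [measurable] = W_borel
  have jm [measurable]: "j \<in> borel_measurable borel"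
  proof -
    have "(\<lambda>(s, x). ennreal (\<bar>W (s, x)\<bar> powr (m + 1))) \<in> borel_measurable (borel \<Otimes>\<^sub>M lborel)"
      using W_borel unfolding borel_prod[symmetric] by measurable
    then show ?thesis unfolding j_def[abs_def] by (rule lborel.borel_measurable_nn_integral)
  qed
  have Jj: "J r = j \<bar>r\<bar>" for r
  proof -
    have "(\<lambda>x. ennreal (\<bar>W (\<bar>r\<bar>, x)\<bar> powr (m + 1))) \<in> borel_measurable borel" by measurable
    then have "J r = (\<integral>\<^sup>+x. ennreal (\<bar>W (\<bar>r\<bar>, x)\<bar> powr (m + 1)) * indicator \<Omega> x \<partial>lborel)"
      unfolding J_def Wb_def by (rule nn_integral_mu)
    also have "\<dots> = j \<bar>r\<bar>"
      unfolding j_def by (intro nn_integral_cong) (use W_out m in \<open>auto simp: indicator_def\<close>)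
    finally show ?thesis .
  qed
  have "(\<integral>\<^sup>+s. j s \<partial>lborel) = (\<integral>\<^sup>+z. ennreal (\<bar>W z\<bar> powr (m + 1)) \<partial>(lborel \<Otimes>\<^sub>M lborel))"
    unfolding j_def by (subst lborel.nn_integral_fst[symmetric]) (auto simp: lborel_prod)
  also have "\<dots> = (\<integral>\<^sup>+z. ennreal (\<bar>W z\<bar> powr (m + 1)) \<partial>lborel)" by (simp add: lborel_prod)
  also have "\<dots> < \<infinity>" using W_int by (simp add: integrable_iff_bounded)
  finally have jf: "(\<integral>\<^sup>+s. j s \<partial>lborel) < \<infinity>" .
  have "(\<integral>\<^sup>+r. J r \<partial>lborel) \<le> (\<integral>\<^sup>+r. j r + j (- r) \<partial>lborel)"
    unfolding Jj by (intro nn_integral_mono) (auto simp: abs_if)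
  also have "\<dots> = (\<integral>\<^sup>+r. j r \<partial>lborel) + (\<integral>\<^sup>+r. j (- r) \<partial>lborel)"
    by (rule nn_integral_add) measurable
  also have "(\<integral>\<^sup>+r. j (- r) \<partial>lborel) = (\<integral>\<^sup>+r. j r \<partial>lborel)"
    using nn_integral_real_affine[of j "-1" 0] by simp
  finally show ?thesis using jf by (simp add: le_less_trans)
qed

abbreviation \<nu> :: "real measure" where "\<nu> \<equiv> lebesgue_on {0..1}"

text \<open>The mean velocity between the times \<open>s\<close> and \<open>s + h\<close>: a jointly
  measurable version of the difference quotient of \<open>ubar\<close>, for either sign of
  \<open>h\<close>.\<close>

definition avg :: "real \<Rightarrow> real \<Rightarrow> real^3 \<Rightarrow> real" where
  "avg h s x = (LINT \<theta>|\<nu>. Wb (s + h * \<theta>) x)"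

lemma lebesgue_on_Icc_finite: "finite_measure (lebesgue_on {a..b::real})"
  by (rule finite_measure_lebesgue_on) simp

lemma avg_measurable [measurable (raw)]:
  assumes "h \<in> borel_measurable N" "f \<in> borel_measurable N" "k \<in> borel_measurable N"
  shows "(\<lambda>z. avg (h z) (f z) (k z)) \<in> borel_measurable N"
proof -
  interpret finite_measure \<nu> by (rule lebesgue_on_Icc_finite)
  have id: "snd \<in> borel_measurable (N \<Otimes>\<^sub>M \<nu>)"
    by (rule measurable_compose[OF measurable_snd id_measurable_lebesgue_on])
  have "(\<lambda>z. Wb (f (fst z) + h (fst z) * snd z) (k (fst z))) \<in> borel_measurable (N \<Otimes>\<^sub>M \<nu>)"
    by (intro Wb_measurable borel_measurable_add borel_measurable_times id
        measurable_compose[OF measurable_fst assms(1)] measurable_compose[OF measurable_fst assms(2)]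
        measurable_compose[OF measurable_fst assms(3)])
  then have "(\<lambda>(z, \<theta>). Wb (f z + h z * \<theta>) (k z)) \<in> borel_measurable (N \<Otimes>\<^sub>M \<nu>)"
    by (simp add: case_prod_unfold)
  then show ?thesis unfolding avg_def by (rule borel_measurable_lebesgue_integral)
qed

lemma measure_nu: "measure \<nu> (space \<nu>) = 1"
  by (simp add: measure_restrict_space)

text \<open>Jensen's inequality on the unit interval; an infinite right side makes the claim
  trivial.\<close>

lemma avg_powr_le:
  "ennreal (\<bar>avg h s x\<bar> powr (m + 1)) \<le> (\<integral>\<^sup>+\<theta>. ennreal (\<bar>Wb (s + h * \<theta>) x\<bar> powr (m + 1)) \<partial>\<nu>)"
proof (cases "(\<integral>\<^sup>+\<theta>. ennreal (\<bar>Wb (s + h * \<theta>) x\<bar> powr (m + 1)) \<partial>\<nu>) < \<infinity>")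
  case True
  interpret finite_measure \<nu> by (rule lebesgue_on_Icc_finite)
  have [measurable]: "(\<lambda>x. x) \<in> borel_measurable \<nu>" by (rule id_measurable_lebesgue_on)
  have Wm: "(\<lambda>\<theta>. Wb (s + h * \<theta>) x) \<in> borel_measurable \<nu>" by measurable
  have i: "integrable \<nu> (\<lambda>\<theta>. \<bar>Wb (s + h * \<theta>) x\<bar> powr (m + 1))"
    by (rule integrableI_bounded) (use True Wm in auto)
  have le: "\<bar>y\<bar> \<le> 1 + \<bar>y\<bar> powr (m + 1)" for y :: real
  proof (cases "\<bar>y\<bar> \<le> 1")
    case False
    then have "\<bar>y\<bar> powr 1 \<le> \<bar>y\<bar> powr (m + 1)" using m by (intro powr_mono) auto
    then show ?thesis using False by simp
  qed (simp add: add_increasing2)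
  have i1: "integrable \<nu> (\<lambda>\<theta>. \<bar>Wb (s + h * \<theta>) x\<bar>)"
    by (rule Bochner_Integration.integrable_bound[of _ "\<lambda>\<theta>. 1 + \<bar>Wb (s + h * \<theta>) x\<bar> powr (m + 1)"])
      (use i Wm le in auto)
  have "\<bar>avg h s x\<bar> powr (m + 1) \<le> (LINT \<theta>|\<nu>. \<bar>Wb (s + h * \<theta>) x\<bar>) powr (m + 1)"
    unfolding avg_def using m by (intro powr_mono2 integral_abs_bound) auto
  also have "\<dots> \<le> (LINT \<theta>|\<nu>. \<bar>Wb (s + h * \<theta>) x\<bar> powr (m + 1))"
    using m by (intro jensen_powr i1 i measure_nu lebesgue_on_Icc_finite) auto
  finally have "ennreal (\<bar>avg h s x\<bar> powr (m + 1)) \<le> ennreal (LINT \<theta>|\<nu>. \<bar>Wb (s + h * \<theta>) x\<bar> powr (m + 1))"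
    by (rule ennreal_leI)
  also have "\<dots> = (\<integral>\<^sup>+\<theta>. ennreal (\<bar>Wb (s + h * \<theta>) x\<bar> powr (m + 1)) \<partial>\<nu>)"
    using i by (intro nn_integral_eq_integral[symmetric]) auto
  finally show ?thesis .
next
  case False
  then have "(\<integral>\<^sup>+\<theta>. ennreal (\<bar>Wb (s + h * \<theta>) x\<bar> powr (m + 1)) \<partial>\<nu>) = top"
    by (metis infinity_ennreal_def less_top)
  then show ?thesis by (metis top_greatest)
qed

end


section \<open>Uniform bounds and weak limits of the time averages\<close>

context joint_rep
begin

abbreviation \<pi> :: "real \<Rightarrow> (real \<times> (real^3)) measure" where
  "\<pi> t \<equiv> lebesgue_on {0..t} \<Otimes>\<^sub>M \<mu>"

lemma pi_fst [measurable]: "fst \<in> borel_measurable (\<pi> t)"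
  by (rule measurable_compose[OF measurable_fst id_measurable_lebesgue_on])

lemma pi_snd [measurable]: "snd \<in> borel_measurable (\<pi> t)"
  by (rule measurable_compose[OF measurable_snd id_measurable_lebesgue_on])

lemma pair_sigma_finite_gen:
  "pair_sigma_finite (lebesgue_on {a..b::real}) \<mu>" "pair_sigma_finite (lebesgue_on {a..b::real}) (lebesgue_on {c..d::real})"
proof -
  interpret A: finite_measure "lebesgue_on {a..b}" by (rule lebesgue_on_Icc_finite)
  interpret B: finite_measure "lebesgue_on {c..d}" by (rule lebesgue_on_Icc_finite)
  interpret C: finite_measure \<mu> by (rule dom_finite)
  show "pair_sigma_finite (lebesgue_on {a..b}) \<mu>" "pair_sigma_finite (lebesgue_on {a..b}) (lebesgue_on {c..d})"
    by unfold_locales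
qed

lemma pi_finite: "finite_measure (\<pi> t)"
proof -
  interpret A: finite_measure "lebesgue_on {0..t}" by (rule lebesgue_on_Icc_finite)
  interpret C: finite_measure \<mu> by (rule dom_finite)
  show ?thesis
  proof
    have "emeasure (\<pi> t) (space (\<pi> t)) = emeasure (lebesgue_on {0..t}) (space (lebesgue_on {0..t})) * emeasure \<mu> (space \<mu>)"
      unfolding space_pair_measure by (rule C.emeasure_pair_measure_Times) auto
    also have "\<dots> < top"
    proof -
      have "emeasure (lebesgue_on {0..t}) (space (lebesgue_on {0..t})) < top" "emeasure \<mu> (space \<mu>) < top"
        using A.emeasure_finite C.emeasure_finite by (metis top.not_eq_extremum)+
      then show ?thesis unfolding ennreal_mult_less_top by blast
    qed
    finally show "emeasure (\<pi> t) (space (\<pi> t)) \<noteq> \<infinity>" by simp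
  qed
qed

lemma pi_integral:
  fixes F :: "real \<times> (real^3) \<Rightarrow> real"
  assumes "integrable (\<pi> t) F"
  shows "(LINT z|\<pi> t. F z) = (LINT s|lebesgue_on {0..t}. LINT x|\<mu>. F (s, x))"
    "integrable (lebesgue_on {0..t}) (\<lambda>s. LINT x|\<mu>. F (s, x))"
    "AE s in lebesgue_on {0..t}. integrable \<mu> (\<lambda>x. F (s, x))"
proof -
  interpret pair_sigma_finite "lebesgue_on {0..t}" \<mu> by (rule pair_sigma_finite_gen)
  show "(LINT z|\<pi> t. F z) = (LINT s|lebesgue_on {0..t}. LINT x|\<mu>. F (s, x))" using integral_fst'[OF assms] by simp
  show "integrable (lebesgue_on {0..t}) (\<lambda>s. LINT x|\<mu>. F (s, x))" by (rule integrable_fst'[OF assms])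
  show "AE s in lebesgue_on {0..t}. integrable \<mu> (\<lambda>x. F (s, x))" by (rule AE_integrable_fst'[OF assms])
qed

lemma nn_integral_Icc_le:
  fixes f :: "real \<Rightarrow> ennreal"
  assumes "f \<in> borel_measurable borel"
  shows "(\<integral>\<^sup>+s. f s \<partial>lebesgue_on {a..b}) \<le> (\<integral>\<^sup>+s. f s \<partial>lborel)"
proof -
  have "(\<integral>\<^sup>+s. f s \<partial>lebesgue_on {a..b}) = (\<integral>\<^sup>+s. f s * indicator {a..b} s \<partial>lborel)"
    by (subst nn_integral_restrict_space) (auto simp: nn_integral_completion)
  also have "\<dots> \<le> (\<integral>\<^sup>+s. f s \<partial>lborel)" by (intro nn_integral_mono) (simp add: indicator_def)
  finally show ?thesis .
qed

text \<open>The whole L^(m+1) mass of the extended velocity; it will bound all averages, whatever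
  the step.\<close>

definition JJ :: ennreal where "JJ = (\<integral>\<^sup>+r. J r \<partial>lborel)"

lemma JJ_finite: "JJ < \<infinity>"
  unfolding JJ_def by (rule J_finite)

lemma J_shift: "(\<integral>\<^sup>+s. J (s + c) \<partial>lebesgue_on {a..b}) \<le> JJ"
proof -
  have "(\<integral>\<^sup>+s. J (s + c) \<partial>lebesgue_on {a..b}) \<le> (\<integral>\<^sup>+s. J (s + c) \<partial>lborel)"
    by (rule nn_integral_Icc_le) measurable
  also have "\<dots> = JJ" unfolding JJ_def using nn_integral_real_affine[of J 1 c] by (simp add: add.commute)
  finally show ?thesis .
qed

lemma powr_measurable [measurable (raw)]: "f \<in> borel_measurable N \<Longrightarrow> (\<lambda>z. ennreal (\<bar>f z\<bar> powr c)) \<in> borel_measurable N" for f :: "_ \<Rightarrow> real"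
  by measurable

text \<open>After Jensen's inequality the mean over \<theta> is moved outermost; for fixed \<theta>
  the rest is a shifted integral of \<open>J\<close>. Translation invariance removes
  \<open>h\<close> from the bound, as weak convergence requires.\<close>

lemma avg_Lq: "(\<integral>\<^sup>+z. ennreal (\<bar>avg h (fst z) (snd z)\<bar> powr (m + 1)) \<partial>\<pi> t) \<le> JJ"
proof -
  interpret P: pair_sigma_finite "lebesgue_on {0..t}" \<mu> by (rule pair_sigma_finite_gen)
  interpret Q: pair_sigma_finite \<nu> \<mu> by (rule pair_sigma_finite_gen)
  interpret R: pair_sigma_finite "lebesgue_on {0..t}" \<nu> by (rule pair_sigma_finite_gen)
  interpret N: finite_measure \<nu> by (rule lebesgue_on_Icc_finite)
  have "(\<integral>\<^sup>+z. ennreal (\<bar>avg h (fst z) (snd z)\<bar> powr (m + 1)) \<partial>\<pi> t)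
      = (\<integral>\<^sup>+s. \<integral>\<^sup>+x. ennreal (\<bar>avg h s x\<bar> powr (m + 1)) \<partial>\<mu> \<partial>lebesgue_on {0..t})"
    by (subst P.M2.nn_integral_fst[symmetric]) (auto intro!: powr_measurable avg_measurable pi_fst pi_snd)
  also have "\<dots> \<le> (\<integral>\<^sup>+s. \<integral>\<^sup>+x. \<integral>\<^sup>+\<theta>. ennreal (\<bar>Wb (s + h * \<theta>) x\<bar> powr (m + 1)) \<partial>\<nu> \<partial>\<mu> \<partial>lebesgue_on {0..t})"
    by (intro nn_integral_mono avg_powr_le)
  also have "\<dots> = (\<integral>\<^sup>+s. \<integral>\<^sup>+\<theta>. J (s + h * \<theta>) \<partial>\<nu> \<partial>lebesgue_on {0..t})"
  proof (rule nn_integral_cong)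
    fix s
    have 1: "fst \<in> borel_measurable (\<nu> \<Otimes>\<^sub>M \<mu>)" "snd \<in> borel_measurable (\<nu> \<Otimes>\<^sub>M \<mu>)"
      by (rule measurable_compose[OF measurable_fst id_measurable_lebesgue_on] measurable_compose[OF measurable_snd id_measurable_lebesgue_on])+
    have 2: "(\<lambda>(\<theta>, x). ennreal (\<bar>Wb (s + h * \<theta>) x\<bar> powr (m + 1))) \<in> borel_measurable (\<nu> \<Otimes>\<^sub>M \<mu>)"
      unfolding case_prod_unfold by (intro powr_measurable Wb_measurable borel_measurable_add borel_measurable_times 1) auto
    show "(\<integral>\<^sup>+x. \<integral>\<^sup>+\<theta>. ennreal (\<bar>Wb (s + h * \<theta>) x\<bar> powr (m + 1)) \<partial>\<nu> \<partial>\<mu>) = (\<integral>\<^sup>+\<theta>. J (s + h * \<theta>) \<partial>\<nu>)"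
      unfolding J_def by (rule Q.Fubini'[OF 2])
  qed
  also have "\<dots> = (\<integral>\<^sup>+\<theta>. \<integral>\<^sup>+s. J (s + h * \<theta>) \<partial>lebesgue_on {0..t} \<partial>\<nu>)"
  proof (rule R.Fubini'[symmetric])
    have "fst \<in> borel_measurable (lebesgue_on {0..t} \<Otimes>\<^sub>M \<nu>)" "snd \<in> borel_measurable (lebesgue_on {0..t} \<Otimes>\<^sub>M \<nu>)"
      by (rule measurable_compose[OF measurable_fst id_measurable_lebesgue_on] measurable_compose[OF measurable_snd id_measurable_lebesgue_on])+
    then show "(\<lambda>(s, \<theta>). J (s + h * \<theta>)) \<in> borel_measurable (lebesgue_on {0..t} \<Otimes>\<^sub>M \<nu>)"
      unfolding case_prod_unfold by (intro measurable_compose[OF _ J_measurable] borel_measurable_add borel_measurable_times) auto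
  qed
  also have "\<dots> \<le> (\<integral>\<^sup>+\<theta>. JJ \<partial>\<nu>)" by (intro nn_integral_mono J_shift)
  also have "\<dots> = JJ" using measure_nu N.emeasure_eq_measure[of "space \<nu>"] by simp
  finally show ?thesis .
qed

lemma Wb_Lq: "(\<integral>\<^sup>+z. ennreal (\<bar>Wb (fst z) (snd z)\<bar> powr (m + 1)) \<partial>\<pi> t) \<le> JJ"
proof -
  interpret P: pair_sigma_finite "lebesgue_on {0..t}" \<mu> by (rule pair_sigma_finite_gen)
  have "(\<integral>\<^sup>+z. ennreal (\<bar>Wb (fst z) (snd z)\<bar> powr (m + 1)) \<partial>\<pi> t) = (\<integral>\<^sup>+s. J (s + 0) \<partial>lebesgue_on {0..t})"
    unfolding J_def by (subst P.M2.nn_integral_fst[symmetric]) (auto intro!: powr_measurable Wb_measurable pi_fst pi_snd)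
  then show ?thesis using J_shift[where c=0 and a=0 and b=t] by simp
qed

text \<open>On a finite measure space L^(m+1) is contained in L^1, by
  \<open>\<bar>y\<bar> \<le> 1 + \<bar>y\<bar> powr (m + 1)\<close>.\<close>

lemma powr_Lq_integrable:
  fixes f :: "'z \<Rightarrow> real"
  assumes M: "finite_measure M" and f: "f \<in> borel_measurable M"
    and fin: "(\<integral>\<^sup>+z. ennreal (\<bar>f z\<bar> powr (m + 1)) \<partial>M) \<le> JJ"
  shows "integrable M f" "integrable M (\<lambda>z. \<bar>f z\<bar> powr (m + 1))" "(LINT z|M. \<bar>f z\<bar> powr (m + 1)) \<le> enn2real JJ"
proof -
  interpret finite_measure M by (rule M)
  show i: "integrable M (\<lambda>z. \<bar>f z\<bar> powr (m + 1))"
    by (rule integrableI_bounded) (use f fin JJ_finite in \<open>auto simp: le_less_trans\<close>)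
  have le: "\<bar>y\<bar> \<le> 1 + \<bar>y\<bar> powr (m + 1)" for y :: real
  proof (cases "\<bar>y\<bar> \<le> 1")
    case False
    then have "\<bar>y\<bar> powr 1 \<le> \<bar>y\<bar> powr (m + 1)" using m by (intro powr_mono) auto
    then show ?thesis using False by simp
  qed (simp add: add_increasing2)
  show "integrable M f"
    by (rule Bochner_Integration.integrable_bound[of _ "\<lambda>z. 1 + \<bar>f z\<bar> powr (m + 1)"]) (use i f le in auto)
  have "ennreal (LINT z|M. \<bar>f z\<bar> powr (m + 1)) \<le> JJ"
    using fin i by (subst (asm) nn_integral_eq_integral) auto
  also have "JJ = ennreal (enn2real JJ)" using JJ_finite by simp
  finally show "(LINT z|M. \<bar>f z\<bar> powr (m + 1)) \<le> enn2real JJ"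
    by (subst (asm) ennreal_le_iff) auto
qed

lemma avg_pi_measurable: "(\<lambda>z. avg h (fst z) (snd z)) \<in> borel_measurable (\<pi> t)"
  by (intro avg_measurable pi_fst pi_snd) simp

lemma Wb_pi_measurable: "(\<lambda>z. Wb (fst z) (snd z)) \<in> borel_measurable (\<pi> t)"
  by (intro Wb_measurable pi_fst pi_snd)

text \<open>Substitution along the segment from \<open>s\<close> to \<open>s + h\<close> bounds the
  mean of \<open>J\<close> by \<open>JJ\<close> divided by |h|. Hence the claim holds at every time
  \<open>s\<close>, not only at almost every one.\<close>

lemma Wb_line_integrable:
  assumes h: "h \<noteq> 0"
  shows "integrable (\<nu> \<Otimes>\<^sub>M \<mu>) (\<lambda>z. Wb (s + h * fst z) (snd z))"
proof (rule integrableI_bounded)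
  interpret Q: pair_sigma_finite \<nu> \<mu> by (rule pair_sigma_finite_gen)
  interpret C: finite_measure \<mu> by (rule dom_finite)
  interpret N: finite_measure \<nu> by (rule lebesgue_on_Icc_finite)
  have 1: "fst \<in> borel_measurable (\<nu> \<Otimes>\<^sub>M \<mu>)" "snd \<in> borel_measurable (\<nu> \<Otimes>\<^sub>M \<mu>)"
    by (rule measurable_compose[OF measurable_fst id_measurable_lebesgue_on] measurable_compose[OF measurable_snd id_measurable_lebesgue_on])+
  show meas: "(\<lambda>z. Wb (s + h * fst z) (snd z)) \<in> borel_measurable (\<nu> \<Otimes>\<^sub>M \<mu>)"
    by (intro Wb_measurable borel_measurable_add borel_measurable_times 1) auto
  have le: "ennreal \<bar>y\<bar> \<le> 1 + ennreal (\<bar>y\<bar> powr (m + 1))" for y :: real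
  proof -
    have "\<bar>y\<bar> \<le> 1 + \<bar>y\<bar> powr (m + 1)"
    proof (cases "\<bar>y\<bar> \<le> 1")
      case False
      then have "\<bar>y\<bar> powr 1 \<le> \<bar>y\<bar> powr (m + 1)" using m by (intro powr_mono) auto
      then show ?thesis using False by simp
    qed (simp add: add_increasing2)
    then have "ennreal \<bar>y\<bar> \<le> ennreal (1 + \<bar>y\<bar> powr (m + 1))" by (rule ennreal_leI)
    then show ?thesis by (simp add: ennreal_plus)
  qed
  have Jm: "(\<lambda>\<theta>. J (s + h * \<theta>)) \<in> borel_measurable borel" by measurable
  have "(\<integral>\<^sup>+z. ennreal (norm (Wb (s + h * fst z) (snd z))) \<partial>(\<nu> \<Otimes>\<^sub>M \<mu>))
      \<le> (\<integral>\<^sup>+z. 1 + ennreal (\<bar>Wb (s + h * fst z) (snd z)\<bar> powr (m + 1)) \<partial>(\<nu> \<Otimes>\<^sub>M \<mu>))"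
    using le by (intro nn_integral_mono) simp
  also have "\<dots> = emeasure (\<nu> \<Otimes>\<^sub>M \<mu>) (space (\<nu> \<Otimes>\<^sub>M \<mu>)) + (\<integral>\<^sup>+z. ennreal (\<bar>Wb (s + h * fst z) (snd z)\<bar> powr (m + 1)) \<partial>(\<nu> \<Otimes>\<^sub>M \<mu>))"
    using meas by (subst nn_integral_add) auto
  also have "(\<integral>\<^sup>+z. ennreal (\<bar>Wb (s + h * fst z) (snd z)\<bar> powr (m + 1)) \<partial>(\<nu> \<Otimes>\<^sub>M \<mu>)) = (\<integral>\<^sup>+\<theta>. J (s + h * \<theta>) \<partial>\<nu>)"
    unfolding J_def by (subst Q.M2.nn_integral_fst[symmetric]) (use powr_measurable[OF meas] in auto)
  also have "(\<integral>\<^sup>+\<theta>. J (s + h * \<theta>) \<partial>\<nu>) \<le> (\<integral>\<^sup>+\<theta>. J (s + h * \<theta>) \<partial>lborel)"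
    by (rule nn_integral_Icc_le[OF Jm])
  finally have "(\<integral>\<^sup>+z. ennreal (norm (Wb (s + h * fst z) (snd z))) \<partial>(\<nu> \<Otimes>\<^sub>M \<mu>))
     \<le> emeasure (\<nu> \<Otimes>\<^sub>M \<mu>) (space (\<nu> \<Otimes>\<^sub>M \<mu>)) + (\<integral>\<^sup>+\<theta>. J (s + h * \<theta>) \<partial>lborel)"
    by (simp add: add_left_mono)
  also have "\<dots> < \<infinity>"
  proof -
    have "JJ = ennreal \<bar>h\<bar> * (\<integral>\<^sup>+\<theta>. J (s + h * \<theta>) \<partial>lborel)"
      unfolding JJ_def by (rule nn_integral_real_affine[OF J_measurable h])
    then have "(\<integral>\<^sup>+\<theta>. J (s + h * \<theta>) \<partial>lborel) < \<infinity>"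
      using JJ_finite h by (auto simp: ennreal_mult_less_top)
    moreover have "emeasure (\<nu> \<Otimes>\<^sub>M \<mu>) (space (\<nu> \<Otimes>\<^sub>M \<mu>)) < \<infinity>"
      using finite_measure.emeasure_finite[OF pi_finite[of 1], of "space (\<pi> 1)"] by (simp add: less_top)
    ultimately show ?thesis by simp
  qed
  finally show "(\<integral>\<^sup>+z. ennreal (norm (Wb (s + h * fst z) (snd z))) \<partial>(\<nu> \<Otimes>\<^sub>M \<mu>)) < \<infinity>" .
qed

text \<open>Both sides have the same inner product with every bounded function, in particular with the sign of
  their difference.\<close>

lemma avg_eq:
  assumes h: "h \<noteq> 0" and sh: "\<bar>s\<bar> + \<bar>h\<bar> < T"
  shows "AE x in \<mu>. avg h s x = (ubar (s + h) x - ubar s x) / h"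
proof -
  interpret Q: pair_sigma_finite \<nu> \<mu> by (rule pair_sigma_finite_gen)
  interpret C: finite_measure \<mu> by (rule dom_finite)
  let ?D = "\<lambda>x. (ubar (s + h) x - ubar s x) / h"
  have Dsq: "sq_int \<mu> ?D" by (rule quotient_sq_int)
  have Dm: "?D \<in> borel_measurable \<mu>" using Dsq by (rule sq_int_measurable)
  have am: "avg h s \<in> borel_measurable \<mu>" by (intro avg_measurable[of "\<lambda>_. h" _ "\<lambda>_. s" "\<lambda>x. x", simplified] id_mu)
  note Wi = Wb_line_integrable[OF h, of s]
  define y where "y x = sgn (?D x - avg h s x)" for x
  have ym: "y \<in> borel_measurable \<mu>" unfolding y_def using Dm am by measurable
  have yb: "\<bar>y x\<bar> \<le> 1" for x by (simp add: y_def sgn_if)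
  have ysq: "sq_int \<mu> y"
    unfolding sq_int_def
  proof
    show "integrable \<mu> (\<lambda>x. (norm (y x))\<^sup>2)"
      by (rule C.integrable_const_bound[of _ 1]) (use ym yb in \<open>auto simp: abs_square_le_1\<close>)
  qed (rule ym)
  have yW: "integrable (\<nu> \<Otimes>\<^sub>M \<mu>) (\<lambda>z. Wb (s + h * fst z) (snd z) * y (snd z))"
  proof (rule Bochner_Integration.integrable_bound[OF Wi])
    show "(\<lambda>z. Wb (s + h * fst z) (snd z) * y (snd z)) \<in> borel_measurable (\<nu> \<Otimes>\<^sub>M \<mu>)"
      using borel_measurable_integrable[OF Wi] measurable_compose[OF measurable_snd ym] by (rule borel_measurable_times)
    have "\<bar>w * y x\<bar> \<le> \<bar>w\<bar>" for w x using mult_left_mono[OF yb[of x], of "\<bar>w\<bar>"] by (simp add: abs_mult)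
    then show "AE z in \<nu> \<Otimes>\<^sub>M \<mu>. norm (Wb (s + h * fst z) (snd z) * y (snd z)) \<le> norm (Wb (s + h * fst z) (snd z))"
      by simp
  qed
  have "ip \<mu> ?D y = (1 / h) * ip \<mu> (\<lambda>x. ubar (s + h) x - ubar s x) y"
    using ip_scaleR_left[of \<mu> "1 / h" "\<lambda>x. ubar (s + h) x - ubar s x" y] by simp
  also have "\<dots> = (LINT \<theta>|\<nu>. ip \<mu> (vbar (s + h * \<theta>)) y)"
    unfolding ip_ubar_FTC[OF ysq] using h by simp
  also have "\<dots> = (LINT \<theta>|\<nu>. LINT x|\<mu>. Wb (s + h * \<theta>) x * y x)"
  proof (rule integral_cong_AE)
    show "(\<lambda>\<theta>. ip \<mu> (vbar (s + h * \<theta>)) y) \<in> borel_measurable \<nu>"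
      by (intro borel_measurable_integrable continuous_imp_integrable_real continuous_on_compose2[OF ip_vbar_continuous[OF ysq]] continuous_intros) auto
    show "(\<lambda>\<theta>. LINT x|\<mu>. Wb (s + h * \<theta>) x * y x) \<in> borel_measurable \<nu>"
      using borel_measurable_integrable[OF Q.integrable_fst'[OF yW]] by simp
    \<comment> \<open>As \<open>\<bar>s\<bar> + \<bar>h\<bar> < T\<close>, the segment stays where
      \<open>Wb\<close> represents \<open>vbar\<close>, and exceptional times correspond to a null
      set of \<theta>.\<close>
    have "AE \<theta> in lborel. \<bar>s + h * \<theta>\<bar> < T \<longrightarrow> (AE x in \<mu>. Wb (s + h * \<theta>) x = vbar (s + h * \<theta>) x)"
      using AE_borel_affine'[OF Wb_eq h] .
    then have "AE \<theta> in lborel. \<theta> \<in> {0..1} \<longrightarrow> ip \<mu> (vbar (s + h * \<theta>)) y = (LINT x|\<mu>. Wb (s + h * \<theta>) x * y x)"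
    proof eventually_elim
      case (elim \<theta>)
      show ?case
      proof
        assume "\<theta> \<in> {0..1}"
        then have "\<bar>h * \<theta>\<bar> \<le> \<bar>h\<bar>" by (simp add: abs_mult mult_left_le)
        then have "\<bar>s + h * \<theta>\<bar> < T" using sh by linarith
        then have e: "AE x in \<mu>. Wb (s + h * \<theta>) x = vbar (s + h * \<theta>) x" using elim by blast
        have wm: "(\<lambda>x. Wb (s + h * \<theta>) x) \<in> borel_measurable \<mu>" by (intro Wb_measurable id_mu) simp
        show "ip \<mu> (vbar (s + h * \<theta>)) y = (LINT x|\<mu>. Wb (s + h * \<theta>) x * y x)"
          unfolding ip_def inner_real_def
        proof (rule integral_cong_AE)
          show "AE x in \<mu>. vbar (s + h * \<theta>) x * y x = Wb (s + h * \<theta>) x * y x"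
            using e by eventually_elim simp
        qed (use wm ym sq_int_measurable[OF vbar_sq_int] in auto)
      qed
    qed
    then show "AE \<theta> in \<nu>. ip \<mu> (vbar (s + h * \<theta>)) y = (LINT x|\<mu>. Wb (s + h * \<theta>) x * y x)"
      by (simp add: AE_restrict_space_iff AE_completion_iff)
  qed
  also have "\<dots> = (LINT x|\<mu>. LINT \<theta>|\<nu>. Wb (s + h * \<theta>) x * y x)"
    using Q.Fubini_integral[of "\<lambda>\<theta> x. Wb (s + h * \<theta>) x * y x"] yW by (simp add: case_prod_unfold)
  also have "\<dots> = (LINT x|\<mu>. avg h s x * y x)"
    by (simp add: avg_def)
  finally have eq: "(LINT x|\<mu>. ?D x * y x) = (LINT x|\<mu>. avg h s x * y x)" by (simp add: ip_def)
  have ai: "integrable \<mu> (\<lambda>x. avg h s x * y x)"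
    using Q.integrable_snd[of "\<lambda>\<theta> x. Wb (s + h * \<theta>) x * y x"] yW by (simp add: case_prod_unfold avg_def)
  have Di: "integrable \<mu> (\<lambda>x. ?D x * y x)" using sq_int_inner[OF Dsq ysq] by simp
  have eq': "?D x * y x - avg h s x * y x = \<bar>?D x - avg h s x\<bar>" for x
    by (simp add: y_def abs_sgn left_diff_distrib[symmetric] mult.commute del: times_divide_eq_left)
  have "(LINT x|\<mu>. \<bar>?D x - avg h s x\<bar>) = 0"
    using eq Bochner_Integration.integral_diff[OF Di ai] unfolding eq' by simp
  moreover have "integrable \<mu> (\<lambda>x. \<bar>?D x - avg h s x\<bar>)"
    using Bochner_Integration.integrable_diff[OF Di ai] unfolding eq' .
  ultimately have "AE x in \<mu>. \<bar>?D x - avg h s x\<bar> = 0"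
    by (subst (asm) integral_nonneg_eq_0_iff_AE) auto
  then show ?thesis by eventually_elim simp
qed

text \<open>At almost every time the L^1 distance in space is at most a constant times the L^2 error
  of the difference quotient, which tends to zero; a bound for the velocity dominates it in
  time.\<close>

lemma avg_L1_limit:
  assumes t: "0 \<le> t" "t < T"
  shows "((\<lambda>h. LINT z|\<pi> t. \<bar>avg h (fst z) (snd z) - Wb (fst z) (snd z)\<bar>) \<longlongrightarrow> 0) (at 0)"
  unfolding tendsto_at_iff_sequentially o_def
proof (intro allI impI)
  fix X :: "nat \<Rightarrow> real" assume X: "\<forall>i. X i \<in> UNIV - {0}" "X \<longlonglongrightarrow> 0"
  interpret C: finite_measure \<mu> by (rule dom_finite)
  interpret S: finite_measure "lebesgue_on {0..t}" by (rule lebesgue_on_Icc_finite)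
  \<comment> \<open>The norm of the constant 1, which passes from L^2 to L^1 by
    Cauchy-Schwarz.\<close>
  define c where "c = nrm \<mu> (\<lambda>x. 1 :: real)"
  have c0: "c \<ge> 0" by (simp add: c_def)
  obtain V where V: "V \<ge> 0" "\<And>r. \<bar>r\<bar> \<le> T \<Longrightarrow> nrm \<mu> (vbar r) \<le> V" using vbar_bound[of T] by blast
  define k where "k h s = (LINT x|\<mu>. \<bar>avg h s x - Wb s x\<bar>)" for h s
  have i: "integrable (\<pi> t) (\<lambda>z. \<bar>avg h (fst z) (snd z) - Wb (fst z) (snd z)\<bar>)" for h
    using powr_Lq_integrable(1)[OF pi_finite avg_pi_measurable avg_Lq] powr_Lq_integrable(1)[OF pi_finite Wb_pi_measurable Wb_Lq]
    by simp
  have I: "(LINT z|\<pi> t. \<bar>avg h (fst z) (snd z) - Wb (fst z) (snd z)\<bar>) = (LINT s|lebesgue_on {0..t}. k h s)" for h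
    unfolding k_def using pi_integral(1)[OF i] by simp
  have ki: "integrable (lebesgue_on {0..t}) (k h)" for h
    unfolding k_def[abs_def] using pi_integral(2)[OF i] by simp
  have "AE s in lborel. \<bar>s\<bar> < T \<longrightarrow> (AE x in \<mu>. Wb s x = vbar s x)" by (rule Wb_eq)
  then have WA: "AE s in lebesgue_on {0..t}. AE x in \<mu>. Wb s x = vbar s x"
    using t by (simp add: AE_restrict_space_iff AE_completion_iff) (auto elim!: eventually_mono)
  have kle: "k h s \<le> c * nrm \<mu> (\<lambda>x. (ubar (s + h) x - ubar s x) / h - vbar s x)"
    if s: "s \<in> {0..t}" "AE x in \<mu>. Wb s x = vbar s x" and h: "h \<noteq> 0" "\<bar>h\<bar> < T - t" for h s
  proof -
    let ?E = "\<lambda>x. (ubar (s + h) x - ubar s x) / h - vbar s x"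
    have E: "sq_int \<mu> ?E" by (intro sq_int_diff quotient_sq_int vbar_sq_int)
    have Ea: "sq_int \<mu> (\<lambda>x. \<bar>?E x\<bar>)" using E by (auto simp: sq_int_def)
    have one: "sq_int \<mu> (\<lambda>x. 1 :: real)" by (simp add: sq_int_def)
    have "AE x in \<mu>. avg h s x = (ubar (s + h) x - ubar s x) / h"
      by (rule avg_eq[OF h(1)]) (use s(1) h(2) in auto)
    then have "AE x in \<mu>. \<bar>avg h s x - Wb s x\<bar> = \<bar>?E x\<bar>" using s(2) by eventually_elim simp
    moreover have "(\<lambda>x. \<bar>avg h s x - Wb s x\<bar>) \<in> borel_measurable \<mu>"
      using avg_measurable[of "\<lambda>_. h" \<mu> "\<lambda>_. s" "\<lambda>x. x"] Wb_measurable[of "\<lambda>_. s" \<mu> "\<lambda>x. x"] by simp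
    ultimately have "k h s = (LINT x|\<mu>. \<bar>?E x\<bar>)"
      unfolding k_def using sq_int_measurable[OF Ea] by (intro integral_cong_AE) auto
    also have "\<dots> = ip \<mu> (\<lambda>x. 1) (\<lambda>x. \<bar>?E x\<bar>)" by (simp add: ip_def)
    also have "\<dots> \<le> c * nrm \<mu> (\<lambda>x. \<bar>?E x\<bar>)" using ip_CS[OF one Ea] by (simp add: c_def)
    also have "nrm \<mu> (\<lambda>x. \<bar>?E x\<bar>) = nrm \<mu> ?E" by (simp add: nrm_def)
    finally show ?thesis .
  qed
  have ev: "\<forall>\<^sub>F n in sequentially. \<bar>X n\<bar> < T - t"
    using order_tendstoD(2)[OF tendsto_rabs_zero[OF X(2)], of "T - t"] t by simp
  \<comment> \<open>Beyond \<open>N\<close> the shifted times stay below \<open>T\<close>, so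
    averages and difference quotients agree for every remaining index.\<close>
  then obtain N where N: "\<And>n. n \<ge> N \<Longrightarrow> \<bar>X n\<bar> < T - t" by (auto simp: eventually_sequentially)
  have "(\<lambda>n. LINT s|lebesgue_on {0..t}. k (X (n + N)) s) \<longlonglongrightarrow> (LINT s|lebesgue_on {0..t}. 0)"
  proof (rule integral_dominated_convergence)
    show "integrable (lebesgue_on {0..t}) (\<lambda>s. c * (2 * V))" by simp
    show "(\<lambda>s. 0) \<in> borel_measurable (lebesgue_on {0..t})" by simp
    show "k (X (n + N)) \<in> borel_measurable (lebesgue_on {0..t})" for n
      using ki by (rule borel_measurable_integrable)
    have Xn: "X n \<noteq> 0" for n using X(1) by auto
    show "AE s in lebesgue_on {0..t}. (\<lambda>n. k (X (n + N)) s) \<longlonglongrightarrow> 0"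
      using WA AE_space
    proof eventually_elim
      case (elim s)
      then have s: "s \<in> {0..t}" by simp
      have "((\<lambda>r. nrm \<mu> (\<lambda>x. (ubar r x - ubar s x) / (r - s) - vbar s x)) \<longlongrightarrow> 0) (at s)" by (rule ubar_deriv)
      moreover have "filterlim (\<lambda>n. s + X (n + N)) (at s) sequentially"
        unfolding filterlim_at
      proof
        have "(\<lambda>n. s + X (n + N)) \<longlonglongrightarrow> s + 0"
          by (intro tendsto_intros LIMSEQ_ignore_initial_segment X(2))
        then show "(\<lambda>n. s + X (n + N)) \<longlonglongrightarrow> s" by simp
        show "\<forall>\<^sub>F x in sequentially. s + X (x + N) \<in> UNIV \<and> s + X (x + N) \<noteq> s"
          using Xn by simp
      qed
      ultimately have "(\<lambda>n. nrm \<mu> (\<lambda>x. (ubar (s + X (n + N)) x - ubar s x) / (s + X (n + N) - s) - vbar s x)) \<longlonglongrightarrow> 0"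
        by (rule filterlim_compose)
      then have l: "(\<lambda>n. c * nrm \<mu> (\<lambda>x. (ubar (s + X (n + N)) x - ubar s x) / X (n + N) - vbar s x)) \<longlonglongrightarrow> 0"
        using tendsto_mult_right_zero by simp
      show ?case
      proof (rule Lim_null_comparison[OF _ l], intro always_eventually allI)
        fix n
        have "0 \<le> k (X (n + N)) s" unfolding k_def by (intro integral_nonneg_AE) auto
        then show "norm (k (X (n + N)) s) \<le> c * nrm \<mu> (\<lambda>x. (ubar (s + X (n + N)) x - ubar s x) / X (n + N) - vbar s x)"
          using kle[OF s elim(1) Xn N, of "n + N"] by simp
      qed
    qed
    show "AE s in lebesgue_on {0..t}. norm (k (X (n + N)) s) \<le> c * (2 * V)" for n
      using WA AE_space
    proof eventually_elim
      case (elim s)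
      then have s: "s \<in> {0..t}" by simp
      let ?h = "X (n + N)"
      have h: "\<bar>s\<bar> + \<bar>?h\<bar> \<le> T" using N[of "n + N"] s by auto
      have "nrm \<mu> (\<lambda>x. (ubar (s + ?h) x - ubar s x) / ?h - vbar s x)
          \<le> nrm \<mu> (\<lambda>x. (ubar (s + ?h) x - ubar s x) / ?h) + nrm \<mu> (vbar s)"
        by (intro nrm_diff quotient_sq_int vbar_sq_int)
      also have "\<dots> \<le> V + V"
        by (intro add_mono quotient_bound[OF V(2) h Xn] V(2)) (use h in auto)
      finally have "c * nrm \<mu> (\<lambda>x. (ubar (s + ?h) x - ubar s x) / ?h - vbar s x) \<le> c * (2 * V)"
        using c0 by (intro mult_left_mono) auto
      moreover have "0 \<le> k ?h s" unfolding k_def by (intro integral_nonneg_AE) auto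
      ultimately show ?case using kle[OF s elim(1) Xn N, of "n + N"] by simp
    qed
  qed
  then have "(\<lambda>n. LINT s|lebesgue_on {0..t}. k (X (n + N)) s) \<longlonglongrightarrow> 0" by simp
  then have "(\<lambda>n. LINT s|lebesgue_on {0..t}. k (X n) s) \<longlonglongrightarrow> 0"
    by (rule LIMSEQ_offset)
  then show "(\<lambda>n. LINT z|\<pi> t. \<bar>avg (X n) (fst z) (snd z) - Wb (fst z) (snd z)\<bar>) \<longlonglongrightarrow> 0"
    unfolding I .
qed

text \<open>\<open>K\<close> has the exponent (m+1)/m dual to m+1; it will be the damping or the
  source.\<close>

lemma avg_weak_limit:
  assumes t: "0 \<le> t" "t < T"
    and K: "K \<in> borel_measurable (\<pi> t)" "integrable (\<pi> t) (\<lambda>z. \<bar>K z\<bar> powr ((m + 1) / m))"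
  shows "((\<lambda>h. LINT z|\<pi> t. K z * avg h (fst z) (snd z)) \<longlongrightarrow> (LINT z|\<pi> t. K z * Wb (fst z) (snd z))) (at 0)"
    "integrable (\<pi> t) (\<lambda>z. K z * Wb (fst z) (snd z))"
    "integrable (\<pi> t) (\<lambda>z. K z * avg h (fst z) (snd z))"
proof -
  have q: "m + 1 > 1" "(m + 1) / m > 1" "1 / (m + 1) + 1 / ((m + 1) / m) = 1"
    using m by (auto simp: field_simps)
  note a = avg_pi_measurable powr_Lq_integrable[OF pi_finite avg_pi_measurable avg_Lq]
  note w = Wb_pi_measurable powr_Lq_integrable[OF pi_finite Wb_pi_measurable Wb_Lq]
  have ev: "\<forall>\<^sub>F h in F. (\<lambda>z. avg h (fst z) (snd z)) \<in> borel_measurable (\<pi> t) \<and> integrable (\<pi> t) (\<lambda>z. avg h (fst z) (snd z)) \<and>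
        integrable (\<pi> t) (\<lambda>z. \<bar>avg h (fst z) (snd z)\<bar> powr (m + 1)) \<and> (LINT z|\<pi> t. \<bar>avg h (fst z) (snd z)\<bar> powr (m + 1)) \<le> enn2real JJ" for F
    using a by (intro always_eventually) auto
  note wc = weak_convergence[OF q ev w K]
  show "((\<lambda>h. LINT z|\<pi> t. K z * avg h (fst z) (snd z)) \<longlongrightarrow> (LINT z|\<pi> t. K z * Wb (fst z) (snd z))) (at 0)"
    by (rule wc(1)[OF avg_L1_limit[OF t]])
  show "integrable (\<pi> t) (\<lambda>z. K z * Wb (fst z) (snd z))"
    by (rule wc(2)[OF avg_L1_limit[OF t]])
  \<comment> \<open>Integrability is wanted at each single \<open>h\<close>; the constant family
    consisting of this one average meets the hypotheses of \<open>weak_convergence\<close>.\<close>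
  have "((\<lambda>h'. LINT x|\<pi> t. \<bar>avg h (fst x) (snd x) - avg h (fst x) (snd x)\<bar>) \<longlongrightarrow> 0) (at (0::real))" by simp
  then show "integrable (\<pi> t) (\<lambda>z. K z * avg h (fst z) (snd z))"
    using weak_convergence(2)[OF q, of "\<lambda>_. \<lambda>z. avg h (fst z) (snd z)" "\<pi> t" "enn2real JJ" "at (0::real)" "\<lambda>z. avg h (fst z) (snd z)" K]
      a K by simp
qed

end


section \<open>The energy identity\<close>

lemma symmetric_difference_quotient:
  fixes f :: "real \<Rightarrow> real"
  assumes "(f has_real_derivative d) (at t)"
  shows "((\<lambda>h. (f (t + h) - f (t - h)) / (2 * h)) \<longlongrightarrow> d) (at 0)"
proof -
  have 1: "((\<lambda>h. (f (t + h) - f t) / h) \<longlongrightarrow> d) (at 0)" using assms by (simp add: DERIV_def)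
  moreover have "filterlim uminus (at 0) (at (0::real))"
    unfolding filterlim_at by (auto intro!: tendsto_eq_intros simp: eventually_at_filter)
  ultimately have 2: "((\<lambda>h. (f (t + - h) - f t) / (- h)) \<longlongrightarrow> d) (at 0)" by (rule filterlim_compose)
  have "((\<lambda>h. ((f (t + h) - f t) / h + (f (t + - h) - f t) / (- h)) / 2) \<longlongrightarrow> (d + d) / 2) (at 0)"
    by (intro tendsto_intros 1 2) simp
  moreover have "((f (t + h) - f t) / h + (f (t + - h) - f t) / (- h)) / 2 = (f (t + h) - f (t - h)) / (2 * h)" for h
    by (cases "h = 0") (simp_all add: field_simps)
  moreover have "(d + d) / 2 = d" by simp
  ultimately show ?thesis by (simp only:)
qed

text \<open>The identity survives \<open>d = 0\<close>, where division yields zero, so it holds at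
  the base point as well.\<close>

lemma difference_quotient_split:
  fixes c d :: real
  assumes "c \<noteq> 0"
  shows "((P - Q) / c - (R - S) / c) / d - (X - Y) / c = (1 / c) * ((P - R) / d - X) + (- 1 / c) * ((Q - S) / d - Y)"
  using assms by (cases "d = 0") (simp_all add: field_simps)

lemma integral_cong_AE_lebesgue_on:
  fixes f g :: "'a::euclidean_space \<Rightarrow> real"
  assumes "S \<in> sets lebesgue" "f \<in> borel_measurable (lebesgue_on S)" "AE x in lebesgue_on S. f x = g x"
  shows "(LINT x|lebesgue_on S. f x) = (LINT x|lebesgue_on S. g x)"
  by (rule integral_cong_AE[OF assms(2) lebesgue_on_measurable_AE[OF assms] assms(3)])

section \<open>Central differences as admissible test functions\<close>

context elliptic_domain
begin

lemma H01_cont_shift: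
  assumes "H01_cont w" shows "H01_cont (\<lambda>s. w (s + c))"
  unfolding H01_cont_def
proof (intro allI conjI)
  fix t
  have "filterlim (\<lambda>s. s + c) (at (t + c)) (at t)"
    unfolding filterlim_at by (auto intro!: tendsto_intros simp: eventually_at_filter)
  from filterlim_compose[OF H01_contD(3)[OF assms] this]
  show "((\<lambda>s. H1_norm \<Omega> (\<lambda>x. w (s + c) x - w (t + c) x)) \<longlongrightarrow> 0) (at t)" .
qed (rule H01_contD(1)[OF assms])

lemma H01_cont_lin:
  assumes "H01_cont w" "H01_cont z" shows "H01_cont (\<lambda>s x. a * w s x + b * z s x)"
  unfolding H01_cont_def
proof (intro allI conjI)
  fix t
  show "(\<lambda>x. a * w t x + b * z t x) \<in> H01 \<Omega>" by (intro H01_lin open_dom H01_contD(1) assms)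
  show "((\<lambda>s. H1_norm \<Omega> (\<lambda>x. a * w s x + b * z s x - (a * w t x + b * z t x))) \<longlongrightarrow> 0) (at t)"
  proof (rule Lim_null_comparison, intro always_eventually allI)
    fix s
    have "(\<lambda>x. a * w s x + b * z s x - (a * w t x + b * z t x)) = (\<lambda>x. a * (w s x - w t x) + b * (z s x - z t x))"
      by (simp add: fun_eq_iff algebra_simps)
    moreover have "(\<lambda>x. w s x - w t x) \<in> H1 \<Omega>" "(\<lambda>x. z s x - z t x) \<in> H1 \<Omega>"
      by (intro H01_D(1) H01_diff open_dom H01_contD(1) assms)+
    ultimately show "norm (H1_norm \<Omega> (\<lambda>x. a * w s x + b * z s x - (a * w t x + b * z t x)))
      \<le> 2 * \<bar>a\<bar> * H1_norm \<Omega> (\<lambda>x. w s x - w t x) + 2 * \<bar>b\<bar> * H1_norm \<Omega> (\<lambda>x. z s x - z t x)"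
      using H1_norm_lin[OF open_dom, of "\<lambda>x. w s x - w t x" "\<lambda>x. z s x - z t x" a b]
        H1_norm_ge(3)[of \<Omega> "\<lambda>x. a * w s x + b * z s x - (a * w t x + b * z t x)"] by simp
  next
    have "((\<lambda>s. 2 * \<bar>a\<bar> * H1_norm \<Omega> (\<lambda>x. w s x - w t x) + 2 * \<bar>b\<bar> * H1_norm \<Omega> (\<lambda>x. z s x - z t x))
      \<longlongrightarrow> 2 * \<bar>a\<bar> * 0 + 2 * \<bar>b\<bar> * 0) (at t)"
      by (intro tendsto_intros H01_contD(3) assms)
    then show "((\<lambda>s. 2 * \<bar>a\<bar> * H1_norm \<Omega> (\<lambda>x. w s x - w t x) + 2 * \<bar>b\<bar> * H1_norm \<Omega> (\<lambda>x. z s x - z t x)) \<longlongrightarrow> 0) (at t)"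
      by simp
  qed
qed

lemma H01_cont_into: "H01_cont w \<Longrightarrow> continuous_into_H01 \<Omega> t w"
  unfolding continuous_into_H01_def using H01_contD(1,3) tendsto_within_subset[where S=UNIV] by blast

lemma sq_cont_into: "sq_cont \<mu> w \<Longrightarrow> continuous_into_L2 \<Omega> t w"
  unfolding continuous_into_L2_def Lp_space_2 Lp_norm_2 sq_cont_def using tendsto_within_subset[where S=UNIV] by blast

end

context joint_rep
begin

text \<open>The central difference is the mean of the averages for \<open>h\<close> and
  \<open>- h\<close>, which gives it a jointly measurable version in L^(m+1). For
  \<open>s < h\<close> it reaches into negative times, which the reflection supplies.\<close>

lemma central_difference_test_function:
  assumes h: "h > 0" and th: "0 < t" "t + h < T"
  defines "\<phi> \<equiv> \<lambda>s x. (ubar (s + h) x - ubar (s - h) x) / (2 * h)"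
    and "\<psi> \<equiv> \<lambda>s x. (vbar (s + h) x - vbar (s - h) x) / (2 * h)"
  shows "continuous_into_H01 \<Omega> t \<phi>" "has_L2_time_derivative \<Omega> t \<phi> \<psi>" "continuous_into_L2 \<Omega> t \<psi>"
    "in_Lp_spacetime \<Omega> t (m + 1) \<phi>"
    "\<And>s. 0 \<le> s \<Longrightarrow> s \<le> t \<Longrightarrow> AE x in \<mu>. \<phi> s x = (avg h s x + avg (- h) s x) / 2"
proof -
  have \<phi>: "\<phi> = (\<lambda>s x. (1 / (2 * h)) * ubar (s + h) x + (- 1 / (2 * h)) * ubar (s + - h) x)"
    by (simp add: \<phi>_def fun_eq_iff diff_divide_distrib)
  show "continuous_into_H01 \<Omega> t \<phi>"
    unfolding \<phi> by (intro H01_cont_into H01_cont_lin H01_cont_shift ubar_H01_cont)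
  have sh: "filterlim (\<lambda>s. s + c) (at (r + c)) (at r)" for c r :: real
    unfolding filterlim_at by (auto intro!: tendsto_intros simp: eventually_at_filter)
  show "has_L2_time_derivative \<Omega> t \<phi> \<psi>"
    unfolding has_L2_time_derivative_def Lp_norm_2
  proof
    fix r assume "r \<in> {0..t}"
    let ?n = "\<lambda>c s. nrm \<mu> (\<lambda>x. (ubar (s + c) x - ubar (r + c) x) / (s - r) - vbar (r + c) x)"
    have n: "(?n c \<longlongrightarrow> 0) (at r)" for c
      using filterlim_compose[OF ubar_deriv[of "r + c"] sh[of c r]] by simp
    have "((\<lambda>s. nrm \<mu> (\<lambda>x. (\<phi> s x - \<phi> r x) / (s - r) - \<psi> r x)) \<longlongrightarrow> 0) (at r)"
    proof (rule Lim_null_comparison, intro always_eventually allI)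
      fix s
      have e: "(\<phi> s x - \<phi> r x) / (s - r) - \<psi> r x = (1 / (2 * h)) *\<^sub>R ((ubar (s + h) x - ubar (r + h) x) / (s - r) - vbar (r + h) x)
          + (- 1 / (2 * h)) *\<^sub>R ((ubar (s + - h) x - ubar (r + - h) x) / (s - r) - vbar (r + - h) x)" for x
        unfolding \<phi>_def \<psi>_def real_scaleR_def using difference_quotient_split[of "2 * h"] h by simp
      show "norm (nrm \<mu> (\<lambda>x. (\<phi> s x - \<phi> r x) / (s - r) - \<psi> r x)) \<le> \<bar>1 / (2 * h)\<bar> * ?n h s + \<bar>- 1 / (2 * h)\<bar> * ?n (- h) s"
        unfolding e real_norm_def abs_of_nonneg[OF nrm_nonneg]
        by (rule nrm_lin[OF sq_int_diff[OF quotient_sq_int vbar_sq_int] sq_int_diff[OF quotient_sq_int vbar_sq_int]])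
    next
      have "((\<lambda>s. \<bar>1 / (2 * h)\<bar> * ?n h s + \<bar>- 1 / (2 * h)\<bar> * ?n (- h) s) \<longlongrightarrow> \<bar>1 / (2 * h)\<bar> * 0 + \<bar>- 1 / (2 * h)\<bar> * 0) (at r)"
        by (intro tendsto_intros n)
      then show "((\<lambda>s. \<bar>1 / (2 * h)\<bar> * ?n h s + \<bar>- 1 / (2 * h)\<bar> * ?n (- h) s) \<longlongrightarrow> 0) (at r)" by simp
    qed
    then show "((\<lambda>s. nrm \<mu> (\<lambda>x. (\<phi> s x - \<phi> r x) / (s - r) - \<psi> r x)) \<longlongrightarrow> 0) (at r within {0..t})"
      by (rule tendsto_within_subset) simp
  qed
  show "continuous_into_L2 \<Omega> t \<psi>"
  proof (rule sq_cont_into, unfold sq_cont_def, intro allI conjI)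
    fix r
    have \<psi>: "\<psi> s x = (1 / (2 * h)) *\<^sub>R vbar (s + h) x + (- 1 / (2 * h)) *\<^sub>R vbar (s + - h) x" for s x
      by (simp add: \<psi>_def diff_divide_distrib)
    show "sq_int \<mu> (\<psi> r)" unfolding \<psi>[abs_def] by (intro sq_int_add sq_int_scaleR vbar_sq_int)
    let ?n = "\<lambda>c s. nrm \<mu> (\<lambda>x. vbar (s + c) x - vbar (r + c) x)"
    have n: "(?n c \<longlongrightarrow> 0) (at r)" for c
    proof -
      have "((\<lambda>s. nrm \<mu> (\<lambda>x. vbar s x - vbar (r + c) x)) \<longlongrightarrow> 0) (at (r + c))"
        using vbar_sq_cont by (simp add: sq_cont_def)
      from filterlim_compose[OF this sh[of c r]] show ?thesis .
    qed
    show "((\<lambda>s. nrm \<mu> (\<lambda>x. \<psi> s x - \<psi> r x)) \<longlongrightarrow> 0) (at r)"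
    proof (rule Lim_null_comparison, intro always_eventually allI)
      fix s
      have e: "\<psi> s x - \<psi> r x = (1 / (2 * h)) *\<^sub>R (vbar (s + h) x - vbar (r + h) x)
          + (- 1 / (2 * h)) *\<^sub>R (vbar (s + - h) x - vbar (r + - h) x)" for x
        using h by (simp add: \<psi>_def field_simps)
      show "norm (nrm \<mu> (\<lambda>x. \<psi> s x - \<psi> r x)) \<le> \<bar>1 / (2 * h)\<bar> * ?n h s + \<bar>- 1 / (2 * h)\<bar> * ?n (- h) s"
        unfolding e real_norm_def abs_of_nonneg[OF nrm_nonneg]
        by (rule nrm_lin[OF sq_int_diff[OF vbar_sq_int vbar_sq_int] sq_int_diff[OF vbar_sq_int vbar_sq_int]])
    next
      have "((\<lambda>s. \<bar>1 / (2 * h)\<bar> * ?n h s + \<bar>- 1 / (2 * h)\<bar> * ?n (- h) s) \<longlongrightarrow> \<bar>1 / (2 * h)\<bar> * 0 + \<bar>- 1 / (2 * h)\<bar> * 0) (at r)"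
        by (intro tendsto_intros n)
      then show "((\<lambda>s. \<bar>1 / (2 * h)\<bar> * ?n h s + \<bar>- 1 / (2 * h)\<bar> * ?n (- h) s) \<longlongrightarrow> 0) (at r)" by simp
    qed
  qed
  show rep: "AE x in \<mu>. \<phi> s x = (avg h s x + avg (- h) s x) / 2" if "0 \<le> s" "s \<le> t" for s
  proof -
    have "AE x in \<mu>. avg h s x = (ubar (s + h) x - ubar s x) / h"
      by (rule avg_eq) (use h th that in auto)
    moreover have "AE x in \<mu>. avg (- h) s x = (ubar (s + - h) x - ubar s x) / (- h)"
      by (rule avg_eq) (use h th that in auto)
    ultimately show ?thesis
      by eventually_elim (use h in \<open>simp add: \<phi>_def field_simps\<close>)
  qed
  show "in_Lp_spacetime \<Omega> t (m + 1) \<phi>"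
  proof (rule in_Lp_spacetimeI)
    let ?\<Phi> = "\<lambda>z. (avg h (fst z) (snd z) + avg (- h) (fst z) (snd z)) / 2"
    have f: "fst \<in> borel_measurable (borel :: (real \<times> (real^3)) measure)" "snd \<in> borel_measurable (borel :: (real \<times> (real^3)) measure)"
      unfolding borel_prod[symmetric] by measurable
    show "?\<Phi> \<in> borel_measurable borel"
      by (intro borel_measurable_divide borel_measurable_add avg_measurable f) auto
    have "ennreal (\<bar>(a + b) / 2\<bar> powr (m + 1)) \<le> ennreal (\<bar>a\<bar> powr (m + 1)) + ennreal (\<bar>b\<bar> powr (m + 1))" for a b :: real
    proof -
      have "\<bar>(a + b) / 2\<bar> powr (m + 1) \<le> (max \<bar>a\<bar> \<bar>b\<bar>) powr (m + 1)"
        using m by (intro powr_mono2) auto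
      also have "\<dots> \<le> \<bar>a\<bar> powr (m + 1) + \<bar>b\<bar> powr (m + 1)" by (simp add: max_def)
      finally have "ennreal (\<bar>(a + b) / 2\<bar> powr (m + 1)) \<le> ennreal (\<bar>a\<bar> powr (m + 1) + \<bar>b\<bar> powr (m + 1))" by (rule ennreal_leI)
      then show ?thesis by (simp add: ennreal_plus)
    qed
    then have "(\<integral>\<^sup>+z. ennreal (\<bar>?\<Phi> z\<bar> powr (m + 1)) \<partial>\<pi> t)
        \<le> (\<integral>\<^sup>+z. ennreal (\<bar>avg h (fst z) (snd z)\<bar> powr (m + 1)) + ennreal (\<bar>avg (- h) (fst z) (snd z)\<bar> powr (m + 1)) \<partial>\<pi> t)"
      by (intro nn_integral_mono)
    also have "\<dots> = (\<integral>\<^sup>+z. ennreal (\<bar>avg h (fst z) (snd z)\<bar> powr (m + 1)) \<partial>\<pi> t) + (\<integral>\<^sup>+z. ennreal (\<bar>avg (- h) (fst z) (snd z)\<bar> powr (m + 1)) \<partial>\<pi> t)"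
      by (intro nn_integral_add powr_measurable avg_pi_measurable)
    also have "\<dots> \<le> JJ + JJ" by (intro add_mono avg_Lq)
    also have "\<dots> < \<infinity>" using JJ_finite by simp
    finally show "(\<integral>\<^sup>+z. ennreal (\<bar>?\<Phi> z\<bar> powr (m + 1)) \<partial>\<pi> t) < \<infinity>" .
    show "AE x in \<mu>. ?\<Phi> (s, x) = \<phi> s x" if "s \<in> {0<..<t}" for s
    proof -
      have "AE x in \<mu>. \<phi> s x = (avg h s x + avg (- h) s x) / 2" by (rule rep) (use that in auto)
      then show ?thesis by eventually_elim simp
    qed
  qed
qed

text \<open>The integrand \<open>f\<close> is known only slice by slice; the jointly measurable
  \<open>F\<close> hands it integrability and the value of the iterated integral.\<close>

lemma iterated_integral_eq:
  fixes F :: "real \<times> (real^3) \<Rightarrow> real"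
  assumes F: "integrable (\<pi> t) F"
    and eq: "AE s in lebesgue_on {0..t}. AE x in \<mu>. F (s, x) = f s x"
  shows "(LINT s|lebesgue_on {0..t}. LINT x|\<mu>. f s x) = (LINT z|\<pi> t. F z)"
    "integrable (lebesgue_on {0..t}) (\<lambda>s. LINT x|\<mu>. f s x)"
    "AE s in lebesgue_on {0..t}. integrable \<mu> (f s)"
proof -
  note i = pi_integral[OF F]
  have Ic: "{0..t} \<in> sets lebesgue" by simp
  have "AE s in lebesgue_on {0..t}. (LINT x|\<mu>. F (s, x)) = (LINT x|\<mu>. f s x) \<and> integrable \<mu> (f s)"
    using i(3) eq
  proof eventually_elim
    case (elim s)
    have m: "(\<lambda>x. F (s, x)) \<in> borel_measurable \<mu>" using elim(1) by (rule borel_measurable_integrable)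
    show ?case
      using integral_cong_AE_lebesgue_on[OF dom_sets m elim(2)]
        integrable_cong_AE_imp[OF elim(1) lebesgue_on_measurable_AE[OF dom_sets m elim(2)] elim(2)] by blast
  qed
  then have e1: "AE s in lebesgue_on {0..t}. (LINT x|\<mu>. F (s, x)) = (LINT x|\<mu>. f s x)"
    and e2: "AE s in lebesgue_on {0..t}. integrable \<mu> (f s)" by auto
  show "AE s in lebesgue_on {0..t}. integrable \<mu> (f s)" by (rule e2)
  have m: "(\<lambda>s. LINT x|\<mu>. F (s, x)) \<in> borel_measurable (lebesgue_on {0..t})" using i(2) by (rule borel_measurable_integrable)
  show "(LINT s|lebesgue_on {0..t}. LINT x|\<mu>. f s x) = (LINT z|\<pi> t. F z)"
    using integral_cong_AE_lebesgue_on[OF Ic m e1] i(1) by simp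
  show "integrable (lebesgue_on {0..t}) (\<lambda>s. LINT x|\<mu>. f s x)"
    by (rule integrable_cong_AE_imp[OF i(2) lebesgue_on_measurable_AE[OF Ic m e1] e1])
qed

lemma central_difference_integral:
  assumes t: "0 < t" "t < T"
    and K: "K \<in> borel_measurable (\<pi> t)" "integrable (\<pi> t) (\<lambda>z. \<bar>K z\<bar> powr ((m + 1) / m))"
    and \<kappa>: "AE s in lebesgue_on {0..t}. AE x in \<mu>. K (s, x) = \<kappa> s x"
  shows "((\<lambda>h. LINT s|lebesgue_on {0..t}. LINT x|\<mu>. \<kappa> s x * ((ubar (s + h) x - ubar (s - h) x) / (2 * h)))
    \<longlongrightarrow> (LINT z|\<pi> t. K z * Wb (fst z) (snd z))) (at_right 0)"
proof -
  have t0: "0 \<le> t" using t by simp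
  let ?I = "\<lambda>h. LINT z|\<pi> t. K z * avg h (fst z) (snd z)"
  note w = avg_weak_limit[OF t0 t(2) K]
  have m1: "filterlim uminus (at 0) (at_right (0::real))"
    unfolding filterlim_at by (auto intro!: tendsto_eq_intros simp: eventually_at_filter)
  have l1: "(?I \<longlongrightarrow> (LINT z|\<pi> t. K z * Wb (fst z) (snd z))) (at_right 0)"
    by (rule tendsto_within_subset[OF w(1)]) simp
  have l2: "((\<lambda>h. ?I (- h)) \<longlongrightarrow> (LINT z|\<pi> t. K z * Wb (fst z) (snd z))) (at_right 0)"
    by (rule filterlim_compose[OF w(1) m1])
  have L: "((\<lambda>h. (?I h + ?I (- h)) / 2) \<longlongrightarrow> ((LINT z|\<pi> t. K z * Wb (fst z) (snd z)) + (LINT z|\<pi> t. K z * Wb (fst z) (snd z))) / 2) (at_right 0)"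
    by (intro tendsto_intros l1 l2) simp
  have ev: "\<forall>\<^sub>F h in at_right 0. (?I h + ?I (- h)) / 2
      = (LINT s|lebesgue_on {0..t}. LINT x|\<mu>. \<kappa> s x * ((ubar (s + h) x - ubar (s - h) x) / (2 * h)))"
    unfolding eventually_at_right_field
  proof (intro exI[of _ "T - t"] conjI allI impI)
    show "0 < T - t" using t by simp
    fix h :: real assume h: "0 < h" "h < T - t"
    have th: "t + h < T" using h by simp
    let ?F = "\<lambda>z. K z * avg h (fst z) (snd z) / 2 + K z * avg (- h) (fst z) (snd z) / 2"
    have i: "integrable (\<pi> t) ?F" using w(3)[of h] w(3)[of "- h"] by simp
    have "AE s in lebesgue_on {0..t}. AE x in \<mu>. ?F (s, x) = \<kappa> s x * ((ubar (s + h) x - ubar (s - h) x) / (2 * h))"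
      using \<kappa> AE_space
    proof eventually_elim
      case (elim s)
      then have s: "0 \<le> s" "s \<le> t" by auto
      show ?case using elim(1) central_difference_test_function(5)[OF h(1) t(1) th s]
        by eventually_elim (simp add: add_divide_distrib distrib_left)
    qed
    from iterated_integral_eq(1)[OF i this]
    show "(?I h + ?I (- h)) / 2 = (LINT s|lebesgue_on {0..t}. LINT x|\<mu>. \<kappa> s x * ((ubar (s + h) x - ubar (s - h) x) / (2 * h)))"
      using w(3)[of h] w(3)[of "- h"] by (simp add: add_divide_distrib)
  qed
  have "(X + X) / 2 = X" for X :: real by simp
  with Lim_transform_eventually[OF L ev] show ?thesis by (simp only:)
qed

end


section \<open>Damping and source in the dual exponent\<close>

context damped_wave
begin

lemma g_sign: "0 \<le> g y * y"
proof (cases "y \<ge> 0")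
  case True
  then have "g 0 \<le> g y" using g_mono by (auto simp: mono_def)
  then show ?thesis using True g_0 by simp
next
  case False
  then have "g y \<le> g 0" using g_mono by (auto simp: mono_def)
  then show ?thesis using False g_0 by (simp add: mult_nonpos_nonpos)
qed

lemma g_abs: "\<bar>g y\<bar> * \<bar>y\<bar> = g y * y"
  using g_sign[of y] by (simp add: abs_mult[symmetric])

lemma g_large:
  assumes "\<bar>y\<bar> > 1"
  shows "b1 * \<bar>y\<bar> powr m \<le> \<bar>g y\<bar>" "\<bar>g y\<bar> \<le> b2 * \<bar>y\<bar> powr m"
proof -
  have "\<bar>y\<bar> powr (m + 1) = \<bar>y\<bar> powr m * \<bar>y\<bar>" using assms by (simp add: powr_add)
  then have "b1 * \<bar>y\<bar> powr m * \<bar>y\<bar> \<le> \<bar>g y\<bar> * \<bar>y\<bar>" "\<bar>g y\<bar> * \<bar>y\<bar> \<le> b2 * \<bar>y\<bar> powr m * \<bar>y\<bar>"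
    using g_growth[OF assms] unfolding g_abs by (simp_all add: mult.assoc)
  then show "b1 * \<bar>y\<bar> powr m \<le> \<bar>g y\<bar>" "\<bar>g y\<bar> \<le> b2 * \<bar>y\<bar> powr m"
    using assms by (auto simp: mult_le_cancel_right)
qed

lemma g_small:
  assumes "\<bar>y\<bar> \<le> 1" shows "\<bar>g y\<bar> \<le> \<bar>g 1\<bar> + \<bar>g (- 1)\<bar>"
proof -
  have "g (- 1) \<le> g y" "g y \<le> g 1" using assms g_mono by (auto simp: mono_def)
  then show ?thesis by linarith
qed

text \<open>Beyond 1 the growth bound yields the power m+1 of \<open>y\<close>, and on the unit
  interval monotonicity bounds \<open>g\<close>. Hence \<open>g\<close> maps L^(m+1) into the dual
  space.\<close>

lemma g_dual_bound: "\<exists>C\<ge>0. \<forall>y. \<bar>g y\<bar> powr ((m + 1) / m) \<le> C * (1 + \<bar>y\<bar> powr (m + 1))"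
proof (intro exI conjI allI)
  let ?q = "(m + 1) / m"
  let ?C = "(\<bar>g 1\<bar> + \<bar>g (- 1)\<bar>) powr ?q + b2 powr ?q"
  show "0 \<le> ?C" by simp
  fix y
  have q: "?q \<ge> 0" using m by simp
  show "\<bar>g y\<bar> powr ?q \<le> ?C * (1 + \<bar>y\<bar> powr (m + 1))"
  proof (cases "\<bar>y\<bar> \<le> 1")
    case True
    have "\<bar>g y\<bar> powr ?q \<le> (\<bar>g 1\<bar> + \<bar>g (- 1)\<bar>) powr ?q" using g_small[OF True] q by (intro powr_mono2) auto
    also have "\<dots> \<le> ?C * 1" by simp
    also have "\<dots> \<le> ?C * (1 + \<bar>y\<bar> powr (m + 1))" by (intro mult_left_mono) auto
    finally show ?thesis .
  next
    case False
    then have "\<bar>g y\<bar> powr ?q \<le> (b2 * \<bar>y\<bar> powr m) powr ?q" using g_large(2)[of y] q by (intro powr_mono2) auto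
    also have "\<dots> = b2 powr ?q * \<bar>y\<bar> powr (m + 1)" using b m by (simp add: powr_mult powr_powr)
    also have "\<dots> \<le> ?C * (1 + \<bar>y\<bar> powr (m + 1))" by (intro mult_mono) auto
    finally show ?thesis .
  qed
qed

lemma g_measurable [measurable]: "g \<in> borel_measurable borel"
  using g_cont by (rule borel_measurable_continuous_onI)

text \<open>Extended constantly to negative times, so that monotonicity on the whole line gives
  Borel measurability.\<close>

definition \<gamma>' :: "real \<Rightarrow> real" where "\<gamma>' s = \<gamma> (max s 0)"

lemma gamma'_measurable [measurable]: "\<gamma>' \<in> borel_measurable borel"
proof -
  have "mono (\<lambda>s. - \<gamma>' s)" unfolding mono_def \<gamma>'_def by (auto intro: gamma_antimono)
  then have "(\<lambda>s. - \<gamma>' s) \<in> borel_measurable borel" by (rule borel_measurable_mono)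
  then have "(\<lambda>s. - (- \<gamma>' s)) \<in> borel_measurable borel" by (rule borel_measurable_uminus)
  then show ?thesis by simp
qed

lemma gamma'_bounds: "0 \<le> \<gamma>' s" "\<gamma>' s \<le> \<gamma> 0"
  unfolding \<gamma>'_def by (auto intro: gamma_nonneg gamma_antimono)

lemma gamma'_eq: "0 \<le> s \<Longrightarrow> \<gamma>' s = \<gamma> s"
  by (simp add: \<gamma>'_def)

lemma ubar_Lq_bound:
  assumes q: "2 \<le> q" "q \<le> 6"
  obtains B where "B \<ge> 0" "\<And>s. 0 \<le> s \<Longrightarrow> s \<le> t \<Longrightarrow> (LINT x|\<mu>. \<bar>u s x\<bar> powr q) \<le> B"
proof -
  have c: "continuous_on {0..t} (\<lambda>s. LINT x|\<mu>. \<bar>ubar s x\<bar> powr q)"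
    by (intro continuous_at_imp_continuous_on ballI Lq_continuous[OF ubar_H01_cont q])
  have "bounded ((\<lambda>s. LINT x|\<mu>. \<bar>ubar s x\<bar> powr q) ` {0..t})"
    by (intro compact_imp_bounded compact_continuous_image c) auto
  then obtain B where B': "\<forall>s\<in>{0..t}. \<bar>LINT x|\<mu>. \<bar>ubar s x\<bar> powr q\<bar> \<le> B" by (auto simp: bounded_iff)
  show ?thesis
  proof
    show "0 \<le> \<bar>B\<bar>" by simp
    fix s assume s: "0 \<le> s" "s \<le> t"
    then have "\<bar>LINT x|\<mu>. \<bar>ubar s x\<bar> powr q\<bar> \<le> B" using B' by simp
    then show "(LINT x|\<mu>. \<bar>u s x\<bar> powr q) \<le> \<bar>B\<bar>" using s(1) by (simp add: ubar_nonneg)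
  qed
qed

end

context joint_rep
begin

lemma Wb_slice:
  assumes "t < T" shows "AE s in lebesgue_on {0..t}. AE x in \<mu>. Wb s x = v s x"
proof -
  have "AE s in lborel. s \<in> {0..t} \<longrightarrow> (AE x in \<mu>. Wb s x = v s x)"
    using Wb_eq
  proof eventually_elim
    case (elim s)
    show ?case
    proof
      assume "s \<in> {0..t}"
      then have "\<bar>s\<bar> < T" "0 \<le> s" using assms by auto
      then show "AE x in \<mu>. Wb s x = v s x" using elim vbar_nonneg by simp
    qed
  qed
  then show ?thesis by (simp add: AE_restrict_space_iff AE_completion_iff)
qed

text \<open>The bounded factor \<open>c\<close> will be the constant 1 or
  \<open>\<gamma>'\<close>.\<close>

lemma damping_dual_integrable:
  assumes c: "c \<in> borel_measurable borel" "\<And>s. \<bar>c s :: real\<bar> \<le> L"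
  shows "(\<lambda>z. c (fst z) * g (Wb (fst z) (snd z))) \<in> borel_measurable (\<pi> t)"
    "integrable (\<pi> t) (\<lambda>z. \<bar>c (fst z) * g (Wb (fst z) (snd z))\<bar> powr ((m + 1) / m))"
proof -
  let ?q = "(m + 1) / m"
  have q: "?q \<ge> 0" using m by simp
  show K: "(\<lambda>z. c (fst z) * g (Wb (fst z) (snd z))) \<in> borel_measurable (\<pi> t)"
    by (intro borel_measurable_times measurable_compose[OF pi_fst c(1)] measurable_compose[OF Wb_pi_measurable g_measurable])
  obtain C where C: "C \<ge> 0" "\<And>y. \<bar>g y\<bar> powr ?q \<le> C * (1 + \<bar>y\<bar> powr (m + 1))" using g_dual_bound by blast
  interpret finite_measure "\<pi> t" by (rule pi_finite)
  show "integrable (\<pi> t) (\<lambda>z. \<bar>c (fst z) * g (Wb (fst z) (snd z))\<bar> powr ?q)"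
  proof (rule Bochner_Integration.integrable_bound)
    show "integrable (\<pi> t) (\<lambda>z. L powr ?q * (C * (1 + \<bar>Wb (fst z) (snd z)\<bar> powr (m + 1))))"
      using powr_Lq_integrable(2)[OF pi_finite Wb_pi_measurable Wb_Lq] by simp
    show "(\<lambda>z. \<bar>c (fst z) * g (Wb (fst z) (snd z))\<bar> powr ?q) \<in> borel_measurable (\<pi> t)"
      using K by measurable
    have "\<bar>a * g y\<bar> powr ?q \<le> L powr ?q * (C * (1 + \<bar>y\<bar> powr (m + 1)))" if "\<bar>a\<bar> \<le> L" for a y
    proof -
      have "\<bar>a * g y\<bar> powr ?q = \<bar>a\<bar> powr ?q * \<bar>g y\<bar> powr ?q" by (simp add: abs_mult powr_mult)
      also have "\<dots> \<le> L powr ?q * (C * (1 + \<bar>y\<bar> powr (m + 1)))"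
        using that q by (intro mult_mono C powr_mono2) auto
      finally show ?thesis .
    qed
    then show "AE z in \<pi> t. norm (\<bar>c (fst z) * g (Wb (fst z) (snd z))\<bar> powr ?q)
        \<le> norm (L powr ?q * (C * (1 + \<bar>Wb (fst z) (snd z)\<bar> powr (m + 1))))"
      using c(2) C(1) by (intro AE_I2) (simp add: abs_of_nonneg del: abs_mult)
  qed
qed

end

text \<open>Unlike \<open>W\<close>, the representative \<open>U\<close> is correct at every time of
  \<open>[0, T)\<close>, not only at almost every one.\<close>

locale joint_rep_u = joint_rep +
  fixes U :: "real \<times> (real^3) \<Rightarrow> real"
  assumes U_borel: "U \<in> borel_measurable borel"
    and U_eq: "\<And>s. 0 \<le> s \<Longrightarrow> s < T \<Longrightarrow> AE x in \<mu>. U (s, x) = u s x"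

text \<open>\<open>u s\<close> is \<open>u 0\<close> plus \<open>s\<close> times the mean velocity
  over \<open>[0, s]\<close>, and \<open>avg s 0\<close> is a measurable version of that mean; it
  remains to choose a Borel representative of \<open>u 0\<close>.\<close>

lemma (in joint_rep) joint_rep_u_exists:
  obtains U where "joint_rep_u \<Omega> A \<omega> p m b1 b2 \<gamma> g u0 u1 u v T W U"
proof -
  have u0m: "u 0 \<in> borel_measurable \<mu>" using sq_int_measurable[OF ubar_sq_int[of 0]] by (simp add: ubar_nonneg)
  then have "(\<lambda>x. if x \<in> \<Omega> then u 0 x else 0) \<in> borel_measurable lebesgue"
    using dom_sets by (simp add: borel_measurable_if)
  then obtain B where B: "B \<in> borel_measurable lborel" "AE x in lborel. (if x \<in> \<Omega> then u 0 x else 0) = B x"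
    using completion_ex_borel_measurable_real by blast
  let ?U = "\<lambda>z. B (snd z) + fst z * avg (fst z) 0 (snd z)"
  have f: "fst \<in> borel_measurable (borel :: (real \<times> (real^3)) measure)" "snd \<in> borel_measurable (borel :: (real \<times> (real^3)) measure)"
    unfolding borel_prod[symmetric] by measurable
  have B': "B \<in> borel_measurable borel" using B(1) by simp
  show ?thesis
  proof (rule that[of ?U], unfold_locales)
    show "?U \<in> borel_measurable borel"
      by (intro borel_measurable_add borel_measurable_times avg_measurable f measurable_compose[OF f(2) B']) simp
    fix s assume s: "0 \<le> s" "s < T"
    have "AE x in lborel. x \<in> \<Omega> \<longrightarrow> u 0 x = B x" using B(2) by eventually_elim auto
    then have e0: "AE x in \<mu>. u 0 x = B x" by (simp add: AE_mu_iff)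
    show "AE x in \<mu>. ?U (s, x) = u s x"
    proof (cases "s = 0")
      case True
      then show ?thesis using e0 by (auto elim: eventually_mono)
    next
      case False
      have "AE x in \<mu>. avg s 0 x = (ubar (0 + s) x - ubar 0 x) / s"
        by (rule avg_eq) (use False s in auto)
      then show ?thesis using e0
        by eventually_elim (use False s in \<open>simp add: ubar_nonneg\<close>)
    qed
  qed
qed

context joint_rep_u
begin

lemma U_pi_measurable: "U \<in> borel_measurable (\<pi> t)"
proof -
  have "(\<lambda>z. (fst z, snd z)) \<in> borel_measurable (\<pi> t)"
    by (intro borel_measurable_Pair pi_fst pi_snd)
  from measurable_compose[OF this U_borel] show ?thesis by simp
qed

lemma U_Lq:
  assumes t: "t < T" and q: "2 \<le> q" "q \<le> 6"
  shows "(\<integral>\<^sup>+z. ennreal (\<bar>U z\<bar> powr q) \<partial>\<pi> t) < \<infinity>" "integrable (\<pi> t) (\<lambda>z. \<bar>U z\<bar> powr q)"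
proof -
  interpret P: pair_sigma_finite "lebesgue_on {0..t}" \<mu> by (rule pair_sigma_finite_gen)
  interpret S: finite_measure "lebesgue_on {0..t}" by (rule lebesgue_on_Icc_finite)
  obtain B where B: "B \<ge> 0" "\<And>s. 0 \<le> s \<Longrightarrow> s \<le> t \<Longrightarrow> (LINT x|\<mu>. \<bar>u s x\<bar> powr q) \<le> B" using ubar_Lq_bound[OF q] by blast
  have Um: "(\<lambda>z. ennreal (\<bar>U z\<bar> powr q)) \<in> borel_measurable (\<pi> t)" by (intro powr_measurable U_pi_measurable)
  have "(\<integral>\<^sup>+z. ennreal (\<bar>U z\<bar> powr q) \<partial>\<pi> t) = (\<integral>\<^sup>+s. \<integral>\<^sup>+x. ennreal (\<bar>U (s, x)\<bar> powr q) \<partial>\<mu> \<partial>lebesgue_on {0..t})"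
    using P.M2.nn_integral_fst[OF Um] by simp
  also have "\<dots> \<le> (\<integral>\<^sup>+s. ennreal B \<partial>lebesgue_on {0..t})"
  proof (rule nn_integral_mono)
    fix s assume "s \<in> space (lebesgue_on {0..t})"
    then have s: "0 \<le> s" "s \<le> t" by auto
    have "(\<integral>\<^sup>+x. ennreal (\<bar>U (s, x)\<bar> powr q) \<partial>\<mu>) = (\<integral>\<^sup>+x. ennreal (\<bar>u s x\<bar> powr q) \<partial>\<mu>)"
      by (rule nn_integral_cong_AE) (use U_eq[of s] s t in \<open>auto elim!: eventually_mono\<close>)
    also have "\<dots> = ennreal (LINT x|\<mu>. \<bar>u s x\<bar> powr q)"
      by (rule nn_integral_eq_integral[OF Lq_bound(1)[OF u_facts(1)[OF s(1)] q]]) simp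
    also have "\<dots> \<le> ennreal B" by (rule ennreal_leI[OF B(2)[OF s]])
    finally show "(\<integral>\<^sup>+x. ennreal (\<bar>U (s, x)\<bar> powr q) \<partial>\<mu>) \<le> ennreal B" .
  qed
  also have "\<dots> < \<infinity>" by (simp add: ennreal_mult_less_top S.emeasure_eq_measure less_top[symmetric] ennreal_mult_eq_top_iff del: space_restrict_space)
  finally show fin: "(\<integral>\<^sup>+z. ennreal (\<bar>U z\<bar> powr q) \<partial>\<pi> t) < \<infinity>" .
  show "integrable (\<pi> t) (\<lambda>z. \<bar>U z\<bar> powr q)"
    by (rule integrableI_bounded) (use fin U_pi_measurable in auto)
qed

text \<open>The condition \<open>p * ((m + 1) / m) < 6\<close> bounds the dual power by
  \<open>1 + \<bar>U z\<bar> powr 6\<close>, and sixth powers are integrable by the Sobolev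
  inequality.\<close>

lemma source_dual_integrable:
  assumes t: "t < T"
  shows "(\<lambda>z. \<bar>U z\<bar> powr (p - 1) * U z) \<in> borel_measurable (\<pi> t)"
    "integrable (\<pi> t) (\<lambda>z. \<bar>\<bar>U z\<bar> powr (p - 1) * U z\<bar> powr ((m + 1) / m))"
proof -
  let ?q = "(m + 1) / m"
  show K: "(\<lambda>z. \<bar>U z\<bar> powr (p - 1) * U z) \<in> borel_measurable (\<pi> t)"
    using U_pi_measurable by measurable
  interpret finite_measure "\<pi> t" by (rule pi_finite)
  show "integrable (\<pi> t) (\<lambda>z. \<bar>\<bar>U z\<bar> powr (p - 1) * U z\<bar> powr ?q)"
  proof (rule Bochner_Integration.integrable_bound)
    show "integrable (\<pi> t) (\<lambda>z. 1 + \<bar>U z\<bar> powr 6)" using U_Lq(2)[OF t, of 6] by simp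
    show "(\<lambda>z. \<bar>\<bar>U z\<bar> powr (p - 1) * U z\<bar> powr ?q) \<in> borel_measurable (\<pi> t)" using K by measurable
    have "\<bar>\<bar>a\<bar> powr (p - 1) * a\<bar> powr ?q \<le> 1 + \<bar>a\<bar> powr 6" for a :: real
    proof (cases "a = 0")
      case False
      have "\<bar>a\<bar> powr ((p - 1) + 1) = \<bar>a\<bar> powr (p - 1) * \<bar>a\<bar> powr 1" by (rule powr_add)
      then have "\<bar>\<bar>a\<bar> powr (p - 1) * a\<bar> = \<bar>a\<bar> powr p" using False by (simp add: abs_mult)
      then have e: "\<bar>\<bar>a\<bar> powr (p - 1) * a\<bar> powr ?q = \<bar>a\<bar> powr (p * ?q)" by (simp add: powr_powr)
      show ?thesis
      proof (cases "\<bar>a\<bar> \<le> 1")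
        case True
        then have "\<bar>a\<bar> powr (p * ?q) \<le> 1" using p m by (intro powr_le1) auto
        then show ?thesis unfolding e by (rule add_increasing2[rotated]) simp
      next
        case False
        then have "\<bar>a\<bar> powr (p * ?q) \<le> \<bar>a\<bar> powr 6" using pm by (intro powr_mono) auto
        then show ?thesis unfolding e by linarith
      qed
    qed simp
    then show "AE z in \<pi> t. norm (\<bar>\<bar>U z\<bar> powr (p - 1) * U z\<bar> powr ?q) \<le> norm (1 + \<bar>U z\<bar> powr 6)"
      by (intro AE_I2) simp
  qed
qed

end


lemma difference_limit:
  fixes G :: "real \<Rightarrow> real"
  assumes G: "isCont G t" "isCont G 0"
    and I: "\<And>h. 0 < h \<Longrightarrow> \<exists>\<xi> \<eta>. \<bar>\<xi> - t\<bar> \<le> h \<and> \<bar>\<eta>\<bar> \<le> h \<and> I h = h * (G \<xi> - G \<eta>)"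
  shows "((\<lambda>h. I h / h) \<longlongrightarrow> G t - G 0) (at_right 0)"
proof (rule tendstoI)
  fix e :: real assume e: "e > 0"
  obtain d1 where d1: "d1 > 0" "\<And>s. \<bar>s - t\<bar> < d1 \<Longrightarrow> \<bar>G s - G t\<bar> < e / 2"
    using G(1)[unfolded continuous_at_eps_delta, rule_format, of "e / 2"] e by (auto simp: dist_real_def)
  obtain d2 where d2: "d2 > 0" "\<And>s. \<bar>s\<bar> < d2 \<Longrightarrow> \<bar>G s - G 0\<bar> < e / 2"
    using G(2)[unfolded continuous_at_eps_delta, rule_format, of "e / 2"] e by (auto simp: dist_real_def)
  show "\<forall>\<^sub>F h in at_right 0. dist (I h / h) (G t - G 0) < e"
    unfolding eventually_at_right_field
  proof (intro exI[of _ "min d1 d2"] conjI allI impI)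
    show "0 < min d1 d2" using d1 d2 by simp
    fix h :: real assume h: "0 < h" "h < min d1 d2"
    obtain \<xi> \<eta> where x: "\<bar>\<xi> - t\<bar> \<le> h" "\<bar>\<eta>\<bar> \<le> h" "I h = h * (G \<xi> - G \<eta>)" using I[OF h(1)] by blast
    have "\<bar>G \<xi> - G t\<bar> < e / 2" "\<bar>G \<eta> - G 0\<bar> < e / 2" using d1(2)[of \<xi>] d2(2)[of \<eta>] x h by auto
    then have "\<bar>(G \<xi> - G \<eta>) - (G t - G 0)\<bar> < e" by argo
    then show "dist (I h / h) (G t - G 0) < e" using x(3) h by (simp add: dist_real_def)
  qed
qed

text \<open>The tangent inequality for the even convex function
  \<open>\<bar>r\<bar> powr (p + 1)\<close>, reduced to nonnegative arguments by
  \<open>a * b \<le> \<bar>a\<bar> * \<bar>b\<bar>\<close>.\<close>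

lemma powr_convex_ineq:
  fixes a b :: real
  assumes p: "p > 1"
  shows "(p + 1) * (\<bar>a\<bar> powr (p - 1) * a * (b - a)) \<le> \<bar>b\<bar> powr (p + 1) - \<bar>a\<bar> powr (p + 1)"
proof -
  have 1: "\<bar>a\<bar> powr (p + 1) + (p + 1) * \<bar>a\<bar> powr p * (\<bar>b\<bar> - \<bar>a\<bar>) \<le> \<bar>b\<bar> powr (p + 1)"
    using powr_tangent[of "p + 1" "\<bar>b\<bar>" "\<bar>a\<bar>"] p by simp
  have 2: "\<bar>a\<bar> powr (p - 1) * a * (b - a) \<le> \<bar>a\<bar> powr p * (\<bar>b\<bar> - \<bar>a\<bar>)"
  proof (cases "a = 0")
    case False
    have "\<bar>a\<bar> powr ((p - 1) + 1) = \<bar>a\<bar> powr (p - 1) * \<bar>a\<bar> powr 1" by (rule powr_add)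
    then have e: "\<bar>a\<bar> powr p = \<bar>a\<bar> powr (p - 1) * \<bar>a\<bar>" using False by simp
    have "a * b \<le> \<bar>a\<bar> * \<bar>b\<bar>" using abs_ge_self[of "a * b"] by (simp add: abs_mult)
    then have "a * (b - a) \<le> \<bar>a\<bar> * (\<bar>b\<bar> - \<bar>a\<bar>)" by (simp add: right_diff_distrib)
    then have "\<bar>a\<bar> powr (p - 1) * (a * (b - a)) \<le> \<bar>a\<bar> powr (p - 1) * (\<bar>a\<bar> * (\<bar>b\<bar> - \<bar>a\<bar>))"
      by (intro mult_left_mono) auto
    then show ?thesis unfolding e by (simp add: mult.assoc)
  qed simp
  have "(p + 1) * (\<bar>a\<bar> powr (p - 1) * a * (b - a)) \<le> (p + 1) * (\<bar>a\<bar> powr p * (\<bar>b\<bar> - \<bar>a\<bar>))"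
    using p by (intro mult_left_mono 2) simp
  then show ?thesis using 1 by (simp add: mult.assoc)
qed

section \<open>Work of the source and the energy identity\<close>

context joint_rep_u
begin

definition Fp :: "real \<Rightarrow> real" where "Fp s = (LINT x|\<mu>. \<bar>ubar s x\<bar> powr (p + 1))"

lemma Fp_cont: "isCont Fp s"
  unfolding Fp_def[abs_def] by (rule Lq_continuous[OF ubar_H01_cont]) (use p in auto)

lemma ubar_powr_integrable: "integrable \<mu> (\<lambda>x. \<bar>ubar s x\<bar> powr (p + 1))"
  by (rule Lq_bound(1)[OF H01_contD(1)[OF ubar_H01_cont]]) (use p in auto)

text \<open>Convexity of \<open>|r| powr (p + 1)\<close> bounds the increments of \<open>Fp\<close> below by the source times the
  difference quotients; the two signs of \<open>h\<close> give the two inequalities.\<close>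

lemma Fp_increment:
  assumes t: "0 < t" "t < T" and h: "h \<noteq> 0" "\<bar>h\<bar> < T - t"
  shows "(p + 1) * (h * (LINT z|\<pi> t. \<bar>U z\<bar> powr (p - 1) * U z * avg h (fst z) (snd z)))
    \<le> (LINT s|lebesgue_on {0..t}. Fp (s + h) - Fp s)"
proof -
  note K = source_dual_integrable[OF t(2)]
  have t0: "0 \<le> t" using t by simp
  note i = avg_weak_limit(3)[OF t0 t(2) K, of h]
  note pi = pi_integral[OF i]
  have "(p + 1) * (h * (LINT z|\<pi> t. \<bar>U z\<bar> powr (p - 1) * U z * avg h (fst z) (snd z)))
      = (LINT s|lebesgue_on {0..t}. (p + 1) * (h * (LINT x|\<mu>. \<bar>U (s, x)\<bar> powr (p - 1) * U (s, x) * avg h s x)))"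
    unfolding pi(1) by simp
  also have "\<dots> \<le> (LINT s|lebesgue_on {0..t}. Fp (s + h) - Fp s)"
  proof (rule integral_mono_AE)
    show "integrable (lebesgue_on {0..t}) (\<lambda>s. (p + 1) * (h * (LINT x|\<mu>. \<bar>U (s, x)\<bar> powr (p - 1) * U (s, x) * avg h s x)))"
      using pi(2) by simp
    have c: "continuous_on UNIV Fp" by (intro continuous_at_imp_continuous_on ballI Fp_cont)
    have "continuous_on UNIV (\<lambda>s. Fp (s + h))" by (rule continuous_on_compose2[OF c]) (auto intro!: continuous_intros)
    from continuous_on_diff[OF this c] have "continuous_on {0..t} (\<lambda>s. Fp (s + h) - Fp s)" by (rule continuous_on_subset) simp
    then show "integrable (lebesgue_on {0..t}) (\<lambda>s. Fp (s + h) - Fp s)" by (rule continuous_imp_integrable_real)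
    show "AE s in lebesgue_on {0..t}. (p + 1) * (h * (LINT x|\<mu>. \<bar>U (s, x)\<bar> powr (p - 1) * U (s, x) * avg h s x)) \<le> Fp (s + h) - Fp s"
      using pi(3) AE_space
    proof eventually_elim
      case (elim s)
      then have s: "0 \<le> s" "s \<le> t" by auto
      have av: "AE x in \<mu>. avg h s x = (ubar (s + h) x - ubar s x) / h"
        by (rule avg_eq) (use h s in auto)
      have "AE x in \<mu>. U (s, x) = u s x" by (rule U_eq) (use s t in auto)
      then have "AE x in \<mu>. (p + 1) * (h * (\<bar>U (s, x)\<bar> powr (p - 1) * U (s, x) * avg h s x))
          \<le> \<bar>ubar (s + h) x\<bar> powr (p + 1) - \<bar>ubar s x\<bar> powr (p + 1)"
        using av
      proof eventually_elim
        case (elim x)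
        have e: "U (s, x) = ubar s x" "h * avg h s x = ubar (s + h) x - ubar s x"
          using elim s h by (simp_all add: ubar_nonneg)
        have "(p + 1) * (h * (\<bar>U (s, x)\<bar> powr (p - 1) * U (s, x) * avg h s x))
            = (p + 1) * (\<bar>ubar s x\<bar> powr (p - 1) * ubar s x * (ubar (s + h) x - ubar s x))"
          unfolding e(2)[symmetric] e(1) by (simp only: mult_ac)
        then show ?case using powr_convex_ineq[OF p(1), of "ubar s x" "ubar (s + h) x"] by linarith
      qed
      then have "(LINT x|\<mu>. (p + 1) * (h * (\<bar>U (s, x)\<bar> powr (p - 1) * U (s, x) * avg h s x)))
          \<le> (LINT x|\<mu>. \<bar>ubar (s + h) x\<bar> powr (p + 1) - \<bar>ubar s x\<bar> powr (p + 1))"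
        using elim(1) by (intro integral_mono_AE Bochner_Integration.integrable_diff ubar_powr_integrable) (auto simp: mult.assoc)
      then show ?case unfolding Fp_def by (simp add: ubar_powr_integrable)
    qed
  qed
  finally show ?thesis .
qed

text \<open>Forward steps bound the increment of \<open>Fp\<close> from below and backward steps
  from above, with the same weak limit; of \<open>Fp\<close> itself only continuity is used.\<close>

lemma source_work:
  assumes t: "0 < t" "t < T"
  shows "Fp t - Fp 0 = (p + 1) * (LINT z|\<pi> t. \<bar>U z\<bar> powr (p - 1) * U z * Wb (fst z) (snd z))"
proof (rule antisym)
  note K = source_dual_integrable[OF t(2)]
  have t0: "0 \<le> t" using t by simp
  let ?S = "\<lambda>h. (p + 1) * (LINT z|\<pi> t. \<bar>U z\<bar> powr (p - 1) * U z * avg h (fst z) (snd z))"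
  let ?L = "(p + 1) * (LINT z|\<pi> t. \<bar>U z\<bar> powr (p - 1) * U z * Wb (fst z) (snd z))"
  have l: "(?S \<longlongrightarrow> ?L) (at 0)" by (intro tendsto_intros avg_weak_limit(1)[OF t0 t(2) K])
  have m1: "filterlim uminus (at 0) (at_right (0::real))"
    unfolding filterlim_at by (auto intro!: tendsto_eq_intros simp: eventually_at_filter)
  have l1: "(?S \<longlongrightarrow> ?L) (at_right 0)" by (rule tendsto_within_subset[OF l]) simp
  have l2: "((\<lambda>h. ?S (- h)) \<longlongrightarrow> ?L) (at_right 0)" by (rule filterlim_compose[OF l m1])
  have c: "continuous_on UNIV Fp" by (intro continuous_at_imp_continuous_on ballI Fp_cont)
  have bw: "((\<lambda>h. (LINT s|lebesgue_on {0..t}. Fp s - Fp (s - h)) / h) \<longlongrightarrow> Fp t - Fp 0) (at_right 0)"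
  proof (rule difference_limit[OF Fp_cont Fp_cont])
    fix h :: real assume h: "0 < h"
    obtain \<xi> \<eta> where "t - h < \<xi>" "\<xi> < t" "- h < \<eta>" "\<eta> < 0"
      "(LINT s|lebesgue_on {0..t}. Fp s - Fp (s - h)) = h * (Fp \<xi> - Fp \<eta>)"
      using continuous_integral_diff_eq_mvt[OF c h t0] .
    then show "\<exists>\<xi> \<eta>. \<bar>\<xi> - t\<bar> \<le> h \<and> \<bar>\<eta>\<bar> \<le> h \<and> (LINT s|lebesgue_on {0..t}. Fp s - Fp (s - h)) = h * (Fp \<xi> - Fp \<eta>)"
      by (intro exI[of _ \<xi>] exI[of _ \<eta>]) auto
  qed
  have fw: "((\<lambda>h. (LINT s|lebesgue_on {0..t}. Fp (s + h) - Fp s) / h) \<longlongrightarrow> Fp t - Fp 0) (at_right 0)"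
  proof (rule difference_limit[OF Fp_cont Fp_cont])
    fix h :: real assume h: "0 < h"
    \<comment> \<open>The mean value form is stated for backward differences; applied to the shifted
      function it yields the forward one.\<close>
    have c': "continuous_on UNIV (\<lambda>s. Fp (s + h))" by (rule continuous_on_compose2[OF c]) (auto intro!: continuous_intros)
    obtain \<xi> \<eta> where "t - h < \<xi>" "\<xi> < t" "- h < \<eta>" "\<eta> < 0"
      "(LINT s|lebesgue_on {0..t}. Fp (s + h) - Fp (s - h + h)) = h * (Fp (\<xi> + h) - Fp (\<eta> + h))"
      using continuous_integral_diff_eq_mvt[OF c' h t0] .
    then show "\<exists>\<xi> \<eta>. \<bar>\<xi> - t\<bar> \<le> h \<and> \<bar>\<eta>\<bar> \<le> h \<and> (LINT s|lebesgue_on {0..t}. Fp (s + h) - Fp s) = h * (Fp \<xi> - Fp \<eta>)"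
      by (intro exI[of _ "\<xi> + h"] exI[of _ "\<eta> + h"]) auto
  qed
  have ev: "\<forall>\<^sub>F h in at_right 0. 0 < h \<and> h < T - t"
    unfolding eventually_at_right_field using t by (intro exI[of _ "T - t"]) auto
  show "?L \<le> Fp t - Fp 0"
  proof (rule tendsto_le[OF _ fw l1])
    show "\<forall>\<^sub>F h in at_right 0. ?S h \<le> (LINT s|lebesgue_on {0..t}. Fp (s + h) - Fp s) / h"
      using ev
    proof eventually_elim
      case (elim h)
      then show ?case using Fp_increment[OF t, of h] by (simp add: field_simps)
    qed
  qed simp
  show "Fp t - Fp 0 \<le> ?L"
  proof (rule tendsto_le[OF _ l2 bw])
    show "\<forall>\<^sub>F h in at_right 0. (LINT s|lebesgue_on {0..t}. Fp s - Fp (s - h)) / h \<le> ?S (- h)"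
      using ev
    proof eventually_elim
      case (elim h)
      have "(LINT s|lebesgue_on {0..t}. Fp s - Fp (s - h)) = - (LINT s|lebesgue_on {0..t}. Fp (s - h) - Fp s)"
        by (simp flip: Bochner_Integration.integral_minus)
      moreover have "h * - ?S (- h) \<le> (LINT s|lebesgue_on {0..t}. Fp (s - h) - Fp s)"
        using Fp_increment[OF t, of "- h"] elim by (simp add: algebra_simps)
      ultimately have "(LINT s|lebesgue_on {0..t}. Fp s - Fp (s - h)) \<le> h * ?S (- h)" by simp
      then show ?case using elim by (simp add: divide_le_eq mult.commute)
    qed
  qed simp
qed

lemma slice:
  assumes "t < T" shows "AE s in lebesgue_on {0..t}. AE x in \<mu>. Wb s x = v s x \<and> U (s, x) = u s x \<and> \<gamma>' s = \<gamma> s"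
  using Wb_slice[OF assms] AE_space
proof eventually_elim
  case (elim s)
  then have s: "0 \<le> s" "s < T" using assms by auto
  show ?case using elim(1) U_eq[OF s] by eventually_elim (simp add: gamma'_eq[OF s(1)])
qed

text \<open>The boundary terms converge to the full increment of the squared velocity norm, while
  the bulk term with the derivative of the test function telescopes to half of it; half is left. The
  elliptic term telescopes likewise.\<close>

lemma energy_balance:
  assumes t: "0 < t" "t < T"
  shows "1/2 * ip \<mu> (v t) (v t) + 1/2 * a_form \<Omega> A (u t) (u t) - Fp t / (p + 1)
    + (LINT s|lebesgue_on {0..t}. LINT x|\<mu>. \<gamma> s * g (v s x) * v s x)
    = 1/2 * ip \<mu> (v 0) (v 0) + 1/2 * a_form \<Omega> A (u 0) (u 0) - Fp 0 / (p + 1)"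
proof -
  have t0: "0 \<le> t" using t by simp
  let ?\<phi> = "\<lambda>h s x. (ubar (s + h) x - ubar (s - h) x) / (2 * h)"
  let ?\<psi> = "\<lambda>h s x. (vbar (s + h) x - vbar (s - h) x) / (2 * h)"
  let ?KD = "\<lambda>z. \<gamma>' (fst z) * g (Wb (fst z) (snd z))"
  let ?KS = "\<lambda>z. \<bar>U z\<bar> powr (p - 1) * U z"
  have gb: "\<bar>\<gamma>' s\<bar> \<le> \<gamma> 0" for s using gamma'_bounds[of s] by simp
  note KD = damping_dual_integrable[OF gamma'_measurable gb, of t]
  note KS = source_dual_integrable[OF t(2)]
  let ?a = "\<lambda>s r. a_form \<Omega> A (ubar s) (ubar r)"
  let ?n = "\<lambda>s r. ip \<mu> (vbar s) (vbar r)"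
  let ?LD = "LINT z|\<pi> t. ?KD z * Wb (fst z) (snd z)" and ?LS = "LINT z|\<pi> t. ?KS z * Wb (fst z) (snd z)"
  have s1: "AE s in lebesgue_on {0..t}. AE x in \<mu>. ?KD (s, x) = \<gamma> s * g (v s x)"
    by (rule eventually_mono[OF slice[OF t(2)]], erule eventually_mono, simp)
  have s2: "AE s in lebesgue_on {0..t}. AE x in \<mu>. ?KD (s, x) * Wb (fst (s, x)) (snd (s, x)) = \<gamma> s * g (v s x) * v s x"
    by (rule eventually_mono[OF slice[OF t(2)]], erule eventually_mono, simp)
  have s3: "AE s in lebesgue_on {0..t}. AE x in \<mu>. ?KS (s, x) = \<bar>u s x\<bar> powr (p - 1) * u s x"
    by (rule eventually_mono[OF slice[OF t(2)]], erule eventually_mono, simp)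
  \<comment> \<open>The weak formulation for the central difference, rewritten so that every
    bilinear term is a difference at shifted times; it is available once
    \<open>t + h < T\<close>.\<close>
  have ident: "\<forall>\<^sub>F h in at_right 0.
      (ip \<mu> (ubar (t + h)) (vbar t) - ip \<mu> (ubar (t - h)) (vbar t)) / (2 * h)
      - (ip \<mu> (ubar (0 + h)) (vbar 0) - ip \<mu> (ubar (0 - h)) (vbar 0)) / (2 * h)
      + (LINT s|lebesgue_on {0..t}. (?a s (s + h) - ?a s (s - h)) / (2 * h))
      - (LINT s|lebesgue_on {0..t}. (?n s (s + h) - ?n s (s - h)) / (2 * h))
      + (LINT s|lebesgue_on {0..t}. LINT x|\<mu>. \<gamma> s * g (v s x) * ?\<phi> h s x)
      = (LINT s|lebesgue_on {0..t}. LINT x|\<mu>. \<bar>u s x\<bar> powr (p - 1) * u s x * ?\<phi> h s x)"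
    unfolding eventually_at_right_field
  proof (intro exI[of _ "T - t"] conjI allI impI)
    show "0 < T - t" using t by simp
    fix h :: real assume h: "0 < h" "h < T - t"
    have th: "t + h < T" using h by simp
    note test = central_difference_test_function[OF h(1) t(1) th]
    have tt: "t \<in> {0..t}" using t by simp
    have "weak_solution_on \<Omega> A \<gamma> g p m u0 u1 t u v" by (rule weak_sol[OF t(1)])
    then have w: "(LINT x|\<mu>. v t x * ?\<phi> h t x) - (LINT x|\<mu>. v 0 x * ?\<phi> h 0 x)
        + (LINT s|lebesgue_on {0..t}. a_form \<Omega> A (u s) (?\<phi> h s))
        - (LINT s|lebesgue_on {0..t}. LINT x|\<mu>. v s x * ?\<psi> h s x)
        + (LINT s|lebesgue_on {0..t}. LINT x|\<mu>. \<gamma> s * g (v s x) * ?\<phi> h s x)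
        = (LINT s|lebesgue_on {0..t}. LINT x|\<mu>. \<bar>u s x\<bar> powr (p - 1) * u s x * ?\<phi> h s x)"
      unfolding weak_solution_on_def using test(1-4) tt by blast
    have e1: "(LINT x|\<mu>. v r x * ?\<phi> h r x) = (ip \<mu> (ubar (r + h)) (vbar r) - ip \<mu> (ubar (r - h)) (vbar r)) / (2 * h)" if "0 \<le> r" for r
    proof -
      have "(LINT x|\<mu>. v r x * ?\<phi> h r x) = ip \<mu> (\<lambda>x. (1 / (2 * h)) *\<^sub>R (ubar (r + h) x - ubar (r - h) x)) (vbar r)"
        unfolding ip_def by (simp add: vbar_nonneg[OF that] mult_ac)
      then show ?thesis unfolding ip_scaleR_left by (simp add: ip_diff_left ubar_sq_int vbar_sq_int)
    qed
    have e2: "(LINT s|lebesgue_on {0..t}. a_form \<Omega> A (u s) (?\<phi> h s)) = (LINT s|lebesgue_on {0..t}. (?a s (s + h) - ?a s (s - h)) / (2 * h))"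
    proof (rule Bochner_Integration.integral_cong[OF refl])
      fix s assume "s \<in> space (lebesgue_on {0..t})"
      then have s: "0 \<le> s" by simp
      have "?\<phi> h s = (\<lambda>x. (1 / (2 * h)) * ubar (s + h) x + (- 1 / (2 * h)) * ubar (s - h) x)"
        by (simp add: fun_eq_iff diff_divide_distrib)
      then have "a_form \<Omega> A (u s) (?\<phi> h s) = (1 / (2 * h)) * ?a s (s + h) + (- 1 / (2 * h)) * ?a s (s - h)"
        using a_form_lin_right[OF H01_contD(2)[OF ubar_H01_cont] H01_contD(2)[OF ubar_H01_cont] H01_contD(2)[OF ubar_H01_cont], of s "1 / (2 * h)" "s + h" "- 1 / (2 * h)" "s - h"]
        by (simp add: ubar_nonneg[OF s])
      then show "a_form \<Omega> A (u s) (?\<phi> h s) = (?a s (s + h) - ?a s (s - h)) / (2 * h)"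
        by (simp add: diff_divide_distrib)
    qed
    have e3: "(LINT s|lebesgue_on {0..t}. LINT x|\<mu>. v s x * ?\<psi> h s x) = (LINT s|lebesgue_on {0..t}. (?n s (s + h) - ?n s (s - h)) / (2 * h))"
    proof (rule Bochner_Integration.integral_cong[OF refl])
      fix s assume "s \<in> space (lebesgue_on {0..t})"
      then have s: "0 \<le> s" by simp
      have "(LINT x|\<mu>. v s x * ?\<psi> h s x) = ip \<mu> (vbar s) (\<lambda>x. (1 / (2 * h)) *\<^sub>R (vbar (s + h) x - vbar (s - h) x))"
        unfolding ip_def by (simp add: vbar_nonneg[OF s])
      then show "(LINT x|\<mu>. v s x * ?\<psi> h s x) = (?n s (s + h) - ?n s (s - h)) / (2 * h)"
        unfolding ip_scaleR_right by (simp add: ip_diff_right vbar_sq_int)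
    qed
    show "(ip \<mu> (ubar (t + h)) (vbar t) - ip \<mu> (ubar (t - h)) (vbar t)) / (2 * h)
      - (ip \<mu> (ubar (0 + h)) (vbar 0) - ip \<mu> (ubar (0 - h)) (vbar 0)) / (2 * h)
      + (LINT s|lebesgue_on {0..t}. (?a s (s + h) - ?a s (s - h)) / (2 * h))
      - (LINT s|lebesgue_on {0..t}. (?n s (s + h) - ?n s (s - h)) / (2 * h))
      + (LINT s|lebesgue_on {0..t}. LINT x|\<mu>. \<gamma> s * g (v s x) * ?\<phi> h s x)
      = (LINT s|lebesgue_on {0..t}. LINT x|\<mu>. \<bar>u s x\<bar> powr (p - 1) * u s x * ?\<phi> h s x)"
      using w unfolding e1[OF t0] e1[OF order_refl] e2 e3 .
  qed
  have l1: "((\<lambda>h. (ip \<mu> (ubar (r + h)) (vbar r) - ip \<mu> (ubar (r - h)) (vbar r)) / (2 * h)) \<longlongrightarrow> ?n r r) (at_right 0)" for r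
    by (rule tendsto_within_subset[OF symmetric_difference_quotient[OF ip_ubar_deriv[OF vbar_sq_int]]]) simp
  have l3: "((\<lambda>h. LINT s|lebesgue_on {0..t}. (?a s (s + h) - ?a s (s - h)) / (2 * h)) \<longlongrightarrow> (?a t t - ?a 0 0) / 2) (at_right 0)"
    by (rule symmetric_telescoping_limit[OF a_form_continuous[OF ubar_H01_cont ubar_H01_cont] a_form_sym t0])
  have l4: "((\<lambda>h. LINT s|lebesgue_on {0..t}. (?n s (s + h) - ?n s (s - h)) / (2 * h)) \<longlongrightarrow> (?n t t - ?n 0 0) / 2) (at_right 0)"
    by (rule symmetric_telescoping_limit[OF sq_cont_ip_continuous[OF vbar_sq_cont vbar_sq_cont] ip_commute t0])
  have l5: "((\<lambda>h. LINT s|lebesgue_on {0..t}. LINT x|\<mu>. \<gamma> s * g (v s x) * ?\<phi> h s x) \<longlongrightarrow> ?LD) (at_right 0)"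
    by (rule central_difference_integral[OF t KD s1])
  have l6: "((\<lambda>h. LINT s|lebesgue_on {0..t}. LINT x|\<mu>. \<bar>u s x\<bar> powr (p - 1) * u s x * ?\<phi> h s x) \<longlongrightarrow> ?LS) (at_right 0)"
    by (rule central_difference_integral[OF t KS s3])
  have "?n t t - ?n 0 0 + (?a t t - ?a 0 0) / 2 - (?n t t - ?n 0 0) / 2 + ?LD = ?LS"
    by (rule tendsto_unique[OF _ Lim_transform_eventually[OF tendsto_add[OF tendsto_diff[OF tendsto_add[OF tendsto_diff[OF l1 l1] l3] l4] l5] ident] l6]) simp
  moreover have "(LINT s|lebesgue_on {0..t}. LINT x|\<mu>. \<gamma> s * g (v s x) * v s x) = ?LD"
    by (rule iterated_integral_eq(1)[OF avg_weak_limit(2)[OF t0 t(2) KD] s2])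
  moreover have "Fp t / (p + 1) - Fp 0 / (p + 1) = ?LS"
    using source_work[OF t] p by (simp add: diff_divide_distrib[symmetric])
  ultimately show ?thesis
    unfolding ubar_nonneg[OF t0] ubar_nonneg[OF order_refl] vbar_nonneg[OF t0] vbar_nonneg[OF order_refl] by argo
qed

end


section \<open>Integrability of the damping terms and the momentum identity\<close>

context joint_rep_u
begin

lemma damping_integrable:
  assumes t: "0 < t" "t < T"
  shows "integrable (\<pi> t) (\<lambda>z. g (Wb (fst z) (snd z)) * Wb (fst z) (snd z))"
    "integrable (\<pi> t) (\<lambda>z. g (Wb (fst z) (snd z)) * U z)"
    "integrable (\<pi> t) (\<lambda>z. \<gamma>' (fst z) * g (Wb (fst z) (snd z)) * Wb (fst z) (snd z))"
    "integrable (\<pi> t) (\<lambda>z. \<gamma>' (fst z) * g (Wb (fst z) (snd z)) * U z)"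
proof -
  have t0: "0 \<le> t" using t by simp
  have one: "(\<lambda>s::real. 1::real) \<in> borel_measurable borel" "\<bar>1::real\<bar> \<le> 1" by simp_all
  note K1 = damping_dual_integrable[OF one, of t]
  have gb: "\<bar>\<gamma>' s\<bar> \<le> \<gamma> 0" for s using gamma'_bounds[of s] by simp
  note K2 = damping_dual_integrable[OF gamma'_measurable gb, of t]
  show "integrable (\<pi> t) (\<lambda>z. g (Wb (fst z) (snd z)) * Wb (fst z) (snd z))"
    using avg_weak_limit(2)[OF t0 t(2) K1] by simp
  show "integrable (\<pi> t) (\<lambda>z. \<gamma>' (fst z) * g (Wb (fst z) (snd z)) * Wb (fst z) (snd z))"
    by (rule avg_weak_limit(2)[OF t0 t(2) K2])
  \<comment> \<open>\<open>U\<close> belongs to L^(m+1) because m+1 lies between 2 and 6, so it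
    pairs with every \<open>K\<close> of the dual exponent.\<close>
  have UK: "integrable (\<pi> t) (\<lambda>z. K z * U z)"
    if K: "K \<in> borel_measurable (\<pi> t)" "integrable (\<pi> t) (\<lambda>z. \<bar>K z\<bar> powr ((m + 1) / m))" for K
  proof (rule Bochner_Integration.integrable_bound)
    have q: "m + 1 > 1" "(m + 1) / m > 1" "1 / ((m + 1) / m) + 1 / (m + 1) = 1"
      using m by (auto simp: field_simps)
    show "integrable (\<pi> t) (\<lambda>z. \<bar>K z\<bar> powr ((m + 1) / m) / ((m + 1) / m) + \<bar>U z\<bar> powr (m + 1) / (m + 1))"
      using K(2) U_Lq(2)[OF t(2), of "m + 1"] m by simp
    show "(\<lambda>z. K z * U z) \<in> borel_measurable (\<pi> t)" using K(1) U_pi_measurable by simp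
    have "\<bar>a * b\<bar> \<le> \<bar>a\<bar> powr ((m + 1) / m) / ((m + 1) / m) + \<bar>b\<bar> powr (m + 1) / (m + 1)" for a b
      unfolding abs_mult by (rule Youngs_inequality[OF q(2,1,3)]) auto
    then show "AE z in \<pi> t. norm (K z * U z) \<le> norm (\<bar>K z\<bar> powr ((m + 1) / m) / ((m + 1) / m) + \<bar>U z\<bar> powr (m + 1) / (m + 1))"
      using m by (intro AE_I2) (simp del: times_divide_eq_left divide_divide_eq_right)
  qed
  show "integrable (\<pi> t) (\<lambda>z. g (Wb (fst z) (snd z)) * U z)" using UK[OF K1] by simp
  show "integrable (\<pi> t) (\<lambda>z. \<gamma>' (fst z) * g (Wb (fst z) (snd z)) * U z)" by (rule UK[OF K2])
qed

lemma damping_slices: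
  assumes t: "0 < t" "t < T"
  shows "integrable (lebesgue_on {0..t}) (\<lambda>s. LINT x|\<mu>. g (v s x) * v s x)"
    "integrable (lebesgue_on {0..t}) (\<lambda>s. LINT x|\<mu>. g (v s x) * u s x)"
    "integrable (lebesgue_on {0..t}) (\<lambda>s. LINT x|\<mu>. \<gamma> s * g (v s x) * v s x)"
    "integrable (lebesgue_on {0..t}) (\<lambda>s. LINT x|\<mu>. \<gamma> s * g (v s x) * u s x)"
    "AE s in lebesgue_on {0..t}. integrable \<mu> (\<lambda>x. g (v s x) * v s x)"
    "AE s in lebesgue_on {0..t}. integrable \<mu> (\<lambda>x. g (v s x) * u s x)"
proof -
  note d = damping_integrable[OF t]
  note e = iterated_integral_eq(2,3)[OF d(1), of "\<lambda>s x. g (v s x) * v s x"] iterated_integral_eq(2,3)[OF d(2), of "\<lambda>s x. g (v s x) * u s x"]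
    iterated_integral_eq(2)[OF d(3), of "\<lambda>s x. \<gamma> s * g (v s x) * v s x"] iterated_integral_eq(2)[OF d(4), of "\<lambda>s x. \<gamma> s * g (v s x) * u s x"]
  show "integrable (lebesgue_on {0..t}) (\<lambda>s. LINT x|\<mu>. g (v s x) * v s x)"
    by (rule e(1), rule eventually_mono[OF slice[OF t(2)]], erule eventually_mono, simp)
  show "integrable (lebesgue_on {0..t}) (\<lambda>s. LINT x|\<mu>. g (v s x) * u s x)"
    by (rule e(3), rule eventually_mono[OF slice[OF t(2)]], erule eventually_mono, simp)
  show "integrable (lebesgue_on {0..t}) (\<lambda>s. LINT x|\<mu>. \<gamma> s * g (v s x) * v s x)"
    by (rule e(5), rule eventually_mono[OF slice[OF t(2)]], erule eventually_mono, simp)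
  show "integrable (lebesgue_on {0..t}) (\<lambda>s. LINT x|\<mu>. \<gamma> s * g (v s x) * u s x)"
    by (rule e(6), rule eventually_mono[OF slice[OF t(2)]], erule eventually_mono, simp)
  show "AE s in lebesgue_on {0..t}. integrable \<mu> (\<lambda>x. g (v s x) * v s x)"
    by (rule e(2), rule eventually_mono[OF slice[OF t(2)]], erule eventually_mono, simp)
  show "AE s in lebesgue_on {0..t}. integrable \<mu> (\<lambda>x. g (v s x) * u s x)"
    by (rule e(4), rule eventually_mono[OF slice[OF t(2)]], erule eventually_mono, simp)
qed

text \<open>Here \<open>u\<close> is its own test function: m+1 is at most 6, so the Sobolev
  inequality puts \<open>u\<close> into the required space-time class.\<close>

lemma momentum_balance:
  assumes t: "0 < t" "t < T"
  shows "ip \<mu> (v t) (u t) - ip \<mu> (v 0) (u 0) + (LINT s|lebesgue_on {0..t}. a_form \<Omega> A (u s) (u s))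
    - (LINT s|lebesgue_on {0..t}. ip \<mu> (v s) (v s)) + (LINT s|lebesgue_on {0..t}. LINT x|\<mu>. \<gamma> s * g (v s x) * u s x)
    = (LINT s|lebesgue_on {0..t}. Fp s)"
proof -
  have w: "weak_solution_on \<Omega> A \<gamma> g p m u0 u1 t u v" by (rule weak_sol[OF t(1)])
  have "in_Lp_spacetime \<Omega> t (m + 1) u"
  proof (rule in_Lp_spacetimeI[OF U_borel])
    show "(\<integral>\<^sup>+z. ennreal (\<bar>U z\<bar> powr (m + 1)) \<partial>\<pi> t) < \<infinity>" by (rule U_Lq(1)[OF t(2)]) (use m in auto)
    show "AE x in \<mu>. U (s, x) = u s x" if "s \<in> {0<..<t}" for s
      by (rule U_eq) (use that t in auto)
  qed
  moreover have "continuous_into_H01 \<Omega> t u" "has_L2_time_derivative \<Omega> t u v" "continuous_into_L2 \<Omega> t v"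
    using w by (simp_all add: weak_solution_on_def)
  moreover have "t \<in> {0..t}" using t by simp
  ultimately have b: "(LINT x|\<mu>. v t x * u t x) - (LINT x|\<mu>. v 0 x * u 0 x)
        + (LINT s|lebesgue_on {0..t}. a_form \<Omega> A (u s) (u s))
        - (LINT s|lebesgue_on {0..t}. LINT x|\<mu>. v s x * v s x)
        + (LINT s|lebesgue_on {0..t}. LINT x|\<mu>. \<gamma> s * g (v s x) * u s x)
        = (LINT s|lebesgue_on {0..t}. LINT x|\<mu>. \<bar>u s x\<bar> powr (p - 1) * u s x * u s x)"
    using w unfolding weak_solution_on_def by blast
  have "\<bar>a\<bar> powr (p - 1) * a * a = \<bar>a\<bar> powr (p + 1)" for a :: real
  proof (cases "a = 0")
    case False
    have "\<bar>a\<bar> powr ((p - 1) + 2) = \<bar>a\<bar> powr (p - 1) * \<bar>a\<bar> powr 2" by (rule powr_add)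
    moreover have "\<bar>a\<bar> powr 2 = a * a" using False by (simp add: powr_numeral power2_eq_square)
    moreover have "(p - 1) + 2 = p + 1" by simp
    ultimately show ?thesis by (simp only: mult.assoc)
  qed simp
  then have "(LINT s|lebesgue_on {0..t}. LINT x|\<mu>. \<bar>u s x\<bar> powr (p - 1) * u s x * u s x) = (LINT s|lebesgue_on {0..t}. Fp s)"
    by (intro Bochner_Integration.integral_cong refl) (simp add: Fp_def ubar_nonneg)
  with b show ?thesis by (simp add: ip_def)
qed

end

section \<open>Scalar functions of time and their balance laws\<close>

context damped_wave
begin

text \<open>The quadratic quantities carry no factor 1/2. Those built from \<open>ubar\<close> and
  \<open>vbar\<close> are continuous on the whole line, while the integrands of \<open>dmp\<close>
  and \<open>crs\<close> are known to be integrable at almost every time only.\<close>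

definition kin :: "real \<Rightarrow> real" where "kin s = ip \<mu> (vbar s) (vbar s)"
definition pot :: "real \<Rightarrow> real" where "pot s = a_form \<Omega> A (ubar s) (ubar s)"
definition src :: "real \<Rightarrow> real" where "src s = (LINT x|\<mu>. \<bar>ubar s x\<bar> powr (p + 1))"
definition mom :: "real \<Rightarrow> real" where "mom s = ip \<mu> (vbar s) (ubar s)"
definition dmp :: "real \<Rightarrow> real" where "dmp s = (LINT x|\<mu>. g (v s x) * v s x)"
definition crs :: "real \<Rightarrow> real" where "crs s = (LINT x|\<mu>. g (v s x) * u s x)"
definition en :: "real \<Rightarrow> real" where "en s = 1/2 * kin s + 1/2 * pot s - src s / (p + 1)"

lemma diag_continuous:
  fixes k :: "real \<Rightarrow> real \<Rightarrow> real"
  assumes "continuous_on UNIV (\<lambda>(s, r). k s r)" shows "continuous_on UNIV (\<lambda>s. k s s)"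
proof -
  have "continuous_on UNIV (\<lambda>r :: real. (r, r))" by (intro continuous_intros)
  from continuous_on_compose2[OF assms this] show ?thesis by simp
qed

lemma time_functions_continuous:
  "continuous_on UNIV kin" "continuous_on UNIV pot" "continuous_on UNIV src" "continuous_on UNIV mom" "continuous_on UNIV en"
proof -
  show k: "continuous_on UNIV kin"
    unfolding kin_def[abs_def] by (rule diag_continuous[OF sq_cont_ip_continuous[OF vbar_sq_cont vbar_sq_cont]])
  show a: "continuous_on UNIV pot"
    unfolding pot_def[abs_def] by (rule diag_continuous[OF a_form_continuous[OF ubar_H01_cont ubar_H01_cont]])
  show f: "continuous_on UNIV src"
    unfolding src_def[abs_def] by (intro continuous_at_imp_continuous_on ballI Lq_continuous[OF ubar_H01_cont]) (use p in auto)
  show "continuous_on UNIV mom"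
    unfolding mom_def[abs_def] by (rule diag_continuous[OF sq_cont_ip_continuous[OF vbar_sq_cont H01_cont_sq_cont(1)[OF ubar_H01_cont]]])
  show "continuous_on UNIV en"
    unfolding en_def[abs_def] by (intro continuous_intros k a f) (use p in auto)
qed

lemma en_eq_energy:
  assumes "0 \<le> t" shows "energy \<Omega> A p (u t) (v t) = en t"
proof -
  have "0 \<le> src t" unfolding src_def by simp
  then have "Lp_norm \<Omega> (p + 1) (u t) powr (p + 1) = src t"
    using p assms by (simp add: Lp_norm_def powr_powr src_def ubar_nonneg)
  then show ?thesis
    unfolding energy_def en_def kin_def pot_def
    by (simp add: Lp_norm_2 nrm_sq_ip ubar_nonneg[OF assms] vbar_nonneg[OF assms])
qed

text \<open>Each horizon has its own representatives; those for \<open>t + 1\<close> are used, and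
  they vanish from the conclusion. At \<open>t = 0\<close> the two identities are trivial, and the
  other claims follow by restriction.\<close>

lemma balance:
  assumes t: "0 \<le> t"
  shows "integrable (lebesgue_on {0..t}) dmp" "integrable (lebesgue_on {0..t}) crs"
    "integrable (lebesgue_on {0..t}) (\<lambda>s. \<gamma> s * dmp s)" "integrable (lebesgue_on {0..t}) (\<lambda>s. \<gamma> s * crs s)"
    "AE s in lebesgue_on {0..t}. integrable \<mu> (\<lambda>x. g (v s x) * v s x)"
    "AE s in lebesgue_on {0..t}. integrable \<mu> (\<lambda>x. g (v s x) * u s x)"
    "en t + (LINT s|lebesgue_on {0..t}. \<gamma> s * dmp s) = en 0"
    "mom t - mom 0 = (LINT s|lebesgue_on {0..t}. kin s - pot s + src s - \<gamma> s * crs s)"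
proof -
  have pos: "integrable (lebesgue_on {0..t}) dmp \<and> integrable (lebesgue_on {0..t}) crs \<and>
    integrable (lebesgue_on {0..t}) (\<lambda>s. \<gamma> s * dmp s) \<and> integrable (lebesgue_on {0..t}) (\<lambda>s. \<gamma> s * crs s) \<and>
    (AE s in lebesgue_on {0..t}. integrable \<mu> (\<lambda>x. g (v s x) * v s x)) \<and>
    (AE s in lebesgue_on {0..t}. integrable \<mu> (\<lambda>x. g (v s x) * u s x)) \<and>
    en t + (LINT s|lebesgue_on {0..t}. \<gamma> s * dmp s) = en 0 \<and>
    mom t - mom 0 = (LINT s|lebesgue_on {0..t}. kin s - pot s + src s - \<gamma> s * crs s)" if t: "0 < t" for t
  proof -
    have "t + 1 > 0" using t by simp
    then obtain W where "joint_rep \<Omega> A \<omega> p m b1 b2 \<gamma> g u0 u1 u v (t + 1) W" by (rule joint_rep_exists)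
    then interpret J: joint_rep \<Omega> A \<omega> p m b1 b2 \<gamma> g u0 u1 u v "t + 1" W .
    obtain U where "joint_rep_u \<Omega> A \<omega> p m b1 b2 \<gamma> g u0 u1 u v (t + 1) W U" by (rule J.joint_rep_u_exists)
    then interpret J: joint_rep_u \<Omega> A \<omega> p m b1 b2 \<gamma> g u0 u1 u v "t + 1" W U .
    have t': "t < t + 1" and t0: "0 \<le> t" using t by simp_all
    note d = J.damping_slices[OF t t']
    have e: "(LINT x|\<mu>. \<gamma> s * g (v s x) * v s x) = \<gamma> s * dmp s" "(LINT x|\<mu>. \<gamma> s * g (v s x) * u s x) = \<gamma> s * crs s" for s
      by (simp_all add: dmp_def crs_def mult.assoc)
    have Fp: "J.Fp s = src s" for s by (simp add: J.Fp_def src_def)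
    note simps = en_def kin_def pot_def mom_def ubar_nonneg vbar_nonneg
    have "en t + (LINT s|lebesgue_on {0..t}. \<gamma> s * dmp s) = en 0"
      using J.energy_balance[OF t t'] unfolding e Fp
      by (simp add: simps t0)
    moreover have "mom t - mom 0 = (LINT s|lebesgue_on {0..t}. kin s - pot s + src s - \<gamma> s * crs s)"
    proof -
      have c: "integrable (lebesgue_on {0..t}) kin" "integrable (lebesgue_on {0..t}) pot" "integrable (lebesgue_on {0..t}) src"
        by (intro continuous_imp_integrable_real continuous_on_subset[OF time_functions_continuous(1)]
            continuous_on_subset[OF time_functions_continuous(2)] continuous_on_subset[OF time_functions_continuous(3)]; simp)+
      have i: "(LINT s|lebesgue_on {0..t}. a_form \<Omega> A (u s) (u s)) = (LINT s|lebesgue_on {0..t}. pot s)"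
        "(LINT s|lebesgue_on {0..t}. ip \<mu> (v s) (v s)) = (LINT s|lebesgue_on {0..t}. kin s)"
        by (intro Bochner_Integration.integral_cong refl; simp add: simps)+
      have "(LINT s|lebesgue_on {0..t}. kin s - pot s + src s - \<gamma> s * crs s)
          = (LINT s|lebesgue_on {0..t}. kin s) - (LINT s|lebesgue_on {0..t}. pot s) + (LINT s|lebesgue_on {0..t}. src s) - (LINT s|lebesgue_on {0..t}. \<gamma> s * crs s)"
        using c d(4) unfolding e by simp
      moreover have "mom t = ip \<mu> (v t) (u t)" "mom 0 = ip \<mu> (v 0) (u 0)" by (simp_all add: simps t0)
      ultimately show ?thesis using J.momentum_balance[OF t t'] unfolding e Fp i by argo
    qed
    ultimately show ?thesis using d unfolding e by (simp add: dmp_def[abs_def] crs_def[abs_def])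
  qed
  have n0: "{0::real} \<in> null_sets lebesgue" by simp
  have sub: "integrable (lebesgue_on {0..t}) f" if "integrable (lebesgue_on {0..t + 1}) f" for f :: "real \<Rightarrow> real"
    using that by (rule integrable_subinterval) (use t in auto)
  have t1: "0 < t + 1" using t by simp
  note P = pos[OF t1]
  show "integrable (lebesgue_on {0..t}) dmp" "integrable (lebesgue_on {0..t}) crs"
    "integrable (lebesgue_on {0..t}) (\<lambda>s. \<gamma> s * dmp s)" "integrable (lebesgue_on {0..t}) (\<lambda>s. \<gamma> s * crs s)"
    using P by (auto intro: sub)
  show "AE s in lebesgue_on {0..t}. integrable \<mu> (\<lambda>x. g (v s x) * v s x)" "AE s in lebesgue_on {0..t}. integrable \<mu> (\<lambda>x. g (v s x) * u s x)"
    by (rule AE_lebesgue_on_subset[of _ "{0..t+1}"]; use P in auto)+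
  have z: "(LINT s|lebesgue_on {0..0::real}. f s) = 0" for f :: "real \<Rightarrow> real"
  proof (rule integral_eq_zero_AE)
    have "AE s in lebesgue. s \<notin> {0::real}" by (rule AE_not_in[OF n0])
    then have "AE s in lebesgue. s \<in> {0..0} \<longrightarrow> f s = 0" by eventually_elim simp
    then show "AE s in lebesgue_on {0..0}. f s = 0" by (rule iffD2[OF AE_restrict_space_iff, rotated]) simp
  qed
  show "en t + (LINT s|lebesgue_on {0..t}. \<gamma> s * dmp s) = en 0"
  proof (cases "t = 0")
    case True
    show ?thesis unfolding True z by simp
  next
    case False
    then show ?thesis using pos[of t] t by simp
  qed
  show "mom t - mom 0 = (LINT s|lebesgue_on {0..t}. kin s - pot s + src s - \<gamma> s * crs s)"
  proof (cases "t = 0")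
    case True
    show ?thesis unfolding True z by simp
  next
    case False
    then show ?thesis using pos[of t] t by simp
  qed
qed

end


section \<open>The potential well\<close>

text \<open>A negative constant would force every gradient norm to vanish, and then a still smaller
  constant would do, against minimality.\<close>

lemma embedding_constant_nonneg:
  assumes "optimal_H01_embedding_constant S q M" shows "0 \<le> M"
proof (rule ccontr)
  assume "\<not> 0 \<le> M"
  then have M: "M < 0" by simp
  have b: "H01_embedding_bound S q M" and opt: "\<And>K. H01_embedding_bound S q K \<Longrightarrow> M \<le> K"
    using assms by (auto simp: optimal_H01_embedding_constant_def)
  have "H01_embedding_bound S q (M - 1)"
    unfolding H01_embedding_bound_def
  proof (intro ballI conjI)
    fix v assume v: "v \<in> H01 S"
    show "v \<in> Lp_space S q" using b v by (simp add: H01_embedding_bound_def)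
    have l: "Lp_norm S q v \<le> M * grad_norm S v" using b v by (simp add: H01_embedding_bound_def)
    have g0: "0 \<le> grad_norm S v" by (simp add: grad_norm_def Lp_norm_def)
    have "0 \<le> Lp_norm S q v" by (simp add: Lp_norm_def)
    then have "0 \<le> M * grad_norm S v" using l by simp
    then have "grad_norm S v = 0" using M g0 by (simp add: zero_le_mult_iff)
    then show "Lp_norm S q v \<le> (M - 1) * grad_norm S v" using l by simp
  qed
  from opt[OF this] show False by simp
qed

locale potential_well = damped_wave +
  fixes M :: real
  assumes emb: "optimal_H01_embedding_constant \<Omega> (p + 1) M"
    and init: "u0 \<in> H01 \<Omega>" "u1 \<in> Lp_space \<Omega> 2"
    and en_pos: "0 < energy \<Omega> A p u0 u1"
    and en_small: "energy \<Omega> A p u0 u1 < (1/2 - 1 / (p + 1)) * (\<omega> powr ((p + 1) / 2) / M powr (p + 1)) powr (2 / (p - 1))"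
    and pot_small: "a_form \<Omega> A u0 u0 < (\<omega> powr ((p + 1) / 2) / M powr (p + 1)) powr (2 / (p - 1))"
begin

text \<open>The positive level \<open>l\<close> at which the bound
  \<open>M powr (p + 1) * (l / \<omega>) powr ((p + 1) / 2)\<close> for the source equals
  \<open>l\<close> itself.\<close>

definition lev :: real where "lev = (\<omega> powr ((p + 1) / 2) / M powr (p + 1)) powr (2 / (p - 1))"

lemma M_pos: "0 < M"
proof -
  have "M \<noteq> 0"
  proof
    assume "M = 0"
    \<comment> \<open>Division by zero yields zero, so the smallness condition would contradict the
      positive initial energy.\<close>
    then have "(\<omega> powr ((p + 1) / 2) / M powr (p + 1)) powr (2 / (p - 1)) = 0" by simp
    with en_small have "energy \<Omega> A p u0 u1 < (1/2 - 1 / (p + 1)) * 0" by (simp only:)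
    then show False using en_pos by simp
  qed
  then show ?thesis using embedding_constant_nonneg[OF emb] by simp
qed

lemma lambda0_pos: "0 < lev"
  using M_pos omega_pos by (simp add: lev_def)

text \<open>The data agree with the solution at time zero only almost everywhere, but every term of
  the energy depends on classes alone.\<close>

lemma initial_values: "energy \<Omega> A p u0 u1 = en 0" "a_form \<Omega> A u0 u0 = pot 0"
proof -
  have w: "weak_solution_on \<Omega> A \<gamma> g p m u0 u1 1 u v" by (rule weak_sol) simp
  have e: "AE x in \<mu>. u 0 x = u0 x" "AE x in \<mu>. v 0 x = u1 x" using w by (simp_all add: weak_solution_on_def)
  have a: "a_form \<Omega> A u0 u0 = a_form \<Omega> A (u 0) (u 0)"
    unfolding a_form_def wgrad_cong_AE[OF dom_sets e(1)] ..
  then show "a_form \<Omega> A u0 u0 = pot 0" by (simp add: pot_def ubar_nonneg)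
  have m: "u 0 \<in> borel_measurable \<mu>" "v 0 \<in> borel_measurable \<mu>"
    using sq_int_measurable[OF ubar_sq_int[of 0]] sq_int_measurable[OF vbar_sq_int[of 0]] by (simp_all add: ubar_nonneg vbar_nonneg)
  have L: "Lp_norm \<Omega> q f = Lp_norm \<Omega> q f'" if "f \<in> borel_measurable \<mu>" "AE x in \<mu>. f x = f' x" for q and f f' :: "real^3 \<Rightarrow> real"
  proof -
    have fm: "(\<lambda>x. \<bar>f x\<bar> powr q) \<in> borel_measurable \<mu>" using that(1) by measurable
    have "(LINT x|\<mu>. \<bar>f x\<bar> powr q) = (LINT x|\<mu>. \<bar>f' x\<bar> powr q)"
      by (rule integral_cong_AE_lebesgue_on[OF dom_sets fm]) (use that(2) in \<open>auto elim: eventually_mono\<close>)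
    then show ?thesis by (simp add: Lp_norm_def)
  qed
  have "energy \<Omega> A p u0 u1 = energy \<Omega> A p (u 0) (v 0)"
    unfolding energy_def a L[OF m(1) e(1)] L[OF m(2) e(2)] ..
  then show "energy \<Omega> A p u0 u1 = en 0" by (simp add: en_eq_energy)
qed

lemma pot_grad: "\<omega> * (grad_norm \<Omega> (ubar t))\<^sup>2 \<le> pot t"
  unfolding pot_def by (rule a_form_coercive[OF H01_contD(2)[OF ubar_H01_cont]])

lemma pot_nonneg: "0 \<le> pot t"
  by (rule order_trans[OF _ pot_grad]) (use omega_pos in simp)

lemma kin_nonneg: "0 \<le> kin t"
  unfolding kin_def nrm_sq_ip[symmetric] by simp

lemma dmp_nonneg: "0 \<le> dmp t"
  unfolding dmp_def by (simp add: g_sign)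

lemma src_nonneg: "0 \<le> src t"
  unfolding src_def by simp

text \<open>Embedding and coercivity bound the source by the power (p+1)/2 of \<open>pot\<close>;
  splitting off one factor leaves the ratio to \<open>lev\<close>.\<close>

lemma src_le: "src t \<le> pot t * (pot t / lev) powr ((p - 1) / 2)"
proof -
  let ?r = "(p + 1) / 2" and ?G = "grad_norm \<Omega> (ubar t)"
  have p1: "p + 1 > 0" "p - 1 > 0" using p by auto
  have "Lp_norm \<Omega> (p + 1) (ubar t) \<le> M * ?G"
    using emb H01_contD(1)[OF ubar_H01_cont] by (simp add: optimal_H01_embedding_constant_def H01_embedding_bound_def)
  moreover have "Lp_norm \<Omega> (p + 1) (ubar t) = src t powr (1 / (p + 1))" by (simp add: Lp_norm_def src_def)
  ultimately have "(src t powr (1 / (p + 1))) powr (p + 1) \<le> (M * ?G) powr (p + 1)"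
    using p1 by (intro powr_mono2) auto
  then have 1: "src t \<le> M powr (p + 1) * ?G powr (p + 1)"
    using p1 src_nonneg[of t] by (simp add: powr_powr powr_mult)
  have "?G powr (p + 1) = (?G\<^sup>2) powr ?r"
  proof (cases "?G = 0")
    case False
    then have "?G\<^sup>2 = ?G powr 2" using grad_norm_nonneg[of "ubar t"] by (simp add: powr_numeral)
    moreover have "(?G powr 2) powr ?r = ?G powr (2 * ?r)" by (rule powr_powr)
    moreover have "2 * ?r = p + 1" by simp
    ultimately show ?thesis by (simp only:)
  qed simp
  also have "\<dots> \<le> (pot t / \<omega>) powr ?r"
    using pot_grad[of t] omega_pos p1 by (intro powr_mono2) (auto simp: le_divide_eq mult.commute)
  finally have "src t \<le> M powr (p + 1) * (pot t / \<omega>) powr ?r"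
    using 1 by (meson mult_left_mono order_trans powr_ge_zero)
  also have "\<dots> = pot t powr ?r / (\<omega> powr ?r / M powr (p + 1))"
    by (simp add: powr_divide)
  also have "\<omega> powr ?r / M powr (p + 1) = lev powr ((p - 1) / 2)"
  proof -
    have e: "2 / (p - 1) * ((p - 1) / 2) = 1" using p1 by simp
    show ?thesis unfolding lev_def powr_powr e using omega_pos M_pos by simp
  qed
  also have "pot t powr ?r = pot t * pot t powr ((p - 1) / 2)"
  proof (cases "pot t = 0")
    case False
    then have "pot t > 0" using pot_nonneg[of t] by simp
    then have "pot t powr (1 + (p - 1) / 2) = pot t * pot t powr ((p - 1) / 2)" by (simp add: powr_add)
    moreover have "1 + (p - 1) / 2 = ?r" by (simp add: field_simps)
    ultimately show ?thesis by simp
  qed simp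
  finally show ?thesis by (simp add: powr_divide)
qed

lemma en_antimono:
  assumes "0 \<le> s" "s \<le> t" shows "en t \<le> en s"
proof -
  have t: "0 \<le> t" using assms by simp
  note b1 = balance(3,7)[OF assms(1)] and b2 = balance(3,7)[OF t]
  have "(LINT r|lebesgue_on {0..s}. \<gamma> r * dmp r) \<le> (LINT r|lebesgue_on {0..t}. \<gamma> r * dmp r)"
  proof -
    have e: "(LINT r|lebesgue_on {0..a}. \<gamma> r * dmp r) = integral {0..a} (\<lambda>r. \<gamma> r * dmp r)"
      if "integrable (lebesgue_on {0..a}) (\<lambda>r. \<gamma> r * dmp r)" for a
      using that by (rule lebesgue_integral_eq_integral) simp
    have "integral {0..s} (\<lambda>r. \<gamma> r * dmp r) \<le> integral {0..t} (\<lambda>r. \<gamma> r * dmp r)"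
    proof (rule integral_subset_le)
      show "(\<lambda>r. \<gamma> r * dmp r) integrable_on {0..s}" "(\<lambda>r. \<gamma> r * dmp r) integrable_on {0..t}"
        using b1(1) b2(1) by (auto intro: integrable_on_lebesgue_on)
      show "\<forall>r\<in>{0..t}. 0 \<le> \<gamma> r * dmp r"
        using mult_nonneg_nonneg[OF gamma_nonneg dmp_nonneg] by simp
    qed (use assms in auto)
    then show ?thesis unfolding e[OF b1(1)] e[OF b2(1)] .
  qed
  then show ?thesis using b1(2) b2(2) by linarith
qed

text \<open>The energy is at least \<open>\<phi> (pot t)\<close> with a continuous \<open>\<phi>\<close> that exceeds \<open>en 0\<close> slightly below
  \<open>lev\<close>; hence \<open>pot\<close> cannot cross that level.\<close>

lemma trapped:
  obtains \<theta> where "0 \<le> \<theta>" "\<theta> < 1" "\<And>t. 0 \<le> t \<Longrightarrow> src t \<le> \<theta> * pot t" "\<And>t. 0 \<le> t \<Longrightarrow> pot t \<le> lev"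
proof -
  define \<phi> where "\<phi> l = 1/2 * l - l * (l / lev) powr ((p - 1) / 2) / (p + 1)" for l
  have c: "isCont \<phi> lev"
    unfolding \<phi>_def[abs_def] using lambda0_pos p by (auto intro!: continuous_intros)
  have "\<phi> lev = (1/2 - 1 / (p + 1)) * lev"
    using lambda0_pos by (simp add: \<phi>_def algebra_simps)
  then have "en 0 < \<phi> lev" using en_small unfolding initial_values(1) lev_def by simp
  then have "\<forall>\<^sub>F l in at lev. en 0 < \<phi> l" using c by (intro order_tendstoD(1)[of \<phi> "\<phi> lev"]) (auto simp: isCont_def)
  then have "\<forall>\<^sub>F l in at_left lev. en 0 < \<phi> l" by (rule filter_leD[OF at_le[OF subset_UNIV]])
  moreover have p0: "pot 0 < lev" using pot_small unfolding initial_values(2) lev_def .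
  then have "\<forall>\<^sub>F l in at_left lev. l \<in> {pot 0<..<lev}" by (intro eventually_at_leftI[of "pot 0"]) auto
  ultimately have "\<forall>\<^sub>F l in at_left lev. en 0 < \<phi> l \<and> l \<in> {pot 0<..<lev}" by (rule eventually_conj)
  then obtain l where l: "en 0 < \<phi> l" "pot 0 < l" "l < lev"
    using eventually_happens'[OF trivial_limit_at_left_real] by fastforce
  have l0: "l > 0" using l(2) pot_nonneg[of 0] by linarith
  have below: "pot t < l" if t: "0 \<le> t" for t
  proof (rule ccontr)
    assume "\<not> pot t < l"
    then have "l \<le> pot t" by simp
    then obtain s where s: "0 \<le> s" "s \<le> t" "pot s = l"
      using IVT'[of pot 0 l t] l(2) t continuous_on_subset[OF time_functions_continuous(2)] by auto
    have "src s / (p + 1) \<le> pot s * (pot s / lev) powr ((p - 1) / 2) / (p + 1)"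
      using src_le[of s] p by (intro divide_right_mono) auto
    then have "\<phi> l \<le> en s" using kin_nonneg[of s] s(3) by (simp add: en_def \<phi>_def)
    then show False using en_antimono[OF order_refl s(1)] l(1) by simp
  qed
  show ?thesis
  \<comment> \<open>The ratio is governed by the level \<open>l\<close>, strictly below
    \<open>lev\<close>, hence a factor below 1 that is uniform in time.\<close>
  proof (rule that[of "(l / lev) powr ((p - 1) / 2)"])
    show "0 \<le> (l / lev) powr ((p - 1) / 2)" by simp
    have "(l / lev) powr ((p - 1) / 2) < 1 powr ((p - 1) / 2)"
      using l l0 lambda0_pos p by (intro powr_less_mono2) auto
    then show "(l / lev) powr ((p - 1) / 2) < 1" by simp
    fix t :: real assume t: "0 \<le> t"
    have "pot t * (pot t / lev) powr ((p - 1) / 2) \<le> pot t * (l / lev) powr ((p - 1) / 2)"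
      using below[OF t] pot_nonneg[of t] lambda0_pos p by (intro mult_left_mono powr_mono2 divide_right_mono) auto
    then show "src t \<le> (l / lev) powr ((p - 1) / 2) * pot t" using src_le[of t] by (simp add: mult.commute)
    show "pot t \<le> lev" using below[OF t] l(3) by simp
  qed
qed

text \<open>What the decay argument takes from the potential well. The gap
  \<open>1 - \<theta>\<close> makes \<open>pot - src\<close> comparable to \<open>pot\<close>, and
  the sixth power of \<open>u\<close> becomes linear in the energy because \<open>pot\<close> stays
  below \<open>lev\<close>.\<close>

lemma well_bounds:
  "\<exists>K \<theta>. 0 < K \<and> \<theta> < 1 \<and> (\<forall>t\<ge>0. 0 \<le> en t) \<and>
    (\<forall>t\<ge>0. en t \<le> 1/2 * kin t + (pot t - src t) / (2 * (1 - \<theta>))) \<and>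
    (\<forall>t\<ge>0. \<bar>mom t\<bar> \<le> K * en t) \<and>
    (\<forall>t\<ge>0. (LINT x|\<mu>. (u t x)\<^sup>2 + (u t x) ^ 6) \<le> K * en t)"
proof -
  obtain \<theta> where th: "0 \<le> \<theta>" "\<theta> < 1" "\<And>t. 0 \<le> t \<Longrightarrow> src t \<le> \<theta> * pot t" "\<And>t. 0 \<le> t \<Longrightarrow> pot t \<le> lev"
    using trapped by blast
  \<comment> \<open>The share of \<open>pot\<close> left in the energy in the worst case
    \<open>src \<le> pot\<close>; being at most 1/2, it serves the kinetic part too.\<close>
  define c where "c = 1/2 - 1 / (p + 1)"
  have c: "c > 0" "c \<le> 1/2" using p by (auto simp: c_def field_simps)
  define P where "P = measure \<mu> \<Omega> + 4096"
  have P: "P > 0" by (simp add: P_def add_nonneg_pos)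
  have lower: "1/2 * kin t + c * pot t \<le> en t" if t: "0 \<le> t" for t
  proof -
    have "src t \<le> pot t" using th(3)[OF t] th(2) pot_nonneg[of t] mult_right_mono[of \<theta> 1 "pot t"] by simp
    then have "src t / (p + 1) \<le> pot t / (p + 1)" using p by (intro divide_right_mono) auto
    then show ?thesis by (simp add: en_def c_def algebra_simps)
  qed
  have pot_en: "pot t \<le> en t / c" "kin t \<le> en t / c" "0 \<le> en t" if t: "0 \<le> t" for t
  proof -
    note lower[OF t]
    moreover have "0 \<le> c * pot t" "0 \<le> kin t" using c pot_nonneg kin_nonneg by simp_all
    moreover have "c * kin t \<le> 1/2 * kin t" using c kin_nonneg by (intro mult_right_mono) auto
    ultimately have "c * pot t \<le> en t" "c * kin t \<le> en t" "0 \<le> en t" by linarith+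
    then show "pot t \<le> en t / c" "kin t \<le> en t / c" "0 \<le> en t" using c by (simp_all add: le_divide_eq mult.commute)
  qed
  have grad: "(grad_norm \<Omega> (ubar t))\<^sup>2 \<le> pot t / \<omega>" for t
    using pot_grad[of t] omega_pos by (simp add: le_divide_eq mult.commute)
  have l2: "(nrm \<mu> (ubar t))\<^sup>2 \<le> P / \<omega> * pot t" for t
  proof -
    have "(nrm \<mu> (ubar t))\<^sup>2 \<le> P * (grad_norm \<Omega> (ubar t))\<^sup>2"
      unfolding P_def by (rule poincare[OF H01_contD(1)[OF ubar_H01_cont]])
    also have "\<dots> \<le> P * (pot t / \<omega>)" using P by (intro mult_left_mono grad) auto
    finally show ?thesis by simp
  qed
  \<comment> \<open>One constant for two purposes: the momentum takes the first two summands, the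
    powers of \<open>u\<close> take the last two.\<close>
  define K where "K = (1 + P / \<omega> + 4096 * lev\<^sup>2 / \<omega> ^ 3) / c"
  have K: "K > 0" unfolding K_def using P omega_pos c by (intro divide_pos_pos add_pos_nonneg) auto
  show ?thesis
  proof (rule exI[of _ K], rule exI[of _ \<theta>], intro conjI allI impI K th(2))
    fix t :: real assume t: "0 \<le> t"
    show "0 \<le> en t" by (rule pot_en(3)[OF t])
    show "en t \<le> 1/2 * kin t + (pot t - src t) / (2 * (1 - \<theta>))"
    proof -
      have "en t \<le> 1/2 * kin t + pot t / 2" using src_nonneg[of t] p by (simp add: en_def)
      moreover have "(1 - \<theta>) * pot t \<le> pot t - src t" using th(3)[OF t] by (simp add: algebra_simps)
      then have "pot t / 2 \<le> (pot t - src t) / (2 * (1 - \<theta>))" using th(2) by (simp add: field_simps)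
      ultimately show ?thesis by linarith
    qed
    have k0: "0 \<le> 4096 * lev\<^sup>2 / \<omega> ^ 3" using omega_pos by simp
    have "\<bar>mom t\<bar> \<le> nrm \<mu> (vbar t) * nrm \<mu> (ubar t)" unfolding mom_def by (rule ip_CS[OF vbar_sq_int ubar_sq_int])
    also have "\<dots> \<le> ((nrm \<mu> (vbar t))\<^sup>2 + (nrm \<mu> (ubar t))\<^sup>2) / 2"
      using sum_squares_bound[of "nrm \<mu> (vbar t)" "nrm \<mu> (ubar t)"] by simp
    also have "\<dots> \<le> kin t + P / \<omega> * pot t"
    proof -
      have N: "(nrm \<mu> (vbar t))\<^sup>2 = kin t" by (simp add: nrm_sq_ip kin_def)
      have "(a + b) / 2 \<le> a' + X" if "a = a'" "b \<le> X" "0 \<le> a'" "0 \<le> b" for a a' b X :: real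
        using that by argo
      from this[OF N l2[of t] kin_nonneg zero_le_power2] show ?thesis .
    qed
    also have "\<dots> \<le> en t / c + P / \<omega> * (en t / c)"
      using P omega_pos by (intro add_mono pot_en(2)[OF t] mult_left_mono pot_en(1)[OF t]) auto
    also have "\<dots> = (1 + P / \<omega> + 0) / c * en t" by (simp add: add_divide_distrib distrib_right)
    also have "\<dots> \<le> K * en t"
      unfolding K_def using c k0 pot_en(3)[OF t] by (intro mult_right_mono divide_right_mono add_left_mono) auto
    finally show "\<bar>mom t\<bar> \<le> K * en t" .
    note sob = sobolev_H01[OF open_dom H01_contD(1)[OF ubar_H01_cont, of t]]
    have sq: "integrable \<mu> (\<lambda>x. (ubar t x)\<^sup>2)" using ubar_sq_int[of t] by (simp add: sq_int_def)
    have "(grad_norm \<Omega> (ubar t)) ^ 6 = ((grad_norm \<Omega> (ubar t))\<^sup>2) ^ 3" by simp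
    also have "\<dots> \<le> (pot t / \<omega>) ^ 3" by (intro power_mono grad) auto
    also have "\<dots> = pot t ^ 2 * pot t / \<omega> ^ 3" by (simp add: power_divide power3_eq_cube power2_eq_square)
    also have "\<dots> \<le> lev\<^sup>2 * pot t / \<omega> ^ 3"
      using omega_pos pot_nonneg[of t] th(4)[OF t] by (intro divide_right_mono mult_right_mono power_mono) auto
    finally have g6: "(grad_norm \<Omega> (ubar t)) ^ 6 \<le> lev\<^sup>2 / \<omega> ^ 3 * pot t" by simp
    have "(LINT x|\<mu>. (u t x)\<^sup>2 + (u t x) ^ 6) = (LINT x|\<mu>. (ubar t x)\<^sup>2) + (LINT x|\<mu>. (ubar t x) ^ 6)"
      using sq sob(1) by (simp add: ubar_nonneg[OF t])
    also have "(LINT x|\<mu>. (ubar t x)\<^sup>2) = (nrm \<mu> (ubar t))\<^sup>2" by (simp add: nrm_sq)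
    also have "(nrm \<mu> (ubar t))\<^sup>2 + (LINT x|\<mu>. (ubar t x) ^ 6) \<le> P / \<omega> * pot t + 4096 * (lev\<^sup>2 / \<omega> ^ 3 * pot t)"
      using l2[of t] sob(2) g6 by linarith
    also have "\<dots> = (P / \<omega> + 4096 * lev\<^sup>2 / \<omega> ^ 3) * pot t" by (simp add: algebra_simps)
    also have "\<dots> \<le> (P / \<omega> + 4096 * lev\<^sup>2 / \<omega> ^ 3) * (en t / c)"
      using P omega_pos k0 by (intro mult_left_mono pot_en(1)[OF t]) auto
    also have "\<dots> \<le> (1 + P / \<omega> + 4096 * lev\<^sup>2 / \<omega> ^ 3) * (en t / c)"
      using c pot_en(3)[OF t] by (intro mult_right_mono) auto
    finally show "(LINT x|\<mu>. (u t x)\<^sup>2 + (u t x) ^ 6) \<le> K * en t" by (simp add: K_def)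
  qed
qed

end


section \<open>Weighted energy estimate\<close>

lemma powr_Suc_eq: "0 \<le> e \<Longrightarrow> e powr (q + 1) = e powr q * e" for e q :: real
  by (cases "e = 0") (simp_all add: powr_add)

text \<open>\<open>k\<close> is the growth order of \<open>h\<close>, either 1 or \<open>m\<close>.
  Of the two bounds near zero, one controls the velocity and the other the damping itself.\<close>

locale damped_decay = potential_well +
  fixes k c :: real
  assumes k: "1 \<le> k" and c: "0 < c"
    and near_zero: "\<And>y. \<bar>y\<bar> \<le> 1 \<Longrightarrow> c * \<bar>y\<bar> powr (k + 1) \<le> g y * y \<and> c * \<bar>g y\<bar> powr (k + 1) \<le> g y * y"
begin

text \<open>For \<open>k > 1\<close> this is the solution of
  \<open>\<kappa> * ((k + 1) / (k - 1)) = \<kappa> + 1\<close>.\<close>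

definition \<kappa> :: real where "\<kappa> = (k - 1) / 2"

lemma kappa_nonneg: "0 \<le> \<kappa>"
  using k by (simp add: \<kappa>_def)

text \<open>Young's inequality with exponents (k+1)/(k-1) and (k+1)/2. For \<open>k = 1\<close> the
  first would be infinite, but then the weight is at most 1.\<close>

lemma young_square:
  assumes "\<epsilon> > 0"
  shows "\<exists>C\<ge>0. \<forall>e\<ge>0. \<forall>Y\<ge>0. e powr \<kappa> * Y\<^sup>2 \<le> \<epsilon> * e powr (\<kappa> + 1) + C * Y powr (k + 1)"
proof (cases "k = 1")
  case True
  have "e powr \<kappa> * Y\<^sup>2 \<le> \<epsilon> * e powr (\<kappa> + 1) + 1 * Y powr (k + 1)" if "e \<ge> 0" "Y \<ge> 0" for e Y :: real
  proof -
    \<comment> \<open>Only an inequality for the power can follow, because \<open>0 powr 0\<close>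
      is 0.\<close>
    have "\<kappa> = 0" unfolding \<kappa>_def using True by simp
    then have "e powr \<kappa> \<le> 1" unfolding powr_def by (simp only: mult_zero_left exp_zero) simp
    then have "e powr \<kappa> * Y\<^sup>2 \<le> 1 * Y\<^sup>2" by (intro mult_right_mono) auto
    moreover have "Y powr (k + 1) = Y\<^sup>2" using True that(2) by (cases "Y = 0") (simp_all add: powr_numeral)
    moreover have "0 \<le> \<epsilon> * e powr (\<kappa> + 1)" using assms by simp
    ultimately show ?thesis by linarith
  qed
  then show ?thesis by (intro exI[of _ 1]) auto
next
  case False
  then have k1: "k > 1" using k by simp
  have P: "(k + 1) / (k - 1) > 1" "(k + 1) / 2 > 1" "1 / ((k + 1) / (k - 1)) + 1 / ((k + 1) / 2) = 1"
    using k1 by (simp_all add: divide_simps)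
  have "\<exists>C>0. \<forall>a\<ge>0. \<forall>b\<ge>0. a * b \<le> \<epsilon> * a powr ((k + 1) / (k - 1)) + C * b powr ((k + 1) / 2)"
    by (rule young_eps[OF P assms]) auto
  then obtain C where C: "C > 0" "\<And>a b. a \<ge> 0 \<Longrightarrow> b \<ge> 0 \<Longrightarrow> a * b \<le> \<epsilon> * a powr ((k + 1) / (k - 1)) + C * b powr ((k + 1) / 2)"
    by blast
  have "e powr \<kappa> * Y\<^sup>2 \<le> \<epsilon> * e powr (\<kappa> + 1) + C * Y powr (k + 1)" if "e \<ge> 0" "Y \<ge> 0" for e Y :: real
  proof -
    have "e powr \<kappa> * Y\<^sup>2 \<le> \<epsilon> * (e powr \<kappa>) powr ((k + 1) / (k - 1)) + C * (Y\<^sup>2) powr ((k + 1) / 2)"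
      by (rule C(2)) auto
    moreover have "(e powr \<kappa>) powr ((k + 1) / (k - 1)) = e powr (\<kappa> + 1)"
    proof -
      have "(k - 1) / 2 * ((k + 1) / (k - 1)) = (k + 1) / 2" using k1 by (simp add: divide_simps)
      also have "\<dots> = (k - 1) / 2 + 1" by argo
      finally have "\<kappa> * ((k + 1) / (k - 1)) = \<kappa> + 1" unfolding \<kappa>_def .
      then show ?thesis by (simp only: powr_powr)
    qed
    moreover have "(Y\<^sup>2) powr ((k + 1) / 2) = Y powr (k + 1)"
    proof (cases "Y = 0")
      case False
      then have "Y\<^sup>2 = Y powr 2" using that(2) by (simp add: powr_numeral)
      moreover have "(Y powr 2) powr ((k + 1) / 2) = Y powr (2 * ((k + 1) / 2))" by (rule powr_powr)
      moreover have "2 * ((k + 1) / 2) = k + 1" by simp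
      ultimately show ?thesis by (simp only:)
    qed simp
    ultimately show ?thesis by simp
  qed
  then show ?thesis using C(1) by (intro exI[of _ C]) auto
qed

text \<open>The product of \<open>g y\<close> and \<open>z\<close> is split into
  \<open>\<epsilon> * z\<^sup>2\<close> and a multiple of \<open>(g y)\<^sup>2\<close>; the squares
  of \<open>y\<close> and of \<open>g y\<close> then yield to \<open>young_square\<close> and the
  bounds near zero.\<close>

lemma pointwise_near:
  assumes \<epsilon>: "\<epsilon> > 0"
  shows "\<exists>C\<ge>0. \<forall>e\<ge>0. \<forall>y z. \<bar>y\<bar> \<le> 1 \<longrightarrow>
    e powr \<kappa> * (y\<^sup>2 + \<bar>g y * z\<bar>) \<le> \<epsilon> * (e powr (\<kappa> + 1) + e powr \<kappa> * (z\<^sup>2 + z ^ 6)) + C * (g y * y)"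
proof -
  \<comment> \<open>The second value turns into \<epsilon>/2 after division by 4 \<epsilon>, so both
    uses of \<open>young_square\<close> together cost \<epsilon>.\<close>
  have e1: "\<epsilon> / 2 > 0" "2 * \<epsilon>\<^sup>2 > 0" using \<epsilon> by simp_all
  obtain C1 where C1: "C1 \<ge> 0" "\<forall>e\<ge>0. \<forall>Y\<ge>0. e powr \<kappa> * Y\<^sup>2 \<le> \<epsilon> / 2 * e powr (\<kappa> + 1) + C1 * Y powr (k + 1)"
    using young_square[OF e1(1)] by (elim exE conjE)
  obtain C2 where C2: "C2 \<ge> 0" "\<forall>e\<ge>0. \<forall>Y\<ge>0. e powr \<kappa> * Y\<^sup>2 \<le> 2 * \<epsilon>\<^sup>2 * e powr (\<kappa> + 1) + C2 * Y powr (k + 1)"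
    using young_square[OF e1(2)] by (elim exE conjE)
  define C where "C = C1 / c + C2 / (4 * \<epsilon> * c)"
  have "e powr \<kappa> * (y\<^sup>2 + \<bar>g y * z\<bar>) \<le> \<epsilon> * (e powr (\<kappa> + 1) + e powr \<kappa> * (z\<^sup>2 + z ^ 6)) + C * (g y * y)"
    if e: "e \<ge> 0" and y: "\<bar>y\<bar> \<le> 1" for e y z
  proof -
    let ?a = "e powr \<kappa>" and ?A = "e powr (\<kappa> + 1)" and ?D = "g y * y"
    have n: "\<bar>y\<bar> powr (k + 1) \<le> ?D / c" "\<bar>g y\<bar> powr (k + 1) \<le> ?D / c"
      using near_zero[OF y] c by (simp_all add: le_divide_eq mult.commute)
    have 1: "?a * y\<^sup>2 \<le> \<epsilon> / 2 * ?A + C1 * (?D / c)"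
    proof -
      have "?a * \<bar>y\<bar>\<^sup>2 \<le> \<epsilon> / 2 * ?A + C1 * \<bar>y\<bar> powr (k + 1)" by (rule C1(2)[rule_format, OF e]) simp
      also have "C1 * \<bar>y\<bar> powr (k + 1) \<le> C1 * (?D / c)" by (intro mult_left_mono n C1)
      finally show ?thesis by simp
    qed
    have 2: "?a * (g y)\<^sup>2 \<le> 2 * \<epsilon>\<^sup>2 * ?A + C2 * (?D / c)"
    proof -
      have "?a * \<bar>g y\<bar>\<^sup>2 \<le> 2 * \<epsilon>\<^sup>2 * ?A + C2 * \<bar>g y\<bar> powr (k + 1)" by (rule C2(2)[rule_format, OF e]) simp
      also have "C2 * \<bar>g y\<bar> powr (k + 1) \<le> C2 * (?D / c)" by (intro mult_left_mono n C2)
      finally show ?thesis by simp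
    qed
    have 3: "\<bar>g y * z\<bar> \<le> \<epsilon> * z\<^sup>2 + (g y)\<^sup>2 / (4 * \<epsilon>)"
    proof -
      have "0 \<le> (2 * \<epsilon> * \<bar>z\<bar> - \<bar>g y\<bar>)\<^sup>2" by simp
      then have "4 * \<epsilon> * \<bar>g y * z\<bar> \<le> 4 * \<epsilon> * (\<epsilon> * z\<^sup>2) + (g y)\<^sup>2"
        by (simp add: power2_diff power_mult_distrib abs_mult power2_eq_square algebra_simps)
      then show ?thesis using \<epsilon> by (simp add: field_simps)
    qed
    have "?a * (y\<^sup>2 + \<bar>g y * z\<bar>) \<le> ?a * (y\<^sup>2 + (\<epsilon> * z\<^sup>2 + (g y)\<^sup>2 / (4 * \<epsilon>)))"
      by (intro mult_left_mono add_left_mono 3) simp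
    also have "\<dots> = ?a * y\<^sup>2 + \<epsilon> * (?a * z\<^sup>2) + (?a * (g y)\<^sup>2) / (4 * \<epsilon>)" by (simp add: algebra_simps)
    also have "\<dots> \<le> (\<epsilon> / 2 * ?A + C1 * (?D / c)) + \<epsilon> * (?a * (z\<^sup>2 + z ^ 6)) + (2 * \<epsilon>\<^sup>2 * ?A + C2 * (?D / c)) / (4 * \<epsilon>)"
      using \<epsilon> by (intro add_mono 1 2 divide_right_mono mult_left_mono) auto
    also have "\<dots> = \<epsilon> * (?A + ?a * (z\<^sup>2 + z ^ 6)) + C * ?D"
      using \<epsilon> c by (simp add: C_def field_simps power2_eq_square)
    finally show ?thesis .
  qed
  moreover have "C \<ge> 0" using C1(1) C2(1) c \<epsilon> by (simp add: C_def)
  ultimately show ?thesis by blast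
qed

text \<open>For large \<open>y\<close> the dissipation dominates \<open>y\<^sup>2\<close> and the
  dual power of \<open>g y\<close> outright; the bound on the energy turns the weight in front of it
  into a constant.\<close>

lemma pointwise_far:
  assumes \<epsilon>: "\<epsilon> > 0" and E: "E \<ge> 0"
  shows "\<exists>C\<ge>0. \<forall>e y z. 0 \<le> e \<longrightarrow> e \<le> E \<longrightarrow> 1 < \<bar>y\<bar> \<longrightarrow>
    e powr \<kappa> * (y\<^sup>2 + \<bar>g y * z\<bar>) \<le> \<epsilon> * (e powr (\<kappa> + 1) + e powr \<kappa> * (z\<^sup>2 + z ^ 6)) + C * (g y * y)"
proof -
  have P: "m + 1 > 1" "(m + 1) / m > 1" "1 / (m + 1) + 1 / ((m + 1) / m) = 1"
    using m by (auto simp: field_simps)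
  have "\<exists>C>0. \<forall>a\<ge>0. \<forall>b\<ge>0. a * b \<le> \<epsilon> * a powr (m + 1) + C * b powr ((m + 1) / m)"
    by (rule young_eps[OF P \<epsilon>]) auto
  then obtain C3 where C3: "C3 > 0" "\<And>a b. a \<ge> 0 \<Longrightarrow> b \<ge> 0 \<Longrightarrow> a * b \<le> \<epsilon> * a powr (m + 1) + C3 * b powr ((m + 1) / m)"
    by blast
  define C where "C = E powr \<kappa> * (1 / b1 + C3 * b2 powr (1 / m))"
  have "e powr \<kappa> * (y\<^sup>2 + \<bar>g y * z\<bar>) \<le> \<epsilon> * (e powr (\<kappa> + 1) + e powr \<kappa> * (z\<^sup>2 + z ^ 6)) + C * (g y * y)"
    if e: "0 \<le> e" "e \<le> E" and y: "1 < \<bar>y\<bar>" for e y z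
  proof -
    let ?a = "e powr \<kappa>" and ?D = "g y * y"
    have D: "0 \<le> ?D" by (rule g_sign)
    have "\<bar>y\<bar> powr 2 \<le> \<bar>y\<bar> powr (m + 1)" using y m by (intro powr_mono) auto
    also have "\<dots> \<le> ?D / b1" using g_growth[OF y] b by (simp add: le_divide_eq mult.commute)
    finally have 1: "y\<^sup>2 \<le> 1 / b1 * ?D" using y by (simp add: powr_numeral)
    have "\<bar>g y\<bar> powr ((m + 1) / m) \<le> b2 powr (1 / m) * ?D"
    proof (cases "g y = 0")
      case False
      have "(m + 1) / m = 1 + 1 / m" using m by (simp add: field_simps)
      then have "\<bar>g y\<bar> powr ((m + 1) / m) = \<bar>g y\<bar> * \<bar>g y\<bar> powr (1 / m)" using False by (simp add: powr_add)
      also have "\<bar>g y\<bar> powr (1 / m) \<le> (b2 * \<bar>y\<bar> powr m) powr (1 / m)"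
        using g_large(2)[OF y] m by (intro powr_mono2) auto
      also have "\<dots> = b2 powr (1 / m) * \<bar>y\<bar>" using b y m by (simp add: powr_mult powr_powr)
      finally have "\<bar>g y\<bar> powr ((m + 1) / m) \<le> \<bar>g y\<bar> * (b2 powr (1 / m) * \<bar>y\<bar>)" by (simp add: mult_left_mono)
      also have "\<dots> = b2 powr (1 / m) * ?D" using g_abs[of y] by (simp add: mult.left_commute)
      finally show ?thesis .
    qed (use D in simp)
    then have 2: "C3 * \<bar>g y\<bar> powr ((m + 1) / m) \<le> C3 * (b2 powr (1 / m) * ?D)" using C3(1) by (intro mult_left_mono) auto
    have z: "\<epsilon> * \<bar>z\<bar> powr (m + 1) \<le> \<epsilon> * (z\<^sup>2 + z ^ 6)"
      using \<epsilon> m by (intro mult_left_mono powr_le_sq_plus_sixth) auto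
    have "\<bar>g y * z\<bar> = \<bar>z\<bar> * \<bar>g y\<bar>" by (simp add: abs_mult)
    also have "\<dots> \<le> \<epsilon> * \<bar>z\<bar> powr (m + 1) + C3 * \<bar>g y\<bar> powr ((m + 1) / m)" by (rule C3(2)) auto
    finally have "y\<^sup>2 + \<bar>g y * z\<bar> \<le> \<epsilon> * (z\<^sup>2 + z ^ 6) + (1 / b1 + C3 * b2 powr (1 / m)) * ?D"
      using 1 2 z by (simp add: algebra_simps)
    then have "?a * (y\<^sup>2 + \<bar>g y * z\<bar>) \<le> ?a * (\<epsilon> * (z\<^sup>2 + z ^ 6) + (1 / b1 + C3 * b2 powr (1 / m)) * ?D)"
      by (rule mult_left_mono) simp
    also have "\<dots> = \<epsilon> * (?a * (z\<^sup>2 + z ^ 6)) + ?a * ((1 / b1 + C3 * b2 powr (1 / m)) * ?D)" by (simp add: algebra_simps)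
    also have "?a * ((1 / b1 + C3 * b2 powr (1 / m)) * ?D) \<le> E powr \<kappa> * ((1 / b1 + C3 * b2 powr (1 / m)) * ?D)"
      using e D b C3(1) kappa_nonneg by (intro mult_right_mono powr_mono2) auto
    also have "\<epsilon> * (?a * (z\<^sup>2 + z ^ 6)) \<le> \<epsilon> * (e powr (\<kappa> + 1) + ?a * (z\<^sup>2 + z ^ 6))"
      using \<epsilon> by (intro mult_left_mono) auto
    finally show ?thesis by (simp add: C_def mult.assoc)
  qed
  moreover have "C \<ge> 0" using C3(1) b by (simp add: C_def)
  ultimately show ?thesis by blast
qed

lemma pointwise:
  assumes \<epsilon>: "\<epsilon> > 0" and E: "E \<ge> 0"
  shows "\<exists>C\<ge>0. \<forall>e y z. 0 \<le> e \<longrightarrow> e \<le> E \<longrightarrow>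
    e powr \<kappa> * (y\<^sup>2 + \<bar>g y * z\<bar>) \<le> \<epsilon> * (e powr (\<kappa> + 1) + e powr \<kappa> * (z\<^sup>2 + z ^ 6)) + C * (g y * y)"
proof -
  obtain C1 where C1: "C1 \<ge> 0" "\<forall>e\<ge>0. \<forall>y z. \<bar>y\<bar> \<le> 1 \<longrightarrow>
    e powr \<kappa> * (y\<^sup>2 + \<bar>g y * z\<bar>) \<le> \<epsilon> * (e powr (\<kappa> + 1) + e powr \<kappa> * (z\<^sup>2 + z ^ 6)) + C1 * (g y * y)"
    using pointwise_near[OF \<epsilon>] by (elim exE conjE)
  obtain C2 where C2: "C2 \<ge> 0" "\<forall>e y z. 0 \<le> e \<longrightarrow> e \<le> E \<longrightarrow> 1 < \<bar>y\<bar> \<longrightarrow>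
    e powr \<kappa> * (y\<^sup>2 + \<bar>g y * z\<bar>) \<le> \<epsilon> * (e powr (\<kappa> + 1) + e powr \<kappa> * (z\<^sup>2 + z ^ 6)) + C2 * (g y * y)"
    using pointwise_far[OF \<epsilon> E] by (elim exE conjE)
  show ?thesis
  proof (intro exI[of _ "C1 + C2"] conjI allI impI)
    show "0 \<le> C1 + C2" using C1 C2 by simp
    fix e y z :: real assume e: "0 \<le> e" "e \<le> E"
    have D: "0 \<le> C1 * (g y * y)" "0 \<le> C2 * (g y * y)" by (intro mult_nonneg_nonneg C1 C2 g_sign)+
    have d: "(C1 + C2) * (g y * y) = C1 * (g y * y) + C2 * (g y * y)" by (rule distrib_right)
    show "e powr \<kappa> * (y\<^sup>2 + \<bar>g y * z\<bar>) \<le> \<epsilon> * (e powr (\<kappa> + 1) + e powr \<kappa> * (z\<^sup>2 + z ^ 6)) + (C1 + C2) * (g y * y)"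
    proof (cases "\<bar>y\<bar> \<le> 1")
      case True
      then show ?thesis using C1(2)[rule_format, OF e(1) True, of z] D unfolding d by linarith
    next
      case False
      then have "1 < \<bar>y\<bar>" by simp
      from C2(2)[rule_format, OF e this, of z] show ?thesis using D unfolding d by linarith
    qed
  qed
qed

end


section \<open>Integration in time against the monotone weight\<close>

context damped_decay
begin

text \<open>Constant for negative times, hence decreasing on the whole line and therefore Borel
  measurable.\<close>

definition wt :: "real \<Rightarrow> real" where "wt s = \<gamma>' s * en (max s 0) powr \<kappa>"

lemma en_nonneg: "0 \<le> t \<Longrightarrow> 0 \<le> en t"
  using well_bounds by blast

lemma en_le_initial: "0 \<le> t \<Longrightarrow> en t \<le> en 0"
  by (rule en_antimono) auto

lemma wt_antimono: "s \<le> t \<Longrightarrow> wt t \<le> wt s"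
  unfolding wt_def
  using gamma'_bounds kappa_nonneg
  by (intro mult_mono powr_mono2 en_antimono en_nonneg) (auto simp: \<gamma>'_def intro!: gamma_antimono)

lemma wt_bounds: "0 \<le> wt s" "wt s \<le> \<gamma> 0 * en 0 powr \<kappa>"
proof -
  show "0 \<le> wt s" unfolding wt_def using gamma'_bounds by simp
  show "wt s \<le> \<gamma> 0 * en 0 powr \<kappa>" unfolding wt_def
    using gamma'_bounds kappa_nonneg order_trans[OF gamma'_bounds]
    by (intro mult_mono powr_mono2 en_antimono en_nonneg) auto
qed

lemma wt_measurable: "wt \<in> borel_measurable borel"
proof -
  have "mono (\<lambda>s. - wt s)" unfolding mono_def by (auto intro: wt_antimono)
  then have "(\<lambda>s. - (- wt s)) \<in> borel_measurable borel"
    by (intro borel_measurable_uminus borel_measurable_mono)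
  then show ?thesis by simp
qed

lemma wt_times_integrable:
  assumes "integrable (lebesgue_on {a..b}) f"
  shows "integrable (lebesgue_on {a..b}) (\<lambda>s. wt s * f s)"
proof (rule Bochner_Integration.integrable_bound)
  have wm: "wt \<in> borel_measurable (lebesgue_on {a..b})"
    by (rule measurable_compose[OF id_measurable_lebesgue_on wt_measurable])
  show "integrable (lebesgue_on {a..b}) (\<lambda>s. \<gamma> 0 * en 0 powr \<kappa> * f s)" using assms by simp
  show "(\<lambda>s. wt s * f s) \<in> borel_measurable (lebesgue_on {a..b})"
    using wm borel_measurable_integrable[OF assms] by simp
  have "\<bar>wt s * x\<bar> \<le> \<bar>\<gamma> 0 * en 0 powr \<kappa> * x\<bar>" for s x
    using wt_bounds[of s] gamma_nonneg[of 0] mult_right_mono[OF wt_bounds(2) abs_ge_zero, of s x] by (simp add: abs_mult)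
  then show "AE s in lebesgue_on {a..b}. norm (wt s * f s) \<le> norm (\<gamma> 0 * en 0 powr \<kappa> * f s)"
    by (intro AE_I2) simp
qed

text \<open>The density whose integral is the increment of the momentum \<open>mom\<close>.\<close>

definition rate :: "real \<Rightarrow> real" where "rate s = kin s - pot s + src s - \<gamma> s * crs s"

lemma continuous_integrable_Icc: "continuous_on UNIV f \<Longrightarrow> integrable (lebesgue_on {a..b}) f" for f :: "real \<Rightarrow> real"
  by (rule continuous_imp_integrable_real) (erule continuous_on_subset, rule subset_UNIV)

lemma rate_integrable:
  assumes "0 \<le> a" "a \<le> b"
  shows "integrable (lebesgue_on {a..b}) rate"
proof -
  have "0 \<le> b" using assms by simp
  note i = balance(4)[OF this]
  have "integrable (lebesgue_on {a..b}) (\<lambda>s. \<gamma> s * crs s)"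
    by (rule integrable_subinterval[OF i]) (use assms in auto)
  then show ?thesis unfolding rate_def[abs_def]
    by (intro Bochner_Integration.integrable_diff Bochner_Integration.integrable_add
        time_functions_continuous[THEN continuous_integrable_Icc])
qed

text \<open>Links the Lebesgue integral with the gauge integral, for which additivity over intervals
  and the second mean value theorem are used.\<close>

lemma integral_split:
  fixes f :: "real \<Rightarrow> real"
  assumes f: "integrable (lebesgue_on {0..b}) f" and ab: "0 \<le> a" "a \<le> b"
  shows "integrable (lebesgue_on {a..b}) f" "f integrable_on {a..b}"
    "(LINT s|lebesgue_on {a..b}. f s) = integral {a..b} f"
    "integral {a..b} f = (LINT s|lebesgue_on {0..b}. f s) - (LINT s|lebesgue_on {0..a}. f s)"
proof -
  show i: "integrable (lebesgue_on {a..b}) f" by (rule integrable_subinterval[OF f]) (use ab in auto)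
  have i0: "integrable (lebesgue_on {0..a}) f" by (rule integrable_subinterval[OF f]) (use ab in auto)
  have e: "(LINT s|lebesgue_on {c..d}. f s) = integral {c..d} f" "f integrable_on {c..d}" if "integrable (lebesgue_on {c..d}) f" for c d
    using lebesgue_integral_eq_integral[OF that] integrable_on_lebesgue_on[OF that] by auto
  show "f integrable_on {a..b}" "(LINT s|lebesgue_on {a..b}. f s) = integral {a..b} f" using e[OF i] by auto
  show "integral {a..b} f = (LINT s|lebesgue_on {0..b}. f s) - (LINT s|lebesgue_on {0..a}. f s)"
    unfolding e(1)[OF f] e(1)[OF i0] using Henstock_Kurzweil_Integration.integral_combine[OF ab e(2)[OF f]] by simp
qed

lemma rate_integral:
  assumes "0 \<le> a" "a \<le> b"
  shows "rate integrable_on {a..b}" "integral {a..b} rate = mom b - mom a"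
proof -
  have b: "0 \<le> b" using assms by simp
  note r = integral_split[OF rate_integrable[OF order_refl b] assms]
  show "rate integrable_on {a..b}" by (rule r(2))
  show "integral {a..b} rate = mom b - mom a"
    using r(4) balance(8)[OF b] balance(8)[OF assms(1)] by (simp add: rate_def)
qed

text \<open>The second mean value theorem replaces the integration by parts that would need a
  derivative of the weight.\<close>

lemma wt_rate_bound:
  assumes K: "\<And>t. 0 \<le> t \<Longrightarrow> \<bar>mom t\<bar> \<le> K * en t" "0 \<le> K" and ST: "0 \<le> S" "S \<le> T"
  shows "\<bar>LINT s|lebesgue_on {S..T}. wt s * rate s\<bar> \<le> 4 * K * (\<gamma> 0 * en 0 powr \<kappa>) * en S"
proof -
  \<comment> \<open>Negated, since the mean value theorem is applied to an increasing
    weight.\<close>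
  have neg: "(\<lambda>s. - wt s) x \<le> (\<lambda>s. - wt s) y" if "S \<le> x" "x \<le> y" "y \<le> T" for x y
    using wt_antimono[OF that(2)] by simp
  have m: "\<bar>mom t\<bar> \<le> K * en S" if "S \<le> t" for t
    using K(1)[of t] mult_left_mono[OF en_antimono[OF ST(1) that] K(2)] that ST by simp
  obtain r where r: "r \<in> {S..T}"
    "((\<lambda>s. - wt s * rate s) has_integral (- wt S * integral {S..r} rate + - wt T * integral {r..T} rate)) {S..T}"
    by (rule second_mean_value_theorem_full[OF rate_integral(1)[OF ST] ST(2) neg])
  have i: "integral {S..r} rate = mom r - mom S" "integral {r..T} rate = mom T - mom r"
    by (rule rate_integral(2); use r(1) ST in auto)+
  have "integral {S..T} (\<lambda>s. - (wt s * rate s)) = - wt S * (mom r - mom S) + - wt T * (mom T - mom r)"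
    using integral_unique[OF r(2)] unfolding i by simp
  then have I: "integral {S..T} (\<lambda>s. wt s * rate s) = wt S * (mom r - mom S) + wt T * (mom T - mom r)"
    by simp
  \<comment> \<open>Each of the two terms carries a momentum difference of at most
    \<open>2 * (K * en S)\<close>, whence the factor 4.\<close>
  have w: "\<bar>wt s * (x - y)\<bar> \<le> (\<gamma> 0 * en 0 powr \<kappa>) * (2 * (K * en S))" if "\<bar>x\<bar> \<le> K * en S" "\<bar>y\<bar> \<le> K * en S" for s x y
  proof -
    have "\<bar>x - y\<bar> \<le> 2 * (K * en S)" using that by linarith
    then have "wt s * \<bar>x - y\<bar> \<le> (\<gamma> 0 * en 0 powr \<kappa>) * (2 * (K * en S))"
      by (intro mult_mono wt_bounds order_trans[OF wt_bounds]) auto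
    then show ?thesis using wt_bounds(1)[of s] by (simp add: abs_mult)
  qed
  have "\<bar>wt S * (mom r - mom S)\<bar> \<le> (\<gamma> 0 * en 0 powr \<kappa>) * (2 * (K * en S))"
    "\<bar>wt T * (mom T - mom r)\<bar> \<le> (\<gamma> 0 * en 0 powr \<kappa>) * (2 * (K * en S))"
    using r(1) ST by (auto intro!: w m)
  then have "\<bar>integral {S..T} (\<lambda>s. wt s * rate s)\<bar> \<le> (\<gamma> 0 * en 0 powr \<kappa>) * (2 * (K * en S)) + (\<gamma> 0 * en 0 powr \<kappa>) * (2 * (K * en S))"
    unfolding I using abs_triangle_ineq[of "wt S * (mom r - mom S)" "wt T * (mom T - mom r)"] by linarith
  moreover have "(LINT s|lebesgue_on {S..T}. wt s * rate s) = integral {S..T} (\<lambda>s. wt s * rate s)"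
    by (rule lebesgue_integral_eq_integral[OF wt_times_integrable[OF rate_integrable[OF ST]]]) simp
  ultimately show ?thesis by (simp add: algebra_simps)
qed

lemma gamma_integrable: "integrable (lebesgue_on {0..t}) \<gamma>"
proof -
  interpret finite_measure "lebesgue_on {0..t}" by (rule finite_measure_lebesgue_on) simp
  have "integrable (lebesgue_on {0..t}) \<gamma>'"
  proof (rule integrable_const_bound[of _ "\<gamma> 0"])
    show "AE s in lebesgue_on {0..t}. norm (\<gamma>' s) \<le> \<gamma> 0" using gamma'_bounds by (intro AE_I2) simp
    show "\<gamma>' \<in> borel_measurable (lebesgue_on {0..t})"
      by (rule measurable_compose[OF id_measurable_lebesgue_on gamma'_measurable])
  qed
  moreover have "integrable (lebesgue_on {0..t}) \<gamma>' \<longleftrightarrow> integrable (lebesgue_on {0..t}) \<gamma>"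
    by (rule Bochner_Integration.integrable_cong[OF refl]) (simp add: gamma'_eq)
  ultimately show ?thesis by simp
qed

definition Gam :: "real \<Rightarrow> real" where "Gam t = (LINT s|lebesgue_on {0..t}. \<gamma> s)"

text \<open>The energy is bounded by \<open>kin\<close> and \<open>pot - src\<close>, and the latter
  equals \<open>kin - \<gamma> * crs - rate\<close>. The pointwise inequality leaves half of
  \<open>wt * en\<close> and a multiple of the dissipation, which integrates to a drop of energy;
  \<open>rate\<close> is controlled by the momentum.\<close>

lemma weighted_estimate:
  "\<exists>C>0. \<forall>S T. 0 \<le> S \<longrightarrow> S \<le> T \<longrightarrow> en T powr (\<kappa> + 1) * (Gam T - Gam S) \<le> C * en S"
proof -
  obtain K \<theta> where "0 < K" "\<theta> < 1" and K': "\<forall>t\<ge>0. 0 \<le> en t"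
    "\<forall>t\<ge>0. en t \<le> 1/2 * kin t + (pot t - src t) / (2 * (1 - \<theta>))"
    "\<forall>t\<ge>0. \<bar>mom t\<bar> \<le> K * en t"
    "\<forall>t\<ge>0. (LINT x|\<mu>. (u t x)\<^sup>2 + (u t x) ^ 6) \<le> K * en t"
    using well_bounds by (elim exE conjE)
  note K = \<open>0 < K\<close> \<open>\<theta> < 1\<close> K'[rule_format]
  define d where "d = 1 / (2 * (1 - \<theta>))"
  have d: "d > 0" using K(2) by (simp add: d_def)
  \<comment> \<open>Dominates the coefficient \<open>1/2 + d\<close> of \<open>kin\<close> as well
    as the coefficient \<open>d * \<gamma> 0\<close> of \<open>crs\<close>.\<close>
  define L where "L = (1/2 + d) * (1 + \<gamma> 0)"
  have g0: "0 \<le> \<gamma> 0" by (rule gamma_nonneg) simp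
  have L: "L > 0" unfolding L_def using d g0 by (intro mult_pos_pos) auto
  \<comment> \<open>The measure comes from the constant term of the pointwise inequality,
    \<open>K\<close> from the powers of \<open>u\<close>; both multiply the same power of the
    energy.\<close>
  define B where "B = measure \<mu> \<Omega> + K"
  have B: "B > 0" using K(1) by (simp add: B_def add_nonneg_pos)
  \<comment> \<open>Makes \<open>L * (\<epsilon> * B)\<close> equal to 1/2, so that half of
    \<open>wt * en\<close> can be absorbed.\<close>
  define \<epsilon> where "\<epsilon> = 1 / (2 * L * B)"
  have \<epsilon>: "\<epsilon> > 0" using L B by (simp add: \<epsilon>_def)
  obtain C where "C \<ge> 0" and C': "\<forall>e y z. 0 \<le> e \<longrightarrow> e \<le> en 0 \<longrightarrow>
    e powr \<kappa> * (y\<^sup>2 + \<bar>g y * z\<bar>) \<le> \<epsilon> * (e powr (\<kappa> + 1) + e powr \<kappa> * (z\<^sup>2 + z ^ 6)) + C * (g y * y)"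
    using pointwise[OF \<epsilon> K(3)[OF order_refl]] by (elim exE conjE)
  note C = \<open>C \<ge> 0\<close> C'[rule_format]
  interpret F: finite_measure \<mu> by (rule dom_finite)
  have slice: "en s powr \<kappa> * (kin s + \<bar>crs s\<bar>) \<le> \<epsilon> * B * en s powr (\<kappa> + 1) + C * dmp s"
    if s: "0 \<le> s" and i: "integrable \<mu> (\<lambda>x. g (v s x) * v s x)" "integrable \<mu> (\<lambda>x. g (v s x) * u s x)" for s
  proof -
    let ?e = "en s"
    have e: "0 \<le> ?e" "?e \<le> en 0" by (rule K(3)[OF s], rule en_le_initial[OF s])
    have sq: "integrable \<mu> (\<lambda>x. (v s x)\<^sup>2)" using u_facts(3)[OF s] by (simp add: sq_int_def)
    have "sq_int \<mu> (u s)" using ubar_sq_int[of s] by (simp add: ubar_nonneg[OF s])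
    then have u2: "integrable \<mu> (\<lambda>x. (u s x)\<^sup>2)" by (simp add: sq_int_def)
    have u6: "integrable \<mu> (\<lambda>x. (u s x) ^ 6)" by (rule sobolev_H01(1)[OF open_dom u_facts(1)[OF s]])
    have "\<bar>crs s\<bar> \<le> (LINT x|\<mu>. \<bar>g (v s x) * u s x\<bar>)"
      unfolding crs_def by (rule integral_abs_bound)
    moreover have "kin s = (LINT x|\<mu>. (v s x)\<^sup>2)"
      by (simp add: kin_def vbar_nonneg[OF s] ip_def power2_eq_square)
    ultimately have "kin s + \<bar>crs s\<bar> \<le> (LINT x|\<mu>. (v s x)\<^sup>2 + \<bar>g (v s x) * u s x\<bar>)"
      using sq i(2) by simp
    then have "?e powr \<kappa> * (kin s + \<bar>crs s\<bar>) \<le> ?e powr \<kappa> * (LINT x|\<mu>. (v s x)\<^sup>2 + \<bar>g (v s x) * u s x\<bar>)"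
      by (rule mult_left_mono) simp
    also have "\<dots> = (LINT x|\<mu>. ?e powr \<kappa> * ((v s x)\<^sup>2 + \<bar>g (v s x) * u s x\<bar>))" by simp
    also have "\<dots> \<le> (LINT x|\<mu>. \<epsilon> * (?e powr (\<kappa> + 1) + ?e powr \<kappa> * ((u s x)\<^sup>2 + (u s x) ^ 6)) + C * (g (v s x) * v s x))"
    proof (rule integral_mono)
      show "integrable \<mu> (\<lambda>x. ?e powr \<kappa> * ((v s x)\<^sup>2 + \<bar>g (v s x) * u s x\<bar>))"
        using sq i(2) by (intro integrable_mult_right Bochner_Integration.integrable_add integrable_abs)
      show "integrable \<mu> (\<lambda>x. \<epsilon> * (?e powr (\<kappa> + 1) + ?e powr \<kappa> * ((u s x)\<^sup>2 + (u s x) ^ 6)) + C * (g (v s x) * v s x))"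
        using u2 u6 i(1) by (intro integrable_mult_right Bochner_Integration.integrable_add F.integrable_const)
      fix x
      show "?e powr \<kappa> * ((v s x)\<^sup>2 + \<bar>g (v s x) * u s x\<bar>)
        \<le> \<epsilon> * (?e powr (\<kappa> + 1) + ?e powr \<kappa> * ((u s x)\<^sup>2 + (u s x) ^ 6)) + C * (g (v s x) * v s x)"
        by (rule C(2)[OF e])
    qed
    also have "\<dots> = \<epsilon> * (measure \<mu> \<Omega> * ?e powr (\<kappa> + 1) + ?e powr \<kappa> * (LINT x|\<mu>. (u s x)\<^sup>2 + (u s x) ^ 6)) + C * dmp s"
      using u2 u6 i(1) by (simp add: dmp_def space_mu)
    also have "\<dots> \<le> \<epsilon> * (measure \<mu> \<Omega> * ?e powr (\<kappa> + 1) + ?e powr \<kappa> * (K * ?e)) + C * dmp s"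
      using \<epsilon> K(6)[OF s] by (intro add_mono mult_left_mono order_refl) auto
    also have "?e powr \<kappa> * (K * ?e) = K * ?e powr (\<kappa> + 1)" using powr_Suc_eq[OF e(1), of \<kappa>] by simp
    finally show ?thesis by (simp add: B_def algebra_simps)
  qed
  \<comment> \<open>The factor 2 compensates for the absorbed half.\<close>
  define C' where "C' = 2 * (L * C + d * (4 * K * (\<gamma> 0 * en 0 powr \<kappa>)))"
  have main: "en T powr (\<kappa> + 1) * (Gam T - Gam S) \<le> C' * en S" if ST: "0 \<le> S" "S \<le> T" for S T
  proof -
    have T: "0 \<le> T" using ST by simp
    note bal = balance[OF T]
    note ig = integral_split[OF gamma_integrable[of T] ST]
    note id = integral_split[OF bal(3) ST]
    note ir = wt_times_integrable[OF rate_integrable[OF ST]]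
    have ie: "integrable (lebesgue_on {S..T}) (\<lambda>s. wt s * en s)"
      by (rule wt_times_integrable[OF continuous_integrable_Icc[OF time_functions_continuous(5)]])
    have sub: "AE s in lebesgue_on {S..T}. P s" if "AE s in lebesgue_on {0..T}. P s" for P
      by (rule AE_lebesgue_on_subset[OF that]) (use ST in auto)
    have pw: "AE s in lebesgue_on {S..T}. 1/2 * (wt s * en s) \<le> L * C * (\<gamma> s * dmp s) - d * (wt s * rate s)"
      using sub[OF bal(5)] sub[OF bal(6)] AE_space
    proof eventually_elim
      case (elim s)
      then have s: "0 \<le> s" using ST by auto
      have \<gamma>: "\<gamma>' s = \<gamma> s" "0 \<le> \<gamma> s" "\<gamma> s \<le> \<gamma> 0" using gamma'_eq[OF s] gamma'_bounds[of s] by auto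
      have wt: "wt s = \<gamma> s * en s powr \<kappa>" using s by (simp add: wt_def \<gamma>)
      let ?a = "en s powr \<kappa>"
      have "wt s * en s \<le> wt s * (1/2 * kin s + d * (pot s - src s))"
        using K(4)[OF s] wt_bounds(1) by (intro mult_left_mono) (simp_all add: d_def)
      also have "\<dots> = wt s * ((1/2 + d) * kin s - d * \<gamma> s * crs s) - d * (wt s * rate s)"
        unfolding rate_def by (simp add: algebra_simps)
      also have "\<dots> \<le> wt s * (L * (kin s + \<bar>crs s\<bar>)) - d * (wt s * rate s)"
      proof (intro diff_right_mono mult_left_mono wt_bounds)
        have "- (d * \<gamma> s * crs s) \<le> d * \<gamma> s * \<bar>crs s\<bar>"
          using mult_left_mono[of "- crs s" "\<bar>crs s\<bar>" "d * \<gamma> s"] d \<gamma>(2) by simp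
        also have "\<dots> \<le> L * \<bar>crs s\<bar>"
        proof (intro mult_right_mono)
          have "d * \<gamma> s \<le> d * \<gamma> 0" using d \<gamma> by (intro mult_left_mono) auto
          also have "\<dots> \<le> L" using d g0 by (simp add: L_def algebra_simps)
          finally show "d * \<gamma> s \<le> L" .
        qed simp
        finally have 1: "- (d * \<gamma> s * crs s) \<le> L * \<bar>crs s\<bar>" .
        have "(1/2 + d) * 1 \<le> L" unfolding L_def using d g0 by (intro mult_left_mono) auto
        then have "(1/2 + d) * kin s \<le> L * kin s" by (intro mult_right_mono kin_nonneg) simp
        then show "(1/2 + d) * kin s - d * \<gamma> s * crs s \<le> L * (kin s + \<bar>crs s\<bar>)"
          using 1 by (simp add: distrib_left)
      qed
      also have "wt s * (L * (kin s + \<bar>crs s\<bar>)) = \<gamma> s * L * (?a * (kin s + \<bar>crs s\<bar>))"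
        by (simp add: wt)
      also have "\<dots> \<le> \<gamma> s * L * (\<epsilon> * B * en s powr (\<kappa> + 1) + C * dmp s)"
        using \<gamma>(2) L by (intro mult_left_mono slice[OF s elim(1,2)]) auto
      also have "\<dots> = 1/2 * (wt s * en s) + L * C * (\<gamma> s * dmp s)"
      proof -
        have "L * (\<epsilon> * B) = 1/2" using L B by (simp add: \<epsilon>_def)
        moreover have "\<gamma> s * L * (\<epsilon> * B * X + C * Y) = (L * (\<epsilon> * B)) * (\<gamma> s * X) + L * C * (\<gamma> s * Y)" for X Y
          by (simp add: algebra_simps)
        ultimately show ?thesis using powr_Suc_eq[OF K(3)[OF s], of \<kappa>] by (simp add: wt mult.assoc)
      qed
      finally show ?case by simp
    qed
    have "1/2 * (LINT s|lebesgue_on {S..T}. wt s * en s) = (LINT s|lebesgue_on {S..T}. 1/2 * (wt s * en s))" by simp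
    also have "\<dots> \<le> (LINT s|lebesgue_on {S..T}. L * C * (\<gamma> s * dmp s) - d * (wt s * rate s))"
      using ie ir id(1) by (intro integral_mono_AE pw Bochner_Integration.integrable_diff integrable_mult_right)
    also have "\<dots> = L * C * (LINT s|lebesgue_on {S..T}. \<gamma> s * dmp s) - d * (LINT s|lebesgue_on {S..T}. wt s * rate s)"
      using ir id(1) by simp
    also have "(LINT s|lebesgue_on {S..T}. \<gamma> s * dmp s) = en S - en T"
      unfolding id(3,4) using bal(7) balance(7)[OF ST(1)] by simp
    finally have 0: "1/2 * (LINT s|lebesgue_on {S..T}. wt s * en s) \<le> L * C * (en S - en T) - d * (LINT s|lebesgue_on {S..T}. wt s * rate s)" .
    have c1: "L * C * (en S - en T) \<le> L * C * en S"
      using L C(1) K(3)[OF T] by (intro mult_left_mono) auto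
    have c2: "- (d * (LINT s|lebesgue_on {S..T}. wt s * rate s)) \<le> d * (4 * K * (\<gamma> 0 * en 0 powr \<kappa>) * en S)"
    proof -
      have "- (LINT s|lebesgue_on {S..T}. wt s * rate s) \<le> 4 * K * (\<gamma> 0 * en 0 powr \<kappa>) * en S"
        using wt_rate_bound[OF K(5) less_imp_le[OF K(1)] ST] by simp
      from mult_left_mono[OF this less_imp_le[OF d]] show ?thesis by simp
    qed
    have c3: "C' * en S = 2 * (L * C * en S + d * (4 * K * (\<gamma> 0 * en 0 powr \<kappa>) * en S))"
      by (simp add: C'_def algebra_simps)
    have "I \<le> c" if "a \<le> b" "- x \<le> y" "c = 2 * (b + y)" "1/2 * I \<le> a - x" for a b x y c I :: real
      using that by argo
    from this[OF c1 c2 c3 0] have 1: "(LINT s|lebesgue_on {S..T}. wt s * en s) \<le> C' * en S" .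
    have "en T powr (\<kappa> + 1) * (Gam T - Gam S) = (LINT s|lebesgue_on {S..T}. en T powr (\<kappa> + 1) * \<gamma> s)"
      unfolding Gam_def using ig(3,4) by simp
    also have "\<dots> \<le> (LINT s|lebesgue_on {S..T}. wt s * en s)"
    proof (rule integral_mono)
      show "integrable (lebesgue_on {S..T}) (\<lambda>s. en T powr (\<kappa> + 1) * \<gamma> s)" using ig(1) by simp
      show "integrable (lebesgue_on {S..T}) (\<lambda>s. wt s * en s)" by (rule ie)
      fix s assume "s \<in> space (lebesgue_on {S..T})"
      then have s: "0 \<le> s" "s \<le> T" using ST by auto
      have "en T powr (\<kappa> + 1) \<le> en s powr (\<kappa> + 1)"
        using kappa_nonneg by (intro powr_mono2 en_antimono K(3) s T) auto
      then have "en T powr (\<kappa> + 1) * \<gamma> s \<le> en s powr (\<kappa> + 1) * \<gamma> s"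
        by (intro mult_right_mono gamma_nonneg s)
      then show "en T powr (\<kappa> + 1) * \<gamma> s \<le> wt s * en s"
        using s powr_Suc_eq[OF K(3)[OF s(1)], of \<kappa>] by (simp add: wt_def gamma'_eq mult_ac)
    qed
    finally show ?thesis using 1 by simp
  qed
  have "0 \<le> C'" unfolding C'_def using L C(1) d K(1) g0 by (intro mult_nonneg_nonneg add_nonneg_nonneg) auto
  show ?thesis
  proof (intro exI[of _ "C' + 1"] conjI allI impI)
    show "0 < C' + 1" using \<open>0 \<le> C'\<close> by simp
    fix S T :: real assume ST: "0 \<le> S" "S \<le> T"
    show "en T powr (\<kappa> + 1) * (Gam T - Gam S) \<le> (C' + 1) * en S"
      using main[OF ST] K(3)[OF ST(1)] by (simp add: distrib_right)
  qed
qed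

end


section \<open>Decay from the integral inequality\<close>

text \<open>\<open>G\<close>, the integral of \<gamma>, acts as a new time. By continuity it takes
  every value below \<open>G t\<close>, which allows steps of prescribed length.\<close>

locale energy_decay =
  fixes e G :: "real \<Rightarrow> real" and C q :: real
  assumes antimono: "\<And>s t. 0 \<le> s \<Longrightarrow> s \<le> t \<Longrightarrow> e t \<le> e s" and nonneg: "\<And>t. 0 \<le> t \<Longrightarrow> 0 \<le> e t"
    and G: "continuous_on {0..} G" "G 0 = 0" "\<And>s t. 0 \<le> s \<Longrightarrow> s \<le> t \<Longrightarrow> G s \<le> G t"
    and C: "0 < C" and ineq: "\<And>s t. 0 \<le> s \<Longrightarrow> s \<le> t \<Longrightarrow> e t powr (q + 1) * (G t - G s) \<le> C * e s"
begin

lemma level: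
  assumes "0 \<le> y" "y \<le> G t" "0 \<le> t"
  obtains s where "0 \<le> s" "s \<le> t" "G s = y"
  using IVT'[of G 0 y t] assms G(2) continuous_on_subset[OF G(1)] by auto

text \<open>Whenever \<open>G\<close> has grown by \<open>C * exp 1\<close>, the inequality divides
  the energy by \<open>exp 1\<close>; the complete steps up to \<open>t\<close> are counted.\<close>

lemma exponential:
  assumes q: "q = 0" and t: "0 \<le> t"
  shows "e t \<le> e 0 * exp (1 - 1 / (C * exp 1) * G t)"
proof -
  let ?K = "C * exp 1"
  have K: "?K > 0" using C by simp
  have step: "\<forall>t\<ge>0. real n * ?K \<le> G t \<longrightarrow> e t \<le> e 0 * exp (- real n)" for n
  proof (induction n)
    case 0
    then show ?case using antimono[OF order_refl] by simp
  next
    case (Suc n)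
    show ?case
    proof (intro allI impI)
      fix t :: real assume t: "0 \<le> t" and Gt: "real (Suc n) * ?K \<le> G t"
      have n: "0 \<le> real n * ?K" using K by simp
      have Sn: "real (Suc n) * ?K = real n * ?K + ?K" by (simp add: algebra_simps)
      then have "real n * ?K \<le> G t" using Gt K by linarith
      then obtain s where s: "0 \<le> s" "s \<le> t" "G s = real n * ?K" using level[OF n _ t] by blast
      have "e t * ?K \<le> e t * (G t - G s)"
        using Gt Sn s(3) nonneg[OF t] by (intro mult_left_mono) auto
      also have "\<dots> \<le> C * e s"
        using ineq[OF s(1,2)] q nonneg[OF t] by simp
      finally have "e t * exp 1 \<le> e s" using C by (simp add: mult.left_commute)
      also have "e s \<le> e 0 * exp (- real n)" using Suc s by simp
      finally have "e t * exp 1 * exp (- 1) \<le> e 0 * exp (- real n) * exp (- 1)" by (intro mult_right_mono) auto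
      moreover have "exp 1 * exp (- 1) = (1 :: real)" by (simp flip: exp_add)
      moreover have "exp (- real n) * exp (- 1) = exp (- real (Suc n))"
        unfolding exp_add[symmetric] by (rule arg_cong[of _ _ exp]) simp
      ultimately show "e t \<le> e 0 * exp (- real (Suc n))" by (simp only: mult.assoc mult_1_right)
    qed
  qed
  have G0: "0 \<le> G t" using G(2) G(3)[OF order_refl t] by simp
  \<comment> \<open>Rounding the number of steps down costs less than one step, which is the 1 in
    the exponent.\<close>
  define n where "n = nat \<lfloor>G t / ?K\<rfloor>"
  have "0 \<le> G t / ?K" using G0 K by simp
  then have n: "real n \<le> G t / ?K" "G t / ?K < real n + 1" unfolding n_def by linarith+
  have "real n * ?K \<le> G t" using n(1) K by (simp add: le_divide_eq)
  then have "e t \<le> e 0 * exp (- real n)" using step[of n] t by blast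
  also have "\<dots> \<le> e 0 * exp (1 - G t / ?K)"
    using n(2) nonneg[of 0] by (intro mult_left_mono) auto
  finally show ?thesis by simp
qed

text \<open>Dyadic induction on the size of \<open>G t\<close>: the inequality started where
  \<open>G\<close> has half its value carries the decay from there to \<open>t\<close>, and
  \<open>L\<close> is large enough to make up for the loss.\<close>

lemma polynomial:
  assumes q: "q > 0"
  shows "\<exists>L>0. \<forall>t\<ge>0. e t \<le> L * (1 / (1 + G t)) powr (1 / q)"
proof -
  define r where "r = 2 powr (1 / q)"
  have r: "r > 0" by (simp add: r_def)
  \<comment> \<open>The first summand covers \<open>G t \<le> 1\<close>, where the decaying factor
    is at least \<open>1 / r\<close>; the second makes \<open>L powr q\<close> at least
    \<open>4 * C * r\<close>, as the induction step demands.\<close>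
  define L where "L = (e 0 + 1) * r + (4 * C * r) powr (1 / q)"
  have L: "L > 0" "(e 0 + 1) * r \<le> L" "(4 * C * r) powr (1 / q) \<le> L"
    using nonneg[of 0] r C by (auto simp: L_def add_pos_nonneg)
  have Lq: "4 * C * r \<le> L powr q"
  proof -
    have "((4 * C * r) powr (1 / q)) powr q \<le> L powr q" using L(3) q by (intro powr_mono2) auto
    then show ?thesis using q C r by (simp add: powr_powr)
  qed
  have G0: "0 \<le> G t" if "0 \<le> t" for t using G(2) G(3)[OF order_refl that] by simp
  have step: "\<forall>t\<ge>0. G t \<le> 2 ^ n \<longrightarrow> e t \<le> L * (1 / (1 + G t)) powr (1 / q)" for n
  proof (induction n)
    case 0
    show ?case
    proof (intro allI impI)
      fix t :: real assume t: "0 \<le> t" and "G t \<le> 2 ^ 0"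
      then have "1 / r \<le> (1 / (1 + G t)) powr (1 / q)"
        using G0[OF t] q by (auto simp: r_def powr_divide intro!: divide_left_mono powr_mono2)
      then have "L * (1 / r) \<le> L * (1 / (1 + G t)) powr (1 / q)" using L by (intro mult_left_mono) auto
      moreover have "e t \<le> L * (1 / r)"
      proof -
        have "e t * r \<le> (e 0 + 1) * r" using antimono[OF order_refl t] r by (intro mult_right_mono) auto
        then have "e t * r \<le> L" using L(2) by linarith
        then show ?thesis using r by (simp add: le_divide_eq)
      qed
      ultimately show "e t \<le> L * (1 / (1 + G t)) powr (1 / q)" by linarith
    qed
  next
    case (Suc n)
    show ?case
    proof (intro allI impI)
      fix t :: real assume t: "0 \<le> t" and Gt: "G t \<le> 2 ^ Suc n"
      show "e t \<le> L * (1 / (1 + G t)) powr (1 / q)"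
      proof (cases "G t \<le> 2 ^ n")
        case True
        then show ?thesis using Suc t by blast
      next
        case False
        moreover have "(1::real) \<le> 2 ^ n" by simp
        ultimately have G1: "1 \<le> G t" by linarith
        have h: "0 \<le> G t / 2" "G t / 2 \<le> G t" using G1 by auto
        obtain s where s: "0 \<le> s" "s \<le> t" "G s = G t / 2" using level[OF h t] .
        define X where "X = 1 / (1 + G t)"
        have X: "X > 0" using G1 by (simp add: X_def)
        have "e s \<le> L * (1 / (1 + G s)) powr (1 / q)" using Suc Gt s by simp
        also have "\<dots> \<le> L * (2 * X) powr (1 / q)"
          using L q G1 s(3) by (intro mult_left_mono powr_mono2) (auto simp: X_def field_simps)
        also have "(2 * X) powr (1 / q) = r * X powr (1 / q)" by (simp add: r_def powr_mult)
        finally have es: "e s \<le> L * (r * X powr (1 / q))" .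
        have "1 / X = 1 + G t" by (simp add: X_def)
        \<comment> \<open>Since \<open>1 \<le> G t\<close>, one has
          \<open>1 + G t \<le> 2 * G t\<close>, and half of \<open>G t\<close> is gained between
          \<open>s\<close> and \<open>t\<close>.\<close>
        then have "1 / X / 4 \<le> G t - G s" using G1 s(3) by simp
        then have "e t powr (q + 1) * (1 / X / 4) \<le> e t powr (q + 1) * (G t - G s)" by (intro mult_left_mono) auto
        also have "\<dots> \<le> C * e s" by (rule ineq[OF s(1,2)])
        also have "\<dots> \<le> C * (L * (r * X powr (1 / q)))" using C by (intro mult_left_mono es) auto
        finally have "e t powr (q + 1) \<le> (4 * C * r) * (L * (X powr (1 / q) * X))"
          using X by (simp add: field_simps)
        also have "\<dots> \<le> L powr q * (L * (X powr (1 / q) * X))" using Lq L X by (intro mult_right_mono) auto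
        also have "\<dots> = (L * X powr (1 / q)) powr (q + 1)"
        proof -
          have "X powr (1 / q) * X = X powr (1 / q + 1)" using X by (simp add: powr_add)
          also have "1 / q + 1 = 1 / q * (q + 1)" using q by (simp add: field_simps)
          also have "X powr (1 / q * (q + 1)) = (X powr (1 / q)) powr (q + 1)" by (rule powr_powr[symmetric])
          finally show ?thesis using L(1) by (simp add: powr_mult powr_add)
        qed
        finally have le: "e t powr (q + 1) \<le> (L * X powr (1 / q)) powr (q + 1)" .
        show ?thesis
        proof (rule ccontr)
          assume "\<not> e t \<le> L * (1 / (1 + G t)) powr (1 / q)"
          then have "L * X powr (1 / q) < e t" by (simp add: X_def)
          then have "(L * X powr (1 / q)) powr (q + 1) < e t powr (q + 1)"
            using q L(1) by (intro powr_less_mono2) auto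
          then show False using le by simp
        qed
      qed
    qed
  qed
  show ?thesis
  proof (intro exI[of _ L] conjI allI impI L(1))
    fix t :: real assume t: "0 \<le> t"
    obtain n where "G t < 2 ^ n" using real_arch_pow[of 2 "G t"] by auto
    then show "e t \<le> L * (1 / (1 + G t)) powr (1 / q)" using step[of n] t by simp
  qed
qed

end

context damped_decay
begin

lemma decay: obtains C where "energy_decay en Gam C \<kappa>"
proof -
  obtain C where C: "0 < C" "\<forall>S T. 0 \<le> S \<longrightarrow> S \<le> T \<longrightarrow> en T powr (\<kappa> + 1) * (Gam T - Gam S) \<le> C * en S"
    using weighted_estimate by (elim exE conjE)
  have e: "Gam t = integral {0..t} \<gamma>" for t
    unfolding Gam_def by (rule lebesgue_integral_eq_integral[OF gamma_integrable]) simp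
  have I: "\<gamma> integrable_on {0..t}" for t
    by (rule integrable_on_lebesgue_on[OF gamma_integrable]) simp
  show ?thesis
  proof (rule that[of C], unfold_locales)
    show "continuous_on {0..} Gam"
      unfolding continuous_on_eq_continuous_within
    proof
      fix t :: real assume t: "t \<in> {0..}"
      have "continuous_on {0..t + 1} Gam"
        unfolding e[abs_def] by (rule indefinite_integral_continuous_1[OF I])
      then have "continuous (at t within {0..t + 1}) Gam"
        using t by (simp add: continuous_on_eq_continuous_within)
      then show "continuous (at t within {0..}) Gam" using within_halfline[of t] t by simp
    qed
    show "Gam 0 = 0" by (simp add: e)
    show "Gam s \<le> Gam t" if "0 \<le> s" "s \<le> t" for s t
      unfolding e by (rule integral_subset_le) (use that I gamma_nonneg in auto)
  qed (use C en_antimono en_nonneg in auto)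
qed

end


section \<open>Decay rates of the energy\<close>

context damped_decay
begin

lemma exponential_decay:
  assumes "k = 1"
  shows "\<exists>C>0. \<forall>t\<ge>0. energy \<Omega> A p (u t) (v t)
    \<le> energy \<Omega> A p (u 0) (v 0) * exp (1 - C * (LINT s|lebesgue_on {0..t}. \<gamma> s))"
proof -
  obtain C where "energy_decay en Gam C \<kappa>" by (rule decay)
  then interpret D: energy_decay en Gam C \<kappa> .
  have "\<kappa> = 0" unfolding \<kappa>_def using assms by simp
  note e = D.exponential[OF this, unfolded Gam_def]
  show ?thesis
  proof (intro exI[of _ "1 / (C * exp 1)"] conjI allI impI)
    show "0 < 1 / (C * exp 1)" using D.C by simp
    show "energy \<Omega> A p (u t) (v t) \<le> energy \<Omega> A p (u 0) (v 0) * exp (1 - 1 / (C * exp 1) * (LINT s|lebesgue_on {0..t}. \<gamma> s))"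
      if "0 \<le> t" for t
      unfolding en_eq_energy[OF that] en_eq_energy[OF order_refl] by (rule e[OF that])
  qed
qed

lemma polynomial_decay:
  assumes "1 < k"
  shows "\<exists>C>0. \<forall>t\<ge>0. energy \<Omega> A p (u t) (v t)
    \<le> C * energy \<Omega> A p (u 0) (v 0) * (1 / (1 + (LINT s|lebesgue_on {0..t}. \<gamma> s))) powr (2 / (k - 1))"
proof -
  obtain C where "energy_decay en Gam C \<kappa>" by (rule decay)
  then interpret D: energy_decay en Gam C \<kappa> .
  have "0 < \<kappa>" unfolding \<kappa>_def using assms by simp
  from D.polynomial[OF this] obtain L where L: "0 < L" "\<forall>t\<ge>0. en t \<le> L * (1 / (1 + Gam t)) powr (1 / \<kappa>)"
    by (elim exE conjE)
  have \<kappa>: "1 / \<kappa> = 2 / (k - 1)" unfolding \<kappa>_def by simp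
  have e0: "0 < en 0" using en_pos unfolding initial_values(1) .
  show ?thesis
  \<comment> \<open>The initial energy is positive and can be factored out; the resulting constant
    depends on it.\<close>
  proof (intro exI[of _ "L / en 0"] conjI allI impI)
    show "0 < L / en 0" using L(1) e0 by simp
    show "energy \<Omega> A p (u t) (v t) \<le> L / en 0 * energy \<Omega> A p (u 0) (v 0) * (1 / (1 + (LINT s|lebesgue_on {0..t}. \<gamma> s))) powr (2 / (k - 1))"
      if "0 \<le> t" for t
      using L(2)[rule_format, OF that] e0 unfolding en_eq_energy[OF that] en_eq_energy[OF order_refl] \<kappa> Gam_def by simp
  qed
qed

end

text \<open>If \<open>y = h x\<close>, the upper bound on \<open>g\<close> reads
  \<open>\<bar>g y\<bar> \<le> \<bar>x\<bar>\<close>, while the growth of \<open>h\<close> gives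
  \<open>b * \<bar>x\<bar> powr k \<le> \<bar>y\<bar>\<close>. If \<open>y\<close> is outside the
  range of \<open>h\<close>, then \<open>h 1 < \<bar>y\<bar>\<close> and monotonicity bounds
  \<open>g\<close>. The lower bound on \<open>g\<close> controls the power of
  \<open>y\<close>.\<close>

lemma near_zero_bounds:
  fixes g h :: "real \<Rightarrow> real"
  assumes k: "1 \<le> k" and h: "strict_mono_on {-1..1} h" "\<forall>s\<in>{-1..1}. h (- s) = - h s" "C1_on {-1..1} h"
    and growth: "polynomial_growth_on_unit k h" and bounds: "damping_bounds_near_zero h g" and g: "mono g" "g 0 = 0"
  shows "\<exists>c>0. \<forall>y. \<bar>y\<bar> \<le> 1 \<longrightarrow> c * \<bar>y\<bar> powr (k + 1) \<le> g y * y \<and> c * \<bar>g y\<bar> powr (k + 1) \<le> g y * y"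
proof -
  obtain b where b: "0 < b" "\<And>s. s \<in> {-1..1} \<Longrightarrow> b * \<bar>s\<bar> powr k \<le> \<bar>h s\<bar>"
    using growth by (auto simp: polynomial_growth_on_unit_def)
  have "continuous_on {-1..1} h"
    using h(3) unfolding C1_on_def continuous_on_eq_continuous_within by (blast intro: DERIV_continuous)
  have inj: "inj_on h {-1..1}" using h(1) by (rule strict_mono_on_imp_inj_on)
  have "h (- 1) < h 1" using h(1) by (rule strict_mono_onD) auto
  moreover have hm: "h (- 1) = - h 1" using h(2) by simp
  ultimately have h1: "0 < h 1" by simp
  have range: "y \<in> h ` {-1..1}" if "\<bar>y\<bar> \<le> h 1" for y
  proof -
    have "h (- 1) \<le> y" "y \<le> h 1" using that hm by auto
    from IVT'[OF this _ \<open>continuous_on {-1..1} h\<close>] show ?thesis by force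
  qed
  define G where "G = (\<bar>g 1\<bar> + \<bar>g (- 1)\<bar>) powr k + 1"
  have G: "0 < G" by (simp add: G_def add_nonneg_pos)
  \<comment> \<open>\<open>b\<close> serves the points in the range of \<open>h\<close>, and
    \<open>h 1 / G\<close> those outside it.\<close>
  define c where "c = min b (h 1 / G)"
  have c: "0 < c" "c \<le> b" "c \<le> h 1 / G" using b h1 G by (auto simp: c_def)
  have powr_Suc: "x powr (k + 1) = x powr k * x" if "0 \<le> x" for x :: real
    by (rule powr_Suc_eq[OF that])
  have main: "c * \<bar>y\<bar> powr (k + 1) \<le> g y * y \<and> c * \<bar>g y\<bar> powr (k + 1) \<le> g y * y" if y: "\<bar>y\<bar> \<le> 1" for y
  proof
    have lower: "\<bar>h y * y\<bar> \<le> g y * y"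
      and upper: "y \<in> h ` {-1..1} \<Longrightarrow> g y * y \<le> \<bar>the_inv_into {-1..1} h y * y\<bar>"
      using bounds y by (auto simp: damping_bounds_near_zero_def)
    have y': "y \<in> {-1..1}" using y by auto
    have "c * \<bar>y\<bar> powr (k + 1) = c * \<bar>y\<bar> powr k * \<bar>y\<bar>" by (simp add: powr_Suc)
    also have "\<dots> \<le> b * \<bar>y\<bar> powr k * \<bar>y\<bar>" using c by (intro mult_right_mono) auto
    also have "\<dots> \<le> \<bar>h y\<bar> * \<bar>y\<bar>" by (intro mult_right_mono b(2)[OF y']) simp
    also have "\<dots> \<le> g y * y" using lower by (simp add: abs_mult)
    finally show "c * \<bar>y\<bar> powr (k + 1) \<le> g y * y" .
    have gy: "g y * y = \<bar>g y\<bar> * \<bar>y\<bar>"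
    proof -
      have "0 \<le> g y * y" using lower abs_ge_zero[of "h y * y"] by linarith
      then show ?thesis by (simp add: abs_mult[symmetric])
    qed
    show "c * \<bar>g y\<bar> powr (k + 1) \<le> g y * y"
    proof (cases "g y = 0")
      case False
      have "c * \<bar>g y\<bar> powr k \<le> \<bar>y\<bar>"
      proof (cases "y \<in> h ` {-1..1}")
        case True
        then obtain x where x: "x \<in> {-1..1}" "y = h x" by blast
        have "the_inv_into {-1..1} h y = x" unfolding x(2) by (rule the_inv_into_f_f[OF inj x(1)])
        then have "\<bar>g y\<bar> * \<bar>y\<bar> \<le> \<bar>x\<bar> * \<bar>y\<bar>" using upper[OF True] unfolding gy by (simp add: abs_mult)
        moreover have "y \<noteq> 0" using False g(2) by auto
        ultimately have "\<bar>g y\<bar> powr k \<le> \<bar>x\<bar> powr k" using k by (intro powr_mono2) (auto simp: mult_le_cancel_right)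
        then have "c * \<bar>g y\<bar> powr k \<le> b * \<bar>x\<bar> powr k" using c b by (intro mult_mono) auto
        then show ?thesis using b(2)[OF x(1)] x(2) by simp
      next
        case False
        then have "h 1 < \<bar>y\<bar>" using range[of y] by linarith
        have "g (- 1) \<le> g y" "g y \<le> g 1" using y g(1) by (auto simp: mono_def)
        then have "\<bar>g y\<bar> powr k \<le> (\<bar>g 1\<bar> + \<bar>g (- 1)\<bar>) powr k" using k by (intro powr_mono2) auto
        then have "\<bar>g y\<bar> powr k \<le> G" by (simp add: G_def)
        then have "c * \<bar>g y\<bar> powr k \<le> h 1 / G * G" using c G h1 by (intro mult_mono) auto
        then show ?thesis using \<open>h 1 < \<bar>y\<bar>\<close> G by simp
      qed
      then have "c * \<bar>g y\<bar> powr k * \<bar>g y\<bar> \<le> \<bar>y\<bar> * \<bar>g y\<bar>" by (rule mult_right_mono) simp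
      then show ?thesis unfolding gy by (simp add: powr_Suc mult_ac)
    next
      case True
      then show ?thesis by simp
    qed
  qed
  then show ?thesis using c(1) by blast
qed

theorem theorem2p5:
  fixes \<Omega> :: "(real^3) set" and A :: "real^3 \<Rightarrow> real^3^3"
    and \<omega> p m M b1 b2 :: real
    and \<gamma> g h :: "real \<Rightarrow> real"
    and u0 u1 :: "real^3 \<Rightarrow> real"
    and u ut :: "real \<Rightarrow> real^3 \<Rightarrow> real"
  assumes "bounded_smooth_domain \<Omega>"
    and "coefficient_matrix \<Omega> A \<omega>"
    and "1 < p" "p \<le> 5" "1 \<le> m" "m \<le> 5" "p * ((m + 1) / m) < 6"
    and "optimal_H01_embedding_constant \<Omega> (p + 1) M"
    and i: "W1inf_loc_halfline \<gamma>" "bounded (\<gamma> ` {0..})" "\<forall>t\<ge>0. 0 \<le> \<gamma> t"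
    and ii: "continuous_on UNIV g" "mono g" "g 0 = 0" "0 < b1" "0 < b2"
      "\<forall>s. \<bar>s\<bar> > 1 \<longrightarrow> b1 * \<bar>s\<bar> powr (m + 1) \<le> g s * s \<and> g s * s \<le> b2 * \<bar>s\<bar> powr (m + 1)"
    and iii: "u0 \<in> H01 \<Omega>" "u1 \<in> Lp_space \<Omega> 2"
    and iv: "0 < energy \<Omega> A p u0 u1"
      "energy \<Omega> A p u0 u1
         < (1/2 - 1 / (p + 1)) * (\<omega> powr ((p + 1) / 2) / M powr (p + 1)) powr (2 / (p - 1))"
      "a_form \<Omega> A u0 u0 < (\<omega> powr ((p + 1) / 2) / M powr (p + 1)) powr (2 / (p - 1))"
    and v: "antimono_on {0..} \<gamma>" "C1_on {0..} \<gamma>"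
      "(\<integral>\<^sup>+t\<in>{0..}. ennreal (\<gamma> t) \<partial>lebesgue) = \<infinity>"
    and vi: "strict_mono_on {-1..1} h" "\<forall>s\<in>{-1..1}. h (- s) = - h s" "C1_on {-1..1} h"
      "damping_bounds_near_zero h g"
    and sol: "global_weak_solution \<Omega> A \<gamma> g p m u0 u1 u ut"
  shows "(linear_on_unit h \<longrightarrow>
           (\<exists>C>0. \<forall>t\<ge>0. energy \<Omega> A p (u t) (ut t)
              \<le> energy \<Omega> A p (u 0) (ut 0) * exp (1 - C * (LINT s|lebesgue_on {0..t}. \<gamma> s)))) \<and>
         (1 < m \<and> polynomial_growth_on_unit m h \<longrightarrow>
           (\<exists>C>0. \<forall>t\<ge>0. energy \<Omega> A p (u t) (ut t)
              \<le> C * energy \<Omega> A p (u 0) (ut 0)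
                  * (1 / (1 + (LINT s|lebesgue_on {0..t}. \<gamma> s))) powr (2 / (m - 1))))"
proof -
  interpret elliptic_domain \<Omega> A \<omega>
    using assms(1,2) by unfold_locales (auto simp: bounded_smooth_domain_def)
  interpret damped_wave \<Omega> A \<omega> p m b1 b2 \<gamma> g u0 u1 u ut
    by unfold_locales (use assms(3-7) i(3) ii monotone_onD[OF v(1)] sol in auto)
  interpret potential_well \<Omega> A \<omega> p m b1 b2 \<gamma> g u0 u1 u ut M
    by unfold_locales (use assms(8) iii iv in auto)
  \<comment> \<open>One argument for both cases, which differ only in the growth order
    \<open>k\<close> of \<open>h\<close>.\<close>
  have decay: "\<exists>c. damped_decay \<Omega> A \<omega> p m b1 b2 \<gamma> g u0 u1 u ut M k c"
    if k: "1 \<le> k" and growth: "polynomial_growth_on_unit k h" for k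
  proof -
    from near_zero_bounds[OF k vi(1-3) growth vi(4) ii(2,3)]
    obtain c where "0 < c" "\<forall>y. \<bar>y\<bar> \<le> 1 \<longrightarrow> c * \<bar>y\<bar> powr (k + 1) \<le> g y * y \<and> c * \<bar>g y\<bar> powr (k + 1) \<le> g y * y"
      by (elim exE conjE)
    then have "damped_decay \<Omega> A \<omega> p m b1 b2 \<gamma> g u0 u1 u ut M k c"
      using k by unfold_locales auto
    then show ?thesis ..
  qed
  show ?thesis
  proof (intro conjI impI)
    assume "linear_on_unit h"
    then obtain a where a: "\<forall>s\<in>{-1..1}. h s = a * s" by (auto simp: linear_on_unit_def)
    \<comment> \<open>Strict monotonicity makes the slope positive, so a linear \<open>h\<close> has
      growth of order exactly 1.\<close>
    have "h 0 < h 1" using vi(1) by (rule strict_mono_onD) auto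
    then have "0 < a" using a by simp
    then have "polynomial_growth_on_unit 1 h"
      unfolding polynomial_growth_on_unit_def using a by (intro exI[of _ a] conjI) (auto simp: abs_mult)
    from decay[OF order_refl this] obtain c where "damped_decay \<Omega> A \<omega> p m b1 b2 \<gamma> g u0 u1 u ut M 1 c" ..
    then show "\<exists>C>0. \<forall>t\<ge>0. energy \<Omega> A p (u t) (ut t)
        \<le> energy \<Omega> A p (u 0) (ut 0) * exp (1 - C * (LINT s|lebesgue_on {0..t}. \<gamma> s))"
      by (rule damped_decay.exponential_decay) simp
  next
    assume m: "1 < m \<and> polynomial_growth_on_unit m h"
    from decay[OF less_imp_le[OF conjunct1[OF m]] conjunct2[OF m]]
    obtain c where "damped_decay \<Omega> A \<omega> p m b1 b2 \<gamma> g u0 u1 u ut M m c" ..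
    then show "\<exists>C>0. \<forall>t\<ge>0. energy \<Omega> A p (u t) (ut t)
        \<le> C * energy \<Omega> A p (u 0) (ut 0) * (1 / (1 + (LINT s|lebesgue_on {0..t}. \<gamma> s))) powr (2 / (m - 1))"
      by (rule damped_decay.polynomial_decay) (use m in simp)
  qed
qed

end
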